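(* Let $G_F$ be an indecomposable Euclidean reflection group and let $G_P\subset G_F$ be a decomposable maximal reflection subgroup, where $F$ is a Coxeter simplex and $P$ is a decomposable Coxeter polytope in $\mathbb{E}^n$. Then $G_P$ is a block-maximal subgroup of $G_F$. Moreover, such a subgroup $G_P\subset G_F$ is determined by the diagrams $\Sigma(F)$, $\Sigma(P)$ and the index $[G_F:G_P]$ uniquely up to an automorphism of $G_F$.
   Context: A Coxeter polytope in $\mathbb{E}^n$ is a finite volume convex polytope all of whose dihedral angles are integer submultiples of $\pi$; $G_P$ is the discrete group generated by the reflections in its facets; $\Sigma(P)$ is its Coxeter diagram (nodes = facets, $(m-2)$-fold edge for angle $\pi/m$, bold edge for parallel facets). $P$ and $G_P$ are decomposable if $\Sigma(P)$ is disconnected; the indecomposable Coxeter polytopes are simplices. A reflection subgroup (subgroup generated by reflections) is maximal if it is proper and there is no reflection subgroup strictly between it and the whole group. Block-maximal: let $M$ be the set of linear parts of all elements of $G_P$; $G_P$ is a block-maximal subgroup of $G_F$ if $G_P$ contains every reflection of $G_F$ whose linear part belongs to $M$. "Determined uniquely up to an automorphism of $G_F$" means that any two such subgroups with the same data are carried one to the other by an automorphism of the group $G_F$. *)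

theory Defs
  imports "HOL-Analysis.Analysis" "HOL-Algebra.Coset" "HOL-Algebra.Generated_Groups"
begin

section \<open>Isometries and reflections\<close>

definition isom_group :: "('a::euclidean_space \<Rightarrow> 'a) monoid" where
  "isom_group =
    \<lparr>carrier = {f. \<forall>x y. dist (f x) (f y) = dist x y}, monoid.mult = (\<circ>), one = id\<rparr>"

definition reflection :: "'a::euclidean_space \<Rightarrow> real \<Rightarrow> 'a \<Rightarrow> 'a" where
  "reflection a b x = x - (2 * (a \<bullet> x - b) / (a \<bullet> a)) *\<^sub>R a"

definition reflections :: "('a::euclidean_space \<Rightarrow> 'a) set" where
  "reflections = {reflection a b | a b. a \<noteq> 0}"

definition linear_part :: "('a::euclidean_space \<Rightarrow> 'a) \<Rightarrow> 'a \<Rightarrow> 'a" where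
  "linear_part f = (\<lambda>x. f x - f 0)"

section \<open>Coxeter polytopes\<close>

definition outward_normal :: "'a::euclidean_space set \<Rightarrow> 'a set \<Rightarrow> 'a" where
  "outward_normal P f =
    (THE u. norm u = 1 \<and> (\<exists>b. P \<subseteq> {x. u \<bullet> x \<le> b} \<and> f = P \<inter> {x. u \<bullet> x = b}))"

definition dihedral_angle :: "'a::euclidean_space set \<Rightarrow> 'a set \<Rightarrow> 'a set \<Rightarrow> real" where
  "dihedral_angle P f g = arccos (- (outward_normal P f \<bullet> outward_normal P g))"

text \<open>A dihedral angle occurs where two distinct facets meet in a nonempty face of codimension 2,
  i.e. where their intersection is a facet of each of them.\<close>

definition coxeter_polytope :: "'a::euclidean_space set \<Rightarrow> bool" where
  "coxeter_polytope P \<longleftrightarrow>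
     polyhedron P \<and> interior P \<noteq> {} \<and> emeasure lborel P < \<infinity> \<and>
     (\<forall>f g. f facet_of P \<and> g facet_of P \<and> f \<noteq> g \<and> f \<inter> g facet_of f \<longrightarrow>
        (\<exists>m::nat. m \<ge> 2 \<and> dihedral_angle P f g = pi / real m))"

definition facet_reflections :: "'a::euclidean_space set \<Rightarrow> ('a \<Rightarrow> 'a) set" where
  "facet_reflections P =
    {reflection a b | a b. a \<noteq> 0 \<and> (\<exists>f. f facet_of P \<and> affine hull f = {x. a \<bullet> x = b})}"

definition reflection_group :: "'a::euclidean_space set \<Rightarrow> ('a \<Rightarrow> 'a) set" where
  "reflection_group P = generate isom_group (facet_reflections P)"

section \<open>Coxeter diagrams\<close>

text \<open>\<open>Edge k\<close> is a \<open>k\<close>-fold edge; in particular \<open>Edge 0\<close> means that the two nodes are not joined.\<close>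

datatype edge = Edge nat | Bold

type_synonym 'n diagram = "'n set \<times> ('n \<Rightarrow> 'n \<Rightarrow> edge)"

definition coxeter_edge :: "'a::euclidean_space set \<Rightarrow> 'a set \<Rightarrow> 'a set \<Rightarrow> edge" where
  "coxeter_edge P f g =
    (if affine_parallel (affine hull f) (affine hull g) then Bold
     else Edge ((THE m::nat. m \<ge> 2 \<and> dihedral_angle P f g = pi / real m) - 2))"

definition coxeter_diagram :: "'a::euclidean_space set \<Rightarrow> 'a set diagram" where
  "coxeter_diagram P = ({f. f facet_of P}, coxeter_edge P)"

text \<open>Only the edges between distinct nodes are part of a diagram.\<close>

definition diagram_connected :: "'n diagram \<Rightarrow> bool" where
  "diagram_connected D \<longleftrightarrow>
    (\<forall>x\<in>fst D. \<forall>y\<in>fst D.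
      (x, y) \<in> {(v, w). v \<in> fst D \<and> w \<in> fst D \<and> v \<noteq> w \<and> snd D v w \<noteq> Edge 0}\<^sup>*)"

definition diagram_iso :: "'n diagram \<Rightarrow> 'm diagram \<Rightarrow> bool" where
  "diagram_iso D D' \<longleftrightarrow>
    (\<exists>h. bij_betw h (fst D) (fst D') \<and>
      (\<forall>x\<in>fst D. \<forall>y\<in>fst D. x \<noteq> y \<longrightarrow> snd D' (h x) (h y) = snd D x y))"

definition decomposable :: "'a::euclidean_space set \<Rightarrow> bool" where
  "decomposable P \<longleftrightarrow> \<not> diagram_connected (coxeter_diagram P)"

section \<open>Reflection subgroups\<close>

text \<open>In what follows \<open>G\<close> is the underlying set of a subgroup of \<^const>\<open>isom_group\<close>.\<close>

definition reflection_subgroup :: "('a::euclidean_space \<Rightarrow> 'a) set \<Rightarrow> ('a \<Rightarrow> 'a) set \<Rightarrow> bool" where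
  "reflection_subgroup H G \<longleftrightarrow>
    H \<subseteq> G \<and> (\<exists>R. R \<subseteq> reflections \<and> H = generate isom_group R)"

definition maximal_reflection_subgroup ::
    "('a::euclidean_space \<Rightarrow> 'a) set \<Rightarrow> ('a \<Rightarrow> 'a) set \<Rightarrow> bool" where
  "maximal_reflection_subgroup H G \<longleftrightarrow>
     reflection_subgroup H G \<and> H \<noteq> G \<and>
     \<not> (\<exists>K. reflection_subgroup K G \<and> H \<subset> K \<and> K \<subset> G)"

definition block_maximal :: "('a::euclidean_space \<Rightarrow> 'a) set \<Rightarrow> ('a \<Rightarrow> 'a) set \<Rightarrow> bool" where
  "block_maximal H G \<longleftrightarrow>
     H \<subseteq> G \<and> (\<forall>r \<in> G \<inter> reflections. linear_part r \<in> linear_part ` H \<longrightarrow> r \<in> H)"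

text \<open>The value is 0 if the index is infinite.\<close>

definition subgroup_index :: "('a::euclidean_space \<Rightarrow> 'a) set \<Rightarrow> ('a \<Rightarrow> 'a) set \<Rightarrow> nat" where
  "subgroup_index G H = card (rcosets\<^bsub>isom_group\<lparr>carrier := G\<rparr>\<^esub> H)"

definition automorphisms ::
    "('a::euclidean_space \<Rightarrow> 'a) set \<Rightarrow> (('a \<Rightarrow> 'a) \<Rightarrow> ('a \<Rightarrow> 'a)) set" where
  "automorphisms G = iso (isom_group\<lparr>carrier := G\<rparr>) (isom_group\<lparr>carrier := G\<rparr>)"

section \<open>Basic facts\<close>

lemma group_isom_group: "group (isom_group :: ('a::euclidean_space \<Rightarrow> 'a) monoid)"
proof (rule groupI)
  fix f :: "'a \<Rightarrow> 'a" assume "f \<in> carrier isom_group"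
  then have d: "dist (f x) (f y) = dist x y" for x y by (simp add: isom_group_def)
  define h where "h = (\<lambda>x. f x - f 0)"
  have dh: "dist (h x) (h y) = dist x y" for x y
    using d[of x y] by (simp add: h_def dist_norm)
  have "h 0 = 0" by (simp add: h_def)
  then have "orthogonal_transformation h"
    using dh by (simp add: orthogonal_transformation_isometry)
  then have "surj h" by (rule orthogonal_transformation_surj)
  have "surj f"
    unfolding surj_def
  proof
    fix y
    obtain x where "y - f 0 = h x" using \<open>surj h\<close> by (metis surjD)
    then show "\<exists>x. y = f x" by (auto simp: h_def)
  qed
  moreover have "inj f" by (metis injI d dist_eq_0_iff)
  ultimately have "inv_into UNIV f \<circ> f = id" "\<And>x. f (inv_into UNIV f x) = x"
    by (auto simp: surj_f_inv_f)
  moreover have "dist (inv_into UNIV f x) (inv_into UNIV f y) = dist x y" for x y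
    using d[of "inv_into UNIV f x" "inv_into UNIV f y"] calculation(2) by simp
  ultimately show "\<exists>g\<in>carrier isom_group. g \<otimes>\<^bsub>isom_group\<^esub> f = \<one>\<^bsub>isom_group\<^esub>"
    by (auto simp: isom_group_def intro!: bexI[of _ "inv_into UNIV f"])
qed (auto simp: isom_group_def o_assoc)

lemma reflections_subset: "reflections \<subseteq> carrier (isom_group :: ('a::euclidean_space \<Rightarrow> 'a) monoid)"
proof -
  have "dist (reflection a b x) (reflection a b y) = dist x y" if "a \<noteq> 0" for a x y :: 'a and b
  proof -
    define z where "z = x - y"
    define t where "t = 2 * (a \<bullet> z) / (a \<bullet> a)"
    have e: "reflection a b x - reflection a b y = z - t *\<^sub>R a"
      by (simp add: reflection_def z_def t_def inner_diff_right algebra_simps diff_divide_distrib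
          scaleR_left_diff_distrib)
    have "t * (a \<bullet> a) = 2 * (a \<bullet> z)" using that by (simp add: t_def)
    then have "(z - t *\<^sub>R a) \<bullet> (z - t *\<^sub>R a) = z \<bullet> z"
      by (simp add: inner_diff_left inner_diff_right inner_commute algebra_simps)
    then show ?thesis using e by (simp add: dist_norm norm_eq_sqrt_inner z_def)
  qed
  then show ?thesis by (auto simp: reflections_def isom_group_def)
qed

lemma subgroup_reflection_group: "subgroup (reflection_group P) isom_group"
  unfolding reflection_group_def
  by (rule group.generate_is_subgroup[OF group_isom_group])
    (use reflections_subset in \<open>auto simp: facet_reflections_def reflections_def\<close>)

end

theory Submission
  imports Defs
begin

text \<open>The normals of \<open>P\<close> split into two nonempty orthogonal sets; let \<open>U\<close> and \<open>V\<close> be their spans. The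
  reflections of \<open>G\<^sub>F\<close> with normal in \<open>U\<close> or \<open>V\<close> generate a subgroup that contains \<open>G\<^sub>P\<close> and is
  proper because \<open>G\<^sub>F\<close> is irreducible, so it equals \<open>G\<^sub>P\<close>. Hence \<open>G\<^sub>P\<close> is block-maximal and determined
  by \<open>U\<close> and \<open>V\<close>.

  The Gram matrix of the normals of the simplex is positive semidefinite with a positive kernel vector;
  this bounds the angles, and the normals can be scaled so that they span a lattice. Its primitive
  vectors that are normal to mirrors form an irreducible root system \<open>\<Phi>\<close>. Maximality of \<open>G\<^sub>P\<close> passes to
  the subsystem \<open>\<Phi> \<inter> (U \<union> V)\<close>. The projections to \<open>U\<close> and \<open>V\<close> of the orbit of a root outside \<open>U \<union> V\<close> are
  orthogonal frames or regular simplices; this determines \<open>\<Phi>\<close> well enough to show that isometric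
  decompositions are equivalent under automorphisms of \<open>\<Phi>\<close>, except for \<open>B\<^sub>2\<close> with its long and its short axes. A linear automorphism of \<open>\<Phi>\<close> that fixes a special point normalizes \<open>G\<^sub>F\<close>. In the
  exceptional case exactly one of the two subgroups has index 2.\<close>

section \<open>Linear reflections and root systems\<close>

text \<open>The diagram of \<open>P\<close> gives the Gram matrix of its normals, hence a linear
  isometry between the normals of two candidates \<open>P\<close> and \<open>P'\<close>. This
  isometry is only known to carry the lines of the roots of one block to those of the other: it may
  mix root lengths and need not preserve the full root system, so it is not yet the wanted
  automorphism. The work lies in replacing it by an automorphism of the root system. Two facts keep
  this manageable. A splitting is already determined by any one nontrivial subspace that is
  compatible with its roots, so it is enough to conjugate a single root or a single plane of type
  \<open>A\<^sub>2\<close>. When no such small piece exists, the orbits of the two components pin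
  down the root system: frames for the types B, C and D, and a pair of simplices with five vertices
  each for \<open>E\<^sub>8\<close>. An automorphism of the root system then normalizes the affine
  group because, measured from a special point, the positions of the mirrors of a root depend only
  on its length.\<close>

abbreviation rf :: "'a::euclidean_space \<Rightarrow> 'a \<Rightarrow> 'a" where
  "rf a \<equiv> reflection a 0"

lemma rf_eq: "rf a x = x - (2 * (a \<bullet> x) / (a \<bullet> a)) *\<^sub>R a"
  by (simp add: reflection_def)

lemma linear_rf: "linear (rf a)"
  by (rule linearI) (simp_all add: rf_eq inner_right_distrib algebra_simps add_divide_distrib)

text \<open>Division by zero makes \<open>rf 0\<close> the identity, which settles the degenerate
  case.\<close>

lemma rf_rf [simp]: "rf a (rf a x) = x"
  by (cases "a = 0") (simp_all add: rf_eq inner_diff_right algebra_simps)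

lemma inner_rf_left: "rf a x \<bullet> y = x \<bullet> rf a y"
  by (simp add: rf_eq inner_diff_left inner_diff_right inner_commute)

lemma inner_rf_rf [simp]: "rf a x \<bullet> rf a y = x \<bullet> y"
  by (simp add: inner_rf_left)

lemma rf_self [simp]: "rf a a = - a"
  by (cases "a = 0") (simp_all add: rf_eq scaleR_2)

lemma rf_fix: "a \<bullet> x = 0 \<Longrightarrow> rf a x = x"
  by (simp add: rf_eq)

lemma rf_zero [simp]: "rf a 0 = 0"
  by (simp add: rf_eq)

lemma rf_minus: "rf a (- x) = - rf a x"
  using linear_neg[OF linear_rf] .

lemma rf_diff: "rf a (x - y) = rf a x - rf a y"
  using linear_diff[OF linear_rf] .

lemma rf_add: "rf a (x + y) = rf a x + rf a y"
  using linear_add[OF linear_rf] .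

lemma rf_scale: "rf a (c *\<^sub>R x) = c *\<^sub>R rf a x"
  using linear_scale[OF linear_rf] .

lemma rf_scaled: "t \<noteq> 0 \<Longrightarrow> rf (t *\<^sub>R a) = rf a"
  by (rule ext) (simp add: rf_eq)

lemma orthogonal_transformation_rf: "orthogonal_transformation (rf a)"
  by (simp add: orthogonal_transformation_def linear_rf)

lemma orthogonal_transformation_rf_conj:
  assumes "orthogonal_transformation B"
  shows "B (rf a x) = rf (B a) (B x)"
proof -
  have "linear B" and "\<And>x y. B x \<bullet> B y = x \<bullet> y"
    using assms by (auto simp: orthogonal_transformation_def)
  then show ?thesis by (simp add: rf_eq linear_diff linear_scale)
qed

lemma rf_subspace:
  assumes "subspace S" "a \<in> S \<or> (\<forall>x\<in>S. a \<bullet> x = 0)" "x \<in> S"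
  shows "rf a x \<in> S"
  using assms by (auto simp: rf_fix) (auto simp: rf_eq intro!: subspace_diff subspace_scale)

text \<open>The vector \<open>x - rf a x\<close> is a multiple of \<open>a\<close>, and a nonzero
  one as soon as \<open>a\<close> is not perpendicular to \<open>x\<close>.\<close>

lemma rf_preserves_subspaceD:
  assumes "subspace S" "\<And>x. x \<in> S \<Longrightarrow> rf a x \<in> S" "a \<noteq> 0"
  shows "a \<in> S \<or> (\<forall>x\<in>S. a \<bullet> x = 0)"
proof (rule disjCI)
  assume "\<not> (\<forall>x\<in>S. a \<bullet> x = 0)"
  then obtain x where x: "x \<in> S" "a \<bullet> x \<noteq> 0" by auto
  define t where "t = 2 * (a \<bullet> x) / (a \<bullet> a)"
  have "t \<noteq> 0" using x assms by (simp add: t_def)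
  have "x - rf a x \<in> S" using x assms by (intro subspace_diff) auto
  then have "t *\<^sub>R a \<in> S" by (simp add: rf_eq t_def)
  then have "inverse t *\<^sub>R (t *\<^sub>R a) \<in> S" using assms(1) subspace_scale by blast
  then show "a \<in> S" using \<open>t \<noteq> 0\<close> by simp
qed

text \<open>Source of most conjugations below: when the difference of two vectors of equal length is
  a root, the reflection in that root exchanges them.\<close>

lemma rf_swap:
  assumes "x \<bullet> x = y \<bullet> y"
  shows "rf (x - y) x = y"
proof (cases "x = y")
  case False
  then have "(x - y) \<bullet> (x - y) \<noteq> 0" by simp
  moreover have "2 * ((x - y) \<bullet> x) = (x - y) \<bullet> (x - y)"
    using assms by (simp add: inner_diff_left inner_diff_right inner_commute)
  ultimately show ?thesis by (simp add: rf_eq)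
qed (simp add: rf_eq)

section \<open>Orbits under sets of linear reflections\<close>

inductive_set orb :: "'a::euclidean_space set \<Rightarrow> 'a \<Rightarrow> 'a set" for \<Psi> x where
  orb_base: "x \<in> orb \<Psi> x"
| orb_step: "y \<in> orb \<Psi> x \<Longrightarrow> a \<in> \<Psi> \<Longrightarrow> rf a y \<in> orb \<Psi> x"

lemma orb_inner: "y \<in> orb \<Psi> x \<Longrightarrow> y \<bullet> y = x \<bullet> x"
  by (induction rule: orb.induct) auto

lemma orb_subset:
  assumes "x \<in> S" "\<And>y a. y \<in> S \<Longrightarrow> a \<in> \<Psi> \<Longrightarrow> rf a y \<in> S"
  shows "orb \<Psi> x \<subseteq> S"
proof
  fix y assume "y \<in> orb \<Psi> x" then show "y \<in> S" by induction (use assms in auto)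
qed

lemma orb_add_fixed:
  assumes "\<And>a. a \<in> \<Psi> \<Longrightarrow> a \<bullet> v = 0"
  shows "y \<in> orb \<Psi> x \<Longrightarrow> y + v \<in> orb \<Psi> (x + v)"
proof (induction rule: orb.induct)
  case (orb_step y a)
  have "rf a y + v = rf a (y + v)" using assms[OF orb_step(2)] by (simp add: rf_add rf_fix)
  then show ?case using orb_step by (auto intro: orb.orb_step)
qed (rule orb_base)

text \<open>The sum over the orbit is fixed by every reflection in \<open>\<Psi>\<close>, hence
  perpendicular to \<open>\<Psi>\<close>; but it also lies in the span of
  \<open>\<Psi>\<close>.\<close>

lemma orb_sum_zero:
  assumes fin: "finite (orb \<Psi> x)" and "x \<in> span \<Psi>"
  shows "\<Sum>(orb \<Psi> x) = 0"
proof -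
  define s where "s = \<Sum>(orb \<Psi> x)"
  have fixed: "rf a s = s" if "a \<in> \<Psi>" for a
  proof -
    have "bij_betw (rf a) (orb \<Psi> x) (orb \<Psi> x)"
      using that by (intro bij_betw_byWitness[where f' = "rf a"]) (auto intro: orb_step)
    then have "(\<Sum>y\<in>orb \<Psi> x. rf a y) = s"
      unfolding s_def by (rule sum.reindex_bij_betw)
    then show ?thesis using linear_sum[OF linear_rf, of a "\<lambda>y. y" "orb \<Psi> x"] by (simp add: s_def)
  qed
  have perp: "s \<bullet> a = 0" if "a \<in> \<Psi>" for a
  proof (cases "a = 0")
    case False
    have "(2 * (a \<bullet> s) / (a \<bullet> a)) *\<^sub>R a = 0" using fixed[OF that] by (simp add: rf_eq)
    then show ?thesis using False by (simp add: inner_commute)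
  qed simp
  have "orthogonal s y" if "y \<in> span \<Psi>" for y
    using that perp by (intro orthogonal_to_span[of y \<Psi>]) (simp_all add: orthogonal_def)
  moreover have "orb \<Psi> x \<subseteq> span \<Psi>"
  proof (rule orb_subset[OF assms(2)])
    fix y a assume "y \<in> span \<Psi>" "a \<in> \<Psi>"
    then show "rf a y \<in> span \<Psi>"
      by (rule rf_subspace[OF subspace_span disjI1[OF span_base], rotated])
  qed
  then have "s \<in> span \<Psi>" unfolding s_def by (intro span_sum) auto
  ultimately have "orthogonal s s" by blast
  then show ?thesis by (simp add: orthogonal_self s_def)
qed

text \<open>Since \<open>y \<bullet> z = x \<bullet> x - N k / 2\<close> with an integer \<open>k\<close>, a short orbit is either an orthogonal
  frame or the vertex set of a regular simplex.\<close>

lemma small_orbit: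
  assumes fin: "finite Q" and "x \<in> Q" and sum0: "\<Sum>Q = 0"
    and nrm: "\<And>y. y \<in> Q \<Longrightarrow> y \<bullet> y = x \<bullet> x"
    and dst: "\<And>y z. y \<in> Q \<Longrightarrow> z \<in> Q \<Longrightarrow> \<exists>k\<in>\<int>. (y - z) \<bullet> (y - z) = N * k"
    and "N > 0" and le: "x \<bullet> x \<le> N / 2" and "x \<noteq> 0"
  shows "(x \<bullet> x = N / 2 \<and> (\<forall>y\<in>Q. - y \<in> Q) \<and> (\<forall>y\<in>Q. \<forall>z\<in>Q. z = y \<or> z = - y \<or> y \<bullet> z = 0)) \<or>
    (x \<bullet> x < N / 2 \<and> (\<forall>y\<in>Q. \<forall>z\<in>Q. y \<noteq> z \<longrightarrow> y \<bullet> z = x \<bullet> x - N / 2)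
      \<and> 2 * (x \<bullet> x) * card Q = N * (real (card Q) - 1))"
proof -
  let ?\<nu> = "x \<bullet> x"
  have "?\<nu> > 0" using \<open>x \<noteq> 0\<close> by simp
  have dich: "y \<bullet> z = ?\<nu> - N / 2 \<or> (?\<nu> = N / 2 \<and> z = - y)" if y: "y \<in> Q" and z: "z \<in> Q" and "y \<noteq> z" for y z
  proof -
    obtain k0 where k0: "k0 \<in> \<int>" "(y - z) \<bullet> (y - z) = N * k0" using dst[OF y z] by blast
    from k0(1) obtain k where k: "k0 = real_of_int k" by (rule Ints_cases)
    have yz: "y \<bullet> z = ?\<nu> - N * k / 2"
    proof -
      have "(y - z) \<bullet> (y - z) = y \<bullet> y + z \<bullet> z - 2 * (y \<bullet> z)"
        by (simp add: inner_diff_left inner_diff_right inner_commute)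
      then show ?thesis using k0(2) nrm[OF that(1)] nrm[OF that(2)] unfolding k by linarith
    qed
    have "(y - z) \<bullet> (y - z) > 0" using that by simp
    then have "k > 0" using k0(2) \<open>N > 0\<close> unfolding k by (simp add: zero_less_mult_iff)
    have "(y + z) \<bullet> (y + z) = 4 * ?\<nu> - N * k"
    proof -
      have "(y + z) \<bullet> (y + z) = y \<bullet> y + z \<bullet> z + 2 * (y \<bullet> z)"
        by (simp add: inner_add_left inner_add_right inner_commute)
      then show ?thesis using yz nrm[OF that(1)] nrm[OF that(2)] by linarith
    qed
    \<comment> \<open>Nonnegativity of the squared length of \<open>y + z\<close> bounds
      \<open>k\<close> by 2, and \<open>k = 2\<close> is possible only if
      \<open>y + z = 0\<close>.\<close>
    then have pos: "N * k \<le> 4 * ?\<nu>" and eq: "N * k = 4 * ?\<nu> \<Longrightarrow> y + z = 0"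
      using inner_ge_zero[of "y + z"] inner_eq_zero_iff[of "y + z"] by simp_all
    have "N * k \<le> N * 2" using pos le by linarith
    then have "k \<le> 2" using \<open>N > 0\<close> by simp
    then consider "k = 1" | "k = 2" using \<open>k > 0\<close> by linarith
    then show ?thesis
    proof cases
      case 2
      then have "N * k = N * 2" by simp
      then have "N * k = 4 * ?\<nu>" "?\<nu> = N / 2" using pos le by linarith+
      moreover from this have "y + z = 0" by (intro eq)
      then have "z = - y" by (simp add: add_eq_0_iff)
      ultimately show ?thesis by blast
    next
      case 1
      then show ?thesis using yz by simp
    qed
  qed
  \<comment> \<open>Because \<open>Q\<close> is centred, the inner products of \<open>y\<close> with
    the other members add up to \<open>- ?\<nu>\<close>. In the first alternative this forces
    \<open>- y\<close> into \<open>Q\<close>; in the second it yields the cardinality of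
    \<open>Q\<close>.\<close>
  have tot: "(\<Sum>z\<in>Q - {y}. y \<bullet> z) = - ?\<nu>" if "y \<in> Q" for y
  proof -
    have "0 = y \<bullet> \<Sum>Q" using sum0 by simp
    also have "\<dots> = (\<Sum>z\<in>Q. y \<bullet> z)" by (simp add: inner_sum_right)
    also have "\<dots> = y \<bullet> y + (\<Sum>z\<in>Q - {y}. y \<bullet> z)" using that fin by (simp add: sum.remove)
    also have "y \<bullet> y = ?\<nu>" using that by (rule nrm)
    finally show ?thesis by linarith
  qed
  show ?thesis
  proof (cases "?\<nu> = N / 2")
    case True
    have neg: "- y \<in> Q" if "y \<in> Q" for y
    proof (rule ccontr)
      assume "- y \<notin> Q"
      have "y \<bullet> z = 0" if z: "z \<in> Q - {y}" for z
      proof -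
        have "z \<noteq> - y" using z \<open>- y \<notin> Q\<close> by blast
        then have "y \<bullet> z = ?\<nu> - N / 2" using dich[OF \<open>y \<in> Q\<close>] z by blast
        then show ?thesis using True by linarith
      qed
      then show False using tot[OF \<open>y \<in> Q\<close>] \<open>?\<nu> > 0\<close> by simp
    qed
    have tri: "z = y \<or> z = - y \<or> y \<bullet> z = 0" if "y \<in> Q" "z \<in> Q" for y z
    proof -
      have zero: "?\<nu> - N / 2 = 0" using True by linarith
      show ?thesis using dich[OF that] unfolding zero by blast
    qed
    show ?thesis using True by (intro disjI1 conjI ballI tri neg)
  next
    case False
    then have "y \<bullet> z = ?\<nu> - N / 2" if "y \<in> Q" "z \<in> Q" "y \<noteq> z" for y z
      using dich that by blast
    note eq = this
    have "real (card Q - 1) * (?\<nu> - N / 2) = - ?\<nu>"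
    proof -
      have "(\<Sum>z\<in>Q - {x}. x \<bullet> z) = (\<Sum>z\<in>Q - {x}. ?\<nu> - N / 2)"
        by (intro sum.cong refl eq) (use \<open>x \<in> Q\<close> in auto)
      then show ?thesis using tot[OF \<open>x \<in> Q\<close>] \<open>x \<in> Q\<close> fin by (simp add: card_Diff_singleton)
    qed
    moreover have "real (card Q - 1) = real (card Q) - 1"
      using \<open>x \<in> Q\<close> fin by (subst of_nat_diff) (auto simp: Suc_le_eq card_gt_0_iff)
    ultimately have "(real (card Q) - 1) * (?\<nu> - N / 2) = - ?\<nu>" by simp
    then have "2 * ?\<nu> * card Q = N * (real (card Q) - 1)" by (simp add: algebra_simps)
    moreover have "?\<nu> < N / 2" using False le by linarith
    ultimately show ?thesis by (intro disjI2 conjI ballI impI eq)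
  qed
qed

section \<open>Irreducible crystallographic root systems\<close>

lemma span_orb_invariant:
  assumes "a \<in> \<Psi>" "v \<in> span (orb \<Psi> x)"
  shows "rf a v \<in> span (orb \<Psi> x)"
proof -
  have "rf a ` orb \<Psi> x \<subseteq> orb \<Psi> x" using assms(1) by (auto intro: orb_step)
  then have "rf a ` span (orb \<Psi> x) \<subseteq> span (orb \<Psi> x)"
    by (metis linear_rf linear_span_image span_mono)
  then show ?thesis using assms(2) by blast
qed

lemma orb_mono: "\<Psi> \<subseteq> \<Psi>' \<Longrightarrow> orb \<Psi> x \<subseteq> orb \<Psi>' x"
  by (rule orb_subset) (auto intro: orb_base orb_step)

text \<open>Irreducibility is stated with subspaces in \<open>irr\<close>: if the roots fell into
  two orthogonal parts, the span of one part would be a nontrivial subspace that contains or is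
  perpendicular to each root.\<close>

locale root_sys =
  fixes \<Phi> :: "'a::euclidean_space set"
  assumes fin: "finite \<Phi>" and nz: "0 \<notin> \<Phi>" and span_roots: "span \<Phi> = UNIV"
    and rf_root: "\<alpha> \<in> \<Phi> \<Longrightarrow> \<beta> \<in> \<Phi> \<Longrightarrow> rf \<alpha> \<beta> \<in> \<Phi>"
    and cryst: "\<alpha> \<in> \<Phi> \<Longrightarrow> \<beta> \<in> \<Phi> \<Longrightarrow> 2 * (\<alpha> \<bullet> \<beta>) / (\<alpha> \<bullet> \<alpha>) \<in> \<int>"
    and reduced: "\<alpha> \<in> \<Phi> \<Longrightarrow> c *\<^sub>R \<alpha> \<in> \<Phi> \<Longrightarrow> c = 1 \<or> c = - 1"
    and irr: "subspace S \<Longrightarrow> (\<And>\<alpha>. \<alpha> \<in> \<Phi> \<Longrightarrow> \<alpha> \<in> S \<or> (\<forall>x\<in>S. \<alpha> \<bullet> x = 0)) \<Longrightarrow> S = {0} \<or> S = UNIV"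
begin

lemma neg_root: "\<alpha> \<in> \<Phi> \<Longrightarrow> - \<alpha> \<in> \<Phi>"
  using rf_root[of \<alpha> \<alpha>] by simp

lemma multiple_root: "\<alpha> \<in> \<Phi> \<Longrightarrow> \<beta> \<in> \<Phi> \<Longrightarrow> \<beta> = k *\<^sub>R \<alpha> \<Longrightarrow> \<beta> = \<alpha> \<or> \<beta> = - \<alpha>"
  using reduced[of \<alpha> k] by auto

lemma norm_pos: "\<alpha> \<in> \<Phi> \<Longrightarrow> 0 < \<alpha> \<bullet> \<alpha>"
  using nz by auto

text \<open>The form of \<open>irr\<close> that orbits produce: invariance under a reflection puts
  its root inside the subspace or perpendicular to it.\<close>

lemma irr_invariant:
  assumes "subspace S" "\<And>\<beta> x. \<beta> \<in> \<Phi> \<Longrightarrow> x \<in> S \<Longrightarrow> rf \<beta> x \<in> S"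
  shows "S = {0} \<or> S = UNIV"
proof (rule irr[OF assms(1)])
  fix \<alpha> assume "\<alpha> \<in> \<Phi>"
  then show "\<alpha> \<in> S \<or> (\<forall>x\<in>S. \<alpha> \<bullet> x = 0)"
    using assms nz by (intro rf_preserves_subspaceD) auto
qed

lemma orb_roots: "\<beta> \<in> \<Phi> \<Longrightarrow> orb \<Phi> \<beta> \<subseteq> \<Phi>"
  by (rule orb_subset) (auto intro: rf_root)

lemma span_orb:
  assumes "x \<noteq> 0"
  shows "span (orb \<Phi> x) = UNIV"
proof -
  have "span (orb \<Phi> x) = {0} \<or> span (orb \<Phi> x) = UNIV"
    by (rule irr_invariant) (auto intro: span_orb_invariant)
  moreover have "x \<in> span (orb \<Phi> x)" by (intro span_base orb_base)
  ultimately show ?thesis using assms by blast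
qed

text \<open>By irreducibility an orbit spans the space, so it cannot lie in a hyperplane.\<close>

lemma orb_nonperp:
  assumes "x \<noteq> 0" "a \<noteq> 0"
  obtains y where "y \<in> orb \<Phi> x" "a \<bullet> y \<noteq> 0"
proof -
  have "\<exists>y\<in>orb \<Phi> x. a \<bullet> y \<noteq> 0"
  proof (rule ccontr)
    assume "\<not> ?thesis"
    then have "orthogonal a y" if "y \<in> span (orb \<Phi> x)" for y
      using that by (intro orthogonal_to_span[of y "orb \<Phi> x"]) (simp_all add: orthogonal_def)
    then have "orthogonal a a" using span_orb[OF assms(1)] by blast
    then show False using assms by (simp add: orthogonal_self)
  qed
  then show ?thesis using that by blast
qed

text \<open>The product \<open>p * q\<close> is four times the squared cosine of the angle. It stays
  below 4 because equality in the Cauchy-Schwarz inequality would make the roots proportional,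
  against \<open>reduced\<close>.\<close>

lemma cartan:
  assumes "\<alpha> \<in> \<Phi>" "\<beta> \<in> \<Phi>" "\<beta> \<noteq> \<alpha>" "\<beta> \<noteq> - \<alpha>"
  obtains p q :: int where "2 * (\<alpha> \<bullet> \<beta>) = p * (\<alpha> \<bullet> \<alpha>)" "2 * (\<alpha> \<bullet> \<beta>) = q * (\<beta> \<bullet> \<beta>)"
    "p * q < 4" "p * q \<ge> 0"
proof -
  have pos: "\<alpha> \<bullet> \<alpha> > 0" "\<beta> \<bullet> \<beta> > 0" using assms norm_pos by auto
  obtain p where p: "2 * (\<alpha> \<bullet> \<beta>) / (\<alpha> \<bullet> \<alpha>) = of_int p"
    using cryst[OF assms(1,2)] by (rule Ints_cases)
  obtain q where q: "2 * (\<beta> \<bullet> \<alpha>) / (\<beta> \<bullet> \<beta>) = of_int q"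
    using cryst[OF assms(2,1)] by (rule Ints_cases)
  have p': "2 * (\<alpha> \<bullet> \<beta>) = p * (\<alpha> \<bullet> \<alpha>)" using p pos by (simp add: divide_eq_eq)
  have q': "2 * (\<alpha> \<bullet> \<beta>) = q * (\<beta> \<bullet> \<beta>)" using q pos by (simp add: divide_eq_eq inner_commute)
  have sq: "(\<alpha> \<bullet> \<beta>)\<^sup>2 < (\<alpha> \<bullet> \<alpha>) * (\<beta> \<bullet> \<beta>)"
  proof (rule ccontr)
    assume "\<not> ?thesis"
    then have eq: "(\<alpha> \<bullet> \<beta>)\<^sup>2 = (\<alpha> \<bullet> \<alpha>) * (\<beta> \<bullet> \<beta>)"
      using Cauchy_Schwarz_ineq[of \<alpha> \<beta>] by linarith
    define c where "c = (\<alpha> \<bullet> \<beta>) / (\<alpha> \<bullet> \<alpha>)"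
    have c1: "c * (\<alpha> \<bullet> \<alpha>) = \<alpha> \<bullet> \<beta>" using pos by (simp add: c_def)
    have c2: "c * (\<alpha> \<bullet> \<beta>) = \<beta> \<bullet> \<beta>" using pos eq by (simp add: c_def power2_eq_square field_simps)
    have "(\<beta> - c *\<^sub>R \<alpha>) \<bullet> (\<beta> - c *\<^sub>R \<alpha>) = \<beta> \<bullet> \<beta> - 2 * (c * (\<alpha> \<bullet> \<beta>)) + c * (c * (\<alpha> \<bullet> \<alpha>))"
      by (simp add: inner_diff_left inner_diff_right inner_commute)
    also have "\<dots> = 0" unfolding c1 c2 by simp
    finally have "\<beta> = c *\<^sub>R \<alpha>" by simp
    then show False using reduced[of \<alpha> c] assms by auto
  qed
  have "(of_int (p * q)) * ((\<alpha> \<bullet> \<alpha>) * (\<beta> \<bullet> \<beta>)) = (p * (\<alpha> \<bullet> \<alpha>)) * (q * (\<beta> \<bullet> \<beta>))" by simp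
  also have "\<dots> = 4 * (\<alpha> \<bullet> \<beta>)\<^sup>2" unfolding p'[symmetric] q'[symmetric] by (simp add: power2_eq_square)
  finally have pq: "(of_int (p * q)) * ((\<alpha> \<bullet> \<alpha>) * (\<beta> \<bullet> \<beta>)) = 4 * (\<alpha> \<bullet> \<beta>)\<^sup>2" .
  have P: "(\<alpha> \<bullet> \<alpha>) * (\<beta> \<bullet> \<beta>) > 0" using pos by simp
  have "real_of_int (p * q) * ((\<alpha> \<bullet> \<alpha>) * (\<beta> \<bullet> \<beta>)) < 4 * ((\<alpha> \<bullet> \<alpha>) * (\<beta> \<bullet> \<beta>))"
    unfolding pq using sq by simp
  then have "real_of_int (p * q) < 4" using P mult_less_cancel_right_pos by blast
  moreover have "real_of_int (p * q) * ((\<alpha> \<bullet> \<alpha>) * (\<beta> \<bullet> \<beta>)) \<ge> 0" unfolding pq by simp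
  then have "real_of_int (p * q) \<ge> 0" using P by (simp only: zero_le_mult_iff) linarith
  ultimately show ?thesis using that[OF p' q'] by linarith
qed

text \<open>Equal lengths make the two Cartan integers equal, so a square is below 4.\<close>

lemma same_norm_inner:
  assumes "\<alpha> \<in> \<Phi>" "\<beta> \<in> \<Phi>" "\<beta> \<noteq> \<alpha>" "\<beta> \<noteq> - \<alpha>" "\<alpha> \<bullet> \<alpha> = \<beta> \<bullet> \<beta>"
  shows "\<alpha> \<bullet> \<beta> = 0 \<or> \<alpha> \<bullet> \<beta> = (\<alpha> \<bullet> \<alpha>) / 2 \<or> \<alpha> \<bullet> \<beta> = - (\<alpha> \<bullet> \<alpha>) / 2"
proof -
  obtain p q :: int where pq: "2 * (\<alpha> \<bullet> \<beta>) = p * (\<alpha> \<bullet> \<alpha>)" "2 * (\<alpha> \<bullet> \<beta>) = q * (\<beta> \<bullet> \<beta>)" "p * q < 4"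
    using cartan[OF assms(1-4)] by metis
  then have "real_of_int p = q" using assms(5) norm_pos[OF assms(1)] by simp
  then have "p * p < 4" using pq by simp
  then have "p = 0 \<or> p = 1 \<or> p = - 1"
    using abs_square_less_1[of p] power2_less_imp_less[of "\<bar>p\<bar>" 2] by (auto simp: power2_eq_square)
  then show ?thesis using pq(1) by auto
qed

lemma diff_root:
  assumes "\<alpha> \<in> \<Phi>" "\<beta> \<in> \<Phi>" "2 * (\<alpha> \<bullet> \<beta>) = \<beta> \<bullet> \<beta>"
  shows "\<alpha> - \<beta> \<in> \<Phi>"
proof -
  have "rf \<beta> \<alpha> = \<alpha> - \<beta>" using assms norm_pos[of \<beta>] by (simp add: rf_eq inner_commute)
  then show ?thesis using rf_root[OF assms(2,1)] by simp
qed

lemma add_root: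
  assumes "\<alpha> \<in> \<Phi>" "\<beta> \<in> \<Phi>" "2 * (\<alpha> \<bullet> \<beta>) = - (\<beta> \<bullet> \<beta>)"
  shows "\<alpha> + \<beta> \<in> \<Phi>"
  using diff_root[OF assms(1) neg_root[OF assms(2)]] assms(3) by simp

text \<open>Some root \<open>y\<close> of the orbit is not perpendicular to \<open>\<beta>\<close>,
  and up to sign the product is positive. For equal lengths it is then half the squared length, so
  \<open>y - \<beta>\<close> is a root and its reflection exchanges \<open>y\<close> and
  \<open>\<beta>\<close>.\<close>

lemma norm_conj:
  assumes "\<alpha> \<in> \<Phi>" "\<beta> \<in> \<Phi>" "\<alpha> \<bullet> \<alpha> = \<beta> \<bullet> \<beta>"
  shows "\<beta> \<in> orb \<Phi> \<alpha>"
proof -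
  have *: "\<beta> \<in> orb \<Phi> \<alpha>" if y: "y \<in> orb \<Phi> \<alpha>" and pos: "\<beta> \<bullet> y > 0" for y
  proof (cases "y = \<beta>")
    case False
    have y': "y \<in> \<Phi>" using y orb_roots[OF assms(1)] by blast
    have yy: "\<beta> \<bullet> \<beta> = y \<bullet> y" using orb_inner[OF y] assms by simp
    have "y \<noteq> - \<beta>"
    proof
      assume "y = - \<beta>"
      then have "\<beta> \<bullet> y = - (\<beta> \<bullet> \<beta>)" by simp
      then show False using pos norm_pos[OF assms(2)] by linarith
    qed
    then have "\<beta> \<bullet> y = (\<beta> \<bullet> \<beta>) / 2"
      using same_norm_inner[OF assms(2) y' False _ yy] pos norm_pos[OF assms(2)] by auto
    then have "y - \<beta> \<in> \<Phi>" using y' assms(2) by (intro diff_root) (simp_all add: inner_commute)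
    then have "rf (y - \<beta>) y \<in> orb \<Phi> \<alpha>" using y by (rule orb_step[rotated])
    then show ?thesis using rf_swap[of y \<beta>] yy by simp
  qed (use that in simp)
  obtain y where y: "y \<in> orb \<Phi> \<alpha>" "\<beta> \<bullet> y \<noteq> 0"
    using orb_nonperp[of \<alpha> \<beta>] assms nz by metis
  show ?thesis
  proof (cases "\<beta> \<bullet> y > 0")
    case False
    have "y \<in> \<Phi>" using y orb_roots[OF assms(1)] by blast
    then have "- y \<in> orb \<Phi> \<alpha>" using orb_step[OF y(1), of y] by simp
    then show ?thesis using * False y(2) by (metis inner_minus_right linorder_neqE_linordered_idom neg_0_less_iff_less)
  qed (use * y in blast)
qed

text \<open>For a conjugate \<open>y\<close> of \<open>\<beta>\<close> that is not perpendicular to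
  \<open>\<alpha>\<close>, the quotient of the two Cartan integers is the ratio of the squared
  lengths. Their product is at most 3, so up to sign the smaller one is 1 and the larger one 2 or
  3.\<close>

lemma norm_ratio:
  assumes "\<alpha> \<in> \<Phi>" "\<beta> \<in> \<Phi>" "\<alpha> \<bullet> \<alpha> < \<beta> \<bullet> \<beta>"
  shows "\<beta> \<bullet> \<beta> = 2 * (\<alpha> \<bullet> \<alpha>) \<or> \<beta> \<bullet> \<beta> = 3 * (\<alpha> \<bullet> \<alpha>)"
proof -
  obtain y where y: "y \<in> orb \<Phi> \<beta>" "\<alpha> \<bullet> y \<noteq> 0"
    using orb_nonperp[of \<beta> \<alpha>] assms nz by metis
  have y': "y \<in> \<Phi>" using y orb_roots[OF assms(2)] by blast
  have yy: "y \<bullet> y = \<beta> \<bullet> \<beta>" using orb_inner[OF y(1)] .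
  have ne: "y \<noteq> \<alpha>" "y \<noteq> - \<alpha>" using yy assms(3) by auto
  obtain p q :: int where pq: "2 * (\<alpha> \<bullet> y) = p * (\<alpha> \<bullet> \<alpha>)" "2 * (\<alpha> \<bullet> y) = q * (y \<bullet> y)"
      "p * q < 4" "p * q \<ge> 0"
    using cartan[OF assms(1) y' ne] by metis
  have eq: "p * (\<alpha> \<bullet> \<alpha>) = q * (\<beta> \<bullet> \<beta>)" using pq(1,2) yy by simp
  have n0: "p \<noteq> 0" "q \<noteq> 0" using pq(1,2) y(2) by auto
  have a: "\<alpha> \<bullet> \<alpha> > 0" using norm_pos assms(1) .
  have main: "\<beta> \<bullet> \<beta> = 2 * (\<alpha> \<bullet> \<alpha>) \<or> \<beta> \<bullet> \<beta> = 3 * (\<alpha> \<bullet> \<alpha>)"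
    if "p' * (\<alpha> \<bullet> \<alpha>) = q' * (\<beta> \<bullet> \<beta>)" "p' > 0" "q' > 0" "p' * q' < 4" for p' q' :: int
  proof -
    have "p' > q'"
    proof (rule ccontr)
      assume "\<not> p' > q'"
      then have "p' * (\<alpha> \<bullet> \<alpha>) \<le> q' * (\<alpha> \<bullet> \<alpha>)" using a by (intro mult_right_mono) auto
      also have "\<dots> < q' * (\<beta> \<bullet> \<beta>)" using that assms(3) by simp
      finally show False using that by simp
    qed
    have "q' = 1"
    proof (rule ccontr)
      assume "q' \<noteq> 1"
      then have "q' \<ge> 2" "p' \<ge> 2" using that \<open>p' > q'\<close> by auto
      then have "2 * 2 \<le> p' * q'" by (intro mult_mono) auto
      then show False using that by simp
    qed
    then have "p' = 2 \<or> p' = 3" using that \<open>p' > q'\<close> by auto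
    then show ?thesis using that(1) \<open>q' = 1\<close> by auto
  qed
  show ?thesis
  proof (cases "p > 0")
    case True
    then have "q > 0" using pq(4) n0 by (simp add: zero_le_mult_iff)
    then show ?thesis using main[of p q] eq True pq(3) by simp
  next
    case False
    then have "q < 0" using pq(4) n0 by (simp add: zero_le_mult_iff)
    then show ?thesis using main[of "- p" "- q"] eq False n0 pq(3) by simp
  qed
qed

text \<open>With three different lengths the extreme ratio would be a product of two factors from 2
  and 3, hence at least 4, against \<open>norm_ratio\<close>.\<close>

lemma two_norms:
  assumes "\<alpha> \<in> \<Phi>" "\<beta> \<in> \<Phi>" "\<gamma> \<in> \<Phi>" "\<alpha> \<bullet> \<alpha> \<noteq> \<beta> \<bullet> \<beta>"
  shows "\<gamma> \<bullet> \<gamma> = \<alpha> \<bullet> \<alpha> \<or> \<gamma> \<bullet> \<gamma> = \<beta> \<bullet> \<beta>"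
proof -
  have r: "x \<bullet> x = y \<bullet> y \<or> x \<bullet> x = 2 * (y \<bullet> y) \<or> x \<bullet> x = 3 * (y \<bullet> y) \<or>
      y \<bullet> y = 2 * (x \<bullet> x) \<or> y \<bullet> y = 3 * (x \<bullet> x)" if "x \<in> \<Phi>" "y \<in> \<Phi>" for x y
    using norm_ratio[OF that] norm_ratio[OF that(2,1)] by linarith
  show ?thesis
    using r[OF assms(1,2)] r[OF assms(1,3)] r[OF assms(2,3)] norm_pos[OF assms(1)]
      norm_pos[OF assms(2)] norm_pos[OF assms(3)] assms(4) by linarith
qed

end

lemma inner_diff_self: "(a - b) \<bullet> (a - b) = a \<bullet> a + b \<bullet> b - 2 * (a \<bullet> b)"
  by (simp add: inner_diff_left inner_diff_right inner_commute)

section \<open>Maximal orthogonal decompositions of a root system\<close>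

text \<open>\<open>E\<close> consists of the vectors of an orthogonal basis, adapted to
  \<open>U\<close> and \<open>V\<close>, and their negatives. Since \<open>E\<close> is closed under
  negation, the differences \<open>y - z\<close> cover all
  \<open>\<plusminus>e\<^sub>i \<plusminus>e\<^sub>j\<close>; the multiples of single vectors form
  the other root length, if there is one. These are the types B, C and D.\<close>

definition frame where
  "frame (\<Phi> :: 'a::euclidean_space set) U V E N \<longleftrightarrow> N > 0 \<and> finite E \<and> span E = UNIV
    \<and> (\<forall>y\<in>E. - y \<in> E \<and> y \<bullet> y = N / 2 \<and> (y \<in> U \<or> y \<in> V))
    \<and> (\<forall>y\<in>E. \<forall>z\<in>E. z = y \<or> z = - y \<or> y \<bullet> z = 0)
    \<and> (\<forall>y\<in>E. \<forall>z\<in>E. y \<bullet> z = 0 \<longrightarrow> y - z \<in> \<Phi>)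
    \<and> (\<forall>\<beta>\<in>\<Phi>. (\<exists>y\<in>E. \<exists>z\<in>E. y \<bullet> z = 0 \<and> \<beta> = y - z) \<or> (\<exists>y\<in>E. \<exists>c. \<beta> = c *\<^sub>R y))"

lemma frameD:
  assumes "frame \<Phi> U V E N"
  shows "\<And>y. y \<in> E \<Longrightarrow> - y \<in> E" "\<And>y. y \<in> E \<Longrightarrow> y \<bullet> y = N / 2" "N > 0" "span E = UNIV"
    "\<And>y. y \<in> E \<Longrightarrow> y \<in> U \<or> y \<in> V" "\<And>y z. y \<in> E \<Longrightarrow> z \<in> E \<Longrightarrow> z = y \<or> z = - y \<or> y \<bullet> z = 0"
    "\<And>y z. y \<in> E \<Longrightarrow> z \<in> E \<Longrightarrow> y \<bullet> z = 0 \<Longrightarrow> y - z \<in> \<Phi>" "finite E"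
  using assms unfolding frame_def by blast+

text \<open>\<open>X\<close> is the vertex set of a regular simplex in \<open>U\<close>, centred at
  0, with squared edge length \<open>N\<close>. The last clause says that the roots in
  \<open>U\<close> are the differences of vertices: type \<open>A\<^sub>n\<close> with
  \<open>n = card X - 1\<close>.\<close>

definition simplex_on where
  "simplex_on (\<Phi> :: 'a::euclidean_space set) U X N \<longleftrightarrow> N > 0 \<and> finite X \<and> card X \<ge> 2 \<and> \<Sum>X = 0 \<and> span X = U
    \<and> (\<forall>y\<in>X. 2 * (y \<bullet> y) * card X = N * (real (card X) - 1))
    \<and> (\<forall>y\<in>X. \<forall>z\<in>X. y \<noteq> z \<longrightarrow> y \<bullet> z = y \<bullet> y - N / 2)
    \<and> \<Phi> \<inter> U = {y - z | y z. y \<in> X \<and> z \<in> X \<and> y \<noteq> z}"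

text \<open>\<open>max\<close> says that the reflections in \<open>U\<close>, those in \<open>V\<close> and any further one generate the
  whole Weyl group; invariant sets take the place of generated groups.\<close>

locale split = root_sys \<Phi> for \<Phi> :: "'a::euclidean_space set" +
  fixes U V :: "'a set"
  assumes subU: "subspace U" and subV: "subspace V"
    and perp: "\<And>x y. x \<in> U \<Longrightarrow> y \<in> V \<Longrightarrow> x \<bullet> y = 0"
    and decomp: "\<And>x. \<exists>u\<in>U. \<exists>v\<in>V. x = u + v"
    and spanU: "span (\<Phi> \<inter> U) = U" and spanV: "span (\<Phi> \<inter> V) = V"
    and U0: "U \<noteq> {0}" and V0: "V \<noteq> {0}"
    and max: "\<And>\<gamma> S \<beta> x. \<gamma> \<in> \<Phi> \<Longrightarrow> \<gamma> \<notin> U \<Longrightarrow> \<gamma> \<notin> V \<Longrightarrow>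
      (\<And>\<alpha> x. \<alpha> \<in> \<Phi> \<Longrightarrow> \<alpha> \<in> U \<or> \<alpha> \<in> V \<Longrightarrow> x \<in> S \<Longrightarrow> rf \<alpha> x \<in> S) \<Longrightarrow>
      (\<And>x. x \<in> S \<Longrightarrow> rf \<gamma> x \<in> S) \<Longrightarrow> \<beta> \<in> \<Phi> \<Longrightarrow> x \<in> S \<Longrightarrow> rf \<beta> x \<in> S"

lemma split_swap: "split \<Phi> U V \<Longrightarrow> split \<Phi> V U"
proof -
  assume "split \<Phi> U V"
  then interpret split \<Phi> U V .
  show "split \<Phi> V U"
  proof
    fix x show "\<exists>u\<in>V. \<exists>v\<in>U. x = u + v" using decomp[of x] by (metis add.commute)
  next
    fix x y assume "x \<in> V" "y \<in> U" then show "x \<bullet> y = 0" using perp[of y x] by (simp add: inner_commute)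
  next
    fix \<gamma> S \<beta> x
    assume *: "\<gamma> \<in> \<Phi>" "\<gamma> \<notin> V" "\<gamma> \<notin> U"
      "\<And>\<alpha> x. \<alpha> \<in> \<Phi> \<Longrightarrow> \<alpha> \<in> V \<or> \<alpha> \<in> U \<Longrightarrow> x \<in> S \<Longrightarrow> rf \<alpha> x \<in> S"
      "\<And>x. x \<in> S \<Longrightarrow> rf \<gamma> x \<in> S" "\<beta> \<in> \<Phi>" "x \<in> S"
    show "rf \<beta> x \<in> S"
      by (rule max[of \<gamma> S, OF *(1,3,2)]) (use * in blast)+
  qed (rule subU subV spanU spanV U0 V0)+
qed

context split
begin

lemma U_notUNIV: "U \<noteq> UNIV"
proof
  assume "U = UNIV"
  then have "y \<bullet> y = 0" if "y \<in> V" for y using perp[of y y] that by simp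
  then show False using V0 subspace_0[OF subV] by auto
qed

lemma mixed_root_exists: obtains \<gamma> where "\<gamma> \<in> \<Phi>" "\<gamma> \<notin> U" "\<gamma> \<notin> V"
proof -
  have "\<exists>\<gamma>\<in>\<Phi>. \<gamma> \<notin> U \<and> \<gamma> \<notin> V"
  proof (rule ccontr)
    assume "\<not> ?thesis"
    then have "U = {0} \<or> U = UNIV"
      using perp by (intro irr[OF subU]) (metis inner_commute)
    then show False using U0 U_notUNIV by blast
  qed
  then show ?thesis using that by blast
qed

lemma decomposeE:
  obtains g h where "g \<in> U" "h \<in> V" "x = g + h" "x \<bullet> x = g \<bullet> g + h \<bullet> h"
proof -
  obtain g h where gh: "g \<in> U" "h \<in> V" "x = g + h" using decomp[of x] by blast
  moreover have "x \<bullet> x = g \<bullet> g + h \<bullet> h"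
    using gh perp[OF gh(1,2)] by (simp add: inner_add_left inner_add_right inner_commute)
  ultimately show ?thesis using that by blast
qed

lemma decompose_mixedE:
  assumes "\<gamma> \<notin> U" "\<gamma> \<notin> V"
  obtains g h where "g \<in> U" "h \<in> V" "\<gamma> = g + h" "\<gamma> \<bullet> \<gamma> = g \<bullet> g + h \<bullet> h" "g \<noteq> 0" "h \<noteq> 0"
proof -
  obtain g h where gh: "g \<in> U" "h \<in> V" "\<gamma> = g + h" "\<gamma> \<bullet> \<gamma> = g \<bullet> g + h \<bullet> h" by (rule decomposeE)
  then show ?thesis using that assms by fastforce
qed

text \<open>Reflections in roots of \<open>U\<close> fix \<open>h\<close>, so moving the component
  \<open>g\<close> moves the whole root \<open>g + h\<close>.\<close>

lemma orb_component:
  assumes "g + h \<in> \<Phi>" "g \<in> U" "h \<in> V" "y \<in> orb (\<Phi> \<inter> U) g"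
  shows "y \<in> U" "y + h \<in> \<Phi>" "y \<bullet> y = g \<bullet> g" "(y + h) \<bullet> (y + h) = (g + h) \<bullet> (g + h)"
proof -
  have "orb (\<Phi> \<inter> U) g \<subseteq> U"
    using assms(2) by (intro orb_subset) (auto intro!: rf_subspace[OF subU])
  then show "y \<in> U" using assms by blast
  have *: "y + h \<in> orb (\<Phi> \<inter> U) (g + h)"
    using assms(3,4) perp by (intro orb_add_fixed) auto
  then have "y + h \<in> orb \<Phi> (g + h)" using orb_mono[of "\<Phi> \<inter> U" \<Phi>] by blast
  then show "y + h \<in> \<Phi>" using orb_roots[OF assms(1)] by blast
  show "y \<bullet> y = g \<bullet> g" by (rule orb_inner[OF assms(4)])
  show "(y + h) \<bullet> (y + h) = (g + h) \<bullet> (g + h)" by (rule orb_inner[OF *])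
qed

lemma orb_component_finite:
  assumes "g + h \<in> \<Phi>" "g \<in> U" "h \<in> V"
  shows "finite (orb (\<Phi> \<inter> U) g)"
proof -
  have "orb (\<Phi> \<inter> U) g \<subseteq> (\<lambda>x. x - h) ` \<Phi>"
  proof
    fix y assume "y \<in> orb (\<Phi> \<inter> U) g"
    then have "y + h \<in> \<Phi>" using orb_component[OF assms] by blast
    then show "y \<in> (\<lambda>x. x - h) ` \<Phi>" by (rule rev_image_eqI) simp
  qed
  then show ?thesis using fin finite_subset by blast
qed

text \<open>\<open>y - z\<close> is also the difference of the roots \<open>y + h\<close> and
  \<open>z + h\<close>. These have the same length, so the square of the difference is that of a
  root times 2 minus a Cartan integer.\<close>

lemma orb_component_dist:
  assumes "g + h \<in> \<Phi>" "g \<in> U" "h \<in> V" "y \<in> orb (\<Phi> \<inter> U) g" "z \<in> orb (\<Phi> \<inter> U) g"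
  shows "\<exists>k\<in>\<int>. (y - z) \<bullet> (y - z) = ((g + h) \<bullet> (g + h)) * k"
proof -
  let ?N = "(g + h) \<bullet> (g + h)"
  note y = orb_component[OF assms(1-3,4)] and z = orb_component[OF assms(1-3,5)]
  have pos: "?N > 0" by (rule norm_pos[OF assms(1)])
  have "2 * ((y + h) \<bullet> (z + h)) / ?N \<in> \<int>" using cryst[OF y(2) z(2)] unfolding y(4) .
  then have "2 - 2 * ((y + h) \<bullet> (z + h)) / ?N \<in> \<int>" by (intro Ints_diff) auto
  moreover have "(y - z) \<bullet> (y - z) = 2 * ?N - 2 * ((y + h) \<bullet> (z + h))"
    using inner_diff_self[of "y + h" "z + h"] y(4) z(4) by simp
  then have "(y - z) \<bullet> (y - z) = ?N * (2 - 2 * ((y + h) \<bullet> (z + h)) / ?N)"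
    using pos by (simp add: right_diff_distrib)
  ultimately show ?thesis by blast
qed

text \<open>The complement of the span of the orbit would be invariant under the whole group.\<close>

lemma orb_component_span:
  assumes "\<gamma> \<in> \<Phi>" "\<gamma> = g + h" "g \<in> U" "h \<in> V" "g \<noteq> 0" "h \<noteq> 0"
  shows "span (orb (\<Phi> \<inter> U) g) = U"
proof -
  let ?S = "span (orb (\<Phi> \<inter> U) g)"
  define T where "T = {x \<in> U. \<forall>y\<in>?S. x \<bullet> y = 0}"
  have S: "?S \<subseteq> U"
    using orb_component[of g h] assms subU by (intro span_minimal) auto
  have subT: "subspace T" using subU unfolding T_def
    by (auto simp: subspace_def inner_add_left)
  have \<gamma>: "\<gamma> \<notin> U" "\<gamma> \<notin> V"
  proof -
    show "\<gamma> \<notin> U"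
    proof
      assume "\<gamma> \<in> U"
      then have "h \<in> U" using subspace_diff[OF subU _ assms(3)] assms(2) by fastforce
      then show False using perp[of h h] assms by simp
    qed
    show "\<gamma> \<notin> V"
    proof
      assume "\<gamma> \<in> V"
      then have "g \<in> V" using subspace_diff[OF subV _ assms(4)] assms(2) by fastforce
      then show False using perp[of g g] assms by simp
    qed
  qed
  have T: "rf \<beta> x \<in> T" if "\<beta> \<in> \<Phi>" "x \<in> T" for \<beta> x
  proof (rule max[OF assms(1) \<gamma> _ _ that])
    fix x assume "x \<in> T"
    then have "x \<bullet> g = 0" "x \<bullet> h = 0"
      using perp[of x h] assms(4) span_base[OF orb_base, of g "\<Phi> \<inter> U"] by (auto simp: T_def)
    then have "\<gamma> \<bullet> x = 0" unfolding assms(2) by (simp add: inner_add_left inner_add_right inner_commute)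
    then show "rf \<gamma> x \<in> T" using \<open>x \<in> T\<close> by (simp add: rf_fix)
  next
    fix \<alpha> x assume \<alpha>: "\<alpha> \<in> \<Phi>" "\<alpha> \<in> U \<or> \<alpha> \<in> V" and x: "x \<in> T"
    show "rf \<alpha> x \<in> T"
    proof (cases "\<alpha> \<in> V")
      case True
      then have "\<alpha> \<bullet> x = 0" using x perp[of x \<alpha>] by (simp add: T_def inner_commute)
      then show ?thesis using x by (simp add: rf_fix)
    next
      case False
      then have "\<alpha> \<in> U" using \<alpha> by blast
      \<comment> \<open>A root of \<open>U\<close> preserves the span of the orbit, so it lies in it
        and fixes \<open>T\<close> pointwise, or it is perpendicular to it and lies in
        \<open>T\<close>.\<close>
      then have "\<alpha> \<in> ?S \<or> (\<forall>x\<in>?S. \<alpha> \<bullet> x = 0)"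
        using \<alpha> nz by (intro rf_preserves_subspaceD subspace_span span_orb_invariant) auto
      then show ?thesis
      proof
        assume "\<alpha> \<in> ?S"
        then have "\<alpha> \<bullet> x = 0" using x by (simp add: T_def inner_commute)
        then show ?thesis using x by (simp add: rf_fix)
      next
        assume "\<forall>x\<in>?S. \<alpha> \<bullet> x = 0"
        then have "\<alpha> \<in> T" using \<open>\<alpha> \<in> U\<close> by (simp add: T_def)
        then show ?thesis using x subT by (intro rf_subspace) auto
      qed
    qed
  qed
  have "T = {0} \<or> T = UNIV" using irr_invariant[OF subT T] by blast
  moreover have "T \<subseteq> U" by (auto simp: T_def)
  then have "T \<noteq> UNIV" using U_notUNIV by blast
  ultimately have "T = {0}" by blast
  have "U \<subseteq> ?S"
  proof
    fix x assume "x \<in> U"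
    obtain y z where yz: "y \<in> span ?S" "\<And>w. w \<in> span ?S \<Longrightarrow> orthogonal z w" "x = y + z"
      using orthogonal_subspace_decomp_exists[of ?S x] by metis
    have "y \<in> U" using yz(1) S by (auto simp: span_span)
    then have "z \<in> U" using subspace_diff[OF subU \<open>x \<in> U\<close>, of y] yz(3) by simp
    then have "z \<in> T" using yz(2) by (simp add: T_def span_span orthogonal_def)
    then show "x \<in> ?S" using \<open>T = {0}\<close> yz by (simp add: span_span)
  qed
  then show ?thesis using S by blast
qed

text \<open>An instance of \<open>small_orbit\<close>, whose integrality hypothesis is
  \<open>orb_component_dist\<close>.\<close>

lemma orb_component_cases:
  assumes "\<gamma> \<in> \<Phi>" "\<gamma> = g + h" "g \<in> U" "h \<in> V" "g \<noteq> 0" "g \<bullet> g \<le> (\<gamma> \<bullet> \<gamma>) / 2"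
  shows "(g \<bullet> g = (\<gamma> \<bullet> \<gamma>) / 2 \<and> (\<forall>y\<in>orb (\<Phi> \<inter> U) g. - y \<in> orb (\<Phi> \<inter> U) g) \<and>
      (\<forall>y\<in>orb (\<Phi> \<inter> U) g. \<forall>z\<in>orb (\<Phi> \<inter> U) g. z = y \<or> z = - y \<or> y \<bullet> z = 0)) \<or>
    (g \<bullet> g < (\<gamma> \<bullet> \<gamma>) / 2 \<and>
      (\<forall>y\<in>orb (\<Phi> \<inter> U) g. \<forall>z\<in>orb (\<Phi> \<inter> U) g. y \<noteq> z \<longrightarrow> y \<bullet> z = g \<bullet> g - (\<gamma> \<bullet> \<gamma>) / 2)
      \<and> 2 * (g \<bullet> g) * card (orb (\<Phi> \<inter> U) g) = (\<gamma> \<bullet> \<gamma>) * (real (card (orb (\<Phi> \<inter> U) g)) - 1))"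
proof (rule small_orbit)
  note gh = assms(1)[unfolded assms(2)]
  show f: "finite (orb (\<Phi> \<inter> U) g)" by (rule orb_component_finite[OF gh assms(3,4)])
  show "\<Sum>(orb (\<Phi> \<inter> U) g) = 0" using f assms(3) spanU by (intro orb_sum_zero) auto
  show "y \<bullet> y = g \<bullet> g" if "y \<in> orb (\<Phi> \<inter> U) g" for y by (rule orb_inner[OF that])
  show "\<exists>k\<in>\<int>. (y - z) \<bullet> (y - z) = (\<gamma> \<bullet> \<gamma>) * k"
    if "y \<in> orb (\<Phi> \<inter> U) g" "z \<in> orb (\<Phi> \<inter> U) g" for y z
    unfolding assms(2) by (rule orb_component_dist[OF gh assms(3,4) that])
  show "0 < \<gamma> \<bullet> \<gamma>" by (rule norm_pos[OF assms(1)])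
qed (use assms in \<open>auto intro: orb_base\<close>)

end

context root_sys
begin

text \<open>If \<open>y - z\<close> has the length of a root \<open>\<gamma>\<close> with \<open>2 * (\<alpha> \<bullet> \<gamma>) = k * (\<alpha> \<bullet> \<alpha>)\<close>, then both \<open>k\<close> and \<open>1 / k\<close>
  are integers.\<close>

lemma root_scaling_unit:
  assumes "\<alpha> \<in> \<Phi>" "\<gamma> \<in> \<Phi>" "w = k *\<^sub>R \<alpha>" "2 * (\<alpha> \<bullet> \<gamma>) = k * (\<alpha> \<bullet> \<alpha>)" "w \<bullet> w = \<gamma> \<bullet> \<gamma>"
  shows "w = \<alpha> \<or> w = - \<alpha>"
proof -
  have a: "\<alpha> \<bullet> \<alpha> > 0" and c: "\<gamma> \<bullet> \<gamma> > 0" using norm_pos assms by auto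
  have N: "\<gamma> \<bullet> \<gamma> = k * k * (\<alpha> \<bullet> \<alpha>)" using assms(3,5) by simp
  then have k0: "k \<noteq> 0" using c by auto
  have "2 * (\<alpha> \<bullet> \<gamma>) / (\<alpha> \<bullet> \<alpha>) = k" using assms(4) a by simp
  then obtain m where m: "k = of_int m" using cryst[OF assms(1,2)] by (metis Ints_cases)
  have "2 * (\<gamma> \<bullet> \<alpha>) / (\<gamma> \<bullet> \<gamma>) = 1 / k"
    using assms(4) a k0 unfolding N by (simp add: inner_commute field_simps)
  then obtain n where n: "1 / k = of_int n" using cryst[OF assms(2,1)] by (metis Ints_cases)
  have "real_of_int (m * n) = 1" using m n k0 by (simp add: field_simps)
  then have "m * n = 1" by linarith
  then have "m = 1 \<or> m = - 1" by (rule zmult_eq_1_iff[THEN iffD1, THEN disj_forward]) auto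
  then show ?thesis using m assms(3) by auto
qed

end

context split
begin

text \<open>Both components have half the squared length of \<open>\<gamma>\<close>, so both orbits
  are orthogonal frames and their union \<open>E\<close> spans. Once \<open>E\<close> is known to be
  invariant under all reflections, every root is parallel to a difference \<open>y - z\<close> of
  members of \<open>E\<close>, which lists all roots.\<close>

lemma frame_case:
  assumes \<gamma>: "\<gamma> \<in> \<Phi>" "\<gamma> = g + h" "g \<in> U" "h \<in> V" "g \<bullet> g = (\<gamma> \<bullet> \<gamma>) / 2"
  shows "\<exists>E. frame \<Phi> U V E (\<gamma> \<bullet> \<gamma>)"
proof -
  interpret s: split \<Phi> V U by (rule split_swap) (rule split_axioms)
  let ?N = "\<gamma> \<bullet> \<gamma>"
  define A where "A = orb (\<Phi> \<inter> U) g"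
  define B where "B = orb (\<Phi> \<inter> V) h"
  have N: "?N > 0" by (rule norm_pos[OF \<gamma>(1)])
  have \<gamma>': "\<gamma> = h + g" using \<gamma>(2) by (simp add: add.commute)
  have "?N = g \<bullet> g + h \<bullet> h"
    using perp[OF \<gamma>(3,4)] unfolding \<gamma>(2) by (simp add: inner_add_left inner_add_right inner_commute)
  then have hh: "h \<bullet> h = ?N / 2" using \<gamma>(5) by simp
  have g0: "g \<noteq> 0" and h0: "h \<noteq> 0" using \<gamma>(5) hh N by auto
  have A: "\<And>y. y \<in> A \<Longrightarrow> - y \<in> A" "\<And>y z. y \<in> A \<Longrightarrow> z \<in> A \<Longrightarrow> z = y \<or> z = - y \<or> y \<bullet> z = 0"
    using orb_component_cases[OF \<gamma>(1-4) g0] \<gamma>(5) unfolding A_def by auto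
  have B: "\<And>y. y \<in> B \<Longrightarrow> - y \<in> B" "\<And>y z. y \<in> B \<Longrightarrow> z \<in> B \<Longrightarrow> z = y \<or> z = - y \<or> y \<bullet> z = 0"
    using s.orb_component_cases[OF \<gamma>(1) \<gamma>' \<gamma>(4,3) h0] hh unfolding B_def by auto
  note gh = \<gamma>(1)[unfolded \<gamma>(2)] and hg = \<gamma>(1)[unfolded \<gamma>']
  have AU: "y \<in> U" "y + h \<in> \<Phi>" "y \<bullet> y = ?N / 2" if "y \<in> A" for y
    using orb_component[OF gh \<gamma>(3,4)] that \<gamma>(5) unfolding A_def by auto
  have BV: "y \<in> V" "y \<bullet> y = ?N / 2" if "y \<in> B" for y
    using s.orb_component[OF hg \<gamma>(4,3)] that hh unfolding B_def by auto
  have AB: "y + z \<in> \<Phi>" if "y \<in> A" "z \<in> B" for y z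
    using s.orb_component(2)[of h y z] AU[OF \<open>y \<in> A\<close>] that(2) \<gamma>(4)
    unfolding B_def by (simp add: add.commute)
  have ABd: "y - z \<in> \<Phi>" if "y \<in> A" "z \<in> B" for y z
    using AB[OF that(1) B(1)[OF that(2)]] by simp
  have finE: "finite (A \<union> B)"
    unfolding A_def B_def
    using orb_component_finite[OF gh \<gamma>(3,4)] s.orb_component_finite[OF hg \<gamma>(4,3)] by blast
  have gA: "g \<in> A" "h \<in> B" by (simp_all add: A_def B_def orb_base)
  define E where "E = A \<union> B"
  have Eneg: "- y \<in> E" if "y \<in> E" for y using that A(1) B(1) by (auto simp: E_def)
  have Enorm: "y \<bullet> y = ?N / 2" if "y \<in> E" for y using that AU BV by (auto simp: E_def)
  have ABp: "y \<bullet> z = 0" if "y \<in> A" "z \<in> B" for y z using perp AU(1) BV(1) that by blast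
  have Etri: "z = y \<or> z = - y \<or> y \<bullet> z = 0" if "y \<in> E" "z \<in> E" for y z
    using that A(2)[of y z] B(2)[of y z] ABp[of y z] ABp[of z y] by (auto simp: E_def inner_commute)
  have spanE: "span E = UNIV"
  proof -
    have "U \<subseteq> span E" "V \<subseteq> span E"
      using orb_component_span[OF \<gamma>(1-4) g0 h0] s.orb_component_span[OF \<gamma>(1) \<gamma>' \<gamma>(4,3) h0 g0]
        span_mono[of A E] span_mono[of B E] unfolding A_def B_def E_def by blast+
    then have "x \<in> span E" for x using decomp[of x] by (metis span_add subset_iff)
    then show ?thesis by blast
  qed
  \<comment> \<open>The reflection in the root \<open>y' - h\<close> fixes \<open>y\<close> and
    exchanges \<open>h\<close> and \<open>y'\<close>, so it carries the root \<open>y - h\<close> to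
    \<open>y - y'\<close>.\<close>
  have diffA: "y - y' \<in> \<Phi>" if "y \<in> A" "y' \<in> A" "y \<bullet> y' = 0" for y y'
  proof -
    have "rf (y' - h) (y - h) = y - y'"
    proof -
      have "y' \<bullet> y = 0" using that by (simp add: inner_commute)
      moreover have "h \<bullet> y = 0" using ABp[OF that(1) gA(2)] by (simp add: inner_commute)
      ultimately have "rf (y' - h) y = y" by (intro rf_fix) (simp add: inner_diff_left)
      moreover have "rf (- (h - y')) h = y'"
        using rf_scaled[of "- 1" "h - y'"] rf_swap[of h y'] AU(3)[OF that(2)] hh by simp
      ultimately show ?thesis by (simp add: rf_diff)
    qed
    moreover have "rf (y' - h) (y - h) \<in> \<Phi>" using ABd that gA by (intro rf_root) auto
    ultimately show ?thesis by simp
  qed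
  have diffB: "y - y' \<in> \<Phi>" if "y \<in> B" "y' \<in> B" "y \<bullet> y' = 0" for y y'
  proof -
    have "rf (g - y') (g - y) = y' - y"
    proof -
      have "y' \<bullet> y = 0" using that by (simp add: inner_commute)
      moreover have "g \<bullet> y = 0" using ABp[OF gA(1) that(1)] .
      ultimately have "rf (g - y') y = y" by (intro rf_fix) (simp add: inner_diff_left)
      moreover have "rf (g - y') g = y'"
        using BV(2)[OF that(2)] \<gamma>(5) by (intro rf_swap) simp
      ultimately show ?thesis by (simp add: rf_diff)
    qed
    moreover have "rf (g - y') (g - y) \<in> \<Phi>" using ABd that gA by (intro rf_root) auto
    ultimately have "- (y' - y) \<in> \<Phi>" by (intro neg_root) simp
    then show ?thesis by simp
  qed
  have Ediff: "y - z \<in> \<Phi>" if "y \<in> E" "z \<in> E" "y \<bullet> z = 0" for y z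
    using that diffA diffB ABd neg_root[OF ABd[of z y]] by (auto simp: E_def)
  have \<gamma>mix: "\<gamma> \<notin> U" "\<gamma> \<notin> V"
  proof -
    show "\<gamma> \<notin> U"
    proof
      assume "\<gamma> \<in> U"
      then have "h \<in> U" using subspace_diff[OF subU _ \<gamma>(3)] \<gamma>(2) by fastforce
      then show False using perp[of h h] \<gamma>(4) h0 by simp
    qed
    show "\<gamma> \<notin> V"
    proof
      assume "\<gamma> \<in> V"
      then have "g \<in> V" using subspace_diff[OF subV _ \<gamma>(4)] \<gamma>(2) by fastforce
      then show False using perp[of g g] \<gamma>(3) g0 by simp
    qed
  qed
  \<comment> \<open>By \<open>max\<close> it is enough to treat the roots in \<open>U\<close> or
    \<open>V\<close>, which preserve one orbit and fix the other pointwise, and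
    \<open>\<gamma>\<close>, which exchanges \<open>g\<close> with \<open>- h\<close> and fixes what
    is perpendicular to both.\<close>
  have Einv: "rf \<beta> x \<in> E" if "\<beta> \<in> \<Phi>" "x \<in> E" for \<beta> x
  proof (rule max[OF \<gamma>(1) \<gamma>mix _ _ that])
    fix \<alpha> x assume \<alpha>: "\<alpha> \<in> \<Phi>" "\<alpha> \<in> U \<or> \<alpha> \<in> V" and x: "x \<in> E"
    consider "\<alpha> \<in> U" "x \<in> A" | "\<alpha> \<in> U" "x \<in> B" | "\<alpha> \<in> V" "x \<in> A" | "\<alpha> \<in> V" "x \<in> B"
      using \<alpha> x by (auto simp: E_def)
    then show "rf \<alpha> x \<in> E"
    proof cases
      case 1 then show ?thesis using \<alpha> by (auto simp: E_def A_def intro: orb_step)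
    next
      case 2 then show ?thesis using perp[of \<alpha> x] BV x by (simp add: rf_fix)
    next
      case 3 then show ?thesis using perp[of x \<alpha>] AU x by (simp add: rf_fix inner_commute)
    next
      case 4 then show ?thesis using \<alpha> by (auto simp: E_def B_def intro: orb_step)
    qed
  next
    fix x assume x: "x \<in> E"
    have gE: "g \<in> E" "h \<in> E" using gA by (auto simp: E_def)
    have r1: "rf \<gamma> g = - h" using rf_swap[of g "- h"] \<gamma>(2,5) hh by simp
    have r2: "rf \<gamma> h = - g" using rf_swap[of h "- g"] \<gamma>' \<gamma>(5) hh by simp
    have r3: "rf \<gamma> x = x" if "g \<bullet> x = 0" "h \<bullet> x = 0"
      using that \<gamma>(2) by (intro rf_fix) (simp add: inner_add_left)
    consider "x = g" | "x = - g" | "x = h" | "x = - h" | "g \<bullet> x = 0" "h \<bullet> x = 0"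
      using Etri[OF gE(1) x] Etri[OF gE(2) x] by blast
    then show "rf \<gamma> x \<in> E"
      by cases (simp_all add: rf_minus r1 r2 r3 gE x Eneg)
  qed
  \<comment> \<open>\<open>E\<close> spans, so \<open>\<beta>\<close> moves some \<open>y\<close> in
    \<open>E\<close> to a \<open>z\<close> in \<open>E\<close>, and \<open>y - z\<close> is a
    multiple of \<open>\<beta>\<close>. If \<open>z = - y\<close> then \<open>\<beta>\<close> is a
    multiple of \<open>y\<close>; otherwise \<open>y - z\<close> is a root itself and equals
    \<open>\<beta>\<close> up to sign.\<close>
  have roots: "(\<exists>y\<in>E. \<exists>z\<in>E. y \<bullet> z = 0 \<and> \<beta> = y - z) \<or> (\<exists>y\<in>E. \<exists>c. \<beta> = c *\<^sub>R y)" if \<beta>: "\<beta> \<in> \<Phi>" for \<beta>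
  proof -
    have "\<exists>y\<in>E. \<beta> \<bullet> y \<noteq> 0"
    proof (rule ccontr)
      assume "\<not> ?thesis"
      then have "orthogonal \<beta> y" if "y \<in> span E" for y
        using that by (intro orthogonal_to_span[of y E]) (simp_all add: orthogonal_def)
      then have "orthogonal \<beta> \<beta>" using spanE by blast
      then show False using \<beta> nz by (auto simp: orthogonal_self)
    qed
    then obtain y where y: "y \<in> E" "\<beta> \<bullet> y \<noteq> 0" by blast
    define t where "t = 2 * (\<beta> \<bullet> y) / (\<beta> \<bullet> \<beta>)"
    have t: "t \<noteq> 0" using y norm_pos[OF \<beta>] by (simp add: t_def)
    define z where "z = rf \<beta> y"
    have z: "z \<in> E" using Einv[OF \<beta> y(1)] by (simp add: z_def)
    have yz: "y - z = t *\<^sub>R \<beta>" by (simp add: z_def rf_eq t_def)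
    consider "z = y" | "z = - y" | "y \<bullet> z = 0" using Etri[OF y(1) z] by blast
    then show ?thesis
    proof cases
      case 1 then show ?thesis using yz t \<beta> nz by auto
    next
      case 2
      then have "t *\<^sub>R \<beta> = 2 *\<^sub>R y" using yz by (simp add: scaleR_2)
      then have "inverse t *\<^sub>R t *\<^sub>R \<beta> = (inverse t * 2) *\<^sub>R y" by simp
      then have "\<beta> = (inverse t * 2) *\<^sub>R y" using t by simp
      then show ?thesis using y(1) by blast
    next
      case 3
      then have "t = 1 \<or> t = - 1" using reduced[OF \<beta>] Ediff[OF y(1) z] yz by metis
      then have "\<beta> = y - z \<or> \<beta> = z - y" using yz minus_diff_eq[of y z] by auto
      then show ?thesis using y(1) z 3 by (metis inner_commute)
    qed
  qed
  have UV: "y \<in> U \<or> y \<in> V" if "y \<in> E" for y using that AU(1) BV(1) by (auto simp: E_def)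
  have "frame \<Phi> U V E ?N"
    unfolding frame_def
    by (intro conjI ballI impI N finE[folded E_def] spanE Eneg Enorm UV Etri Ediff roots)
  then show ?thesis by blast
qed

end

section \<open>Regular simplices and the roots of type A\<close>

lemma simplex_dist:
  assumes "simplex_on \<Phi> U X N" "y \<in> X" "z \<in> X" "y \<noteq> z"
  shows "(y - z) \<bullet> (y - z) = N"
proof -
  have "y \<bullet> z = y \<bullet> y - N / 2" "z \<bullet> y = z \<bullet> z - N / 2"
    using assms unfolding simplex_on_def by metis+
  then show ?thesis by (simp add: inner_diff_self inner_commute)
qed

text \<open>The Gram matrix of the vertices is \<open>N / 2\<close> times the identity plus a
  constant matrix, and the constant part vanishes against \<open>\<Sum>X = 0\<close>. Hence
  \<open>T\<close> fixes each vertex and is the identity on \<open>U\<close>.\<close>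

lemma simplex_tight_frame:
  assumes X: "simplex_on \<Phi> U X N" and "v \<in> U"
  shows "v \<bullet> v = (2 / N) * (\<Sum>x\<in>X. (v \<bullet> x)\<^sup>2)"
proof -
  define T where "T = (\<lambda>v. (2 / N) *\<^sub>R (\<Sum>x\<in>X. (v \<bullet> x) *\<^sub>R x))"
  have N: "N > 0" and f: "finite X" and s0: "\<Sum>X = 0" and sp: "span X = U"
    using X by (auto simp: simplex_on_def)
  have in1: "x \<bullet> z = x \<bullet> x - N / 2" if "x \<in> X" "z \<in> X" "x \<noteq> z" for x z
    using X that unfolding simplex_on_def by metis
  have "linear T"
  proof (rule linearI)
    show "T (v + w) = T v + T w" for v w
      by (simp add: T_def inner_add_left scaleR_add_left sum.distrib scaleR_add_right)
    show "T (c *\<^sub>R v) = c *\<^sub>R T v" for c v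
      by (simp add: T_def scaleR_sum_right mult.left_commute mult.commute)
  qed
  have TX: "T x = x" if x: "x \<in> X" for x
  proof -
    have "(\<Sum>z\<in>X. (x \<bullet> z) *\<^sub>R z) = (x \<bullet> x) *\<^sub>R x + (\<Sum>z\<in>X - {x}. (x \<bullet> z) *\<^sub>R z)"
      using f x by (simp add: sum.remove)
    also have "(\<Sum>z\<in>X - {x}. (x \<bullet> z) *\<^sub>R z) = (\<Sum>z\<in>X - {x}. (x \<bullet> x - N / 2) *\<^sub>R z)"
      using in1[OF x] by (intro sum.cong refl) auto
    also have "\<dots> = (x \<bullet> x - N / 2) *\<^sub>R (\<Sum>X - x)"
      using f x by (simp add: scaleR_sum_right[symmetric] sum_diff1)
    finally have "(\<Sum>z\<in>X. (x \<bullet> z) *\<^sub>R z) = (N / 2) *\<^sub>R x"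
      using s0 by (simp add: algebra_simps)
    then show ?thesis using N by (simp add: T_def)
  qed
  have "T v = v"
    using linear_eq_on_span[OF \<open>linear T\<close> linear_ident, of X v] TX assms(2) sp by blast
  then have "v \<bullet> v = T v \<bullet> v" by simp
  also have "\<dots> = (2 / N) * (\<Sum>x\<in>X. (v \<bullet> x)\<^sup>2)"
    by (simp add: T_def inner_sum_left power2_eq_square) (simp add: inner_commute)
  finally show ?thesis .
qed

text \<open>Type \<open>A\<^sub>1\<close>: two centred vertices are opposite, so their difference
  spans \<open>U\<close>.\<close>

lemma simplex_line:
  assumes X: "simplex_on \<Phi> U X N" and "card X = 2"
  obtains \<alpha> where "\<alpha> \<in> \<Phi>" "\<alpha> \<bullet> \<alpha> = N" "span {\<alpha>} = U" "\<Phi> \<inter> U = {\<alpha>, - \<alpha>}"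
proof -
  obtain x y where xy: "X = {x, y}" "x \<noteq> y" using assms(2) by (meson card_2_iff)
  have R: "\<Phi> \<inter> U = {x - y, - (x - y)}" using X xy unfolding simplex_on_def by auto
  have "\<Sum>X = 0" "span X = U" using X by (auto simp: simplex_on_def)
  then have y: "y = - x" using xy by (simp add: add_eq_0_iff)
  have "span {x - y} = span {x, y}"
  proof -
    have 1: "x - y = 2 *\<^sub>R x" using y by (simp add: scaleR_2)
    have "x = (1/2) *\<^sub>R (x - y)" unfolding 1 by simp
    then have "x \<in> span {x - y}" by (metis span_base span_scale singletonI)
    then have "span {x, y} \<subseteq> span {x - y}" unfolding y
      by (intro span_minimal) (auto simp: span_neg)
    moreover have "x - y \<in> span {x, y}" by (intro span_diff span_base) auto
    then have "span {x - y} \<subseteq> span {x, y}" by (intro span_minimal) auto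
    ultimately show ?thesis by blast
  qed
  then show ?thesis
    using that[of "x - y"] R simplex_dist[OF X, of x y] xy \<open>span X = U\<close> by auto
qed

text \<open>Type \<open>A\<^sub>2\<close>: two consecutive edges of an equilateral triangle enclose,
  as vectors, an angle of 120 degrees.\<close>

lemma simplex_triangle:
  assumes X: "simplex_on \<Phi> U X N" and "card X = 3" and spanU: "span (\<Phi> \<inter> U) = U"
  obtains \<alpha> \<beta> where "\<alpha> \<in> \<Phi>" "\<beta> \<in> \<Phi>" "\<alpha> \<bullet> \<alpha> = N" "\<beta> \<bullet> \<beta> = N" "\<alpha> \<bullet> \<beta> = - N / 2" "span {\<alpha>, \<beta>} = U"
proof -
  obtain x y z where xyz: "X = {x, y, z}" "x \<noteq> y" "y \<noteq> z" "x \<noteq> z"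
    using assms(2) by (auto simp: card_Suc_eq numeral_3_eq_3)
  have R: "\<Phi> \<inter> U = {y - z | y z. y \<in> X \<and> z \<in> X \<and> y \<noteq> z}" using X unfolding simplex_on_def by blast
  have r: "x - y \<in> \<Phi> \<inter> U" "y - z \<in> \<Phi> \<inter> U" using R xyz by blast+
  have d: "(x - y) \<bullet> (x - y) = N" "(y - z) \<bullet> (y - z) = N" "(x - z) \<bullet> (x - z) = N"
    using simplex_dist[OF X] xyz by auto
  have "(x - z) \<bullet> (x - z) = ((x - y) + (y - z)) \<bullet> ((x - y) + (y - z))" by simp
  also have "\<dots> = (x - y) \<bullet> (x - y) + (y - z) \<bullet> (y - z) + 2 * ((x - y) \<bullet> (y - z))"
    by (simp only: inner_add_left inner_add_right inner_commute[of "y - z" "x - y"])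
  finally have "(x - y) \<bullet> (y - z) = - N / 2" using d by simp
  moreover have "span {x - y, y - z} = U"
  proof
    show "span {x - y, y - z} \<subseteq> U"
      using span_mono[of "{x - y, y - z}" "\<Phi> \<inter> U"] r spanU by auto
    have b1: "x - y \<in> span {x - y, y - z}" and b2: "y - z \<in> span {x - y, y - z}"
      by (auto intro: span_base)
    have b3: "x - z \<in> span {x - y, y - z}" using span_add[OF b1 b2] by simp
    note b = b1 b2 b3
    have "\<alpha> \<in> span {x - y, y - z}" if "\<alpha> \<in> \<Phi> \<inter> U" for \<alpha>
    proof -
      have "\<alpha> \<in> {x - y, - (x - y), y - z, - (y - z), x - z, - (x - z)}"
        using that R xyz(1) by auto
      then show ?thesis using b span_neg by (metis insertE singletonD)
    qed
    then have "\<Phi> \<inter> U \<subseteq> span {x - y, y - z}" by blast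
    then have "span (\<Phi> \<inter> U) \<subseteq> span {x - y, y - z}" by (metis span_mono span_span)
    then show "U \<subseteq> span {x - y, y - z}" using spanU by simp
  qed
  ultimately show ?thesis using that[of "x - y" "y - z"] r d by blast
qed

context split
begin

text \<open>\<open>small_orbit\<close> makes the orbit of \<open>g\<close> a simplex with squared
  edge length that of \<open>\<gamma>\<close>. What remains is that its edges are exactly the roots
  in \<open>U\<close>. A root of \<open>U\<close> that moves a vertex is parallel to an edge, and
  \<open>root_scaling_unit\<close> makes it equal to that edge up to sign.\<close>

lemma simplex_case:
  assumes \<gamma>: "\<gamma> \<in> \<Phi>" "\<gamma> = g + h" "g \<in> U" "h \<in> V" "g \<noteq> 0" "h \<noteq> 0" "g \<bullet> g < (\<gamma> \<bullet> \<gamma>) / 2"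
  shows "simplex_on \<Phi> U (orb (\<Phi> \<inter> U) g) (\<gamma> \<bullet> \<gamma>)"
proof -
  define N where "N = \<gamma> \<bullet> \<gamma>"
  define X where "X = orb (\<Phi> \<inter> U) g"
  note gh = \<gamma>(1)[unfolded \<gamma>(2)]
  have N: "N > 0" unfolding N_def by (rule norm_pos[OF \<gamma>(1)])
  have fX: "finite X" unfolding X_def by (rule orb_component_finite[OF gh \<gamma>(3,4)])
  have gX: "g \<in> X" by (simp add: X_def orb_base)
  have XU: "y \<in> U" "y + h \<in> \<Phi>" "y \<bullet> y = g \<bullet> g" "(y + h) \<bullet> (y + h) = N" if "y \<in> X" for y
    using orb_component[OF gh \<gamma>(3,4)] that unfolding X_def N_def \<gamma>(2) by blast+
  have sX: "\<Sum>X = 0" unfolding X_def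
    using fX \<gamma>(3) spanU by (intro orb_sum_zero) (auto simp: X_def)
  have spX: "span X = U" unfolding X_def by (rule orb_component_span[OF \<gamma>(1-6)])
  have g2: "g \<bullet> g \<le> (\<gamma> \<bullet> \<gamma>) / 2" using \<gamma>(7) by simp
  have ne: "g \<bullet> g \<noteq> (\<gamma> \<bullet> \<gamma>) / 2" using \<gamma>(7) by simp
  have c: "y \<bullet> z = g \<bullet> g - N / 2" if "y \<in> X" "z \<in> X" "y \<noteq> z" for y z
    using orb_component_cases[OF \<gamma>(1-5) g2] that ne unfolding X_def N_def by blast
  have cc: "2 * (g \<bullet> g) * card X = N * (real (card X) - 1)"
    using orb_component_cases[OF \<gamma>(1-5) g2] ne unfolding X_def N_def by blast
  have "card X \<noteq> 0" using gX fX by auto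
  moreover have "card X \<noteq> 1" using cc \<gamma>(5) by auto
  ultimately have c2: "card X \<ge> 2" by linarith
  have d: "(y - z) \<bullet> (y - z) = N" if "y \<in> X" "z \<in> X" "y \<noteq> z" for y z
    using c[OF that] XU(3)[OF that(1)] XU(3)[OF that(2)] by (simp add: inner_diff_self)
  have unit: "y - rf \<alpha> y = \<alpha> \<or> y - rf \<alpha> y = - \<alpha>" if "\<alpha> \<in> \<Phi>" "\<alpha> \<in> U" "y \<in> X" "rf \<alpha> y \<noteq> y" for \<alpha> y
  proof (rule root_scaling_unit[OF that(1) XU(2)[OF that(3)]])
    show "y - rf \<alpha> y = (2 * (\<alpha> \<bullet> y) / (\<alpha> \<bullet> \<alpha>)) *\<^sub>R \<alpha>" by (simp add: rf_eq)
    show "2 * (\<alpha> \<bullet> (y + h)) = 2 * (\<alpha> \<bullet> y) / (\<alpha> \<bullet> \<alpha>) * (\<alpha> \<bullet> \<alpha>)"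
      using perp[OF that(2) \<gamma>(4)] norm_pos[OF that(1)] by (simp add: inner_add_right)
    have "rf \<alpha> y \<in> X" using that by (auto simp: X_def intro: orb_step)
    then show "(y - rf \<alpha> y) \<bullet> (y - rf \<alpha> y) = (y + h) \<bullet> (y + h)"
      using d[of y "rf \<alpha> y"] that XU(4)[OF that(3)] by simp
  qed
  \<comment> \<open>Induction along the orbit. When a reflection moves \<open>y\<close> to another
    vertex \<open>z\<close>, the edge \<open>y - z\<close> is a root. If \<open>g\<close> is neither
    of them, the reflection in \<open>y - z\<close> fixes \<open>g\<close> and turns the root
    \<open>g - y\<close> into \<open>g - z\<close>.\<close>
  have star: "y = g \<or> g - y \<in> \<Phi>" if "y \<in> orb (\<Phi> \<inter> U) g" for y
    using that
  proof (induction rule: orb.induct)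
    case (orb_step y \<alpha>)
    define z where "z = rf \<alpha> y"
    have yX: "y \<in> X" and zX: "z \<in> X" and a: "\<alpha> \<in> \<Phi>" "\<alpha> \<in> U"
      using orb_step by (auto simp: X_def z_def intro: orb.orb_step)
    show ?case unfolding z_def[symmetric]
    proof (cases "z = y \<or> z = g")
      case False
      have yz: "y - z \<in> \<Phi>" using unit[OF a yX] False neg_root[OF a(1)] a(1) unfolding z_def by auto
      show "z = g \<or> g - z \<in> \<Phi>"
      proof (cases "y = g")
        case y: False
        then have "g - y \<in> \<Phi>" using orb_step by blast
        moreover have "rf (y - z) g = g"
        proof (rule rf_fix)
          show "(y - z) \<bullet> g = 0" using c[OF yX gX] c[OF zX gX] y False by (simp add: inner_diff_left)
        qed
        moreover have "rf (y - z) y = z" by (rule rf_swap) (simp add: XU(3)[OF yX] XU(3)[OF zX])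
        ultimately show ?thesis using rf_root[OF yz, of "g - y"] by (simp add: rf_diff)
      qed (use yz in simp)
    qed (use orb_step in auto)
  qed simp
  \<comment> \<open>The edges at \<open>g\<close> give all others: the reflection in
    \<open>g - y\<close> fixes \<open>z\<close> and turns \<open>g - z\<close> into
    \<open>y - z\<close>.\<close>
  have dr: "y - z \<in> \<Phi>" if yz: "y \<in> X" "z \<in> X" "y \<noteq> z" for y z
  proof -
    have s: "y = g \<or> g - y \<in> \<Phi>" "z = g \<or> g - z \<in> \<Phi>" using star yz by (auto simp: X_def)
    consider "y = g" | "z = g" "y \<noteq> g" | "y \<noteq> g" "z \<noteq> g" by blast
    then show ?thesis
    proof cases
      case 1 then show ?thesis using s yz by simp
    next
      case 2
      then have "- (g - y) \<in> \<Phi>" using s by (intro neg_root) simp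
      then show ?thesis using 2 by simp
    next
      case 3
      have "rf (g - y) z = z"
        using c[OF gX yz(2)] c[OF yz(1,2)] 3 yz(3) by (intro rf_fix) (simp add: inner_diff_left)
      moreover have "rf (g - y) g = y" by (rule rf_swap) (simp add: XU(3)[OF yz(1)])
      ultimately have "rf (g - y) (g - z) = y - z" by (simp add: rf_diff)
      then show ?thesis using rf_root[of "g - y" "g - z"] s 3 by simp
    qed
  qed
  have rd: "\<exists>y z. \<alpha> = y - z \<and> y \<in> X \<and> z \<in> X \<and> y \<noteq> z" if a: "\<alpha> \<in> \<Phi>" "\<alpha> \<in> U" for \<alpha>
  proof -
    have "\<exists>y\<in>X. \<alpha> \<bullet> y \<noteq> 0"
    proof (rule ccontr)
      assume "\<not> ?thesis"
      then have "orthogonal \<alpha> y" if "y \<in> span X" for y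
        using that by (intro orthogonal_to_span[of y X]) (simp_all add: orthogonal_def)
      then have "orthogonal \<alpha> \<alpha>" using spX a by blast
      then show False using a nz by (auto simp: orthogonal_self)
    qed
    then obtain y where y: "y \<in> X" "\<alpha> \<bullet> y \<noteq> 0" by blast
    then have ne: "rf \<alpha> y \<noteq> y" using norm_pos[OF a(1)] nz a by (auto simp: rf_eq)
    have "rf \<alpha> y \<in> X" using y a by (auto simp: X_def intro: orb_step)
    then obtain w where w: "w \<in> X" "w \<noteq> y" "y - w = \<alpha> \<or> y - w = - \<alpha>"
      using unit[OF a y(1) ne] ne by blast
    have "\<alpha> = y - w \<or> \<alpha> = w - y" using w(3) minus_diff_eq[of y w] by (elim disjE) simp_all
    then show ?thesis
    proof
      assume "\<alpha> = y - w"
      then show ?thesis using y(1) w(1,2) by blast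
    next
      assume "\<alpha> = w - y"
      then show ?thesis using y(1) w(1,2) by blast
    qed
  qed
  have R: "\<Phi> \<inter> U = {y - z | y z. y \<in> X \<and> z \<in> X \<and> y \<noteq> z}"
  proof (intro equalityI subsetI)
    fix \<alpha> assume "\<alpha> \<in> {y - z | y z. y \<in> X \<and> z \<in> X \<and> y \<noteq> z}"
    then obtain y z where yz: "\<alpha> = y - z" "y \<in> X" "z \<in> X" "y \<noteq> z" by blast
    then show "\<alpha> \<in> \<Phi> \<inter> U" using dr[OF yz(2-4)] subspace_diff[OF subU] XU(1) by simp
  next
    fix \<alpha> assume "\<alpha> \<in> \<Phi> \<inter> U"
    then show "\<alpha> \<in> {y - z | y z. y \<in> X \<and> z \<in> X \<and> y \<noteq> z}" using rd[of \<alpha>] by simp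
  qed
  have p1: "2 * (y \<bullet> y) * card X = N * (real (card X) - 1)" if "y \<in> X" for y
    unfolding XU(3)[OF that] by (rule cc)
  have p2: "y \<bullet> z = y \<bullet> y - N / 2" if "y \<in> X" "z \<in> X" "y \<noteq> z" for y z
    unfolding XU(3)[OF that(1)] by (rule c[OF that])
  show ?thesis
    unfolding simplex_on_def X_def[symmetric] N_def[symmetric]
    by (intro conjI ballI impI N fX c2 sX spX p1 p2 R)
qed

end

text \<open>The map is defined on a basis chosen among the vectors \<open>u i\<close>. It preserves
  inner products there, hence everywhere. For the remaining indices \<open>f (u i) - v i\<close> is
  perpendicular to the range of \<open>f\<close>, which is the whole space because \<open>f\<close>
  is orthogonal.\<close>

lemma gram_isometry:
  fixes u v :: "'i \<Rightarrow> 'a::euclidean_space"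
  assumes gram: "\<And>i j. i \<in> I \<Longrightarrow> j \<in> I \<Longrightarrow> u i \<bullet> u j = v i \<bullet> v j"
    and span: "span (u ` I) = UNIV"
  obtains B where "orthogonal_transformation B" "\<And>i. i \<in> I \<Longrightarrow> B (u i) = v i"
proof -
  obtain b where b: "b \<subseteq> u ` I" "independent b" "u ` I \<subseteq> span b"
    using maximal_independent_subset[of "u ` I"] by metis
  have sb: "span b = UNIV" using span_mono[OF b(3)] span by (simp add: span_span top.extremum_unique)
  obtain s where s: "\<And>x. x \<in> b \<Longrightarrow> s x \<in> I \<and> u (s x) = x"
    using b(1) by (metis (no_types, lifting) image_iff subset_iff)
  obtain f where f: "linear f" "\<And>x. x \<in> b \<Longrightarrow> f x = v (s x)"
    using linear_independent_extend[OF b(2), of "\<lambda>x. v (s x)"] by metis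
  have bb: "f x \<bullet> f y = x \<bullet> y" if "x \<in> b" "y \<in> b" for x y
    using f(2) gram[of "s x" "s y"] s that by simp
  have b1: "f x \<bullet> f y = x \<bullet> y" if y: "y \<in> b" for x y
  proof -
    have lf: "linear (\<lambda>x. f x \<bullet> f y)" "linear (\<lambda>x. x \<bullet> y)"
      using f(1) by (auto intro!: linearI simp: linear_add linear_scale inner_add_left)
    show ?thesis
      using linear_eq_on_span[OF lf, of b x] bb[OF _ y] sb by auto
  qed
  have b2: "f x \<bullet> f y = x \<bullet> y" for x y
  proof -
    have lf: "linear (\<lambda>y. f x \<bullet> f y)" "linear (\<lambda>y. x \<bullet> y)"
      using f(1) by (auto intro!: linearI simp: linear_add linear_scale inner_add_right)
    show ?thesis
      using linear_eq_on_span[OF lf, of b y] b1 sb by auto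
  qed
  have o: "orthogonal_transformation f" using f(1) b2 by (simp add: orthogonal_transformation_def)
  have "f (u i) = v i" if i: "i \<in> I" for i
  proof -
    define w where "w = f (u i) - v i"
    have "w \<bullet> f x = 0" if x: "x \<in> b" for x
      using b2[of "u i" x] f(2)[OF x] gram[OF i, of "s x"] s[OF x] by (simp add: w_def inner_diff_left)
    moreover have lf: "linear (\<lambda>x. w \<bullet> f x)" "linear (\<lambda>x::'a. 0::real)"
      using f(1) by (auto intro!: linearI simp: linear_add linear_scale inner_add_right)
    ultimately have "w \<bullet> f x = 0" for x
      using linear_eq_on_span[OF lf, of b x] sb by auto
    moreover obtain x where "w = f x" using orthogonal_transformation_surj[OF o] by (metis surjD)
    ultimately have "w \<bullet> w = 0" by metis
    then show ?thesis by (simp add: w_def)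
  qed
  then show ?thesis using that o by blast
qed

lemma orthogonal_transformation_inner:
  "orthogonal_transformation B \<Longrightarrow> B x \<bullet> B y = x \<bullet> y"
  by (simp add: orthogonal_transformation_def)

section \<open>Automorphisms of a root system\<close>

context root_sys
begin

definition aut :: "('a \<Rightarrow> 'a) \<Rightarrow> bool" where
  "aut B \<longleftrightarrow> orthogonal_transformation B \<and> B ` \<Phi> = \<Phi>"

lemma autI:
  assumes "orthogonal_transformation B" "\<And>\<alpha>. \<alpha> \<in> \<Phi> \<Longrightarrow> B \<alpha> \<in> \<Phi>"
  shows "aut B"
proof -
  have "inj_on B \<Phi>" using orthogonal_transformation_inj[OF assms(1)] by (rule inj_on_subset) auto
  then show ?thesis using endo_inj_surj[OF fin, of B] assms by (auto simp: aut_def)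
qed

lemma aut_root: "aut B \<Longrightarrow> \<alpha> \<in> \<Phi> \<Longrightarrow> B \<alpha> \<in> \<Phi>"
  by (auto simp: aut_def)

lemma aut_id: "aut (\<lambda>x. x)"
  by (rule autI) (auto simp: orthogonal_transformation_def linear_ident)

lemma aut_comp: "aut B \<Longrightarrow> aut C \<Longrightarrow> aut (B \<circ> C)"
  by (rule autI) (auto simp: aut_root aut_def intro: orthogonal_transformation_compose)

lemma aut_rf: "\<alpha> \<in> \<Phi> \<Longrightarrow> aut (rf \<alpha>)"
  by (rule autI) (auto simp: orthogonal_transformation_rf rf_root)

lemma aut_inner: "aut B \<Longrightarrow> B x \<bullet> B y = x \<bullet> y"
  by (simp add: aut_def orthogonal_transformation_inner)

lemma aut_linear: "aut B \<Longrightarrow> linear B"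
  by (simp add: aut_def orthogonal_transformation_linear)

lemma orb_aut:
  assumes "y \<in> orb \<Phi> x"
  obtains B where "aut B" "B x = y"
proof -
  have "\<exists>B. aut B \<and> B x = y" using assms
  proof induction
    case (orb_step y a)
    then obtain B where "aut B" "B x = y" by blast
    then show ?case using aut_comp[OF aut_rf[OF orb_step(2)], of B] by (metis comp_apply)
  qed (use aut_id in blast)
  then show ?thesis using that by blast
qed

text \<open>Of three vectors with sum 0 any two span the same plane. In type
  \<open>A\<^sub>2\<close> this allows replacing a root by the third one of its triple.\<close>

lemma span_pair_neg_sum: "span {a, - a - b} = span {a, b :: 'a}"
proof
  have "- a - b \<in> span {a, b}" by (intro span_diff span_neg span_base) auto
  then show "span {a, - a - b} \<subseteq> span {a, b}" by (intro span_minimal) (auto intro: span_base)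
  have "- a - (- a - b) \<in> span {a, - a - b}" by (intro span_diff span_neg span_base) auto
  then have "b \<in> span {a, - a - b}" by simp
  then show "span {a, b} \<subseteq> span {a, - a - b}" by (intro span_minimal) (auto intro: span_base)
qed

text \<open>All subsystems of type \<open>A\<^sub>2\<close> in one length are conjugate: once the first roots agree, so do the
  planes, up to a reflection that fixes the first root.\<close>

lemma A2_conj:
  assumes r: "\<alpha> \<in> \<Phi>" "\<beta> \<in> \<Phi>" "\<alpha>' \<in> \<Phi>" "\<beta>' \<in> \<Phi>"
    and n: "\<alpha> \<bullet> \<alpha> = N" "\<beta> \<bullet> \<beta> = N" "\<alpha>' \<bullet> \<alpha>' = N" "\<beta>' \<bullet> \<beta>' = N"
    and i: "\<alpha> \<bullet> \<beta> = - N / 2" "\<alpha>' \<bullet> \<beta>' = - N / 2"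
  obtains B where "aut B" "span {B \<alpha>, B \<beta>} = span {\<alpha>', \<beta>'}"
proof -
  have N: "N > 0" using norm_pos[OF r(1)] n by simp
  obtain B where B: "aut B" "B \<alpha> = \<alpha>'" using orb_aut norm_conj[OF r(1,3)] n by metis
  define b where "b = B \<beta>"
  have b: "b \<in> \<Phi>" "b \<bullet> b = N" "\<alpha>' \<bullet> b = - N / 2"
    using aut_root[OF B(1) r(2)] aut_inner[OF B(1), of \<beta> \<beta>] aut_inner[OF B(1), of \<alpha> \<beta>] n i B(2)
    by (simp_all add: b_def)
  \<comment> \<open>\<open>c\<close> and \<open>\<beta>'\<close> have the same product with
    \<open>\<alpha>'\<close>, so the root \<open>c - \<beta>'\<close> is perpendicular to
    \<open>\<alpha>'\<close>: its reflection fixes \<open>\<alpha>'\<close> while it moves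
    \<open>c\<close> to \<open>\<beta>'\<close>.\<close>
  have half: "\<exists>C. aut C \<and> C \<alpha>' = \<alpha>' \<and> C c = \<beta>'"
    if c: "c \<in> \<Phi>" "c \<bullet> c = N" "\<alpha>' \<bullet> c = - N / 2" "c \<bullet> \<beta>' = N / 2" for c
  proof -
    have "c - \<beta>' \<in> \<Phi>" using c n r by (intro diff_root) auto
    moreover have "rf (c - \<beta>') c = \<beta>'" using c n by (intro rf_swap) simp
    moreover have "(c - \<beta>') \<bullet> \<alpha>' = \<alpha>' \<bullet> c - \<alpha>' \<bullet> \<beta>'"
      by (simp add: inner_commute[of "c - \<beta>'"] inner_diff_right)
    then have "rf (c - \<beta>') \<alpha>' = \<alpha>'" using c i by (intro rf_fix) simp
    ultimately show ?thesis using aut_rf by blast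
  qed
  have "\<exists>C. aut C \<and> span {C \<alpha>', C b} = span {\<alpha>', \<beta>'}"
  proof (cases "\<beta>' = b")
    case True then show ?thesis using aut_id by blast
  next
    case False
    have "\<beta>' \<noteq> - b" using b i N by auto
    then consider "b \<bullet> \<beta>' = 0" | "b \<bullet> \<beta>' = N / 2" | "b \<bullet> \<beta>' = - N / 2"
      using same_norm_inner[OF b(1) r(4) False] b n by auto
    then show ?thesis
    proof cases
      case 1
      have s: "\<alpha>' + b \<in> \<Phi>" using b n r by (intro add_root) auto
      \<comment> \<open>If \<open>b\<close> is perpendicular to \<open>\<beta>'\<close>, the third
        root of its triple has product \<open>N / 2\<close> with \<open>\<beta>'\<close>, so that
        \<open>half\<close> applies to it.\<close>
      define c where "c = - \<alpha>' - b"
      have c': "c = - (\<alpha>' + b)" by (simp add: c_def)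
      have "c \<in> \<Phi>" unfolding c' by (rule neg_root[OF s])
      moreover have "c \<bullet> c = N" unfolding c_def using b n
        by (simp add: inner_diff_left inner_diff_right inner_commute)
      moreover have "\<alpha>' \<bullet> c = - N / 2" unfolding c_def using b n by (simp add: inner_diff_right)
      moreover have "c \<bullet> \<beta>' = N / 2" unfolding c_def using 1 i by (simp add: inner_diff_left)
      ultimately obtain C where C: "aut C" "C \<alpha>' = \<alpha>'" "C c = \<beta>'" using half by blast
      have "C c = - \<alpha>' - C b"
        unfolding c_def using aut_linear[OF C(1)] C(2) by (simp add: linear_diff linear_neg)
      then have "C b = - \<alpha>' - \<beta>'" using C(3) by simp
      then show ?thesis using C span_pair_neg_sum[of \<alpha>' \<beta>'] by metis
    next
      case 2 then show ?thesis using half[OF b(1-3)] by metis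
    next
      case 3
      \<comment> \<open>Three vectors of equal length at 120 degrees to each other add up to 0, so
        the planes agree already.\<close>
      have "(\<alpha>' + b + \<beta>') \<bullet> (\<alpha>' + b + \<beta>') = 0"
        using b n i 3 by (simp add: inner_add_left inner_add_right inner_commute)
      then have "\<alpha>' + b + \<beta>' = 0" by simp
      then have "b = - \<alpha>' - \<beta>'" by (simp add: eq_neg_iff_add_eq_0 add.assoc add.commute add.left_commute algebra_simps)
      then show ?thesis using aut_id span_pair_neg_sum[of \<alpha>' \<beta>'] by metis
    qed
  qed
  then obtain C where C: "aut C" "span {C \<alpha>', C b} = span {\<alpha>', \<beta>'}" by blast
  show ?thesis using that[OF aut_comp[OF C(1) B(1)]] C(2) B(2) by (simp add: b_def)
qed

end

text \<open>\<open>K\<close> may be smaller than \<open>U\<close> and \<open>V\<close>. By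
  \<open>component_iff\<close> any such \<open>K\<close> determines which roots lie in
  \<open>U\<close> or \<open>V\<close>, so two splittings can be matched through one line or one
  plane.\<close>

definition component where
  "component (\<Phi> :: 'a::euclidean_space set) U V K \<longleftrightarrow> subspace K \<and> K \<noteq> {0} \<and> K \<noteq> UNIV
    \<and> (\<forall>\<alpha>\<in>\<Phi>. \<alpha> \<in> U \<or> \<alpha> \<in> V \<longrightarrow> \<alpha> \<in> K \<or> (\<forall>x\<in>K. \<alpha> \<bullet> x = 0))"

text \<open>Only membership in the union is compared, so \<open>B\<close> may exchange the two
  summands; the subgroup depends on the union alone.\<close>

definition matches where
  "matches (\<Phi> :: 'a::euclidean_space set) U V U' V' B \<longleftrightarrow> orthogonal_transformation B \<and> B ` \<Phi> = \<Phi>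
    \<and> (\<forall>\<gamma>\<in>\<Phi>. (\<gamma> \<in> U \<or> \<gamma> \<in> V) \<longleftrightarrow> (B \<gamma> \<in> U' \<or> B \<gamma> \<in> V'))"

lemma matches_inv:
  assumes "matches \<Phi> U V U' V' B"
  shows "matches \<Phi> U' V' U V (inv_into UNIV B)"
proof -
  have B: "orthogonal_transformation B" "B ` \<Phi> = \<Phi>" using assms by (auto simp: matches_def)
  have bij: "bij B" using orthogonal_transformation_bij[OF B(1)] .
  have inv: "inv_into UNIV B ` \<Phi> = \<Phi>"
    using B(2) bij by (metis bij_is_inj image_inv_f_f)
  moreover have "B (inv_into UNIV B \<gamma>) = \<gamma>" for \<gamma> using bij by (simp add: bij_is_surj surj_f_inv_f)
  ultimately show ?thesis
    using assms orthogonal_transformation_inv[OF B(1)] unfolding matches_def by (metis imageI)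
qed

context split
begin

lemma component_self: "component \<Phi> U V U" "component \<Phi> U V V"
proof -
  have "V \<noteq> UNIV" using split.U_notUNIV[OF split_swap[OF split_axioms]] .
  moreover have p: "y \<bullet> x = 0" if "x \<in> U" "y \<in> V" for x y
    using perp[OF that] by (simp add: inner_commute)
  ultimately show "component \<Phi> U V U" "component \<Phi> U V V"
    unfolding component_def using subU subV U0 V0 U_notUNIV perp p by blast+
qed

text \<open>A root outside \<open>U\<close> and \<open>V\<close> that lay in \<open>K\<close> or
  perpendicular to it would preserve \<open>K\<close>. By \<open>max\<close> all reflections would
  then preserve \<open>K\<close>, against irreducibility.\<close>

lemma component_iff:
  assumes "component \<Phi> U V K" "\<gamma> \<in> \<Phi>"
  shows "(\<gamma> \<in> U \<or> \<gamma> \<in> V) \<longleftrightarrow> (\<gamma> \<in> K \<or> (\<forall>x\<in>K. \<gamma> \<bullet> x = 0))"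
proof
  have K: "subspace K" "K \<noteq> {0}" "K \<noteq> UNIV"
    "\<And>\<alpha>. \<alpha> \<in> \<Phi> \<Longrightarrow> \<alpha> \<in> U \<or> \<alpha> \<in> V \<Longrightarrow> \<alpha> \<in> K \<or> (\<forall>x\<in>K. \<alpha> \<bullet> x = 0)"
    using assms(1) by (auto simp: component_def)
  show "\<gamma> \<in> U \<or> \<gamma> \<in> V \<Longrightarrow> \<gamma> \<in> K \<or> (\<forall>x\<in>K. \<gamma> \<bullet> x = 0)" by (rule K(4)[OF assms(2)])
  assume *: "\<gamma> \<in> K \<or> (\<forall>x\<in>K. \<gamma> \<bullet> x = 0)"
  show "\<gamma> \<in> U \<or> \<gamma> \<in> V"
  proof (rule ccontr)
    assume "\<not> ?thesis"
    then have m: "\<gamma> \<notin> U" "\<gamma> \<notin> V" by auto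
    have "rf \<beta> x \<in> K" if "\<beta> \<in> \<Phi>" "x \<in> K" for \<beta> x
      by (rule max[OF assms(2) m _ _ that]) (use rf_subspace[OF K(1) K(4)] rf_subspace[OF K(1) *] in blast)+
    then show False using irr_invariant[OF K(1)] K(2,3) by blast
  qed
qed

end

lemma matches_component:
  assumes "split \<Phi> U V" "split \<Phi> U' V'" "component \<Phi> U V K" "component \<Phi> U' V' K'"
    "orthogonal_transformation B" "B ` \<Phi> = \<Phi>" "B ` K = K'"
  shows "matches \<Phi> U V U' V' B"
proof -
  have "(\<gamma> \<in> U \<or> \<gamma> \<in> V) \<longleftrightarrow> (B \<gamma> \<in> U' \<or> B \<gamma> \<in> V')" if "\<gamma> \<in> \<Phi>" for \<gamma>
  proof -
    have inj: "inj B" by (rule orthogonal_transformation_inj[OF assms(5)])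
    have "B \<gamma> \<in> \<Phi>" using that assms(6) by blast
    then have "(B \<gamma> \<in> U' \<or> B \<gamma> \<in> V') \<longleftrightarrow> (B \<gamma> \<in> B ` K \<or> (\<forall>x\<in>B ` K. B \<gamma> \<bullet> x = 0))"
      using split.component_iff[OF assms(2,4)] assms(7) by simp
    also have "\<dots> \<longleftrightarrow> (\<gamma> \<in> K \<or> (\<forall>x\<in>K. \<gamma> \<bullet> x = 0))"
      using inj by (simp add: inj_image_mem_iff orthogonal_transformation_inner[OF assms(5)])
    also have "\<dots> \<longleftrightarrow> (\<gamma> \<in> U \<or> \<gamma> \<in> V)" using split.component_iff[OF assms(1,3) that] by simp
    finally show ?thesis by simp
  qed
  then show ?thesis using assms by (simp add: matches_def)
qed

lemma frame_swap: "frame \<Phi> U V E N \<Longrightarrow> frame \<Phi> V U E N"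
proof -
  assume f: "frame \<Phi> U V E N"
  have *: "\<And>y. (y \<in> U \<or> y \<in> V) = (y \<in> V \<or> y \<in> U)" by blast
  show "frame \<Phi> V U E N" using f unfolding frame_def * .
qed

lemma sum_orbit_negative:
  fixes y :: "'a::euclidean_space"
  assumes "finite Q" "\<Sum>Q = 0" "y \<in> Q" "y \<noteq> 0"
  obtains z where "z \<in> Q" "y \<bullet> z < 0"
proof -
  have "\<exists>z\<in>Q. y \<bullet> z < 0"
  proof (rule ccontr)
    assume "\<not> ?thesis"
    then have nn: "y \<bullet> z \<ge> 0" if "z \<in> Q" for z using that by force
    have "(\<Sum>z\<in>Q. y \<bullet> z) = y \<bullet> \<Sum>Q" by (simp add: inner_sum_right)
    then have "(\<Sum>z\<in>Q. y \<bullet> z) = 0" using assms(2) by simp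
    then have "y \<bullet> y = 0" using assms(1,3) nn by (simp add: sum_nonneg_eq_0_iff)
    then show False using assms(4) by simp
  qed
  then show ?thesis using that by blast
qed

section \<open>Simply laced root systems: the possible splittings\<close>

definition rank_one_component where
  "rank_one_component \<Phi> U V \<longleftrightarrow> (\<exists>\<alpha>\<in>\<Phi>. (\<alpha> \<in> U \<or> \<alpha> \<in> V) \<and> component \<Phi> U V (span {\<alpha>}))"

definition A2_component where
  "A2_component \<Phi> U V N \<longleftrightarrow> (\<exists>\<alpha>\<in>\<Phi>. \<exists>\<beta>\<in>\<Phi>. (\<alpha> \<in> U \<or> \<alpha> \<in> V) \<and> (\<beta> \<in> U \<or> \<beta> \<in> V) \<and>
    \<alpha> \<bullet> \<alpha> = N \<and> \<beta> \<bullet> \<beta> = N \<and> \<alpha> \<bullet> \<beta> = - N / 2 \<and> component \<Phi> U V (span {\<alpha>, \<beta>}))"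

text \<open>The splitting \<open>A\<^sub>4 + A\<^sub>4\<close> of \<open>E\<^sub>8\<close>. The root
  \<open>x + x' + y\<close> glues the two simplices: its components have squared lengths
  \<open>3 * N / 5\<close> and \<open>2 * N / 5\<close>.\<close>

definition double_A4 where
  "double_A4 \<Phi> U V N X Y x x' y \<longleftrightarrow> simplex_on \<Phi> U X N \<and> simplex_on \<Phi> V Y N \<and>
    card X = 5 \<and> card Y = 5 \<and> x \<in> X \<and> x' \<in> X \<and> x \<noteq> x' \<and> y \<in> Y \<and> x + x' + y \<in> \<Phi>"

lemma component_swap: "component \<Phi> U V K \<longleftrightarrow> component \<Phi> V U K"
  unfolding component_def by blast

lemma rank_one_component_swap: "rank_one_component \<Phi> U V \<longleftrightarrow> rank_one_component \<Phi> V U"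
  unfolding rank_one_component_def component_swap[of \<Phi> U V] by blast

lemma A2_component_swap: "A2_component \<Phi> U V N \<longleftrightarrow> A2_component \<Phi> V U N"
  unfolding A2_component_def component_swap[of \<Phi> U V] by blast

context split
begin

lemma simplex_low_rank:
  assumes "simplex_on \<Phi> U X N"
  shows "card X = 2 \<Longrightarrow> rank_one_component \<Phi> U V" "card X = 3 \<Longrightarrow> A2_component \<Phi> U V N"
proof -
  assume "card X = 2"
  then obtain \<alpha> where "\<alpha> \<in> \<Phi>" "span {\<alpha>} = U" using simplex_line[OF assms] by metis
  then show "rank_one_component \<Phi> U V"
    unfolding rank_one_component_def using component_self(1) span_base[of \<alpha> "{\<alpha>}"] by auto
next
  assume "card X = 3"
  then obtain \<alpha> \<beta> where *: "\<alpha> \<in> \<Phi>" "\<beta> \<in> \<Phi>" "\<alpha> \<bullet> \<alpha> = N" "\<beta> \<bullet> \<beta> = N" "\<alpha> \<bullet> \<beta> = - N / 2"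
      "span {\<alpha>, \<beta>} = U"
    using simplex_triangle[OF assms _ spanU] by metis
  moreover have "\<alpha> \<in> U" "\<beta> \<in> U" using *(6) by (auto intro: span_base)
  ultimately show "A2_component \<Phi> U V N"
    unfolding A2_component_def using component_self(1) by metis
qed

text \<open>Let \<open>n\<close> be the number of vertices of the simplex in \<open>U\<close>. For
  \<open>n \<ge> 4\<close> a second mixed root is built whose component in \<open>V\<close> has
  squared length only \<open>2 * N / n\<close>. If \<open>n = 4\<close> this is half of
  \<open>N\<close> and a frame arises. Otherwise \<open>V\<close> carries a simplex as well, with
  \<open>m\<close> vertices, and comparing lengths gives \<open>4 * m = n * (m - 1)\<close>; this
  leaves a small simplex in \<open>V\<close> or \<open>n = m = 5\<close>.\<close>

lemma simply_laced_core:
  assumes sl: "\<And>\<alpha>. \<alpha> \<in> \<Phi> \<Longrightarrow> \<alpha> \<bullet> \<alpha> = N"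
    and \<gamma>: "\<gamma> \<in> \<Phi>" "\<gamma> = g + h" "g \<in> U" "h \<in> V" "g \<noteq> 0" "h \<noteq> 0" "g \<bullet> g \<le> N / 2"
  shows "rank_one_component \<Phi> U V \<or> A2_component \<Phi> U V N \<or> (\<exists>E. frame \<Phi> U V E N) \<or>
    (\<exists>X Y x x' y. double_A4 \<Phi> U V N X Y x x' y)"
proof (cases "g \<bullet> g = N / 2")
  case True
  then show ?thesis using frame_case[OF \<gamma>(1-4)] sl[OF \<gamma>(1)] by auto
next
  case False
  interpret s: split \<Phi> V U by (rule split_swap) (rule split_axioms)
  define X where "X = orb (\<Phi> \<inter> U) g"
  define n where "n = card X"
  have Npos: "N > 0" using norm_pos[OF \<gamma>(1)] sl[OF \<gamma>(1)] by simp
  have X: "simplex_on \<Phi> U X N"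
    using simplex_case[OF \<gamma>(1-6)] False \<gamma>(7) sl[OF \<gamma>(1)] unfolding X_def by auto
  have gX: "g \<in> X" by (simp add: X_def orb_base)
  have n2: "n \<ge> 2" and fX: "finite X" using X by (auto simp: simplex_on_def n_def)
  have gg: "2 * (g \<bullet> g) * n = N * (real n - 1)"
    using X gX unfolding simplex_on_def n_def by blast
  have \<gamma>': "\<gamma> = h + g" using \<gamma>(2) by (simp add: add.commute)
  note gh = \<gamma>(1)[unfolded \<gamma>(2)] and hg = \<gamma>(1)[unfolded \<gamma>']
  have hh: "h \<bullet> h = N - g \<bullet> g"
    using sl[OF \<gamma>(1)] perp[OF \<gamma>(3,4)] unfolding \<gamma>(2)
    by (simp add: inner_add_left inner_add_right inner_commute)
  consider "n = 2" | "n = 3" | "n \<ge> 4" using n2 by linarith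
  then show ?thesis
  proof cases
    case 1 then show ?thesis using simplex_low_rank(1)[OF X] by (simp add: n_def)
  next
    case 2 then show ?thesis using simplex_low_rank(2)[OF X] by (simp add: n_def)
  next
    case 3
    define Q where "Q = orb (\<Phi> \<inter> V) h"
    have fQ: "finite Q" unfolding Q_def by (rule s.orb_component_finite[OF hg \<gamma>(4,3)])
    have sQ: "\<Sum>Q = 0" unfolding Q_def
      using fQ \<gamma>(4) spanV by (intro orb_sum_zero) (auto simp: Q_def)
    obtain z where z: "z \<in> Q" "h \<bullet> z < 0"
      using sum_orbit_negative[OF fQ sQ _ \<gamma>(6)] by (metis Q_def orb_base)
    have zz: "z \<bullet> z = h \<bullet> h" using orb_inner[of z "\<Phi> \<inter> V" h] z(1) by (simp add: Q_def)
    obtain k0 where k0: "k0 \<in> \<int>" "(h - z) \<bullet> (h - z) = ((h + g) \<bullet> (h + g)) * k0"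
      using s.orb_component_dist[OF hg \<gamma>(4,3) orb_base z(1)[unfolded Q_def]] by blast
    from k0(1) obtain k where k: "k0 = real_of_int k" by (rule Ints_cases)
    have hz: "h \<bullet> z = h \<bullet> h - N * k / 2"
      using k0(2) sl[OF hg] zz unfolding k inner_diff_self by simp
    have nr: "real n \<ge> 4" using 3 by simp
    have gg': "g \<bullet> g = N / 2 - N / (2 * n)" using gg nr by (simp add: field_simps)
    have hh': "h \<bullet> h = N / 2 + N / (2 * n)" using hh gg' by simp
    have small: "N / (2 * n) \<le> N / 8" using nr Npos by (intro divide_left_mono) auto
    have pos: "N / (2 * n) > 0" using nr Npos by simp
    \<comment> \<open>The negative product with \<open>z\<close> needs \<open>k > 1\<close>, and
      nonnegativity of the square of \<open>h + z\<close> needs \<open>k < 3\<close>.\<close>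
    have "N * k > N" using hz z(2) hh' pos by linarith
    then have "k > 1" using Npos by (simp add: mult_less_cancel_left1)
    have "(h + z) \<bullet> (h + z) = 2 * (h \<bullet> h) + 2 * (h \<bullet> z)"
      using zz by (simp add: inner_add_left inner_add_right inner_commute)
    then have hz2: "(h + z) \<bullet> (h + z) = 4 * (h \<bullet> h) - N * k" using hz by simp
    then have "N * k \<le> 4 * (h \<bullet> h)" by (metis diff_ge_0_iff_ge inner_ge_zero)
    then have "N * k < N * 3" using hh' small Npos by linarith
    then have "k < 3" using Npos by simp
    then have k2: "k = 2" using \<open>k > 1\<close> by linarith
    have hz': "h \<bullet> z = h \<bullet> h - N" using hz k2 by simp
    have "card (X - {g}) \<noteq> 0" using n2 gX fX by (simp add: n_def)
    then obtain x1 where x1: "x1 \<in> X" "x1 \<noteq> g" by (metis Diff_iff card.empty ex_in_conv insertI1)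
    have gx: "g \<bullet> x1 = g \<bullet> g - N / 2" using X gX x1 unfolding simplex_on_def by metis
    have x1U: "x1 \<in> U" "x1 + h \<in> \<Phi>" using orb_component[OF gh \<gamma>(3,4)] x1 unfolding X_def by auto
    have x1z: "z + x1 \<in> \<Phi>"
      using s.orb_component(2)[of h x1 z] x1U \<gamma>(4) z(1) unfolding Q_def by (simp add: add.commute)
    have zV: "z \<in> V" using s.orb_component(1)[OF hg \<gamma>(4,3)] z(1) unfolding Q_def by blast
    \<comment> \<open>The two products contribute \<open>g \<bullet> g - N / 2\<close> and
      \<open>h \<bullet> h - N\<close>, whose sum is \<open>- N / 2\<close>. So the roots
      \<open>\<gamma>\<close> and \<open>z + x1\<close> enclose 120 degrees and their sum is a
      root.\<close>
    have "2 * (\<gamma> \<bullet> (z + x1)) = - N"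
      unfolding \<gamma>(2) using perp[OF \<gamma>(3) zV] perp[OF x1U(1) \<gamma>(4)] gx hz' hh
      by (simp add: inner_add_left inner_add_right inner_commute)
    then have "\<gamma> + (z + x1) \<in> \<Phi>" using sl[OF x1z] by (intro add_root[OF \<gamma>(1) x1z]) simp
    moreover have "\<gamma> + (z + x1) = (g + x1) + (h + z)" unfolding \<gamma>(2) by simp
    ultimately have \<delta>: "(g + x1) + (h + z) \<in> \<Phi>" by simp
    have dU: "g + x1 \<in> U" "h + z \<in> V"
      using subspace_add[OF subU \<gamma>(3) x1U(1)] subspace_add[OF subV \<gamma>(4) zV] by auto
    have e1: "(h + z) \<bullet> (h + z) = 2 * N / n" using hz2 hh' k2 by simp
    have "x1 \<bullet> x1 = g \<bullet> g" using orb_inner[of x1 "\<Phi> \<inter> U" g] x1(1) by (simp add: X_def)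
    then have "(g + x1) \<bullet> (g + x1) = 4 * (g \<bullet> g) - N"
      using gx by (simp add: inner_add_left inner_add_right inner_commute)
    then have e2: "(g + x1) \<bullet> (g + x1) = N - 2 * N / n" using gg' by simp
    have le: "2 * N / n \<le> N / 2" using small by simp
    have ne: "g + x1 \<noteq> 0" "h + z \<noteq> 0"
    proof -
      have "2 * N / n > 0" using pos by simp
      then show "h + z \<noteq> 0" using e1 by auto
      show "g + x1 \<noteq> 0" using e2 le Npos by auto
    qed
    show ?thesis
    proof (cases "n = 4")
      case True
      then have "(g + x1) \<bullet> (g + x1) = N / 2" using e2 by simp
      then have "\<exists>E. frame \<Phi> U V E N" using frame_case[OF \<delta> refl dU] sl[OF \<delta>] by simp
      then show ?thesis by blast
    next
      case False
      then have n5: "n \<ge> 5" using 3 by linarith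
      then have "N / real n < N / 4" using Npos by (intro divide_strict_left_mono) auto
      moreover have "2 * N / n = 2 * (N / n)" by simp
      ultimately have lt: "2 * N / n < N / 2" by linarith
      define Y where "Y = orb (\<Phi> \<inter> V) (h + z)"
      define m where "m = card Y"
      have \<delta>': "(h + z) + (g + x1) \<in> \<Phi>" using \<delta> by (simp add: add.commute)
      have Y: "simplex_on \<Phi> V Y N"
        using s.simplex_case[OF \<delta>' refl dU(2,1) ne(2,1)] lt e1 sl[OF \<delta>'] unfolding Y_def by simp
      have yY: "h + z \<in> Y" by (simp add: Y_def orb_base)
      have m2: "m \<ge> 2" using Y by (simp add: simplex_on_def m_def)
      have "2 * (2 * N / n) * m = N * (real m - 1)"
        using Y yY e1 unfolding simplex_on_def m_def by metis
      then have "N * (4 * m) = N * (n * (real m - 1))" using n5 by (simp add: field_simps)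
      then have "4 * real m = n * (real m - 1)" using Npos by (simp only: mult_cancel_left) simp
      also have "\<dots> = real (n * (m - 1))" using m2 by (simp add: of_nat_diff)
      finally have mn: "4 * m = n * (m - 1)" by linarith
      consider "m = 2" | "m = 3" | "m \<ge> 4" using m2 by linarith
      then show ?thesis
      proof cases
        case 1
        then show ?thesis using s.simplex_low_rank(1)[OF Y] rank_one_component_swap by (auto simp: m_def)
      next
        case 2
        then show ?thesis using s.simplex_low_rank(2)[OF Y] A2_component_swap[of \<Phi> U V N] by (auto simp: m_def)
      next
        case 3
        \<comment> \<open>Together with \<open>m \<ge> 4\<close> this leaves 4 and 5;
          \<open>m = 4\<close> would need 16 to be a multiple of 3.\<close>
        have "5 * (m - 1) \<le> 4 * m" unfolding mn using n5 by simp
        then have "m = 4 \<or> m = 5" using 3 by linarith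
        then have "m = 5" using mn by (elim disjE) (simp_all, presburger)
        then have "n = 5" using mn by simp
        then have "double_A4 \<Phi> U V N X Y g x1 (h + z)"
          unfolding double_A4_def using X Y \<open>m = 5\<close> gX x1 yY \<delta> by (simp add: n_def m_def)
        then show ?thesis by blast
      qed
    qed
  qed
qed

text \<open>One of the two components of a mixed root has at most half the squared length, so the
  core lemma applies to \<open>U\<close>, \<open>V\<close> or with the roles exchanged.\<close>

lemma simply_laced_cases:
  assumes sl: "\<And>\<alpha>. \<alpha> \<in> \<Phi> \<Longrightarrow> \<alpha> \<bullet> \<alpha> = N"
  shows "rank_one_component \<Phi> U V \<or> A2_component \<Phi> U V N \<or> (\<exists>E. frame \<Phi> U V E N) \<or>
    (\<exists>X Y x x' y. double_A4 \<Phi> U V N X Y x x' y)"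
proof -
  interpret s: split \<Phi> V U by (rule split_swap) (rule split_axioms)
  obtain \<gamma> where \<gamma>: "\<gamma> \<in> \<Phi>" "\<gamma> \<notin> U" "\<gamma> \<notin> V" by (rule mixed_root_exists)
  obtain g h where gh: "g \<in> U" "h \<in> V" "\<gamma> = g + h" "\<gamma> \<bullet> \<gamma> = g \<bullet> g + h \<bullet> h" "g \<noteq> 0" "h \<noteq> 0"
    using decompose_mixedE[OF \<gamma>(2,3)] .
  show ?thesis
  proof (cases "g \<bullet> g \<le> N / 2")
    case True
    show ?thesis by (rule simply_laced_core[OF sl \<gamma>(1) gh(3,1,2,5,6) True])
  next
    case False
    then have le: "h \<bullet> h \<le> N / 2" using gh(4) sl[OF \<gamma>(1)] by simp
    have \<gamma>': "\<gamma> = h + g" using gh(3) by (simp add: add.commute)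
    have "rank_one_component \<Phi> V U \<or> A2_component \<Phi> V U N \<or> (\<exists>E. frame \<Phi> V U E N) \<or>
        (\<exists>X Y x x' y. double_A4 \<Phi> V U N X Y x x' y)"
      by (rule s.simply_laced_core[OF sl \<gamma>(1) \<gamma>' gh(2,1,6,5) le])
    then consider "rank_one_component \<Phi> U V \<or> A2_component \<Phi> U V N \<or> (\<exists>E. frame \<Phi> U V E N)"
      | X Y x x' y where "double_A4 \<Phi> V U N X Y x x' y"
      using rank_one_component_swap A2_component_swap frame_swap by metis
    then show ?thesis
    proof cases
      \<comment> \<open>\<open>double_A4\<close> is the one outcome that is not symmetric in
        \<open>U\<close> and \<open>V\<close>. Here the component of its glue root in
        \<open>U\<close> is the short one, \<open>y\<close>, so the core lemma applies again in the
        original order.\<close>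
      case 2
      then have X: "simplex_on \<Phi> V X N" and Y: "simplex_on \<Phi> U Y N" and c: "card X = 5" "card Y = 5"
        and xy: "x \<in> X" "x' \<in> X" "x \<noteq> x'" "y \<in> Y" and \<delta>: "x + x' + y \<in> \<Phi>"
        by (auto simp: double_A4_def)
      have N: "N > 0" using X by (simp add: simplex_on_def)
      have mem: "y \<in> U" "x + x' \<in> V"
        using X Y xy subspace_add[OF subV] unfolding simplex_on_def by (auto intro: span_base)
      have ny: "2 * (y \<bullet> y) * 5 = N * (5 - 1)" using Y xy(4) c(2) unfolding simplex_on_def by force
      then have ylt: "y \<bullet> y < N / 2" "y \<noteq> 0" using N by auto
      have "(x + x' + y) \<bullet> (x + x' + y) = (x + x') \<bullet> (x + x') + y \<bullet> y"
        using perp[OF mem] by (simp add: inner_add_left inner_add_right inner_commute)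
      moreover have "N / 2 < N" using N by simp
      ultimately have "(x + x') \<bullet> (x + x') > 0" using sl[OF \<delta>] ylt(1) by linarith
      then have "x + x' \<noteq> 0" by auto
      moreover have "x + x' + y = y + (x + x')" by (simp add: add.commute)
      ultimately show ?thesis
        using simply_laced_core[OF sl \<delta> _ mem ylt(2)] ylt(1) by simp
    qed blast
  qed
qed

end

section \<open>Orthogonal frames\<close>

lemma exists_regular_vector:
  fixes S :: "'a::euclidean_space set"
  assumes "finite S" "0 \<notin> S"
  obtains \<rho> where "\<And>x. x \<in> S \<Longrightarrow> \<rho> \<bullet> x \<noteq> 0"
proof -
  have "negligible (\<Union>x\<in>S. {y. x \<bullet> y = 0})"
    using assms by (intro negligible_Union) (auto intro: negligible_hyperplane)
  then have "(\<Union>x\<in>S. {y. x \<bullet> y = 0}) \<noteq> UNIV" using non_negligible_UNIV by metis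
  then obtain \<rho> where "\<rho> \<notin> (\<Union>x\<in>S. {y. x \<bullet> y = 0})" by blast
  then have "\<rho> \<bullet> x \<noteq> 0" if "x \<in> S" for x using that by (auto simp: inner_commute)
  then show ?thesis by (rule that)
qed

text \<open>A vector perpendicular to no member of \<open>E\<close> selects one of each pair
  \<open>y\<close>, \<open>- y\<close>, and the selected half is an orthogonal basis.\<close>

lemma frame_half:
  assumes E: "frame \<Phi> U V E N"
  obtains H where "H \<subseteq> E" "\<And>y. y \<in> E \<Longrightarrow> y \<in> H \<or> - y \<in> H"
    "\<And>y z. y \<in> H \<Longrightarrow> z \<in> H \<Longrightarrow> y \<noteq> z \<Longrightarrow> y \<bullet> z = 0" "independent H" "span H = UNIV"
proof -
  note f = frameD(8)[OF E] and nrm = frameD(2)[OF E] and N = frameD(3)[OF E]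
    and neg = frameD(1)[OF E] and sp = frameD(4)[OF E] and tri = frameD(6)[OF E]
  have "0 \<notin> E" using nrm[of 0] N by auto
  then obtain \<rho> where \<rho>: "\<And>x. x \<in> E \<Longrightarrow> \<rho> \<bullet> x \<noteq> 0" using exists_regular_vector[OF f] by metis
  define H where "H = {e \<in> E. \<rho> \<bullet> e > 0}"
  have 1: "y \<in> H \<or> - y \<in> H" if "y \<in> E" for y
    using \<rho>[OF that] neg[OF that] that by (auto simp: H_def)
  have 2: "y \<bullet> z = 0" if "y \<in> H" "z \<in> H" "y \<noteq> z" for y z
  proof -
    have "z \<noteq> - y" using that by (auto simp: H_def)
    then show ?thesis using tri[of y z] that by (auto simp: H_def)
  qed
  have "0 \<notin> H" using \<open>0 \<notin> E\<close> by (auto simp: H_def)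
  then have 3: "independent H" using 2 by (intro pairwise_orthogonal_independent) (auto simp: pairwise_def orthogonal_def)
  have "E \<subseteq> span H"
  proof
    fix y assume "y \<in> E"
    from 1[OF this] show "y \<in> span H"
    proof
      assume "- y \<in> H"
      then have "- (- y) \<in> span H" by (intro span_neg span_base)
      then show ?thesis by simp
    qed (rule span_base)
  qed
  then have "span H = UNIV" using sp span_mono[of E "span H"] by (simp add: span_span top.extremum_unique)
  moreover have "H \<subseteq> E" by (auto simp: H_def)
  ultimately show ?thesis using that[OF _ 1 2 3] by blast
qed

text \<open>Prescribing two values allows the glue root of one \<open>double_A4\<close> to be sent
  to that of another.\<close>

lemma bij_prescribed:
  assumes "finite X" "finite X'" "card X = card X'" "a \<in> X" "b \<in> X" "a \<noteq> b" "a' \<in> X'" "b' \<in> X'" "a' \<noteq> b'"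
  obtains f where "bij_betw f X X'" "f a = a'" "f b = b'"
proof -
  have "card (X - {a, b}) = card (X' - {a', b'})" using assms by (simp add: card_Diff_subset)
  then obtain g where g: "bij_betw g (X - {a, b}) (X' - {a', b'})"
    using finite_same_card_bij[of "X - {a, b}" "X' - {a', b'}"] assms by auto
  define f where "f = g(a := a', b := b')"
  have fa: "f a = a'" "f b = b'" using assms by (auto simp: f_def)
  have "bij_betw f (X - {a, b}) (X' - {a', b'})"
    using g by (rule bij_betw_cong[THEN iffD1, rotated]) (auto simp: f_def)
  then have "bij_betw f ((X - {a, b}) \<union> {a, b}) ((X' - {a', b'}) \<union> {a', b'})"
    using assms by (intro bij_betw_combine) (auto simp: bij_betw_def fa)
  moreover have "(X - {a, b}) \<union> {a, b} = X" "(X' - {a', b'}) \<union> {a', b'} = X'" using assms by auto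
  ultimately show ?thesis using that fa by simp
qed

context split
begin

lemma UV_disjoint: "x \<in> U \<Longrightarrow> x \<in> V \<Longrightarrow> x = 0"
  using perp[of x x] by simp

text \<open>The two parts lie in \<open>U\<close> and \<open>V\<close> and together span the space.
  Since \<open>U\<close> and \<open>V\<close> meet only in 0, each part must span its
  summand.\<close>

lemma half_frame_span:
  assumes E: "frame \<Phi> U V E N" and H: "H \<subseteq> E" "span H = UNIV"
  shows "span (H \<inter> U) = U" "span (H \<inter> V) = V"
proof -
  have UV: "y \<in> U \<or> y \<in> V" if "y \<in> H" for y using E H(1) that unfolding frame_def by blast
  have sU: "span (H \<inter> U) \<subseteq> U" and sV: "span (H \<inter> V) \<subseteq> V"
    by (rule span_minimal[OF _ subU], blast) (rule span_minimal[OF _ subV], blast)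
  have "H = (H \<inter> U) \<union> (H \<inter> V)" using UV by blast
  then have "span ((H \<inter> U) \<union> (H \<inter> V)) = UNIV" using H(2) by simp
  then have ab: "\<exists>a b. a \<in> span (H \<inter> U) \<and> b \<in> span (H \<inter> V) \<and> x = a + b" for x
  proof -
    have "x \<in> span ((H \<inter> U) \<union> (H \<inter> V))" by (simp add: \<open>span ((H \<inter> U) \<union> (H \<inter> V)) = UNIV\<close>)
    then show ?thesis unfolding span_Un by blast
  qed
  have "x \<in> span (H \<inter> U)" if "x \<in> U" for x
  proof -
    obtain a b where *: "a \<in> span (H \<inter> U)" "b \<in> span (H \<inter> V)" "x = a + b" using ab by blast
    then have "b = x - a" by simp
    then have "b \<in> U" using subspace_diff[OF subU that, of a] * sU by blast
    then show ?thesis using * UV_disjoint[of b] sV by auto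
  qed
  moreover have "x \<in> span (H \<inter> V)" if "x \<in> V" for x
  proof -
    obtain a b where *: "a \<in> span (H \<inter> U)" "b \<in> span (H \<inter> V)" "x = a + b" using ab by blast
    then have "a = x - b" by simp
    then have "a \<in> V" using subspace_diff[OF subV that, of b] * sV by blast
    then show ?thesis using * UV_disjoint[of a] sU by auto
  qed
  ultimately show "span (H \<inter> U) = U" "span (H \<inter> V) = V" using sU sV by blast+
qed

lemma frame_perp_exists:
  assumes E: "frame \<Phi> U V E N" and "y \<in> E"
  obtains z where "z \<in> E" "y \<bullet> z = 0"
proof -
  obtain H where H: "H \<subseteq> E" "span H = UNIV" using frame_half[OF E] by metis
  note sp = half_frame_span[OF E H]
  have "H \<inter> U \<noteq> {}" "H \<inter> V \<noteq> {}" using sp U0 V0 by auto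
  then obtain a b where ab: "a \<in> E" "a \<in> U" "b \<in> E" "b \<in> V" using H(1) by blast
  have "y \<in> U \<or> y \<in> V" using E assms(2) unfolding frame_def by blast
  then show ?thesis
  proof
    assume "y \<in> U" then show ?thesis using that[of b] ab perp by blast
  next
    assume "y \<in> V" then show ?thesis using that[of a] ab perp[of a y] by (simp add: inner_commute)
  qed
qed

text \<open>Paired with the root \<open>y - z\<close>, the multiple \<open>c *\<^sub>R y\<close> has
  Cartan integer \<open>c\<close>. Hence \<open>c\<^sup>2 = 2\<close> is impossible, and the
  multiples of frame vectors never have the length of the differences.\<close>

lemma frame_scalar_norm:
  assumes E: "frame \<Phi> U V E N" and y: "y \<in> E" "c *\<^sub>R y \<in> \<Phi>"
  shows "(c *\<^sub>R y) \<bullet> (c *\<^sub>R y) = c\<^sup>2 * (N / 2)" "(c *\<^sub>R y) \<bullet> (c *\<^sub>R y) \<noteq> N" "c \<noteq> 0" "c \<in> \<int>"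
proof -
  note yy = frameD(2)[OF E] and N = frameD(3)[OF E] and d = frameD(7)[OF E]
  show n: "(c *\<^sub>R y) \<bullet> (c *\<^sub>R y) = c\<^sup>2 * (N / 2)" using yy[OF y(1)] by (simp add: power2_eq_square)
  show "c \<noteq> 0" using y(2) nz by auto
  obtain z where z: "z \<in> E" "y \<bullet> z = 0" using frame_perp_exists[OF E y(1)] .
  have nn: "(y - z) \<bullet> (y - z) = N" using yy[OF y(1)] yy[OF z(1)] z(2) by (simp add: inner_diff_self)
  have "2 * ((y - z) \<bullet> (c *\<^sub>R y)) / ((y - z) \<bullet> (y - z)) \<in> \<int>" using cryst[OF d[OF y(1) z] y(2)] .
  moreover have "(y - z) \<bullet> y = N / 2"
    using yy[OF y(1)] z(2) by (simp add: inner_diff_left inner_commute[of z y])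
  then have "(y - z) \<bullet> (c *\<^sub>R y) = c * (N / 2)" by simp
  ultimately have "2 * (c * (N / 2)) / N \<in> \<int>" using nn by (simp only:)
  then show "c \<in> \<int>" using N by simp
  then obtain k where k: "c = of_int k" by (rule Ints_cases)
  show "(c *\<^sub>R y) \<bullet> (c *\<^sub>R y) \<noteq> N"
  proof
    assume "(c *\<^sub>R y) \<bullet> (c *\<^sub>R y) = N"
    then have "c\<^sup>2 = 2" using n N by simp
    then have "of_int (k\<^sup>2) = (2::real)" using k by simp
    then have k2: "k * k = 2" by (simp only: of_int_eq_numeral_iff power2_eq_square)
    then have "\<bar>k\<bar> < 2" using abs_le_square_iff[of 2 k] by (auto simp: power2_eq_square)
    then have "k = 0 \<or> k = 1 \<or> k = - 1" by linarith
    then show False using k2 by auto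
  qed
qed

lemma frame_scalar_transfer:
  assumes E: "frame \<Phi> U V E N" and y: "y \<in> E" "z \<in> E" "c *\<^sub>R y \<in> \<Phi>"
  shows "c *\<^sub>R z \<in> \<Phi>"
proof -
  note yy = frameD(2)[OF E] and d = frameD(7)[OF E] and tri = frameD(6)[OF E y(1,2)]
  from tri show ?thesis
  proof (elim disjE)
    assume "z = - y" then show ?thesis using neg_root[OF y(3)] by simp
  next
    assume "y \<bullet> z = 0"
    then have "rf (y - z) (c *\<^sub>R y) \<in> \<Phi>" using y d by (intro rf_root) auto
    moreover have "rf (y - z) y = z" using yy[OF y(1)] yy[OF y(2)] by (intro rf_swap) simp
    ultimately show ?thesis by (simp add: rf_scale)
  qed (use y in simp)
qed

end

text \<open>Equal dimensions allow the half frames to be matched part by part. The resulting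
  isometry carries frame to frame and so differences to differences. For the multiples of frame
  vectors the common value \<open>N\<close> is decisive: it makes the scalars in both frames agree
  up to sign.\<close>

lemma frame_match:
  assumes s: "split \<Phi> U V" and s': "split \<Phi> U' V'"
    and E: "frame \<Phi> U V E N" and E': "frame \<Phi> U' V' E' N" and dim: "dim U = dim U'"
  shows "\<exists>B. matches \<Phi> U V U' V' B"
proof -
  interpret s: split \<Phi> U V by (rule s)
  interpret t: split \<Phi> U' V' by (rule s')
  obtain H where H: "H \<subseteq> E" "\<And>y. y \<in> E \<Longrightarrow> y \<in> H \<or> - y \<in> H"
    "\<And>y z. y \<in> H \<Longrightarrow> z \<in> H \<Longrightarrow> y \<noteq> z \<Longrightarrow> y \<bullet> z = 0" "independent H" "span H = UNIV"
    using frame_half[OF E] by metis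
  obtain H' where H': "H' \<subseteq> E'" "\<And>y. y \<in> E' \<Longrightarrow> y \<in> H' \<or> - y \<in> H'"
    "\<And>y z. y \<in> H' \<Longrightarrow> z \<in> H' \<Longrightarrow> y \<noteq> z \<Longrightarrow> y \<bullet> z = 0" "independent H'" "span H' = UNIV"
    using frame_half[OF E'] by metis
  note EE = frameD(1,2,8,5,3)[OF E]
  note EE' = frameD(1,2,8,5,7)[OF E']
  note sp = s.half_frame_span[OF E H(1,5)] and sp' = t.half_frame_span[OF E' H'(1,5)]
  have fH: "finite H" "finite H'" using H(1) H'(1) EE EE' finite_subset by blast+
  have cU: "card (H \<inter> U) = card (H' \<inter> U')"
  proof -
    have "independent (H \<inter> U)" "independent (H' \<inter> U')"
      using independent_mono[OF H(4), of "H \<inter> U"] independent_mono[OF H'(4), of "H' \<inter> U'"] by auto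
    then have "dim (span (H \<inter> U)) = card (H \<inter> U)" "dim (span (H' \<inter> U')) = card (H' \<inter> U')"
      by (simp_all add: dim_eq_card_independent)
    then show ?thesis using sp sp' dim by simp
  qed
  have "card H = card H'"
    using H(4,5) H'(4,5) by (metis dim_eq_card_independent dim_span)
  moreover have "H - U = H \<inter> V" "H' - U' = H' \<inter> V'"
  proof -
    have "0 \<notin> E" "0 \<notin> E'" using EE(2)[of 0] EE'(2)[of 0] EE(5) by auto
    then show "H - U = H \<inter> V" "H' - U' = H' \<inter> V'"
      using H(1) H'(1) EE(4) EE'(4) s.UV_disjoint t.UV_disjoint by blast+
  qed
  ultimately have cV: "card (H \<inter> V) = card (H' \<inter> V')"
    using cU fH by (metis card_Diff_subset_Int finite_Int)
  obtain f where f: "bij_betw f (H \<inter> U) (H' \<inter> U')"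
    using finite_same_card_bij[OF _ _ cU] fH by auto
  obtain g where g: "bij_betw g (H \<inter> V) (H' \<inter> V')"
    using finite_same_card_bij[OF _ _ cV] fH by auto
  define h where "h = (\<lambda>e. if e \<in> U then f e else g e)"
  have hU: "h e \<in> H'" "h e \<in> U'" if "e \<in> H" "e \<in> U" for e
    using f that by (auto simp: h_def bij_betw_def)
  have hV: "h e \<in> H'" "h e \<in> V'" if "e \<in> H" "e \<notin> U" for e
    using g that H(1) EE(4) by (auto simp: h_def bij_betw_def)
  have hH: "h e \<in> H'" if "e \<in> H" for e using hU hV that by blast
  have hne: "h e \<noteq> h e'" if "e \<in> H" "e' \<in> H" "e \<noteq> e'" for e e'
  proof -
    have z: "0 \<notin> H'" using H'(1) EE'(2)[of 0] EE(5) by auto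
    consider "e \<in> U" "e' \<in> U" | "e \<notin> U" "e' \<notin> U" | "e \<in> U" "e' \<notin> U" | "e \<notin> U" "e' \<in> U" by blast
    then show ?thesis
    proof cases
      case 1 then show ?thesis using f that unfolding h_def bij_betw_def inj_on_def by auto
    next
      case 2
      then have "e \<in> V" "e' \<in> V" using that H(1) EE(4) by blast+
      then show ?thesis using g that 2 unfolding h_def bij_betw_def inj_on_def by auto
    next
      case 3 then show ?thesis using hU[of e] hV[of e'] that z t.UV_disjoint by metis
    next
      case 4 then show ?thesis using hU[of e'] hV[of e] that z t.UV_disjoint by metis
    qed
  qed
  have gram: "e \<bullet> e' = h e \<bullet> h e'" if "e \<in> H" "e' \<in> H" for e e'
  proof (cases "e = e'")
    case True
    have "e \<in> E" "h e \<in> E'" using that hH H(1) H'(1) by auto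
    then show ?thesis using EE(2)[of e] EE'(2)[of "h e"] True by simp
  next
    case False
    then show ?thesis using H(3)[OF that False] H'(3)[OF hH[OF that(1)] hH[OF that(2)] hne[OF that False]] by simp
  qed
  obtain B where B: "orthogonal_transformation B" "\<And>e. e \<in> H \<Longrightarrow> B e = h e"
    using gram_isometry[of H "\<lambda>e. e" h] gram H(5) by auto
  have lin: "linear B" using B(1) by (rule orthogonal_transformation_linear)
  have BE: "B y \<in> E'" if "y \<in> E" for y
    using H(2)[OF that]
  proof
    assume "y \<in> H" then show ?thesis using B(2) hH H'(1) by auto
  next
    assume "- y \<in> H"
    then have "- B y \<in> E'" using B(2)[of "- y"] hH H'(1) linear_neg[OF lin, of y] by auto
    then show ?thesis using EE'(1) by fastforce
  qed
  have BU: "B x \<in> U'" if "x \<in> U" for x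
  proof -
    have "B ` (H \<inter> U) \<subseteq> U'" using B(2) hU by auto
    then have "span (B ` (H \<inter> U)) \<subseteq> U'" using t.subU by (intro span_minimal) auto
    then show ?thesis using that sp(1) linear_span_image[OF lin, of "H \<inter> U"] by blast
  qed
  have BV: "B x \<in> V'" if "x \<in> V" for x
  proof -
    have "B e \<in> V'" if "e \<in> H" "e \<in> V" for e
    proof (cases "e \<in> U")
      case True
      then have "e = 0" using s.UV_disjoint that by blast
      then show ?thesis using linear_0[OF lin] subspace_0[OF t.subV] by simp
    next
      case False
      then show ?thesis using B(2)[OF that(1)] hV(2)[OF that(1)] by simp
    qed
    then have "span (B ` (H \<inter> V)) \<subseteq> V'" using t.subV by (intro span_minimal) auto
    then show ?thesis using that sp(2) linear_span_image[OF lin, of "H \<inter> V"] by blast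
  qed
  have root: "B \<alpha> \<in> \<Phi>" if a: "\<alpha> \<in> \<Phi>" for \<alpha>
  proof -
    consider y z where "y \<in> E" "z \<in> E" "y \<bullet> z = 0" "\<alpha> = y - z" | y c where "y \<in> E" "\<alpha> = c *\<^sub>R y"
      using E a unfolding frame_def by blast
    then show ?thesis
    proof cases
      case 1
      then have "B y - B z \<in> \<Phi>"
        using BE orthogonal_transformation_inner[OF B(1), of y z] by (intro EE'(5)) auto
      then show ?thesis using 1 linear_diff[OF lin] by simp
    next
      case 2
      \<comment> \<open>The length of \<open>\<alpha>\<close> is not that of a difference. So
        \<open>\<alpha>\<close> is a multiple of a frame vector in the second frame too, with the
        same scalar up to sign.\<close>
      have n: "\<alpha> \<bullet> \<alpha> = c\<^sup>2 * (N / 2)" "\<alpha> \<bullet> \<alpha> \<noteq> N"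
        using s.frame_scalar_norm[OF E 2(1)] a 2(2) by blast+
      consider y z where "y \<in> E'" "z \<in> E'" "y \<bullet> z = 0" "\<alpha> = y - z" | y' c' where "y' \<in> E'" "\<alpha> = c' *\<^sub>R y'"
        using E' a unfolding frame_def by blast
      then show ?thesis
      proof cases
        case 1
        then have "\<alpha> \<bullet> \<alpha> = N" using EE'(2)[OF 1(1)] EE'(2)[OF 1(2)] by (simp add: inner_diff_self)
        then show ?thesis using n(2) by blast
      next
        case c': 2
        have "\<alpha> \<bullet> \<alpha> = c'\<^sup>2 * (N / 2)" using t.frame_scalar_norm(1)[OF E' c'(1)] a c'(2) by blast
        then have "c\<^sup>2 = c'\<^sup>2" using n EE(5) by simp
        then have "c = c' \<or> c = - c'" by (simp add: power2_eq_iff)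
        moreover have "c' *\<^sub>R B y \<in> \<Phi>"
          using t.frame_scalar_transfer[OF E' c'(1) BE[OF 2(1)]] a c'(2) by simp
        ultimately have "c *\<^sub>R B y \<in> \<Phi>" using s.neg_root by fastforce
        then show ?thesis using 2(2) linear_scale[OF lin] by simp
      qed
    qed
  qed
  have aut: "s.aut B" by (rule s.autI[OF B(1) root])
  have "(\<gamma> \<in> U \<or> \<gamma> \<in> V) \<longleftrightarrow> (B \<gamma> \<in> U' \<or> B \<gamma> \<in> V')" for \<gamma>
  proof
    assume *: "B \<gamma> \<in> U' \<or> B \<gamma> \<in> V'"
    obtain u v where uv: "u \<in> U" "v \<in> V" "\<gamma> = u + v" using s.decomp[of \<gamma>] by blast
    have eq: "B \<gamma> = B u + B v" using uv linear_add[OF lin] by simp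
    have inj0: "x = 0" if "B x = 0" for x
      using orthogonal_transformation_inner[OF B(1), of x x] that by simp
    from * show "\<gamma> \<in> U \<or> \<gamma> \<in> V"
    proof
      assume "B \<gamma> \<in> U'"
      then have "B v \<in> U'" using subspace_diff[OF t.subU _ BU[OF uv(1)], of "B \<gamma>"] eq by simp
      then have "v = 0" using t.UV_disjoint[of "B v"] BV[OF uv(2)] inj0 by blast
      then show ?thesis using uv by simp
    next
      assume "B \<gamma> \<in> V'"
      then have "B u \<in> V'" using subspace_diff[OF t.subV _ BV[OF uv(2)], of "B \<gamma>"] eq by simp
      then have "u = 0" using t.UV_disjoint[of "B u"] BU[OF uv(1)] inj0 by blast
      then show ?thesis using uv by simp
    qed
  next
    assume "\<gamma> \<in> U \<or> \<gamma> \<in> V"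
    then show "B \<gamma> \<in> U' \<or> B \<gamma> \<in> V'" using BU[of \<gamma>] BV[of \<gamma>] by blast
  qed
  then have "matches \<Phi> U V U' V' B" using aut by (simp add: matches_def s.aut_def)
  then show ?thesis by blast
qed

section \<open>Matching simply laced splittings\<close>

lemma simplex_inner:
  assumes "simplex_on \<Phi> U X N" "card X = 5" "p \<in> X" "q \<in> X"
  shows "p \<bullet> q = (if p = q then 2 * N / 5 else - N / 10)"
proof -
  have "2 * (p \<bullet> p) * 5 = N * (5 - 1)" using assms unfolding simplex_on_def by force
  then have pp: "p \<bullet> p = 2 * N / 5" by simp
  moreover have "p \<noteq> q \<longrightarrow> p \<bullet> q = p \<bullet> p - N / 2" using assms unfolding simplex_on_def by blast
  ultimately show ?thesis by auto
qed

lemma simplex_root_image: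
  assumes X: "simplex_on \<Phi> U X N" and X': "simplex_on \<Phi> U' X' N'" and f: "bij_betw f X X'"
    and lin: "linear B" and B: "\<And>x. x \<in> X \<Longrightarrow> B x = f x" and \<alpha>: "\<alpha> \<in> \<Phi>" "\<alpha> \<in> U"
  shows "B \<alpha> \<in> \<Phi>"
proof -
  obtain p q where pq: "\<alpha> = p - q" "p \<in> X" "q \<in> X" "p \<noteq> q"
    using X IntI[OF \<alpha>] unfolding simplex_on_def by auto
  have "B \<alpha> = f p - f q" using pq B linear_diff[OF lin] by simp
  moreover have "f p \<in> X'" "f q \<in> X'" "f p \<noteq> f q" using f pq by (auto simp: bij_betw_def inj_on_def)
  moreover have "\<Phi> \<inter> U' = {y - z | y z. y \<in> X' \<and> z \<in> X' \<and> y \<noteq> z}" using X' unfolding simplex_on_def by blast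
  ultimately show ?thesis by blast
qed

text \<open>The bijections of vertices are chosen to send the glue root to the glue root. The
  isometry then maps to roots all roots in \<open>U\<close> and \<open>V\<close> and one mixed root,
  and by \<open>max\<close> these generate everything.\<close>

lemma double_A4_match:
  assumes s: "split \<Phi> U V" and s': "split \<Phi> U' V'"
    and sl: "\<And>\<alpha>. \<alpha> \<in> \<Phi> \<Longrightarrow> \<alpha> \<bullet> \<alpha> = N"
    and d: "double_A4 \<Phi> U V N X Y x1 x2 y1" and d': "double_A4 \<Phi> U' V' N X' Y' x1' x2' y1'"
  shows "\<exists>B. matches \<Phi> U V U' V' B"
proof -
  interpret s: split \<Phi> U V by (rule s)
  interpret t: split \<Phi> U' V' by (rule s')
  have X: "simplex_on \<Phi> U X N" "card X = 5" and Y: "simplex_on \<Phi> V Y N" "card Y = 5"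
    and xy: "x1 \<in> X" "x2 \<in> X" "x1 \<noteq> x2" "y1 \<in> Y" and \<delta>: "x1 + x2 + y1 \<in> \<Phi>"
    using d by (auto simp: double_A4_def)
  have X': "simplex_on \<Phi> U' X' N" "card X' = 5" and Y': "simplex_on \<Phi> V' Y' N" "card Y' = 5"
    and xy': "x1' \<in> X'" "x2' \<in> X'" "x1' \<noteq> x2'" "y1' \<in> Y'" and \<delta>': "x1' + x2' + y1' \<in> \<Phi>"
    using d' by (auto simp: double_A4_def)
  have N: "N > 0" and fin: "finite X" "finite Y" "finite X'" "finite Y'"
    and sp: "span X = U" "span Y = V" "span X' = U'" "span Y' = V'"
    using X Y X' Y' by (auto simp: simplex_on_def)
  obtain f where f: "bij_betw f X X'" "f x1 = x1'" "f x2 = x2'"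
    using bij_prescribed[OF fin(1,3) _ xy(1,2,3) xy'(1,2,3)] X X' by metis
  have "card (Y - {y1}) \<noteq> 0" "card (Y' - {y1'}) \<noteq> 0" using xy(4) xy'(4) Y(2) Y'(2) by simp_all
  then obtain y2 y2' where y2: "y2 \<in> Y" "y1 \<noteq> y2" "y2' \<in> Y'" "y1' \<noteq> y2'"
    by (metis Diff_iff all_not_in_conv card.empty insertI1)
  obtain g where g: "bij_betw g Y Y'" "g y1 = y1'"
    using bij_prescribed[OF fin(2,4) _ xy(4) y2(1,2) xy'(4) y2(3,4)] Y Y' by metis
  have mem: "x \<in> U" if "x \<in> X" for x using sp(1) that span_base by blast
  have memY: "x \<in> V" if "x \<in> Y" for x using sp(2) that span_base by blast
  have mem': "x \<in> U'" if "x \<in> X'" for x using sp(3) that span_base by blast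
  have memY': "x \<in> V'" if "x \<in> Y'" for x using sp(4) that span_base by blast
  have XY: "x \<notin> Y" if "x \<in> X" for x
  proof
    assume "x \<in> Y"
    then have "x = 0" using s.UV_disjoint mem memY that by blast
    then show False using simplex_inner[OF X that that] N by simp
  qed
  define h where "h = (\<lambda>x. if x \<in> X then f x else g x)"
  have hX: "h x = f x" "h x \<in> X'" if "x \<in> X" for x using f(1) that by (auto simp: h_def bij_betw_def)
  have hY: "h x = g x" "h x \<in> Y'" if "x \<in> Y" for x
    using g(1) that XY by (auto simp: h_def bij_betw_def)
  have gram: "p \<bullet> q = h p \<bullet> h q" if m: "p \<in> X \<union> Y" "q \<in> X \<union> Y" for p q
  proof -
    consider "p \<in> X" "q \<in> X" | "p \<in> Y" "q \<in> Y" | "p \<in> X" "q \<in> Y" | "p \<in> Y" "q \<in> X" using m by blast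
    then show ?thesis
    proof cases
      case 1
      then have "h p = h q \<longleftrightarrow> p = q" using f(1) hX by (auto simp: bij_betw_def inj_on_def)
      then show ?thesis using simplex_inner[OF X 1] simplex_inner[OF X' hX(2)[OF 1(1)] hX(2)[OF 1(2)]] by simp
    next
      case 2
      then have "h p = h q \<longleftrightarrow> p = q" using g(1) hY by (auto simp: bij_betw_def inj_on_def)
      then show ?thesis using simplex_inner[OF Y 2] simplex_inner[OF Y' hY(2)[OF 2(1)] hY(2)[OF 2(2)]] by simp
    next
      case 3
      then show ?thesis using s.perp[of p q] t.perp[of "h p" "h q"] hX hY mem memY mem' memY' by simp
    next
      case 4
      then show ?thesis using s.perp[of q p] t.perp[of "h q" "h p"] hX hY mem memY mem' memY'
        by (simp add: inner_commute)
    qed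
  qed
  have "span ((\<lambda>x. x) ` (X \<union> Y)) = UNIV"
  proof -
    have "U \<subseteq> span (X \<union> Y)" "V \<subseteq> span (X \<union> Y)" using sp span_mono[of X "X \<union> Y"] span_mono[of Y "X \<union> Y"] by auto
    then have "x \<in> span (X \<union> Y)" for x using s.decomp[of x] by (metis span_add subset_iff)
    then show ?thesis by auto
  qed
  then obtain B where B: "orthogonal_transformation B" "\<And>e. e \<in> X \<union> Y \<Longrightarrow> B e = h e"
    using gram_isometry[of "X \<union> Y" "\<lambda>x. x" h] gram by metis
  have lin: "linear B" using B(1) by (rule orthogonal_transformation_linear)
  have fX: "f ` X = X'" and gY: "g ` Y = Y'" using f(1) g(1) by (auto simp: bij_betw_def)
  have "B ` X = X'" using B(2) hX(1) fX by (metis (no_types, lifting) UnI1 image_cong)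
  then have BU: "B ` U = U'" using linear_span_image[OF lin, of X] sp by simp
  have "B ` Y = Y'" using B(2) hY(1) gY by (metis (no_types, lifting) UnI2 image_cong)
  then have BV: "B ` V = V'" using linear_span_image[OF lin, of Y] sp by simp
  have rU: "B \<alpha> \<in> \<Phi>" if "\<alpha> \<in> \<Phi>" "\<alpha> \<in> U" for \<alpha>
    by (rule simplex_root_image[OF X(1) X'(1) f(1) lin _ that]) (simp add: B(2) hX(1))
  have rV: "B \<alpha> \<in> \<Phi>" if "\<alpha> \<in> \<Phi>" "\<alpha> \<in> V" for \<alpha>
    by (rule simplex_root_image[OF Y(1) Y'(1) g(1) lin _ that]) (simp add: B(2) hY(1))
  define d where "d = x1 + x2 + y1"
  have dr: "d \<in> \<Phi>" using \<delta> by (simp add: d_def)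
  have "B d = x1' + x2' + y1'"
    using B(2) hX(1) hY(1) xy f g linear_add[OF lin] by (simp add: d_def)
  then have Bd: "B d \<in> \<Phi>" using \<delta>' by simp
  have sums: "x1 + x2 \<in> U" "y1 \<in> V" using s.subU mem memY xy by (auto intro: subspace_add)
  have dmix: "d \<notin> U" "d \<notin> V"
  proof -
    show "d \<notin> U"
    proof
      assume "d \<in> U"
      then have "y1 \<in> U" using subspace_diff[OF s.subU _ sums(1), of d] by (simp add: d_def)
      then have "y1 = 0" using s.UV_disjoint sums by blast
      then show False using simplex_inner[OF Y xy(4) xy(4)] N by simp
    qed
    show "d \<notin> V"
    proof
      assume "d \<in> V"
      then have "x1 + x2 \<in> V" using subspace_diff[OF s.subV _ sums(2), of d] by (simp add: d_def)
      then have "x1 + x2 = 0" using s.UV_disjoint sums by blast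
      then have "(x1 + x2) \<bullet> x1 = 0" by simp
      then show False using simplex_inner[OF X xy(1) xy(1)] simplex_inner[OF X xy(2) xy(1)] xy N
        by (simp add: inner_add_left)
    qed
  qed
  \<comment> \<open>The preimage of the root system is invariant under the roots of \<open>U\<close>
    and \<open>V\<close> and under \<open>d\<close>, hence under all roots. It contains
    \<open>d\<close>, whose orbit is the whole simply laced system.\<close>
  define S where "S = {v. B v \<in> \<Phi>}"
  have inv: "rf \<beta> v \<in> S" if "\<beta> \<in> \<Phi>" "v \<in> S" for \<beta> v
  proof (rule s.max[OF dr dmix _ _ that])
    fix \<alpha> x assume "\<alpha> \<in> \<Phi>" "\<alpha> \<in> U \<or> \<alpha> \<in> V" "x \<in> S"
    then show "rf \<alpha> x \<in> S"
      using s.rf_root rU rV by (auto simp: S_def orthogonal_transformation_rf_conj[OF B(1)])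
  next
    fix x assume "x \<in> S"
    then show "rf d x \<in> S"
      using s.rf_root Bd by (auto simp: S_def orthogonal_transformation_rf_conj[OF B(1)])
  qed
  have "orb \<Phi> d \<subseteq> S" by (rule orb_subset) (use inv Bd in \<open>auto simp: S_def\<close>)
  then have root: "B \<alpha> \<in> \<Phi>" if "\<alpha> \<in> \<Phi>" for \<alpha>
    using s.norm_conj[OF dr that] sl[OF dr] sl[OF that] by (auto simp: S_def)
  have "s.aut B" by (rule s.autI[OF B(1) root])
  then have "matches \<Phi> U V U' V' B"
    using BU BV inj_image_mem_iff[OF orthogonal_transformation_inj[OF B(1)]]
    unfolding matches_def s.aut_def by metis
  then show ?thesis by blast
qed

text \<open>In a frame a root \<open>y - z\<close> comes with the perpendicular root
  \<open>y + z\<close>. Pulled back to the simplex these are two edges without common vertex. An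
  edge from the second one to the fifth vertex is perpendicular to the first and has product
  \<open>N / 2\<close> with the second, which would require products of frame vectors that are not
  multiples of \<open>N / 2\<close>.\<close>

lemma double_A4_not_frame:
  assumes s: "split \<Phi> U V" and s': "split \<Phi> U' V'"
    and sl: "\<And>\<alpha>. \<alpha> \<in> \<Phi> \<Longrightarrow> \<alpha> \<bullet> \<alpha> = N"
    and X: "simplex_on \<Phi> U X N" "card X = 5" and E: "frame \<Phi> U' V' E N"
    and A: "orthogonal_transformation A" "A ` U = U'" "\<And>\<alpha>. \<alpha> \<in> \<Phi> \<Longrightarrow> \<alpha> \<in> U \<Longrightarrow> A \<alpha> \<in> \<Phi>"
      "\<And>\<alpha>. A \<alpha> \<in> \<Phi> \<Longrightarrow> \<alpha> \<in> U \<Longrightarrow> \<alpha> \<in> \<Phi>"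
  shows False
proof -
  interpret s: split \<Phi> U V by (rule s)
  interpret t: split \<Phi> U' V' by (rule s')
  note AA = orthogonal_transformation_inner[OF A(1)]
  have N: "N > 0" and fX: "finite X" using X by (auto simp: simplex_on_def)
  have R: "\<Phi> \<inter> U = {y - z | y z. y \<in> X \<and> z \<in> X \<and> y \<noteq> z}" using X unfolding simplex_on_def by blast
  note EE = frameD(1,2,6,5,7)[OF E]
  have ED: "\<exists>y z. y \<in> E \<and> z \<in> E \<and> y \<bullet> z = 0 \<and> \<alpha> = y - z" if a: "\<alpha> \<in> \<Phi>" for \<alpha>
  proof -
    have "\<not> (\<exists>y\<in>E. \<exists>c. \<alpha> = c *\<^sub>R y)" using t.frame_scalar_norm(2)[OF E] sl a by metis
    then show ?thesis using E a unfolding frame_def by blast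
  qed
  obtain x0 x1 where x: "x0 \<in> X" "x1 \<in> X" "x0 \<noteq> x1"
  proof -
    have "\<not> card X \<le> Suc 0" using X(2) by simp
    then show ?thesis using that card_le_Suc0_iff_eq[OF fX] by blast
  qed
  have a: "x0 - x1 \<in> \<Phi>" "x0 - x1 \<in> U" using R x by blast+
  obtain y z where yz: "y \<in> E" "z \<in> E" "y \<bullet> z = 0" "A (x0 - x1) = y - z"
    using ED[OF A(3)[OF a]] by blast
  have AU: "y - z \<in> U'" using yz(4) a(2) A(2) by (metis imageI)
  have y0: "y \<noteq> 0" "z \<noteq> 0" using EE(2)[OF yz(1)] EE(2)[OF yz(2)] N by auto
  have yU: "y \<in> U' \<and> z \<in> U'"
  proof -
    consider "y \<in> U'" "z \<in> U'" | "y \<in> U'" "z \<in> V'" | "y \<in> V'" "z \<in> U'" | "y \<in> V'" "z \<in> V'"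
      using EE(4) yz by blast
    then show ?thesis
    proof cases
      case 2
      have "y - (y - z) \<in> U'" by (rule subspace_diff[OF t.subU 2(1) AU])
      then show ?thesis using t.UV_disjoint[of z] 2 y0 by simp
    next
      case 3
      have "(y - z) + z \<in> U'" by (rule subspace_add[OF t.subU AU 3(2)])
      then show ?thesis using t.UV_disjoint[of y] 3 y0 by simp
    next
      case 4
      then have "y - z \<in> V'" using t.subV by (intro subspace_diff) auto
      then have "y - z = 0" using t.UV_disjoint AU by blast
      then show ?thesis using yz(3) EE(2)[OF yz(1)] N by simp
    qed simp
  qed
  have "y - (- z) \<in> \<Phi>" using yz EE(1) by (intro EE(5)) auto
  then have b': "y + z \<in> \<Phi>" "y + z \<in> U'" using yU t.subU by (auto intro: subspace_add)
  then obtain b where b: "b \<in> U" "A b = y + z" using A(2) by (metis imageE)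
  have bR: "b \<in> \<Phi>" using A(4)[of b] b b' by simp
  then obtain p q where pq: "b = p - q" "p \<in> X" "q \<in> X" "p \<noteq> q" using R b by blast
  have ab: "(x0 - x1) \<bullet> (p - q) = 0"
  proof -
    have "(x0 - x1) \<bullet> b = (y - z) \<bullet> (y + z)" using AA[of "x0 - x1" b] yz(4) b(2) by simp
    also have "\<dots> = 0" using yz(3) EE(2)[OF yz(1)] EE(2)[OF yz(2)]
      by (simp add: inner_diff_left inner_add_right inner_commute[of z y])
    finally show ?thesis using pq(1) by simp
  qed
  note I = simplex_inner[OF X]
  have ex: "x0 \<bullet> p - x0 \<bullet> q - x1 \<bullet> p + x1 \<bullet> q = 0"
    using ab by (simp add: inner_diff_left inner_diff_right)
  \<comment> \<open>Perpendicular edges of a regular simplex share no vertex.\<close>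
  have dist: "p \<noteq> x0" "p \<noteq> x1" "q \<noteq> x0" "q \<noteq> x1"
    using ex I[OF x(1) pq(2)] I[OF x(1) pq(3)] I[OF x(2) pq(2)] I[OF x(2) pq(3)] x(3) pq(4) N
    by (auto split: if_splits)
  have "card {x0, x1, p, q} = 4" using dist x(3) pq(4) by auto
  then have "X \<noteq> {x0, x1, p, q}" using X(2) by auto
  then obtain x4 where x4: "x4 \<in> X" "x4 \<notin> {x0, x1, p, q}" using x pq by blast
  have c: "p - x4 \<in> \<Phi>" "p - x4 \<in> U" using R x4 pq by blast+
  obtain y2 z2 where yz2: "y2 \<in> E" "z2 \<in> E" "y2 \<bullet> z2 = 0" "A (p - x4) = y2 - z2"
    using ED[OF A(3)[OF c]] by blast
  have "(p - x4) \<bullet> (x0 - x1) = 0"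
    using I[OF pq(2) x(1)] I[OF pq(2) x(2)] I[OF x4(1) x(1)] I[OF x4(1) x(2)] dist x4(2)
    by (simp add: inner_diff_left inner_diff_right)
  then have e1: "(y2 - z2) \<bullet> (y - z) = 0" using AA[of "p - x4" "x0 - x1"] yz yz2 by simp
  have "(p - x4) \<bullet> (p - q) = N / 2"
    using I[OF pq(2) pq(2)] I[OF pq(2) pq(3)] I[OF x4(1) pq(2)] I[OF x4(1) pq(3)] pq(4) x4(2)
    by (simp add: inner_diff_left inner_diff_right)
  then have e2: "(y2 - z2) \<bullet> (y + z) = N / 2" using AA[of "p - x4" b] b pq(1) yz2 by simp
  have "2 * (y2 \<bullet> y - z2 \<bullet> y) = (y2 - z2) \<bullet> (y - z) + (y2 - z2) \<bullet> (y + z)"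
    by (simp add: inner_diff_left inner_diff_right inner_add_right)
  \<comment> \<open>Products of frame vectors are 0 or \<open>\<plusminus>N / 2\<close>, so a
    difference of two of them is never \<open>N / 4\<close>.\<close>
  then have 4: "y2 \<bullet> y - z2 \<bullet> y = N / 4" using e1 e2 by simp
  have w: "w \<bullet> y = 0 \<or> w \<bullet> y = N / 2 \<or> w \<bullet> y = - N / 2" if "w \<in> E" for w
    using EE(3)[OF yz(1) that] EE(2)[OF yz(1)] by (auto simp: inner_commute)
  show False using w[OF yz2(1)] w[OF yz2(2)] 4 N by (elim disjE) linarith+
qed

text \<open>\<open>A\<close> carries the small component to a component of the second splitting.
  Roots of equal length are conjugate, and so are planes of type \<open>A\<^sub>2\<close>; hence
  some automorphism of the root system has the same effect on this component, and a component
  determines its splitting.\<close>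

lemma low_rank_match:
  assumes s: "split \<Phi> U V" and s': "split \<Phi> U' V'"
    and sl: "\<And>\<alpha>. \<alpha> \<in> \<Phi> \<Longrightarrow> \<alpha> \<bullet> \<alpha> = N"
    and A: "orthogonal_transformation A"
      "\<And>\<alpha>. \<alpha> \<in> \<Phi> \<Longrightarrow> \<alpha> \<in> U \<or> \<alpha> \<in> V \<Longrightarrow> A \<alpha> \<in> \<Phi>"
      "\<And>\<alpha>. \<alpha> \<in> \<Phi> \<Longrightarrow> \<alpha> \<in> U' \<or> \<alpha> \<in> V' \<Longrightarrow> \<exists>\<beta>\<in>\<Phi>. (\<beta> \<in> U \<or> \<beta> \<in> V) \<and> \<alpha> = A \<beta>"
    and low: "rank_one_component \<Phi> U V \<or> A2_component \<Phi> U V N"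
  shows "\<exists>B. matches \<Phi> U V U' V' B"
proof -
  interpret s: split \<Phi> U V by (rule s)
  have lin: "linear A" using A(1) by (rule orthogonal_transformation_linear)
  have inj: "inj A" by (rule orthogonal_transformation_inj[OF A(1)])
  have comp: "component \<Phi> U' V' (A ` K)" if K: "component \<Phi> U V K" for K
  proof -
    have K': "subspace K" "K \<noteq> {0}" "K \<noteq> UNIV"
      "\<And>\<alpha>. \<alpha> \<in> \<Phi> \<Longrightarrow> \<alpha> \<in> U \<or> \<alpha> \<in> V \<Longrightarrow> \<alpha> \<in> K \<or> (\<forall>x\<in>K. \<alpha> \<bullet> x = 0)"
      using K unfolding component_def by blast+
    have "subspace (A ` K)" using lin K'(1) by (rule linear_subspace_image)
    moreover have "A ` K \<noteq> {0}"
      using K'(1,2) inj linear_0[OF lin] by (metis image_empty image_insert inj_image_eq_iff)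
    moreover have "A ` K \<noteq> UNIV"
      using K'(3) inj orthogonal_transformation_surj[OF A(1)] by (metis inj_image_eq_iff)
    moreover have "\<alpha> \<in> A ` K \<or> (\<forall>x\<in>A ` K. \<alpha> \<bullet> x = 0)" if a: "\<alpha> \<in> \<Phi>" "\<alpha> \<in> U' \<or> \<alpha> \<in> V'" for \<alpha>
    proof -
      obtain \<beta> where b: "\<beta> \<in> \<Phi>" "\<beta> \<in> U \<or> \<beta> \<in> V" "\<alpha> = A \<beta>" using A(3)[OF a] by blast
      from K'(4)[OF b(1,2)] show ?thesis
      proof
        assume "\<beta> \<in> K" then show ?thesis using b(3) by blast
      next
        assume "\<forall>x\<in>K. \<beta> \<bullet> x = 0"
        then have "\<forall>x\<in>A ` K. \<alpha> \<bullet> x = 0" using b(3) orthogonal_transformation_inner[OF A(1)] by simp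
        then show ?thesis ..
      qed
    qed
    ultimately show ?thesis unfolding component_def by blast
  qed
  have fin: "\<exists>B. matches \<Phi> U V U' V' B"
    if "component \<Phi> U V (span T)" "s.aut B" "span (B ` T) = span (A ` T)" for B T
  proof -
    have "B ` span T = A ` span T"
      using linear_span_image[OF s.aut_linear[OF that(2)], of T] linear_span_image[OF lin, of T] that(3) by simp
    then have "matches \<Phi> U V U' V' B"
      using that(2) comp[OF that(1)] unfolding s.aut_def
      by (intro matches_component[OF s s' that(1)]) auto
    then show ?thesis by blast
  qed
  from low show ?thesis
  proof
    assume "rank_one_component \<Phi> U V"
    then obtain \<alpha> where a: "\<alpha> \<in> \<Phi>" "\<alpha> \<in> U \<or> \<alpha> \<in> V" "component \<Phi> U V (span {\<alpha>})"
      unfolding rank_one_component_def by blast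
    have "A \<alpha> \<in> orb \<Phi> \<alpha>" using A(2)[OF a(1,2)] sl a(1) by (intro s.norm_conj) auto
    then obtain B where "s.aut B" "B \<alpha> = A \<alpha>" by (rule s.orb_aut)
    then show ?thesis using fin[OF a(3)] by simp
  next
    assume "A2_component \<Phi> U V N"
    then obtain \<alpha> \<beta> where a: "\<alpha> \<in> \<Phi>" "\<beta> \<in> \<Phi>" "\<alpha> \<in> U \<or> \<alpha> \<in> V" "\<beta> \<in> U \<or> \<beta> \<in> V"
        "\<alpha> \<bullet> \<alpha> = N" "\<beta> \<bullet> \<beta> = N" "\<alpha> \<bullet> \<beta> = - N / 2" "component \<Phi> U V (span {\<alpha>, \<beta>})"
      unfolding A2_component_def by blast
    obtain B where "s.aut B" "span {B \<alpha>, B \<beta>} = span {A \<alpha>, A \<beta>}"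
      using s.A2_conj[OF a(1,2) A(2)[OF a(1,3)] A(2)[OF a(2,4)] a(5,6) _ _ a(7)]
        sl[OF A(2)[OF a(1,3)]] sl[OF A(2)[OF a(2,4)]] orthogonal_transformation_inner[OF A(1), of \<alpha> \<beta>] a(7)
      by metis
    then show ?thesis using fin[OF a(8)] by simp
  qed
qed

text \<open>If only the second splitting has a small component, the inverse of \<open>A\<close> is
  used. Otherwise both are frames or both are of type \<open>double_A4\<close>, because
  \<open>A\<close> identifies the roots in \<open>U\<close> with those in \<open>U'\<close> and so
  excludes a mixture.\<close>

lemma simply_laced_match:
  assumes s: "split \<Phi> U V" and s': "split \<Phi> U' V'"
    and sl: "\<And>\<alpha>. \<alpha> \<in> \<Phi> \<Longrightarrow> \<alpha> \<bullet> \<alpha> = N"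
    and A: "orthogonal_transformation A"
      "\<And>\<alpha>. \<alpha> \<in> \<Phi> \<Longrightarrow> \<alpha> \<in> U \<or> \<alpha> \<in> V \<Longrightarrow> A \<alpha> \<in> \<Phi>"
      "\<And>\<alpha>. \<alpha> \<in> \<Phi> \<Longrightarrow> \<alpha> \<in> U' \<or> \<alpha> \<in> V' \<Longrightarrow> \<exists>\<beta>\<in>\<Phi>. (\<beta> \<in> U \<or> \<beta> \<in> V) \<and> \<alpha> = A \<beta>"
      "A ` U = U'" "A ` V = V'"
  shows "\<exists>B. matches \<Phi> U V U' V' B"
proof -
  interpret s: split \<Phi> U V by (rule s)
  interpret t: split \<Phi> U' V' by (rule s')
  have lin: "linear A" using A(1) by (rule orthogonal_transformation_linear)
  have inj: "inj A" by (rule orthogonal_transformation_inj[OF A(1)])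
  let ?A = "inv_into UNIV A"
  have A': "orthogonal_transformation ?A" by (rule orthogonal_transformation_inv[OF A(1)])
  have inv1: "?A (A x) = x" for x using inj by simp
  have inv2: "A (?A x) = x" for x using orthogonal_transformation_surj[OF A(1)] by (simp add: surj_f_inv_f)
  have memU: "A \<alpha> \<in> U'" if "\<alpha> \<in> U" for \<alpha> using A(4) that by blast
  have memV: "A \<alpha> \<in> V'" if "\<alpha> \<in> V" for \<alpha> using A(5) that by blast
  have low': "\<exists>B. matches \<Phi> U V U' V' B" if "rank_one_component \<Phi> U' V' \<or> A2_component \<Phi> U' V' N"
  proof -
    have "\<exists>B. matches \<Phi> U' V' U V B"
    proof (rule low_rank_match[OF s' s _ A' _ _ that])
      fix \<alpha> assume "\<alpha> \<in> \<Phi>" "\<alpha> \<in> U' \<or> \<alpha> \<in> V'"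
      then show "?A \<alpha> \<in> \<Phi>" using A(3)[of \<alpha>] inv1 by auto
    next
      fix \<alpha> assume "\<alpha> \<in> \<Phi>" "\<alpha> \<in> U \<or> \<alpha> \<in> V"
      then show "\<exists>\<beta>\<in>\<Phi>. (\<beta> \<in> U' \<or> \<beta> \<in> V') \<and> \<alpha> = ?A \<beta>"
        using A(2)[of \<alpha>] inv1 memU memV by (intro bexI[of _ "A \<alpha>"]) auto
    qed (rule sl)
    then show ?thesis using matches_inv by blast
  qed
  have dim: "dim U = dim U'" using dim_image_eq[OF lin, of U] inj A(4) by (metis inj_on_subset subset_UNIV)
  have aR: "\<alpha> \<in> \<Phi>" if "A \<alpha> \<in> \<Phi>" "\<alpha> \<in> U" for \<alpha>
    using A(3)[OF that(1)] memU[OF that(2)] inj by (auto simp: inj_def)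
  have c: "rank_one_component \<Phi> U V \<or> A2_component \<Phi> U V N \<or> (\<exists>E. frame \<Phi> U V E N) \<or>
      (\<exists>X Y x x' y. double_A4 \<Phi> U V N X Y x x' y)"
    by (rule s.simply_laced_cases) (fact sl)
  have c': "rank_one_component \<Phi> U' V' \<or> A2_component \<Phi> U' V' N \<or> (\<exists>E. frame \<Phi> U' V' E N) \<or>
      (\<exists>X Y x x' y. double_A4 \<Phi> U' V' N X Y x x' y)"
    by (rule t.simply_laced_cases) (fact sl)
  consider "rank_one_component \<Phi> U V \<or> A2_component \<Phi> U V N"
    | "rank_one_component \<Phi> U' V' \<or> A2_component \<Phi> U' V' N"
    | "(\<exists>E. frame \<Phi> U V E N)" "(\<exists>E. frame \<Phi> U' V' E N)"
    | "(\<exists>X Y x x' y. double_A4 \<Phi> U V N X Y x x' y)" "(\<exists>X Y x x' y. double_A4 \<Phi> U' V' N X Y x x' y)"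
    | "(\<exists>X Y x x' y. double_A4 \<Phi> U V N X Y x x' y)" "(\<exists>E. frame \<Phi> U' V' E N)"
    | "(\<exists>X Y x x' y. double_A4 \<Phi> U' V' N X Y x x' y)" "(\<exists>E. frame \<Phi> U V E N)"
    using c c' by argo
  then show ?thesis
  proof cases
    case 1
    show ?thesis by (rule low_rank_match[OF s s' _ A(1)]) (fact sl A(2) A(3) 1)+
  next
    case 2 then show ?thesis by (rule low')
  next
    case 3
    then obtain E E' where "frame \<Phi> U V E N" "frame \<Phi> U' V' E' N" by (elim exE)
    then show ?thesis by (rule frame_match[OF s s' _ _ dim])
  next
    case 4
    then obtain X Y x x' y X' Y' u u' v
      where d: "double_A4 \<Phi> U V N X Y x x' y" "double_A4 \<Phi> U' V' N X' Y' u u' v" by (elim exE)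
    show ?thesis by (rule double_A4_match[OF s s' _ d]) (fact sl)
  next
    case 5
    then obtain X Y x x' y E' where d: "double_A4 \<Phi> U V N X Y x x' y" "frame \<Phi> U' V' E' N"
      by (elim exE)
    then have "simplex_on \<Phi> U X N" "card X = 5" by (auto simp: double_A4_def)
    then have False using double_A4_not_frame[OF s s' _ _ _ d(2) A(1,4)] sl A(2) aR by blast
    then show ?thesis ..
  next
    case 6
    then obtain X' Y' u u' v E where d: "double_A4 \<Phi> U' V' N X' Y' u u' v" "frame \<Phi> U V E N"
      by (elim exE)
    then have X': "simplex_on \<Phi> U' X' N" "card X' = 5" by (auto simp: double_A4_def)
    have AU: "?A ` U' = U" using A(4) inj by (metis image_inv_f_f)
    have False
    proof (rule double_A4_not_frame[OF s' s _ X' d(2) A' AU])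
      fix \<alpha> assume "\<alpha> \<in> \<Phi>" "\<alpha> \<in> U'"
      then show "?A \<alpha> \<in> \<Phi>" using A(3)[of \<alpha>] inv1 by auto
    next
      fix \<alpha> assume a: "?A \<alpha> \<in> \<Phi>" "\<alpha> \<in> U'"
      then have "?A \<alpha> \<in> U" using AU by blast
      then show "\<alpha> \<in> \<Phi>" using A(2)[OF a(1)] inv2[of \<alpha>] by simp
    qed (rule sl)
    then show ?thesis ..
  qed
qed

section \<open>Root systems with two root lengths\<close>

context root_sys
begin

text \<open>One Cartan integer is \<open>r\<close> times the other and their product is below 4, so
  the smaller one is \<open>\<plusminus>1\<close> and the product is \<open>r\<close>.\<close>

lemma mixed_norm_inner:
  assumes "\<alpha> \<in> \<Phi>" "\<delta> \<in> \<Phi>" "\<alpha> \<bullet> \<alpha> \<noteq> \<delta> \<bullet> \<delta>" "\<alpha> \<bullet> \<delta> \<noteq> 0"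
    and "\<delta> \<bullet> \<delta> = r * (\<alpha> \<bullet> \<alpha>) \<or> \<alpha> \<bullet> \<alpha> = r * (\<delta> \<bullet> \<delta>)" "r = 2 \<or> r = 3"
  shows "4 * (\<alpha> \<bullet> \<delta>)\<^sup>2 = r * ((\<alpha> \<bullet> \<alpha>) * (\<delta> \<bullet> \<delta>))"
proof -
  have ne: "\<delta> \<noteq> \<alpha>" "\<delta> \<noteq> - \<alpha>" using assms(3) by auto
  obtain p q :: int where pq: "2 * (\<alpha> \<bullet> \<delta>) = p * (\<alpha> \<bullet> \<alpha>)" "2 * (\<alpha> \<bullet> \<delta>) = q * (\<delta> \<bullet> \<delta>)"
      "p * q < 4" "p * q \<ge> 0"
    using cartan[OF assms(1,2) ne] by metis
  have pos: "\<alpha> \<bullet> \<alpha> > 0" "\<delta> \<bullet> \<delta> > 0" using norm_pos assms by auto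
  have sq: "4 * (\<alpha> \<bullet> \<delta>)\<^sup>2 = real_of_int (p * q) * ((\<alpha> \<bullet> \<alpha>) * (\<delta> \<bullet> \<delta>))"
  proof -
    have "4 * (\<alpha> \<bullet> \<delta>)\<^sup>2 = (2 * (\<alpha> \<bullet> \<delta>)) * (2 * (\<alpha> \<bullet> \<delta>))" by (simp add: power2_eq_square)
    also have "\<dots> = (p * (\<alpha> \<bullet> \<alpha>)) * (q * (\<delta> \<bullet> \<delta>))" using pq(1,2) by simp
    finally show ?thesis by simp
  qed
  have n0: "p \<noteq> 0" "q \<noteq> 0" using pq(1,2) assms(4) by auto
  obtain k :: int where k: "r = of_int k" "k = 2 \<or> k = 3" using assms(6) by (metis of_int_numeral)
  have "p * q = k"
  proof (rule disjE[OF assms(5)])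
    assume "\<delta> \<bullet> \<delta> = r * (\<alpha> \<bullet> \<alpha>)"
    then have "real_of_int p = q * r" using pq(1,2) pos by simp
    then have p: "p = q * k" unfolding k by (metis of_int_eq_iff of_int_mult)
    then have "q * q * k < 4" using pq(3) by (simp add: mult.commute mult.left_commute)
    then have "q * q < 2" using k(2) by auto
    then have "q * q = 1" using n0(2) by (smt (verit) zero_less_mult_iff mult_neg_neg)
    then show ?thesis using p by (simp add: mult.commute mult.left_commute)
  next
    assume "\<alpha> \<bullet> \<alpha> = r * (\<delta> \<bullet> \<delta>)"
    then have "real_of_int q = p * r" using pq(1,2) pos by simp
    then have q: "q = p * k" unfolding k by (metis of_int_eq_iff of_int_mult)
    then have "p * p * k < 4" using pq(3) by (simp add: mult.commute mult.left_commute)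
    then have "p * p < 2" using k(2) by auto
    then have "p * p = 1" using n0(1) by (smt (verit) zero_less_mult_iff mult_neg_neg)
    then show ?thesis using q by (simp add: mult.commute mult.left_commute)
  qed
  then show ?thesis using sq k(1) by simp
qed

end

text \<open>A vector whose inner products with the vertices of a centred simplex differ by 0 or
  \<open>\<plusminus>l\<close> takes two values on the vertices; the tight frame identity gives its length.\<close>

lemma simplex_two_values:
  fixes l :: real
  assumes X: "simplex_on \<Phi> U X N" and v: "v \<in> U" "v \<noteq> 0" and l: "l > 0"
    and diff: "\<And>x y. x \<in> X \<Longrightarrow> y \<in> X \<Longrightarrow> v \<bullet> x - v \<bullet> y = 0 \<or> v \<bullet> x - v \<bullet> y = l \<or> v \<bullet> x - v \<bullet> y = - l"
  obtains s :: nat where "1 \<le> s" "s < card X" "v \<bullet> v = (2 / N) * (real s * real (card X - s) * l\<^sup>2 / card X)"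
proof -
  have fX: "finite X" and c: "card X \<ge> 2" and sX: "\<Sum>X = 0" and N: "N > 0"
    using X by (auto simp: simplex_on_def)
  then have ne: "X \<noteq> {}" by auto
  define a where "a = Max ((\<lambda>x. v \<bullet> x) ` X)"
  have amax: "v \<bullet> x \<le> a" if "x \<in> X" for x using that fX by (simp add: a_def)
  have "a \<in> (\<lambda>x. v \<bullet> x) ` X" unfolding a_def using fX ne by (intro Max_in) auto
  then obtain x0 where x0: "x0 \<in> X" "v \<bullet> x0 = a" by auto
  define S where "S = {x \<in> X. v \<bullet> x = a}"
  have vals: "v \<bullet> x = a - l" if "x \<in> X - S" for x
    using diff[OF x0(1), of x] amax[of x] that x0(2) l by (auto simp: S_def)
  have fS: "finite S" "S \<subseteq> X" using fX by (auto simp: S_def)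
  have decompose: "(\<Sum>x\<in>X. F (v \<bullet> x)) = card S * F a + (card X - card S) * F (a - l)" for F :: "real \<Rightarrow> real"
  proof -
    have "(\<Sum>x\<in>X. F (v \<bullet> x)) = (\<Sum>x\<in>X - S. F (v \<bullet> x)) + (\<Sum>x\<in>S. F (v \<bullet> x))"
      using fX fS by (intro sum.subset_diff) auto
    also have "(\<Sum>x\<in>S. F (v \<bullet> x)) = card S * F a" by (simp add: S_def)
    also have "(\<Sum>x\<in>X - S. F (v \<bullet> x)) = (\<Sum>x\<in>X - S. F (a - l))" using vals by (intro sum.cong) auto
    finally show ?thesis using fS fX by (simp add: card_Diff_subset)
  qed
  have cle: "card S \<le> card X" using fS fX by (simp add: card_mono)
  have c1: "card S \<ge> 1"
  proof -
    have "x0 \<in> S" using x0 by (simp add: S_def)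
    then show ?thesis using fS(1) by (metis One_nat_def Suc_leI card_gt_0_iff empty_iff)
  qed
  have "(\<Sum>x\<in>X. v \<bullet> x) = v \<bullet> \<Sum>X" by (simp add: inner_sum_right)
  \<comment> \<open>The vertices sum to 0, so the weighted values of \<open>v\<close> cancel; this
    fixes \<open>a = (n - s) * l / n\<close>.\<close>
  then have z: "card S * a + (real (card X) - card S) * (a - l) = 0"
    using decompose[of "\<lambda>x. x"] sX cle by (simp add: of_nat_diff)
  define n s where "n = real (card X)" and "s = real (card S)"
  have n0: "n > 0" using c by (simp add: n_def)
  have "n * a = (n - s) * l" using z unfolding n_def[symmetric] s_def[symmetric] by (simp add: algebra_simps)
  then have a: "a = (n - s) * l / n" and b: "a - l = - s * l / n" using n0 by (simp_all add: field_simps)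
  have "v \<bullet> v = (2 / N) * (\<Sum>x\<in>X. (v \<bullet> x)\<^sup>2)" by (rule simplex_tight_frame[OF X v(1)])
  also have "(\<Sum>x\<in>X. (v \<bullet> x)\<^sup>2) = s * a\<^sup>2 + (n - s) * (a - l)\<^sup>2"
    using decompose[of "\<lambda>x. x\<^sup>2"] cle by (simp add: n_def s_def of_nat_diff)
  also have "\<dots> = s * (n - s) * l\<^sup>2 / n"
  proof -
    have "s * a\<^sup>2 + (n - s) * (a - l)\<^sup>2 = (s * (n - s)\<^sup>2 * l\<^sup>2 + (n - s) * s\<^sup>2 * l\<^sup>2) / n\<^sup>2"
      unfolding a b[unfolded a] by (simp add: power_divide power_mult_distrib add_divide_distrib)
    also have "s * (n - s)\<^sup>2 * l\<^sup>2 + (n - s) * s\<^sup>2 * l\<^sup>2 = n * (s * (n - s) * l\<^sup>2)"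
      by (simp add: power2_eq_square algebra_simps)
    finally show ?thesis using n0 by (simp add: power2_eq_square)
  qed
  finally have vv: "v \<bullet> v = (2 / N) * (s * (n - s) * l\<^sup>2 / n)" .
  have "card S \<noteq> card X"
  proof
    assume "card S = card X"
    then have "v \<bullet> v = 0" using vv by (simp add: n_def s_def)
    then show False using v(2) by simp
  qed
  then show ?thesis using that[OF c1] cle vv by (simp add: n_def s_def of_nat_diff)
qed

context split
begin

text \<open>The products of a root of the other length with the edges of the simplex can only be 0
  or \<open>\<plusminus>l\<close>, so \<open>simplex_two_values\<close> computes the length of its
  component in \<open>U\<close>. The component in \<open>V\<close> does not vanish because the roots
  in \<open>U\<close> are edges and have length \<open>N\<close>.\<close>

lemma other_norm_root:
  assumes X: "simplex_on \<Phi> U X N" and \<delta>0: "\<delta>0 \<in> \<Phi>" "\<delta>0 \<bullet> \<delta>0 = N'" "N' \<noteq> N"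
    and r: "N' = r * N \<or> N = r * N'" "r = 2 \<or> r = 3"
  obtains \<delta> d e s t where "\<delta> \<in> \<Phi>" "\<delta> \<bullet> \<delta> = N'" "\<delta> = d + e" "d \<in> U" "e \<in> V" "d \<noteq> 0" "e \<noteq> 0"
    "1 \<le> s" "1 \<le> t" "s + t = card X" "d \<bullet> d = r * N' * (real s * real t) / (2 * real (card X))"
    "e \<bullet> e = N' - d \<bullet> d"
proof -
  have N: "N > 0" and R: "\<Phi> \<inter> U = {y - z | y z. y \<in> X \<and> z \<in> X \<and> y \<noteq> z}" and fX: "finite X"
    and cX: "card X \<ge> 2"
    using X unfolding simplex_on_def by blast+
  have N': "N' > 0" using norm_pos \<delta>0 by auto
  have "\<not> card X \<le> Suc 0" using cX by simp
  then obtain x y where xy: "x \<in> X" "y \<in> X" "x \<noteq> y" using card_le_Suc0_iff_eq[OF fX] by blast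
  then obtain \<delta> where \<delta>: "\<delta> \<in> orb \<Phi> \<delta>0" "(x - y) \<bullet> \<delta> \<noteq> 0"
    using orb_nonperp[of \<delta>0 "x - y"] \<delta>0(1) nz by auto
  have d\<Phi>: "\<delta> \<in> \<Phi>" using \<delta>(1) orb_roots[OF \<delta>0(1)] by blast
  have dN: "\<delta> \<bullet> \<delta> = N'" using orb_inner[OF \<delta>(1)] \<delta>0(2) by simp
  have xyU: "x - y \<in> \<Phi>" "x - y \<in> U" using R xy by blast+
  have NU: "\<alpha> \<bullet> \<alpha> = N" if "\<alpha> \<in> \<Phi>" "\<alpha> \<in> U" for \<alpha>
  proof -
    have "\<alpha> \<in> \<Phi> \<inter> U" using that by blast
    then obtain y z where "\<alpha> = y - z" "y \<in> X" "z \<in> X" "y \<noteq> z" unfolding R by blast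
    then show ?thesis using simplex_dist[OF X] by simp
  qed
  obtain d e where de: "d \<in> U" "e \<in> V" "\<delta> = d + e" "\<delta> \<bullet> \<delta> = d \<bullet> d + e \<bullet> e" by (rule decomposeE)
  have inU: "\<delta> \<bullet> u = d \<bullet> u" if "u \<in> U" for u
    using perp[OF that de(2)] de(3) by (simp add: inner_add_left inner_commute[of e])
  have d0: "d \<noteq> 0" using inU[OF xyU(2)] \<delta>(2) inner_commute[of "x - y" \<delta>] by auto
  have e0: "e \<noteq> 0"
  proof
    assume "e = 0"
    then have "\<delta> \<in> U" using de by simp
    then show False using NU[OF d\<Phi>] dN \<delta>0(3) by simp
  qed
  \<comment> \<open>By \<open>mixed_norm_inner\<close> a nonzero product with an edge has square
    \<open>r * N * N' / 4\<close>.\<close>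
  define l where "l = sqrt (r * N * N') / 2"
  have rpos: "r > 0" using r(2) by auto
  have l: "l > 0" using N N' rpos by (simp add: l_def)
  have l2: "l\<^sup>2 = r * N * N' / 4" using N N' rpos by (simp add: l_def power_divide)
  have diff: "d \<bullet> x - d \<bullet> y = 0 \<or> d \<bullet> x - d \<bullet> y = l \<or> d \<bullet> x - d \<bullet> y = - l" if m: "x \<in> X" "y \<in> X" for x y
  proof (cases "x = y \<or> d \<bullet> x - d \<bullet> y = 0")
    case False
    have xyU: "x - y \<in> \<Phi>" "x - y \<in> U" using R m False by blast+
    have eq: "(x - y) \<bullet> \<delta> = d \<bullet> x - d \<bullet> y"
      using inU[OF xyU(2)] by (simp add: inner_commute inner_diff_right)
    have "4 * ((x - y) \<bullet> \<delta>)\<^sup>2 = r * (((x - y) \<bullet> (x - y)) * (\<delta> \<bullet> \<delta>))"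
    proof (rule mixed_norm_inner[OF xyU(1) d\<Phi> _ _ _ r(2)])
      show "(x - y) \<bullet> (x - y) \<noteq> \<delta> \<bullet> \<delta>" using NU[OF xyU] dN \<delta>0(3) by simp
      show "(x - y) \<bullet> \<delta> \<noteq> 0" using eq False by simp
      show "\<delta> \<bullet> \<delta> = r * ((x - y) \<bullet> (x - y)) \<or> (x - y) \<bullet> (x - y) = r * (\<delta> \<bullet> \<delta>)"
        unfolding NU[OF xyU] dN using r(1) .
    qed
    then have "(d \<bullet> x - d \<bullet> y)\<^sup>2 = l\<^sup>2" unfolding eq NU[OF xyU] dN l2 by simp
    then show ?thesis by (auto simp: power2_eq_iff)
  qed auto
  obtain s where s: "1 \<le> s" "s < card X" "d \<bullet> d = (2 / N) * (real s * real (card X - s) * l\<^sup>2 / card X)"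
    using simplex_two_values[OF X de(1) d0 l diff] by blast
  have dd: "d \<bullet> d = r * N' * (real s * real (card X - s)) / (2 * real (card X))"
    using s(3) N unfolding l2 by simp
  show ?thesis
    by (rule that[OF d\<Phi> dN de(3,1,2) d0 e0 s(1), of "card X - s"]) (use s(2) dd de(4) dN in auto)
qed

lemma frame_norm_root:
  assumes E: "frame \<Phi> U V E N"
  obtains \<alpha> where "\<alpha> \<in> \<Phi>" "\<alpha> \<bullet> \<alpha> = N"
proof -
  have "E \<noteq> {}"
  proof
    assume "E = {}"
    then have "(UNIV :: 'a set) = {0}" using E by (simp add: frame_def)
    then show False using U0 subspace_0[OF subU] by blast
  qed
  then obtain y where y: "y \<in> E" by blast
  obtain z where z: "z \<in> E" "y \<bullet> z = 0" using frame_perp_exists[OF E y] .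
  have "y - z \<in> \<Phi>" "y \<bullet> y = N / 2" "z \<bullet> z = N / 2" using E y z unfolding frame_def by blast+
  then show ?thesis using that[of "y - z"] z(2) by (simp add: inner_diff_self)
qed

lemma frame_other_norm:
  assumes E: "frame \<Phi> U V E N" and \<beta>: "\<beta> \<in> \<Phi>" "\<beta> \<bullet> \<beta> \<noteq> N"
  obtains y c where "y \<in> E" "\<beta> = c *\<^sub>R y" "c \<noteq> 0" "c \<in> \<int>" "\<beta> \<bullet> \<beta> = c\<^sup>2 * (N / 2)"
proof -
  consider y z where "y \<in> E" "z \<in> E" "y \<bullet> z = 0" "\<beta> = y - z" | y c where "y \<in> E" "\<beta> = c *\<^sub>R y"
    using E \<beta>(1) unfolding frame_def by blast
  then show ?thesis
  proof cases
    case 1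
    then have "y \<bullet> y = N / 2" "z \<bullet> z = N / 2" using E unfolding frame_def by blast+
    then have "\<beta> \<bullet> \<beta> = N" using 1 by (simp add: inner_diff_self)
    then show ?thesis using \<beta>(2) by blast
  next
    case 2
    then have "c *\<^sub>R y \<in> \<Phi>" using \<beta>(1) by blast
    note f = frame_scalar_norm[OF E 2(1) this]
    show ?thesis by (rule that[OF 2 f(3,4)]) (simp only: 2(2) f(1))
  qed
qed

text \<open>Let \<open>n\<close> be the number of vertices in \<open>U\<close>. A root of the other
  length splits with squared lengths \<open>N' - N' / n\<close> in \<open>U\<close> and
  \<open>N' / n\<close> in \<open>V\<close>. For \<open>n = 2\<close> this gives a frame. Otherwise
  \<open>V\<close> carries a simplex with \<open>m\<close> vertices and
  \<open>2 * m = n * (m - 1)\<close>, so \<open>m = 2\<close> or \<open>n = m = 3\<close>; the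
  latter is \<open>A\<^sub>2 + A\<^sub>2\<close> in \<open>F\<^sub>4\<close>.\<close>

lemma ratio_two_core:
  assumes \<gamma>: "\<gamma> \<in> \<Phi>" "\<gamma> = g + h" "g \<in> U" "h \<in> V" "g \<noteq> 0" "h \<noteq> 0" "g \<bullet> g \<le> (\<gamma> \<bullet> \<gamma>) / 2"
    and \<delta>: "\<delta> \<in> \<Phi>" "\<delta> \<bullet> \<delta> = 2 * (\<gamma> \<bullet> \<gamma>) \<or> \<gamma> \<bullet> \<gamma> = 2 * (\<delta> \<bullet> \<delta>)"
  shows "(\<exists>E N. frame \<Phi> U V E N) \<or>
    (\<exists>X Y. simplex_on \<Phi> U X (\<gamma> \<bullet> \<gamma>) \<and> simplex_on \<Phi> V Y (\<delta> \<bullet> \<delta>) \<and> card X = 3 \<and> card Y = 3)"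
proof (cases "g \<bullet> g = (\<gamma> \<bullet> \<gamma>) / 2")
  case True
  then show ?thesis using frame_case[OF \<gamma>(1-4)] by blast
next
  case False
  interpret s: split \<Phi> V U by (rule split_swap) (rule split_axioms)
  define N N' where "N = \<gamma> \<bullet> \<gamma>" and "N' = \<delta> \<bullet> \<delta>"
  define X where "X = orb (\<Phi> \<inter> U) g"
  have Npos: "N > 0" "N' > 0" unfolding N_def N'_def using norm_pos \<gamma> \<delta> by auto
  have X: "simplex_on \<Phi> U X N" unfolding X_def N_def
    by (rule simplex_case[OF \<gamma>(1-6)]) (use False \<gamma>(7) in simp)
  have ne: "N' \<noteq> N" using \<delta>(2) Npos unfolding N_def N'_def by auto
  have ratio: "N' = 2 * N \<or> N = 2 * N'" using \<delta>(2) unfolding N_def N'_def .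
  obtain \<epsilon> d e s t where \<epsilon>: "\<epsilon> \<in> \<Phi>" "\<epsilon> \<bullet> \<epsilon> = N'" "\<epsilon> = d + e" "d \<in> U" "e \<in> V" "d \<noteq> 0" "e \<noteq> 0"
    "1 \<le> s" "1 \<le> t" "s + t = card X" "d \<bullet> d = 2 * N' * (real s * real t) / (2 * real (card X))"
    "e \<bullet> e = N' - d \<bullet> d"
    by (rule other_norm_root[OF X \<delta>(1) N'_def[symmetric] ne ratio disjI1[OF refl]])
  define n where "n = card X"
  have n: "n \<ge> 2" using X by (simp add: simplex_on_def n_def)
  have dd: "d \<bullet> d = N' * (s * t) / n" using \<epsilon>(11) by (simp add: n_def)
  have "e \<bullet> e > 0" using \<epsilon>(7) by simp
  then have "N' * (s * t) / n < N'" using \<epsilon>(12) dd by linarith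
  then have "N' * (s * t) < N' * n" using n by (simp add: divide_less_eq)
  then have "real (s * t) < real n" using Npos by simp
  then have st: "s * t < s + t" using \<epsilon>(10) unfolding n_def by linarith
  \<comment> \<open>The component in \<open>U\<close> is strictly shorter than the root, which means
    \<open>s * t < s + t\<close>.\<close>
  have "s = 1 \<or> t = 1"
  proof (rule ccontr)
    assume "\<not> ?thesis"
    then have "2 \<le> s" "2 \<le> t" using \<epsilon>(8,9) by auto
    then obtain s' t' where "s = 2 + s'" "t = 2 + t'" by (metis le_Suc_ex)
    then show False using st by simp
  qed
  then have "s * t = n - 1" using \<epsilon>(10) unfolding n_def by auto
  then have "real s * real t = real n - 1" using n by (metis of_nat_mult of_nat_diff of_nat_1 One_nat_def Suc_1 Suc_leD)
  then have "d \<bullet> d = N' * (real n - 1) / n" using dd by simp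
  then have dd': "d \<bullet> d = N' - N' / n" using n by (simp add: field_simps)
  then have ee: "e \<bullet> e = N' / n" using \<epsilon>(12) by simp
  have \<epsilon>': "\<epsilon> = e + d" using \<epsilon>(3) by (simp add: add.commute)
  consider "n = 2" | "n \<ge> 3" using n by linarith
  then show ?thesis
  proof cases
    case 1
    then have "d \<bullet> d = (\<epsilon> \<bullet> \<epsilon>) / 2" using dd' \<epsilon>(2) by simp
    then show ?thesis using frame_case[OF \<epsilon>(1,3,4,5)] by blast
  next
    case 2
    then have "N' / n < N' / 2" using Npos by (intro divide_strict_left_mono) auto
    then have lt: "e \<bullet> e < (\<epsilon> \<bullet> \<epsilon>) / 2" using ee \<epsilon>(2) by simp
    define Y where "Y = orb (\<Phi> \<inter> V) e"
    have Y: "simplex_on \<Phi> V Y N'"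
      using s.simplex_case[OF \<epsilon>(1) \<epsilon>' \<epsilon>(5,4,7,6) lt] unfolding Y_def \<epsilon>(2) .
    have eY: "e \<in> Y" by (simp add: Y_def orb_base)
    define m where "m = card Y"
    have m2: "m \<ge> 2" using Y by (simp add: simplex_on_def m_def)
    have "2 * (N' / n) * m = N' * (real m - 1)" using Y eY ee unfolding simplex_on_def m_def by metis
    then have "N' * (2 * m) = N' * (n * (real m - 1))" using n by (simp add: field_simps)
    then have "2 * real m = n * (real m - 1)" using Npos by (simp only: mult_cancel_left) simp
    also have "\<dots> = real (n * (m - 1))" using m2 by (simp add: of_nat_diff)
    finally have mn: "2 * m = n * (m - 1)" by linarith
    have "3 * (m - 1) \<le> 2 * m" unfolding mn using 2 by simp
    then have "m = 2 \<or> m = 3" using m2 by linarith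
    then show ?thesis
    proof
      assume "m = 3"
      then have "n = 3" using mn by simp
      then show ?thesis using X Y \<open>m = 3\<close> unfolding n_def m_def N_def N'_def by blast
    next
      \<comment> \<open>Now the argument is repeated from the segment in \<open>V\<close>: a root of
        length \<open>N\<close> not perpendicular to it is halved by the splitting, and a frame
        results.\<close>
      assume m: "m = 2"
      have ratio': "N = 2 * N' \<or> N' = 2 * N" using ratio by blast
      obtain \<eta> d e s t where \<eta>: "\<eta> \<in> \<Phi>" "\<eta> \<bullet> \<eta> = N" "\<eta> = d + e" "d \<in> V" "e \<in> U" "d \<noteq> 0" "e \<noteq> 0"
        "1 \<le> s" "1 \<le> t" "s + t = card Y" "d \<bullet> d = 2 * N * (real s * real t) / (2 * real (card Y))"
        "e \<bullet> e = N - d \<bullet> d"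
        by (rule s.other_norm_root[OF Y \<gamma>(1) N_def[symmetric] ne[symmetric] ratio' disjI1[OF refl]])
      have "s = 1" "t = 1" using \<eta>(8-10) m by (auto simp: m_def)
      then have "d \<bullet> d = (\<eta> \<bullet> \<eta>) / 2" using \<eta>(2,11) m by (simp add: m_def)
      then have "\<exists>E. frame \<Phi> V U E N" using s.frame_case[OF \<eta>(1,3,4,5)] \<eta>(2) by simp
      then show ?thesis using frame_swap by blast
    qed
  qed
qed

text \<open>Type \<open>G\<^sub>2\<close>. A frame is impossible for arithmetic reasons, and the
  length of the component of a root of the other length leaves only a segment in \<open>U\<close>
  and then a segment in \<open>V\<close>.\<close>

lemma ratio_three_core:
  assumes \<gamma>: "\<gamma> \<in> \<Phi>" "\<gamma> = g + h" "g \<in> U" "h \<in> V" "g \<noteq> 0" "h \<noteq> 0" "g \<bullet> g \<le> (\<gamma> \<bullet> \<gamma>) / 2"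
    and \<delta>: "\<delta> \<in> \<Phi>" "\<delta> \<bullet> \<delta> = 3 * (\<gamma> \<bullet> \<gamma>) \<or> \<gamma> \<bullet> \<gamma> = 3 * (\<delta> \<bullet> \<delta>)"
  shows "\<exists>\<alpha>\<in>\<Phi>. \<exists>\<beta>\<in>\<Phi>. \<alpha> \<bullet> \<alpha> = \<gamma> \<bullet> \<gamma> \<and> \<beta> \<bullet> \<beta> = \<delta> \<bullet> \<delta> \<and> span {\<alpha>} = U \<and> span {\<beta>} = V"
proof -
  interpret s: split \<Phi> V U by (rule split_swap) (rule split_axioms)
  define N N' where "N = \<gamma> \<bullet> \<gamma>" and "N' = \<delta> \<bullet> \<delta>"
  define X where "X = orb (\<Phi> \<inter> U) g"
  have Npos: "N > 0" "N' > 0" unfolding N_def N'_def using norm_pos \<gamma> \<delta> by auto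
  have ne: "N' \<noteq> N" using \<delta>(2) Npos unfolding N_def N'_def by auto
  have ratio: "N' = 3 * N \<or> N = 3 * N'" using \<delta>(2) unfolding N_def N'_def .
  have "g \<bullet> g \<noteq> (\<gamma> \<bullet> \<gamma>) / 2"
  proof
    assume "g \<bullet> g = (\<gamma> \<bullet> \<gamma>) / 2"
    then obtain E where E: "frame \<Phi> U V E N" using frame_case[OF \<gamma>(1-4)] by (auto simp: N_def)
    obtain y c where c: "c \<in> \<int>" "N' = c\<^sup>2 * (N / 2)"
      using frame_other_norm[OF E \<delta>(1)] ne unfolding N'_def by metis
    \<comment> \<open>In a frame the other root length would be an integer multiple of a frame
      vector, but a ratio of 3 asks for a square equal to 6 or to two thirds.\<close>
    obtain k where k: "c = of_int k" using c(1) by (rule Ints_cases)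
    have "c\<^sup>2 = 6 \<or> 3 * c\<^sup>2 = 2" using c(2) ratio Npos by auto
    then have "real_of_int (k\<^sup>2) = real_of_int 6 \<or> real_of_int (3 * k\<^sup>2) = real_of_int 2" unfolding k by simp
    then have k6: "k * k = 6 \<or> 3 * (k * k) = 2" by (simp only: of_int_eq_iff power2_eq_square)
    then have "\<bar>k\<bar> < 3" using abs_le_square_iff[of 3 k] by (auto simp: power2_eq_square)
    then have "k = 0 \<or> k = 1 \<or> k = - 1 \<or> k = 2 \<or> k = - 2" by linarith
    then show False using k6 by auto
  qed
  then have X: "simplex_on \<Phi> U X N" unfolding X_def N_def
    by (intro simplex_case[OF \<gamma>(1-6)]) (use \<gamma>(7) in simp)
  obtain \<epsilon> d e s t where \<epsilon>: "\<epsilon> \<in> \<Phi>" "\<epsilon> \<bullet> \<epsilon> = N'" "\<epsilon> = d + e" "d \<in> U" "e \<in> V" "d \<noteq> 0" "e \<noteq> 0"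
    "1 \<le> s" "1 \<le> t" "s + t = card X" "d \<bullet> d = 3 * N' * (real s * real t) / (2 * real (card X))"
    "e \<bullet> e = N' - d \<bullet> d"
    by (rule other_norm_root[OF X \<delta>(1) N'_def[symmetric] ne ratio disjI2[OF refl]])
  define n where "n = card X"
  have n: "n \<ge> 2" using X by (simp add: simplex_on_def n_def)
  have dd: "d \<bullet> d = 3 * N' * (s * t) / (2 * n)" using \<epsilon>(11) by (simp add: n_def)
  have "e \<bullet> e > 0" using \<epsilon>(7) by simp
  then have "3 * N' * (s * t) / (2 * n) < N'" using \<epsilon>(12) dd by linarith
  then have "N' * (3 * (s * t)) < N' * (2 * n)" using n by (simp add: divide_less_eq)
  then have "real (3 * (s * t)) < real (2 * n)" using Npos by simp
  then have "3 * (s * t) < 2 * n" by (simp only: of_nat_less_iff)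
  then have st: "3 * (s * t) < 2 * (s + t)" using \<epsilon>(10) unfolding n_def by simp
  \<comment> \<open>In terms of \<open>s'\<close> and \<open>t'\<close> the inequality says
    \<open>s' + t' + 3 * s' * t' < 1\<close>.\<close>
  obtain s' t' where s': "s = 1 + s'" "t = 1 + t'" using le_Suc_ex[OF \<epsilon>(8)] le_Suc_ex[OF \<epsilon>(9)] by blast
  have "s' = 0 \<and> t' = 0" using st unfolding s' by simp
  then have s1: "s = 1" "t = 1" using s' by auto
  then have n2: "n = 2" using \<epsilon>(10) by (simp add: n_def)
  have "d \<bullet> d = 3 * N' / 4" using dd s1 n2 by simp
  then have ee: "e \<bullet> e = N' / 4" using \<epsilon>(12) by simp
  then have lt: "e \<bullet> e < (\<epsilon> \<bullet> \<epsilon>) / 2" using \<epsilon>(2) Npos by simp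
  define Y where "Y = orb (\<Phi> \<inter> V) e"
  have \<epsilon>': "\<epsilon> = e + d" using \<epsilon>(3) by (simp add: add.commute)
  have Y: "simplex_on \<Phi> V Y N'"
    using s.simplex_case[OF \<epsilon>(1) \<epsilon>' \<epsilon>(5,4,7,6) lt] unfolding Y_def \<epsilon>(2) .
  have eY: "e \<in> Y" by (simp add: Y_def orb_base)
  have "2 * (N' / 4) * card Y = N' * (real (card Y) - 1)" using Y eY ee unfolding simplex_on_def by metis
  then have "N' * (real (card Y) / 2) = N' * (real (card Y) - 1)" by simp
  then have "real (card Y) / 2 = real (card Y) - 1" using Npos by (simp only: mult_cancel_left) simp
  then have m2: "card Y = 2" by simp
  obtain \<alpha> where "\<alpha> \<in> \<Phi>" "\<alpha> \<bullet> \<alpha> = N" "span {\<alpha>} = U" using simplex_line[OF X] n2 by (metis n_def)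
  moreover obtain \<beta> where "\<beta> \<in> \<Phi>" "\<beta> \<bullet> \<beta> = N'" "span {\<beta>} = V" using simplex_line[OF Y m2] by metis
  ultimately show ?thesis unfolding N_def N'_def by blast
qed

lemma mixed_root_short:
  obtains \<gamma> g h where "\<gamma> \<in> \<Phi>" "\<gamma> = g + h" "g \<in> U" "h \<in> V" "g \<noteq> 0" "h \<noteq> 0" "g \<bullet> g \<le> (\<gamma> \<bullet> \<gamma>) / 2"
  | \<gamma> g h where "\<gamma> \<in> \<Phi>" "\<gamma> = h + g" "g \<in> U" "h \<in> V" "g \<noteq> 0" "h \<noteq> 0" "h \<bullet> h \<le> (\<gamma> \<bullet> \<gamma>) / 2"
proof -
  obtain \<gamma> where \<gamma>: "\<gamma> \<in> \<Phi>" "\<gamma> \<notin> U" "\<gamma> \<notin> V" by (rule mixed_root_exists)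
  obtain g h where gh: "g \<in> U" "h \<in> V" "\<gamma> = g + h" "\<gamma> \<bullet> \<gamma> = g \<bullet> g + h \<bullet> h" "g \<noteq> 0" "h \<noteq> 0"
    using decompose_mixedE[OF \<gamma>(2,3)] .
  have "g \<bullet> g \<le> (\<gamma> \<bullet> \<gamma>) / 2 \<or> h \<bullet> h \<le> (\<gamma> \<bullet> \<gamma>) / 2" using gh(4) by linarith
  then show ?thesis
  proof
    assume "g \<bullet> g \<le> (\<gamma> \<bullet> \<gamma>) / 2" then show ?thesis by (rule that(1)[OF \<gamma>(1) gh(3,1,2,5,6)])
  next
    assume *: "h \<bullet> h \<le> (\<gamma> \<bullet> \<gamma>) / 2"
    have "\<gamma> = h + g" using gh(3) by (simp add: add.commute)
    then show ?thesis by (rule that(2)[OF \<gamma>(1) _ gh(1,2,5,6) *])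
  qed
qed

end

text \<open>Type \<open>B\<^sub>2\<close>: the two lines of one root length against the two lines of the other.\<close>

definition exceptional where
  "exceptional (\<Phi> :: 'a::euclidean_space set) U V U' V' \<longleftrightarrow> (\<exists>a b c. a \<noteq> 0 \<and> a \<bullet> b = 0 \<and> a \<bullet> a = b \<bullet> b \<and> span {a, b} = UNIV \<and> c \<noteq> 0
    \<and> \<Phi> = {a, - a, b, - b, c *\<^sub>R (a + b), - (c *\<^sub>R (a + b)), c *\<^sub>R (a - b), - (c *\<^sub>R (a - b))}
    \<and> \<Phi> \<inter> (U \<union> V) = {a, - a, b, - b}
    \<and> \<Phi> \<inter> (U' \<union> V') = {c *\<^sub>R (a + b), - (c *\<^sub>R (a + b)), c *\<^sub>R (a - b), - (c *\<^sub>R (a - b))})"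

lemma notin_orthogonal_sum:
  assumes "subspace W" "x \<in> W" "\<And>z. z \<in> W \<Longrightarrow> z \<bullet> y = 0" "y \<noteq> 0" "l \<noteq> 0"
  shows "k *\<^sub>R x + l *\<^sub>R y \<notin> W"
proof
  assume "k *\<^sub>R x + l *\<^sub>R y \<in> W"
  then have "(k *\<^sub>R x + l *\<^sub>R y) - k *\<^sub>R x \<in> W" using assms by (intro subspace_diff subspace_scale)
  then have "l *\<^sub>R y \<in> W" by simp
  then have "(l *\<^sub>R y) \<bullet> y = 0" by (rule assms(3))
  then show False using assms(4,5) by simp
qed

context split
begin

lemma combination_notin:
  assumes "(x \<in> U \<and> y \<in> V) \<or> (x \<in> V \<and> y \<in> U)" "x \<noteq> 0" "y \<noteq> 0" "k \<noteq> 0" "l \<noteq> 0"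
  shows "k *\<^sub>R x + l *\<^sub>R y \<notin> U \<union> V"
proof -
  have perp': "b \<bullet> a = 0" if "a \<in> U" "b \<in> V" for a b using perp[OF that] by (simp add: inner_commute)
  from assms(1) show ?thesis
  proof
    assume xy: "x \<in> U \<and> y \<in> V"
    have "k *\<^sub>R x + l *\<^sub>R y \<notin> U" using xy assms perp by (intro notin_orthogonal_sum[OF subU]) auto
    moreover have "l *\<^sub>R y + k *\<^sub>R x \<notin> V" using xy assms perp' by (intro notin_orthogonal_sum[OF subV]) auto
    ultimately show ?thesis by (simp add: add.commute)
  next
    assume xy: "x \<in> V \<and> y \<in> U"
    have "k *\<^sub>R x + l *\<^sub>R y \<notin> V" using xy assms perp' by (intro notin_orthogonal_sum[OF subV]) auto
    moreover have "l *\<^sub>R y + k *\<^sub>R x \<notin> U" using xy assms perp by (intro notin_orthogonal_sum[OF subU]) auto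
    ultimately show ?thesis by (simp add: add.commute)
  qed
qed

lemma frame_mem_exists:
  assumes E: "frame \<Phi> U V E N"
  obtains p q where "p \<in> E" "p \<in> U" "q \<in> E" "q \<in> V" "p \<bullet> q = 0"
proof -
  obtain H where H: "H \<subseteq> E" "span H = UNIV" using frame_half[OF E] by metis
  note sp = half_frame_span[OF E H]
  have "H \<inter> U \<noteq> {}" "H \<inter> V \<noteq> {}" using sp U0 V0 by auto
  then obtain p q where "p \<in> E" "p \<in> U" "q \<in> E" "q \<in> V" using H(1) by blast
  then show ?thesis using that perp by blast
qed

end

text \<open>The roots of squared length \<open>N'\<close> are differences in the second frame but
  multiples of frame vectors in the first. In the first description two such roots are parallel or
  perpendicular; in the second this allows only two axes. So the rank is 2 and all roots can be
  listed.\<close>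

lemma frame_exceptional:
  assumes s: "split \<Phi> U V" and s': "split \<Phi> U' V'"
    and E: "frame \<Phi> U V E N" and E': "frame \<Phi> U' V' E' N'" and ne: "N \<noteq> N'"
  shows "exceptional \<Phi> U V U' V'"
proof -
  interpret s: split \<Phi> U V by (rule s)
  interpret t: split \<Phi> U' V' by (rule s')
  note F = frameD[OF E]
  note F' = frameD[OF E']
  obtain p q where pq: "p \<in> E'" "p \<in> U'" "q \<in> E'" "q \<in> V'" "p \<bullet> q = 0" by (rule t.frame_mem_exists[OF E'])
  define a b where "a = p + q" and "b = p - q"
  have b\<Phi>: "b \<in> \<Phi>" unfolding b_def by (rule F'(7)[OF pq(1,3,5)])
  have "p - (- q) \<in> \<Phi>" by (rule F'(7)[OF pq(1) F'(1)[OF pq(3)]]) (simp add: pq(5))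
  then have a\<Phi>: "a \<in> \<Phi>" by (simp add: a_def)
  note pp = F'(2)[OF pq(1)] and qq = F'(2)[OF pq(3)]
  have aa: "a \<bullet> a = N'" and bb: "b \<bullet> b = N'" and ab: "a \<bullet> b = 0"
    using pp qq pq(5) unfolding a_def b_def
    by (simp_all add: inner_add_left inner_add_right inner_diff_left inner_diff_right inner_commute[of q p])
  obtain y c1 where y: "y \<in> E" "a = c1 *\<^sub>R y" "c1 \<noteq> 0"
    using s.frame_other_norm[OF E a\<Phi>] aa ne by metis
  obtain z c2 where z: "z \<in> E" "b = c2 *\<^sub>R z" "c2 \<noteq> 0"
    using s.frame_other_norm[OF E b\<Phi>] bb ne by metis
  \<comment> \<open>All roots of this length lie on axes of the first frame, so one that is not
    perpendicular to \<open>a\<close> or to \<open>b\<close> is parallel to it.\<close>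
  have normN': "\<beta> = a \<or> \<beta> = - a \<or> \<beta> = b \<or> \<beta> = - b" if \<beta>: "\<beta> \<in> \<Phi>" "\<beta> \<bullet> \<beta> = N'" "a \<bullet> \<beta> \<noteq> 0 \<or> b \<bullet> \<beta> \<noteq> 0" for \<beta>
  proof -
    obtain w c3 where w: "w \<in> E" "\<beta> = c3 *\<^sub>R w" "c3 \<noteq> 0"
      using s.frame_other_norm[OF E \<beta>(1)] \<beta>(2) ne by metis
    from \<beta>(3) show ?thesis
    proof
      assume "a \<bullet> \<beta> \<noteq> 0"
      then have "w = y \<or> w = - y" using F(6)[OF y(1) w(1)] y w by auto
      then have "\<beta> = (c3 / c1) *\<^sub>R a \<or> \<beta> = (- c3 / c1) *\<^sub>R a" using y w by auto
      then show ?thesis using s.multiple_root[OF a\<Phi> \<beta>(1)] by blast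
    next
      assume "b \<bullet> \<beta> \<noteq> 0"
      then have "w = z \<or> w = - z" using F(6)[OF z(1) w(1)] z w by auto
      then have "\<beta> = (c3 / c2) *\<^sub>R b \<or> \<beta> = (- c3 / c2) *\<^sub>R b" using z w by auto
      then show ?thesis using s.multiple_root[OF b\<Phi> \<beta>(1)] by blast
    qed
  qed
  \<comment> \<open>A third axis \<open>w\<close> would give the root \<open>p - w\<close> of
    squared length \<open>N'\<close>, whose product with \<open>a\<close> is \<open>N' / 2\<close>:
    neither parallel nor perpendicular to \<open>a\<close>.\<close>
  have E'4: "w = p \<or> w = - p \<or> w = q \<or> w = - q" if w: "w \<in> E'" for w
  proof (rule ccontr)
    assume n: "\<not> ?thesis"
    then have pw: "p \<bullet> w = 0" "q \<bullet> w = 0" using F'(6)[OF pq(1) w] F'(6)[OF pq(3) w] by auto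
    have "p - w \<in> \<Phi>" by (rule F'(7)[OF pq(1) w pw(1)])
    moreover have "(p - w) \<bullet> (p - w) = N'" using pp F'(2)[OF w] pw by (simp add: inner_diff_self)
    moreover have apw: "a \<bullet> (p - w) = N' / 2"
      using pp pq(5) pw unfolding a_def by (simp add: inner_add_left inner_diff_right inner_commute[of q p])
    then have "a \<bullet> (p - w) \<noteq> 0" using F'(3) by simp
    ultimately consider "p - w = a" | "p - w = - a" | "p - w = b" | "p - w = - b" using normN' by blast
    then show False
    proof cases
      case 1 then show ?thesis using apw aa F'(3) by simp
    next
      case 2 then show ?thesis using apw aa F'(3) by simp
    next
      case 3 then show ?thesis using apw ab F'(3) by simp
    next
      case 4 then show ?thesis using apw ab F'(3) by simp
    qed
  qed
  have sab: "span {a, b} = UNIV"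
  proof -
    have "p = (1/2) *\<^sub>R (a + b)" "q = (1/2) *\<^sub>R (a - b)" unfolding a_def b_def
      by (simp_all add: scaleR_2[symmetric])
    then have "p \<in> span {a, b}" "q \<in> span {a, b}"
      using span_scale[OF span_add[OF span_base[of a "{a, b}"] span_base[of b "{a, b}"]], of "1/2"]
        span_scale[OF span_diff[OF span_base[of a "{a, b}"] span_base[of b "{a, b}"]], of "1/2"] by simp_all
    then have "E' \<subseteq> span {a, b}" using E'4 span_neg[of p "{a, b}"] span_neg[of q "{a, b}"] by blast
    then show ?thesis using F'(4) span_mono[of E' "span {a, b}"] by (simp add: span_span top.extremum_unique)
  qed
  have perp0: "w = 0" if "a \<bullet> w = 0" "b \<bullet> w = 0" for w
  proof -
    have "orthogonal w v" if "v \<in> span {a, b}" for v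
      using that \<open>a \<bullet> w = 0\<close> \<open>b \<bullet> w = 0\<close>
      by (intro orthogonal_to_span[of v "{a, b}"]) (auto simp: orthogonal_def inner_commute)
    then have "orthogonal w w" using sab by blast
    then show ?thesis by (simp add: orthogonal_self)
  qed
  have N'roots: "\<beta> = a \<or> \<beta> = - a \<or> \<beta> = b \<or> \<beta> = - b" if "\<beta> \<in> \<Phi>" "\<beta> \<bullet> \<beta> = N'" for \<beta>
    using normN'[OF that] perp0[of \<beta>] that(1) s.nz by blast
  have abUV: "(a \<in> U \<and> b \<in> V) \<or> (a \<in> V \<and> b \<in> U)"
  proof -
    have E4: "w = y \<or> w = - y \<or> w = z \<or> w = - z" if w: "w \<in> E" for w
    proof (rule ccontr)
      assume "\<not> ?thesis"
      then have "y \<bullet> w = 0" "z \<bullet> w = 0" using F(6)[OF y(1) w] F(6)[OF z(1) w] by auto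
      then have "w = 0" using perp0[of w] y z by simp
      then show False using F(2)[OF w] F(3) by simp
    qed
    obtain u v where uv: "u \<in> E" "u \<in> U" "v \<in> E" "v \<in> V" "u \<bullet> v = 0" by (rule s.frame_mem_exists[OF E])
    have sc: "c *\<^sub>R x \<in> W" if "subspace W" "x \<in> W \<or> - x \<in> W" for c x and W :: "'a set"
    proof -
      have "x \<in> W" using that(2) subspace_neg[OF that(1), of "- x"] by auto
      then show ?thesis by (rule subspace_scale[OF that(1)])
    qed
    have u0: "u \<noteq> 0" "v \<noteq> 0" using F(2)[OF uv(1)] F(2)[OF uv(3)] F(3) by auto
    have vv: "v \<bullet> v \<noteq> 0" "u \<bullet> u \<noteq> 0" using u0 by auto
    have "((u = y \<or> u = - y) \<and> (v = z \<or> v = - z)) \<or> ((u = z \<or> u = - z) \<and> (v = y \<or> v = - y))"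
      using E4[OF uv(1)] E4[OF uv(3)] uv(5) vv by (elim disjE) simp_all
    then consider "u = y \<or> u = - y" "v = z \<or> v = - z" | "u = z \<or> u = - z" "v = y \<or> v = - y"
      by blast
    then show ?thesis
    proof cases
      case 1
      then have "y \<in> U \<or> - y \<in> U" "z \<in> V \<or> - z \<in> V" using uv by auto
      then show ?thesis using sc[OF s.subU] sc[OF s.subV] y(2) z(2) by blast
    next
      case 2
      then have "z \<in> U \<or> - z \<in> U" "y \<in> V \<or> - y \<in> V" using uv by auto
      then show ?thesis using sc[OF s.subU] sc[OF s.subV] y(2) z(2) by blast
    qed
  qed
  obtain \<alpha> where \<alpha>: "\<alpha> \<in> \<Phi>" "\<alpha> \<bullet> \<alpha> = N" by (rule s.frame_norm_root[OF E])
  obtain w c0 where w: "w \<in> E'" "\<alpha> = c0 *\<^sub>R w" "c0 \<noteq> 0" "\<alpha> \<bullet> \<alpha> = c0\<^sup>2 * (N' / 2)"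
    using t.frame_other_norm[OF E' \<alpha>(1)] \<alpha>(2) ne by metis
  define P Q where "P = c0 *\<^sub>R p" and "Q = c0 *\<^sub>R q"
  have P: "P \<in> \<Phi>" "Q \<in> \<Phi>"
    unfolding P_def Q_def using t.frame_scalar_transfer[OF E' w(1)] pq \<alpha>(1) w(2) by blast+
  have "P \<bullet> P = c0\<^sup>2 * (p \<bullet> p)" "Q \<bullet> Q = c0\<^sup>2 * (q \<bullet> q)"
    by (simp_all add: P_def Q_def power2_eq_square)
  then have PN: "P \<bullet> P = N" "Q \<bullet> Q = N" using pp qq w(4) \<alpha>(2) by simp_all
  have Nroots: "\<beta> = P \<or> \<beta> = - P \<or> \<beta> = Q \<or> \<beta> = - Q" if \<beta>: "\<beta> \<in> \<Phi>" "\<beta> \<bullet> \<beta> = N" for \<beta>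
  proof -
    obtain u c4 where u: "u \<in> E'" "\<beta> = c4 *\<^sub>R u" "c4 \<noteq> 0"
      using t.frame_other_norm[OF E' \<beta>(1)] \<beta>(2) ne by metis
    have "\<beta> = (c4 / c0) *\<^sub>R P \<or> \<beta> = (- c4 / c0) *\<^sub>R P \<or> \<beta> = (c4 / c0) *\<^sub>R Q \<or> \<beta> = (- c4 / c0) *\<^sub>R Q"
      using E'4[OF u(1)] u(2) w(3) by (auto simp: P_def Q_def)
    then show ?thesis using s.multiple_root[OF P(1) \<beta>(1)] s.multiple_root[OF P(2) \<beta>(1)] by blast
  qed
  define c where "c = c0 / 2"
  have Pc: "P = c *\<^sub>R (a + b)" "Q = c *\<^sub>R (a - b)"
    unfolding P_def Q_def c_def a_def b_def by (simp_all add: scaleR_2[symmetric])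
  have neg: "- P \<in> \<Phi>" "- Q \<in> \<Phi>" "- a \<in> \<Phi>" "- b \<in> \<Phi>" using s.neg_root P a\<Phi> b\<Phi> by auto
  have "\<beta> \<bullet> \<beta> = N \<or> \<beta> \<bullet> \<beta> = N'" if "\<beta> \<in> \<Phi>" for \<beta>
    using s.two_norms[OF P(1) a\<Phi> that] PN aa ne by auto
  then have \<Phi>: "\<Phi> = {a, - a, b, - b, P, - P, Q, - Q}"
    using Nroots N'roots neg P a\<Phi> b\<Phi> by blast
  have negmem: "- x \<in> W \<longleftrightarrow> x \<in> W" if "subspace W" for x and W :: "'a set"
    using subspace_neg[OF that, of x] subspace_neg[OF that, of "- x"] by auto
  have ab0: "a \<noteq> 0" "b \<noteq> 0" using aa bb F'(3) by auto
  have pq0: "p \<noteq> 0" "q \<noteq> 0" using pp qq F'(3) by auto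
  have notUV: "k *\<^sub>R a + l *\<^sub>R b \<notin> U \<union> V" if "k \<noteq> 0" "l \<noteq> 0" for k l
    by (rule s.combination_notin[OF abUV ab0 that])
  have notUV': "k *\<^sub>R p + l *\<^sub>R q \<notin> U' \<union> V'" if "k \<noteq> 0" "l \<noteq> 0" for k l
    by (rule t.combination_notin[OF _ pq0 that]) (use pq in blast)
  have c0: "c \<noteq> 0" using w(3) by (simp add: c_def)
  have PQn: "P \<notin> U \<union> V" "Q \<notin> U \<union> V"
    using notUV[of c c] notUV[of c "- c"] c0 unfolding Pc by (auto simp: algebra_simps)
  have abn: "a \<notin> U' \<union> V'" "b \<notin> U' \<union> V'"
    using notUV'[of 1 1] notUV'[of 1 "- 1"] unfolding a_def b_def by auto
  have abin: "a \<in> U \<union> V" "b \<in> U \<union> V" using abUV by auto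
  have PQin: "P \<in> U' \<union> V'" "Q \<in> U' \<union> V'"
    using subspace_scale[OF t.subU pq(2)] subspace_scale[OF t.subV pq(4)] by (auto simp: P_def Q_def)
  have nm: "- x \<in> U \<union> V \<longleftrightarrow> x \<in> U \<union> V" "- x \<in> U' \<union> V' \<longleftrightarrow> x \<in> U' \<union> V'" for x
    using negmem s.subU s.subV t.subU t.subV by auto
  have I1: "\<Phi> \<inter> (U \<union> V) = {a, - a, b, - b}"
  proof -
    have "- P \<notin> U \<union> V" "- Q \<notin> U \<union> V" "- a \<in> U \<union> V" "- b \<in> U \<union> V" using nm PQn abin by blast+
    then show ?thesis using PQn abin unfolding \<Phi> by blast
  qed
  have I2: "\<Phi> \<inter> (U' \<union> V') = {P, - P, Q, - Q}"
  proof -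
    have "- a \<notin> U' \<union> V'" "- b \<notin> U' \<union> V'" "- P \<in> U' \<union> V'" "- Q \<in> U' \<union> V'" using nm PQin abn by blast+
    then show ?thesis using PQin abn unfolding \<Phi> by blast
  qed
  show ?thesis
    unfolding exceptional_def
    by (rule exI[of _ a], rule exI[of _ b], rule exI[of _ c])
      (unfold Pc[symmetric], intro conjI ab0(1) ab sab c0 \<Phi> I1 I2, simp add: aa bb)
qed

context split
begin

lemma ratio_two_cases:
  assumes "\<alpha>0 \<in> \<Phi>" "\<beta>0 \<in> \<Phi>" "\<beta>0 \<bullet> \<beta>0 = 2 * (\<alpha>0 \<bullet> \<alpha>0)"
  shows "(\<exists>E N. frame \<Phi> U V E N) \<or> (A2_component \<Phi> U V (\<alpha>0 \<bullet> \<alpha>0) \<and> A2_component \<Phi> U V (\<beta>0 \<bullet> \<beta>0))"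
proof -
  interpret s: split \<Phi> V U by (rule split_swap) (rule split_axioms)
  have pos: "\<alpha>0 \<bullet> \<alpha>0 > 0" using norm_pos assms by blast
  have ne: "\<alpha>0 \<bullet> \<alpha>0 \<noteq> \<beta>0 \<bullet> \<beta>0" using assms(3) pos by linarith
  have other: "\<exists>\<delta>\<in>\<Phi>. (\<delta> \<bullet> \<delta> = 2 * (\<gamma> \<bullet> \<gamma>) \<or> \<gamma> \<bullet> \<gamma> = 2 * (\<delta> \<bullet> \<delta>)) \<and>
      (\<gamma> \<bullet> \<gamma> = \<alpha>0 \<bullet> \<alpha>0 \<and> \<delta> \<bullet> \<delta> = \<beta>0 \<bullet> \<beta>0 \<or> \<gamma> \<bullet> \<gamma> = \<beta>0 \<bullet> \<beta>0 \<and> \<delta> \<bullet> \<delta> = \<alpha>0 \<bullet> \<alpha>0)" if "\<gamma> \<in> \<Phi>" for \<gamma>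
    using two_norms[OF assms(1,2) that ne] assms by auto
  show ?thesis
  proof (rule mixed_root_short)
    fix \<gamma> g h assume \<gamma>: "\<gamma> \<in> \<Phi>" "\<gamma> = g + h" "g \<in> U" "h \<in> V" "g \<noteq> 0" "h \<noteq> 0" "g \<bullet> g \<le> (\<gamma> \<bullet> \<gamma>) / 2"
    obtain \<delta> where \<delta>: "\<delta> \<in> \<Phi>" "\<delta> \<bullet> \<delta> = 2 * (\<gamma> \<bullet> \<gamma>) \<or> \<gamma> \<bullet> \<gamma> = 2 * (\<delta> \<bullet> \<delta>)"
        "\<gamma> \<bullet> \<gamma> = \<alpha>0 \<bullet> \<alpha>0 \<and> \<delta> \<bullet> \<delta> = \<beta>0 \<bullet> \<beta>0 \<or> \<gamma> \<bullet> \<gamma> = \<beta>0 \<bullet> \<beta>0 \<and> \<delta> \<bullet> \<delta> = \<alpha>0 \<bullet> \<alpha>0"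
      using other[OF \<gamma>(1)] by blast
    from ratio_two_core[OF \<gamma> \<delta>(1,2)] show ?thesis
    proof
      assume "\<exists>X Y. simplex_on \<Phi> U X (\<gamma> \<bullet> \<gamma>) \<and> simplex_on \<Phi> V Y (\<delta> \<bullet> \<delta>) \<and> card X = 3 \<and> card Y = 3"
      then obtain X Y where "simplex_on \<Phi> U X (\<gamma> \<bullet> \<gamma>)" "simplex_on \<Phi> V Y (\<delta> \<bullet> \<delta>)" "card X = 3" "card Y = 3" by blast
      then have "A2_component \<Phi> U V (\<gamma> \<bullet> \<gamma>)" "A2_component \<Phi> U V (\<delta> \<bullet> \<delta>)"
        using simplex_low_rank(2) s.simplex_low_rank(2) A2_component_swap[of \<Phi> U V] by auto
      then show ?thesis using \<delta>(3) by auto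
    qed blast
  next
    fix \<gamma> g h assume \<gamma>: "\<gamma> \<in> \<Phi>" "\<gamma> = h + g" "g \<in> U" "h \<in> V" "g \<noteq> 0" "h \<noteq> 0" "h \<bullet> h \<le> (\<gamma> \<bullet> \<gamma>) / 2"
    obtain \<delta> where \<delta>: "\<delta> \<in> \<Phi>" "\<delta> \<bullet> \<delta> = 2 * (\<gamma> \<bullet> \<gamma>) \<or> \<gamma> \<bullet> \<gamma> = 2 * (\<delta> \<bullet> \<delta>)"
        "\<gamma> \<bullet> \<gamma> = \<alpha>0 \<bullet> \<alpha>0 \<and> \<delta> \<bullet> \<delta> = \<beta>0 \<bullet> \<beta>0 \<or> \<gamma> \<bullet> \<gamma> = \<beta>0 \<bullet> \<beta>0 \<and> \<delta> \<bullet> \<delta> = \<alpha>0 \<bullet> \<alpha>0"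
      using other[OF \<gamma>(1)] by blast
    from s.ratio_two_core[OF \<gamma>(1,2,4,3,6,5,7) \<delta>(1,2)] show ?thesis
    proof
      assume "\<exists>E N. frame \<Phi> V U E N" then show ?thesis using frame_swap by blast
    next
      assume "\<exists>X Y. simplex_on \<Phi> V X (\<gamma> \<bullet> \<gamma>) \<and> simplex_on \<Phi> U Y (\<delta> \<bullet> \<delta>) \<and> card X = 3 \<and> card Y = 3"
      then obtain X Y where "simplex_on \<Phi> V X (\<gamma> \<bullet> \<gamma>)" "simplex_on \<Phi> U Y (\<delta> \<bullet> \<delta>)" "card X = 3" "card Y = 3" by blast
      then have "A2_component \<Phi> U V (\<gamma> \<bullet> \<gamma>)" "A2_component \<Phi> U V (\<delta> \<bullet> \<delta>)"
        using simplex_low_rank(2) s.simplex_low_rank(2) A2_component_swap[of \<Phi> U V] by auto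
      then show ?thesis using \<delta>(3) by auto
    qed
  qed
qed

text \<open>\<open>U\<close> and \<open>V\<close> are spanned by roots of different lengths.
  Choosing the one with the length of \<open>\<alpha>0\<close> makes any two splittings
  comparable.\<close>

lemma ratio_three_cases:
  assumes "\<alpha>0 \<in> \<Phi>" "\<beta>0 \<in> \<Phi>" "\<beta>0 \<bullet> \<beta>0 = 3 * (\<alpha>0 \<bullet> \<alpha>0)"
  shows "\<exists>\<alpha>\<in>\<Phi>. \<alpha> \<bullet> \<alpha> = \<alpha>0 \<bullet> \<alpha>0 \<and> component \<Phi> U V (span {\<alpha>})"
proof -
  interpret s: split \<Phi> V U by (rule split_swap) (rule split_axioms)
  have pos: "\<alpha>0 \<bullet> \<alpha>0 > 0" using norm_pos assms by blast
  have ne: "\<alpha>0 \<bullet> \<alpha>0 \<noteq> \<beta>0 \<bullet> \<beta>0" using assms(3) pos by linarith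
  have other: "\<exists>\<delta>\<in>\<Phi>. (\<delta> \<bullet> \<delta> = 3 * (\<gamma> \<bullet> \<gamma>) \<or> \<gamma> \<bullet> \<gamma> = 3 * (\<delta> \<bullet> \<delta>)) \<and>
      (\<gamma> \<bullet> \<gamma> = \<alpha>0 \<bullet> \<alpha>0 \<or> \<delta> \<bullet> \<delta> = \<alpha>0 \<bullet> \<alpha>0)" if "\<gamma> \<in> \<Phi>" for \<gamma>
    using two_norms[OF assms(1,2) that ne] assms by auto
  show ?thesis
  proof (rule mixed_root_short)
    fix \<gamma> g h assume \<gamma>: "\<gamma> \<in> \<Phi>" "\<gamma> = g + h" "g \<in> U" "h \<in> V" "g \<noteq> 0" "h \<noteq> 0" "g \<bullet> g \<le> (\<gamma> \<bullet> \<gamma>) / 2"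
    obtain \<delta> where \<delta>: "\<delta> \<in> \<Phi>" "\<delta> \<bullet> \<delta> = 3 * (\<gamma> \<bullet> \<gamma>) \<or> \<gamma> \<bullet> \<gamma> = 3 * (\<delta> \<bullet> \<delta>)"
        "\<gamma> \<bullet> \<gamma> = \<alpha>0 \<bullet> \<alpha>0 \<or> \<delta> \<bullet> \<delta> = \<alpha>0 \<bullet> \<alpha>0" using other[OF \<gamma>(1)] by blast
    show ?thesis using ratio_three_core[OF \<gamma> \<delta>(1,2)] \<delta>(3) component_self by metis
  next
    fix \<gamma> g h assume \<gamma>: "\<gamma> \<in> \<Phi>" "\<gamma> = h + g" "g \<in> U" "h \<in> V" "g \<noteq> 0" "h \<noteq> 0" "h \<bullet> h \<le> (\<gamma> \<bullet> \<gamma>) / 2"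
    obtain \<delta> where \<delta>: "\<delta> \<in> \<Phi>" "\<delta> \<bullet> \<delta> = 3 * (\<gamma> \<bullet> \<gamma>) \<or> \<gamma> \<bullet> \<gamma> = 3 * (\<delta> \<bullet> \<delta>)"
        "\<gamma> \<bullet> \<gamma> = \<alpha>0 \<bullet> \<alpha>0 \<or> \<delta> \<bullet> \<delta> = \<alpha>0 \<bullet> \<alpha>0" using other[OF \<gamma>(1)] by blast
    show ?thesis using s.ratio_three_core[OF \<gamma>(1,2,4,3,6,5,7) \<delta>(1,2)] \<delta>(3) component_self by metis
  qed
qed

text \<open>Roots whose length is not that of the differences lie on the axes of the frame, so two
  of them cannot enclose 120 degrees.\<close>

lemma triangle_frame_absurd:
  assumes E: "frame \<Phi> U V E N" and t: "\<alpha> \<in> \<Phi>" "\<beta> \<in> \<Phi>" "\<alpha> \<bullet> \<alpha> = N'" "\<beta> \<bullet> \<beta> = N'" "\<alpha> \<bullet> \<beta> = - N' / 2" "N' \<noteq> N"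
  shows False
proof -
  obtain y c where y: "y \<in> E" "\<alpha> = c *\<^sub>R y" "c \<noteq> 0" using frame_other_norm[OF E t(1)] t by metis
  obtain z d where z: "z \<in> E" "\<beta> = d *\<^sub>R z" "d \<noteq> 0" using frame_other_norm[OF E t(2)] t by metis
  have pos: "N' > 0" using norm_pos[OF t(1)] t by simp
  have "z = y \<or> z = - y \<or> y \<bullet> z = 0" using E y z unfolding frame_def by blast
  moreover have "y \<bullet> z \<noteq> 0" using y z t(5) pos by auto
  ultimately have "\<beta> = (d / c) *\<^sub>R \<alpha> \<or> \<beta> = (- d / c) *\<^sub>R \<alpha>" using y z by auto
  then have "\<beta> = \<alpha> \<or> \<beta> = - \<alpha>" using reduced[OF t(1)] t(2) by fastforce
  then show False using t pos by auto
qed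

end

text \<open>\<open>A\<close> respects lines of roots only. With a single root length the scalars are
  \<open>\<plusminus>1\<close>, so \<open>A\<close> respects the roots of the blocks. With two
  lengths the case lists alone provide components of a common prescribed length, or frames on both
  sides, and \<open>A\<close> only contributes that \<open>U\<close> and \<open>U'\<close> have the
  same dimension.\<close>

lemma linear_match:
  assumes s: "split \<Phi> U V" and s': "split \<Phi> U' V'"
    and A: "orthogonal_transformation A"
      "\<And>\<alpha>. \<alpha> \<in> \<Phi> \<Longrightarrow> \<alpha> \<in> U \<or> \<alpha> \<in> V \<Longrightarrow> \<exists>c. c *\<^sub>R A \<alpha> \<in> \<Phi>"
      "\<And>\<alpha>. \<alpha> \<in> \<Phi> \<Longrightarrow> \<alpha> \<in> U' \<or> \<alpha> \<in> V' \<Longrightarrow> \<exists>\<beta>\<in>\<Phi>. (\<beta> \<in> U \<or> \<beta> \<in> V) \<and> (\<exists>c. \<alpha> = c *\<^sub>R A \<beta>)"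
      "A ` U = U'" "A ` V = V'"
  shows "(\<exists>B. matches \<Phi> U V U' V' B) \<or> exceptional \<Phi> U V U' V'"
proof -
  interpret s: split \<Phi> U V by (rule s)
  interpret t: split \<Phi> U' V' by (rule s')
  have lin: "linear A" using A(1) by (rule orthogonal_transformation_linear)
  have inj: "inj A" by (rule orthogonal_transformation_inj[OF A(1)])
  have dim: "dim U = dim U'" using dim_image_eq[OF lin, of U] inj A(4) by (metis inj_on_subset subset_UNIV)
  have comp: "\<exists>B. matches \<Phi> U V U' V' B"
    if "component \<Phi> U V (span T)" "component \<Phi> U' V' (span T')" "s.aut B" "span (B ` T) = span T'" for B T T'
  proof -
    have "B ` span T = span T'" using linear_span_image[OF s.aut_linear[OF that(3)], of T] that(4) by simp
    then have "matches \<Phi> U V U' V' B"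
      using that(3) unfolding s.aut_def by (intro matches_component[OF s s' that(1,2)]) auto
    then show ?thesis by blast
  qed
  show ?thesis
  proof (cases "\<exists>\<alpha>\<in>\<Phi>. \<exists>\<beta>\<in>\<Phi>. \<alpha> \<bullet> \<alpha> < \<beta> \<bullet> \<beta>")
    case False
    obtain \<gamma> where \<gamma>: "\<gamma> \<in> \<Phi>" by (rule s.mixed_root_exists)
    define N where "N = \<gamma> \<bullet> \<gamma>"
    have sl: "\<alpha> \<bullet> \<alpha> = N" if "\<alpha> \<in> \<Phi>" for \<alpha> using False that \<gamma> unfolding N_def by (meson linorder_neqE_linordered_idom)
    have Npos: "N > 0" unfolding N_def by (rule s.norm_pos[OF \<gamma>])
    have unit: "c = 1 \<or> c = - 1" if "c *\<^sub>R A \<beta> \<in> \<Phi>" "\<beta> \<in> \<Phi>" for c \<beta>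
    proof -
      have "(c *\<^sub>R A \<beta>) \<bullet> (c *\<^sub>R A \<beta>) = c\<^sup>2 * (\<beta> \<bullet> \<beta>)"
        by (simp add: orthogonal_transformation_inner[OF A(1)] power2_eq_square)
      then have "c\<^sup>2 = 1" using sl[OF that(1)] sl[OF that(2)] Npos by simp
      then show ?thesis by (simp add: power2_eq_1_iff)
    qed
    have "\<exists>B. matches \<Phi> U V U' V' B"
    proof (rule simply_laced_match[OF s s' _ A(1) _ _ A(4,5)])
      show "\<alpha> \<bullet> \<alpha> = N" if "\<alpha> \<in> \<Phi>" for \<alpha> by (rule sl[OF that])
      show "A \<alpha> \<in> \<Phi>" if a: "\<alpha> \<in> \<Phi>" "\<alpha> \<in> U \<or> \<alpha> \<in> V" for \<alpha>
      proof -
        obtain c where c: "c *\<^sub>R A \<alpha> \<in> \<Phi>" using A(2)[OF a] by blast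
        from unit[OF c a(1)] show ?thesis
        proof
          assume "c = 1" then show ?thesis using c by simp
        next
          assume "c = - 1" then show ?thesis using s.neg_root[OF c] by simp
        qed
      qed
      show "\<exists>\<beta>\<in>\<Phi>. (\<beta> \<in> U \<or> \<beta> \<in> V) \<and> \<alpha> = A \<beta>" if a: "\<alpha> \<in> \<Phi>" "\<alpha> \<in> U' \<or> \<alpha> \<in> V'" for \<alpha>
      proof -
        obtain \<beta> c where b: "\<beta> \<in> \<Phi>" "\<beta> \<in> U \<or> \<beta> \<in> V" "\<alpha> = c *\<^sub>R A \<beta>" using A(3)[OF a] by blast
        have "c *\<^sub>R A \<beta> \<in> \<Phi>" using a(1) b(3) by simp
        from unit[OF this b(1)] show ?thesis
        proof
          assume "c = 1" then show ?thesis using b by auto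
        next
          assume "c = - 1"
          then have "\<alpha> = A (- \<beta>)" using b(3) linear_neg[OF lin] by simp
          moreover have "- \<beta> \<in> U \<or> - \<beta> \<in> V" using b(2) subspace_neg[OF s.subU] subspace_neg[OF s.subV] by blast
          ultimately show ?thesis using s.neg_root[OF b(1)] by blast
        qed
      qed
    qed
    then show ?thesis ..
  next
    case True
    then obtain \<alpha>0 \<beta>0 where ab: "\<alpha>0 \<in> \<Phi>" "\<beta>0 \<in> \<Phi>" "\<alpha>0 \<bullet> \<alpha>0 < \<beta>0 \<bullet> \<beta>0" by blast
    from s.norm_ratio[OF ab] show ?thesis
    proof
      assume r: "\<beta>0 \<bullet> \<beta>0 = 3 * (\<alpha>0 \<bullet> \<alpha>0)"
      obtain \<alpha> where a: "\<alpha> \<in> \<Phi>" "\<alpha> \<bullet> \<alpha> = \<alpha>0 \<bullet> \<alpha>0" "component \<Phi> U V (span {\<alpha>})"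
        using s.ratio_three_cases[OF ab(1,2) r] by blast
      obtain \<alpha>' where a': "\<alpha>' \<in> \<Phi>" "\<alpha>' \<bullet> \<alpha>' = \<alpha>0 \<bullet> \<alpha>0" "component \<Phi> U' V' (span {\<alpha>'})"
        using t.ratio_three_cases[OF ab(1,2) r] by blast
      have "\<alpha>' \<in> orb \<Phi> \<alpha>" using a a' by (intro s.norm_conj) auto
      then obtain B where "s.aut B" "B \<alpha> = \<alpha>'" by (rule s.orb_aut)
      then have "\<exists>B. matches \<Phi> U V U' V' B" using comp[OF a(3) a'(3)] by simp
      then show ?thesis ..
    next
      assume r: "\<beta>0 \<bullet> \<beta>0 = 2 * (\<alpha>0 \<bullet> \<alpha>0)"
      let ?N = "\<alpha>0 \<bullet> \<alpha>0"
      have Npos: "?N > 0" using s.norm_pos ab by blast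
      have tri: "(\<exists>E N. frame \<Phi> U V E N) \<or> (A2_component \<Phi> U V ?N \<and> A2_component \<Phi> U V (\<beta>0 \<bullet> \<beta>0))"
        if "split \<Phi> U V" for U V
        by (rule split.ratio_two_cases[OF that ab(1,2) r])
      have absurd: False if fr: "frame \<Phi> U V E N" and sp: "split \<Phi> U V" and t3: "A2_component \<Phi> U1 V1 ?N" "A2_component \<Phi> U1 V1 (\<beta>0 \<bullet> \<beta>0)"
        for U V U1 V1 E N
      proof -
        interpret u: split \<Phi> U V by (rule sp)
        \<comment> \<open>The frame leaves one of the two root lengths on its axes, where no triple
          of type \<open>A\<^sub>2\<close> fits.\<close>
        have "?N \<noteq> N \<or> \<beta>0 \<bullet> \<beta>0 \<noteq> N" using r Npos by auto
        then show False
        proof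
          assume "?N \<noteq> N" then show False using t3(1) u.triangle_frame_absurd[OF fr] unfolding A2_component_def by blast
        next
          assume "\<beta>0 \<bullet> \<beta>0 \<noteq> N" then show False using t3(2) u.triangle_frame_absurd[OF fr] unfolding A2_component_def by blast
        qed
      qed
      consider "\<exists>E N. frame \<Phi> U V E N" "\<exists>E N. frame \<Phi> U' V' E N"
        | "A2_component \<Phi> U V ?N" "A2_component \<Phi> U' V' ?N"
      proof -
        have "\<not> (\<exists>E N. frame \<Phi> U V E N) \<or> \<not> (A2_component \<Phi> U' V' ?N \<and> A2_component \<Phi> U' V' (\<beta>0 \<bullet> \<beta>0))"
          using absurd[OF _ s, of _ _ U' V'] by blast
        moreover have "\<not> (\<exists>E N. frame \<Phi> U' V' E N) \<or> \<not> (A2_component \<Phi> U V ?N \<and> A2_component \<Phi> U V (\<beta>0 \<bullet> \<beta>0))"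
          using absurd[OF _ s', of _ _ U V] by blast
        ultimately show ?thesis using that tri[OF s] tri[OF s'] by argo
      qed
      then show ?thesis
      proof cases
        case 1
        then obtain E N E' N' where f: "frame \<Phi> U V E N" "frame \<Phi> U' V' E' N'" by (elim exE)
        show ?thesis
        proof (cases "N = N'")
          case True
          then show ?thesis using frame_match[OF s s' f(1) _ dim] f(2) by simp
        next
          case False
          then show ?thesis using frame_exceptional[OF s s' f] by blast
        qed
      next
        case 2
        obtain \<alpha> \<beta> where x: "\<alpha> \<in> \<Phi>" "\<beta> \<in> \<Phi>" "\<alpha> \<bullet> \<alpha> = ?N" "\<beta> \<bullet> \<beta> = ?N" "\<alpha> \<bullet> \<beta> = - ?N / 2"
          "component \<Phi> U V (span {\<alpha>, \<beta>})" using 2(1) unfolding A2_component_def by blast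
        obtain \<alpha>' \<beta>' where x': "\<alpha>' \<in> \<Phi>" "\<beta>' \<in> \<Phi>" "\<alpha>' \<bullet> \<alpha>' = ?N" "\<beta>' \<bullet> \<beta>' = ?N" "\<alpha>' \<bullet> \<beta>' = - ?N / 2"
          "component \<Phi> U' V' (span {\<alpha>', \<beta>'})" using 2(2) unfolding A2_component_def by blast
        obtain B where "s.aut B" "span {B \<alpha>, B \<beta>} = span {\<alpha>', \<beta>'}"
          by (rule s.A2_conj[OF x(1,2) x'(1,2) x(3,4) x'(3,4) x(5) x'(5)])
        then have "\<exists>B. matches \<Phi> U V U' V' B" using comp[OF x(6) x'(6)] by simp
        then show ?thesis ..
      qed
    qed
  qed
qed

section \<open>Coxeter polytopes\<close>

text \<open>Allowing a translate of the second hyperplane covers parallel facets as well as equal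
  hyperplanes.\<close>

lemma hyperplane_eq_normals:
  fixes u a :: "'a::euclidean_space"
  assumes "norm u = 1" "{x. a \<bullet> x = b} = (\<lambda>x. v + x) ` {x. u \<bullet> x = c}"
  shows "a = (a \<bullet> u) *\<^sub>R u" "b = (a \<bullet> u) * (c + u \<bullet> v)"
proof -
  have uu: "u \<bullet> u = 1" using assms(1) by (simp add: norm_eq_1)
  have "v + c *\<^sub>R u \<in> {x. a \<bullet> x = b}" unfolding assms(2) using uu by (intro imageI) simp
  then have x0: "a \<bullet> (v + c *\<^sub>R u) = b" by simp
  define w where "w = a - (a \<bullet> u) *\<^sub>R u"
  have uw: "u \<bullet> w = 0" using uu by (simp add: w_def inner_diff_right inner_commute)
  then have "v + (c *\<^sub>R u + w) \<in> (\<lambda>x. v + x) ` {x. u \<bullet> x = c}" using uu by (auto simp: inner_add_right)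
  then have "a \<bullet> (v + (c *\<^sub>R u + w)) = b" unfolding assms(2)[symmetric] by simp
  then have "a \<bullet> w = 0" using x0 by (simp add: inner_add_right)
  then have "w \<bullet> w = 0" using uw by (simp add: w_def inner_diff_left)
  then show a: "a = (a \<bullet> u) *\<^sub>R u" by (simp add: w_def)
  have "a \<bullet> (v + c *\<^sub>R u) = (a \<bullet> u) * (u \<bullet> v) + c * (a \<bullet> u)"
    by (subst a) (simp add: inner_add_right uu)
  then show "b = (a \<bullet> u) * (c + u \<bullet> v)" using x0 by (simp add: algebra_simps)
qed

lemma hyperplane_eq_normals':
  fixes u a :: "'a::euclidean_space"
  assumes "norm u = 1" "{x. a \<bullet> x = b} = {x. u \<bullet> x = c}"
  shows "a = (a \<bullet> u) *\<^sub>R u" "b = (a \<bullet> u) * c"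
  using hyperplane_eq_normals[of u a b 0 c] assms by simp_all

text \<open>The last point of the segment from \<open>q\<close> to \<open>p\<close> that belongs to
  \<open>S\<close> lies on the relative boundary, which for a polyhedron is the union of its
  facets.\<close>

lemma exit_facet:
  fixes S :: "'a::euclidean_space set"
  assumes S: "polyhedron S" and q: "q \<in> rel_interior S" and p: "p \<in> affine hull S" "p \<notin> S"
  obtains k t where "k facet_of S" "0 \<le> t" "t < 1" "(1 - t) *\<^sub>R q + t *\<^sub>R p \<in> k"
proof -
  define x where "x = (\<lambda>t::real. (1 - t) *\<^sub>R q + t *\<^sub>R p)"
  have cl: "closed S" using S by (rule polyhedron_imp_closed)
  define T where "T = {0..1} \<inter> x -` S"
  have qS: "q \<in> S" using q rel_interior_subset by blast
  have cont: "continuous_on {0..1} x" unfolding x_def by (intro continuous_intros)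
  have clT: "closed T" unfolding T_def by (rule continuous_closed_preimage[OF cont _ cl]) simp
  have T0: "0 \<in> T" using qS by (simp add: T_def x_def)
  have bT: "bdd_above T" by (auto simp: T_def bdd_above_def intro!: exI[of _ 1])
  define s where "s = Sup T"
  have sT: "s \<in> T" unfolding s_def using closed_contains_Sup[OF _ bT clT] T0 by blast
  have s1: "0 \<le> s" "s \<le> 1" "x s \<in> S" using sT by (auto simp: T_def)
  have "s \<noteq> 1" using s1(3) p(2) by (auto simp: x_def)
  then have s2: "s < 1" using s1 by simp
  have notin: "x s \<notin> rel_interior S"
  proof
    assume "x s \<in> rel_interior S"
    then obtain e where e: "e > 0" "cball (x s) e \<inter> affine hull S \<subseteq> S" by (auto simp: mem_rel_interior_cball)
    \<comment> \<open>The step is short enough both to remain in the ball around \<open>x s\<close>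
      and to keep the parameter at most 1.\<close>
    define d where "d = min (1 - s) (e / (norm (p - q) + 1))"
    have d: "d > 0" "d \<le> 1 - s" using s2 e by (auto simp: d_def add_nonneg_pos)
    have "d * norm (p - q) \<le> e / (norm (p - q) + 1) * norm (p - q)"
      by (intro mult_right_mono) (auto simp: d_def)
    also have "\<dots> \<le> e"
    proof -
      have "e * norm (p - q) \<le> e * (norm (p - q) + 1)" using e by (intro mult_left_mono) auto
      then show ?thesis by (simp add: divide_le_eq add_nonneg_pos)
    qed
    finally have de: "d * norm (p - q) \<le> e" .
    have "x (s + d) - x s = d *\<^sub>R (p - q)" by (simp add: x_def algebra_simps)
    then have "dist (x s) (x (s + d)) \<le> e" using de d norm_minus_commute[of "x s" "x (s + d)"] by (simp add: dist_norm)
    moreover have "x (s + d) \<in> affine hull S"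
      unfolding x_def using qS p(1) by (intro mem_affine[OF affine_affine_hull]) (auto intro: hull_inc)
    ultimately have "x (s + d) \<in> S" using e(2) by auto
    then have "s + d \<in> T" using s1 d by (auto simp: T_def)
    then have "s + d \<le> s" unfolding s_def by (intro cSup_upper bT)
    then show False using d by simp
  qed
  then have "x s \<in> \<Union> {F. F facet_of S}" using rel_boundary_of_polyhedron[OF S] s1(3) by blast
  then show ?thesis using that s1 s2 by (auto simp: x_def)
qed

section \<open>Facets and normals of a full-dimensional polyhedron\<close>

locale full_polyhedron =
  fixes P :: "'a::euclidean_space set"
  assumes poly: "polyhedron P" and int: "interior P \<noteq> {}"
begin

abbreviation nrm :: "'a set \<Rightarrow> 'a" where "nrm f \<equiv> outward_normal P f"

text \<open>The normal is constant on the facet, so the choice of the point does not affect the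
  value.\<close>

definition off :: "'a set \<Rightarrow> real" where "off f = nrm f \<bullet> (SOME x. x \<in> f)"

lemma aff_dimP: "aff_dim P = int DIM('a)"
  using int by (rule aff_dim_nonempty_interior)

lemma aff_dim_facet: "f facet_of P \<Longrightarrow> aff_dim f = int DIM('a) - 1"
  by (simp add: facet_of_def aff_dimP)

lemma facet_hull:
  assumes "f facet_of P" "a \<noteq> 0" "f \<subseteq> {x. a \<bullet> x = b}"
  shows "affine hull f = {x. a \<bullet> x = b}"
proof (rule affine_dim_equal)
  show "affine (affine hull f)" by (rule affine_affine_hull)
  show "affine {x. a \<bullet> x = b}" by (rule affine_hyperplane)
  show "affine hull f \<noteq> {}" using assms(1) by (simp add: facet_of_def)
  show "affine hull f \<subseteq> {x. a \<bullet> x = b}" using assms(3) by (intro hull_minimal affine_hyperplane)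
  show "aff_dim (affine hull f) = aff_dim {x. a \<bullet> x = b}"
    using aff_dim_facet[OF assms(1)] assms(2) by (simp add: aff_dim_hyperplane)
qed

text \<open>Both vectors are unit normals of the hyperplane of the facet. Opposite signs would
  squeeze \<open>P\<close> into that hyperplane, which has no interior. This justifies the
  \<open>THE\<close> in \<open>outward_normal\<close>.\<close>

lemma normal_unique:
  assumes f: "f facet_of P" and u: "norm u = 1" "P \<subseteq> {x. u \<bullet> x \<le> b}" "f = P \<inter> {x. u \<bullet> x = b}"
    and v: "norm v = 1" "P \<subseteq> {x. v \<bullet> x \<le> c}" "f = P \<inter> {x. v \<bullet> x = c}"
  shows "v = u"
proof -
  have "u \<noteq> 0" "v \<noteq> 0" using u v by auto
  then have "{x. v \<bullet> x = c} = {x. u \<bullet> x = b}"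
    using facet_hull[OF f, of u b] facet_hull[OF f, of v c] u v by blast
  then have e: "v = (v \<bullet> u) *\<^sub>R u" "c = (v \<bullet> u) * b" using hyperplane_eq_normals'[OF u(1)] by blast+
  have "\<bar>v \<bullet> u\<bar> = 1" using arg_cong[OF e(1), of norm] u(1) v(1) by simp
  moreover have "v \<bullet> u \<noteq> - 1"
  proof
    assume "v \<bullet> u = - 1"
    then have "v = - u" "c = - b" using e by simp_all
    have "P \<subseteq> {x. u \<bullet> x = b}"
    proof
      fix x assume x: "x \<in> P"
      then have "v \<bullet> x \<le> c" using v(2) by blast
      then have "b \<le> u \<bullet> x" using \<open>v = - u\<close> \<open>c = - b\<close> by simp
      then show "x \<in> {x. u \<bullet> x = b}" using u(2) x by auto
    qed
    then have "interior P \<subseteq> interior {x. u \<bullet> x = b}" by (rule interior_mono)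
    then show False using int \<open>u \<noteq> 0\<close> by (simp add: interior_hyperplane)
  qed
  ultimately have "v \<bullet> u = 1" by linarith
  then show ?thesis using e by simp
qed

lemma facet_normal:
  assumes f: "f facet_of P"
  shows "norm (nrm f) = 1" "P \<subseteq> {x. nrm f \<bullet> x \<le> off f}" "f = P \<inter> {x. nrm f \<bullet> x = off f}"
    "affine hull f = {x. nrm f \<bullet> x = off f}"
proof -
  obtain a b where ab: "a \<noteq> 0" "P \<subseteq> {x. a \<bullet> x \<le> b}" "f = P \<inter> {x. a \<bullet> x = b}"
    using facet_of_polyhedron[OF poly f] .
  define u c where "u = a /\<^sub>R norm a" and "c = b / norm a"
  have u: "norm u = 1" "P \<subseteq> {x. u \<bullet> x \<le> c}" "f = P \<inter> {x. u \<bullet> x = c}"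
    using ab by (auto simp: u_def c_def divide_simps)
  have ex1: "\<exists>!u. norm u = 1 \<and> (\<exists>b. P \<subseteq> {x. u \<bullet> x \<le> b} \<and> f = P \<inter> {x. u \<bullet> x = b})"
    using u normal_unique[OF f u] by (intro ex1I[of _ u]) blast+
  have "nrm f = u" unfolding outward_normal_def
    by (rule the1_equality[OF ex1]) (use u in blast)
  moreover have "off f = c"
  proof -
    have "f \<noteq> {}" using f by (simp add: facet_of_def)
    then have "(SOME x. x \<in> f) \<in> f" by (simp add: some_in_eq)
    then show ?thesis using u(3) \<open>nrm f = u\<close> by (auto simp: off_def)
  qed
  moreover have "affine hull f = {x. u \<bullet> x = c}"
    by (rule facet_hull[OF f]) (use u in auto)
  ultimately show "norm (nrm f) = 1" "P \<subseteq> {x. nrm f \<bullet> x \<le> off f}" "f = P \<inter> {x. nrm f \<bullet> x = off f}"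
    "affine hull f = {x. nrm f \<bullet> x = off f}"
    using u by simp_all
qed

lemma nrm_inner: "f facet_of P \<Longrightarrow> nrm f \<bullet> nrm f = 1"
  using facet_normal(1) by (simp add: norm_eq_1)

lemma facet_subset_le: "f facet_of P \<Longrightarrow> x \<in> P \<Longrightarrow> nrm f \<bullet> x \<le> off f"
  using facet_normal(2) by blast

lemma facet_mem: "f facet_of P \<Longrightarrow> x \<in> f \<longleftrightarrow> x \<in> P \<and> nrm f \<bullet> x = off f"
  using facet_normal(3) by blast

lemma finite_facets: "finite {f. f facet_of P}"
  using finite_polyhedron_facets[OF poly] .

text \<open>From an interior point the segment to an outside point leaves through a facet
  \<open>k\<close>. It starts strictly inside the half-space of \<open>k\<close> and ends inside it,
  so it cannot meet the hyperplane of \<open>k\<close> on the way.\<close>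

lemma mem_polyhedron:
  assumes "\<And>f. f facet_of P \<Longrightarrow> nrm f \<bullet> y \<le> off f"
  shows "y \<in> P"
proof (rule ccontr)
  assume y: "y \<notin> P"
  obtain q where q: "q \<in> interior P" using int by blast
  have hull: "affine hull P = UNIV" using int by (rule affine_hull_nonempty_interior)
  have ri: "rel_interior P = interior P" using int by (rule rel_interior_nonempty_interior)
  obtain k t where k: "k facet_of P" "0 \<le> t" "t < 1" "(1 - t) *\<^sub>R q + t *\<^sub>R y \<in> k"
    using exit_facet[OF poly, of q y] q y hull ri by auto
  have qP: "q \<in> P" using q interior_subset by blast
  have "q \<notin> k"
    using k(1) q ri face_of_disjoint_rel_interior[of k P] facet_of_imp_face_of[OF k(1)] facet_of_irrefl
    by blast
  then have "nrm k \<bullet> q < off k" using facet_subset_le[OF k(1) qP] facet_mem[OF k(1)] qP by force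
  then have "(1 - t) * (nrm k \<bullet> q) < (1 - t) * off k" using k(3) by simp
  moreover have "t * (nrm k \<bullet> y) \<le> t * off k" using assms[OF k(1)] k(2) by (intro mult_left_mono)
  ultimately have "nrm k \<bullet> ((1 - t) *\<^sub>R q + t *\<^sub>R y) < off k"
    by (simp add: inner_add_right algebra_simps)
  then show False using k(4) facet_mem[OF k(1)] by simp
qed

lemma facet_not_subset:
  assumes "f facet_of P" "g facet_of P" "f \<noteq> g"
  shows "\<not> f \<subseteq> g"
proof
  assume "f \<subseteq> g"
  then have "f face_of g"
    using assms facet_of_imp_face_of facet_of_imp_subset by (blast intro: face_of_subset)
  moreover have "convex g" using assms(2) facet_of_imp_face_of face_of_imp_convex by blast
  ultimately have "aff_dim f < aff_dim g" using face_of_aff_dim_lt assms(3) by blast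
  then show False using aff_dim_facet assms by simp
qed

lemma facet_Int_face:
  assumes "f facet_of P" "g facet_of P" "f \<noteq> g"
  shows "f \<inter> g face_of f" "f \<inter> g \<noteq> f" "aff_dim (f \<inter> g) < aff_dim f"
proof -
  have "f \<inter> g face_of P" using assms facet_of_imp_face_of by (blast intro: face_of_Int)
  then show 1: "f \<inter> g face_of f"
    using assms(1) facet_of_imp_subset by (blast intro: face_of_subset)
  show 2: "f \<inter> g \<noteq> f" using facet_not_subset[OF assms] by blast
  have "convex f" using assms(1) facet_of_imp_face_of face_of_imp_convex by blast
  then show "aff_dim (f \<inter> g) < aff_dim f" using 1 2 face_of_aff_dim_lt by blast
qed

text \<open>A proper face is the intersection of the facets that contain it, so \<open>k\<close>
  lies in a second facet \<open>g\<close>. The dimension then leaves no room between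
  \<open>k\<close> and \<open>f \<inter> g\<close>.\<close>

lemma facet_of_facet:
  assumes f: "f facet_of P" and k: "k facet_of f"
  obtains g where "g facet_of P" "g \<noteq> f" "k \<subseteq> g" "f \<inter> g facet_of f"
proof -
  have fP: "f face_of P" using f by (rule facet_of_imp_face_of)
  have kP: "k face_of P" using facet_of_imp_face_of[OF k] fP by (rule face_of_trans)
  have kf: "k \<subseteq> f" "k \<noteq> f" using facet_of_imp_subset[OF k] k facet_of_irrefl by auto
  have k0: "k \<noteq> {}" "k \<noteq> P"
  proof -
    show "k \<noteq> {}" using k by (simp add: facet_of_def)
    show "k \<noteq> P" using kf facet_of_imp_subset[OF f] by blast
  qed
  have "k = \<Inter> {F. F facet_of P \<and> k \<subseteq> F}" by (rule face_of_polyhedron[OF poly kP k0])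
  then have "\<exists>g. g facet_of P \<and> g \<noteq> f \<and> k \<subseteq> g" using kf f by blast
  then obtain g where g: "g facet_of P" "g \<noteq> f" "k \<subseteq> g" by blast
  note i = facet_Int_face[OF f g(1) g(2)[symmetric]]
  have "aff_dim k \<le> aff_dim (f \<inter> g)" using kf g by (intro aff_dim_subset) auto
  then have "aff_dim (f \<inter> g) = aff_dim f - 1" using k i(3) by (simp add: facet_of_def)
  moreover have "f \<inter> g \<noteq> {}" using k0 kf g by blast
  ultimately have "f \<inter> g facet_of f" using i(1) by (simp add: facet_of_def)
  then show ?thesis using that g by blast
qed

end

lemma reflection_scale:
  assumes "t \<noteq> 0"
  shows "reflection (t *\<^sub>R a) (t * b) = reflection a b"
proof
  fix x
  have "(t *\<^sub>R a) \<bullet> x - t * b = t * (a \<bullet> x - b)" by (simp add: right_diff_distrib)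
  then have "reflection (t *\<^sub>R a) (t * b) x = x - (2 * (t * (a \<bullet> x - b)) / (t * t * (a \<bullet> a)) * t) *\<^sub>R a"
    unfolding reflection_def by simp
  also have "2 * (t * (a \<bullet> x - b)) / (t * t * (a \<bullet> a)) * t = 2 * (a \<bullet> x - b) / (a \<bullet> a)"
    using assms by simp
  finally show "reflection (t *\<^sub>R a) (t * b) x = reflection a b x" by (simp only: reflection_def)
qed

lemma pi_div_nat_inj: "0 < m \<Longrightarrow> 0 < n \<Longrightarrow> pi / real m = pi / real n \<Longrightarrow> m = n"
  by (simp add: frac_eq_eq)

section \<open>Coxeter polytopes: nonobtuse angles and the meaning of the edges\<close>

locale coxeter =
  fixes P :: "'a::euclidean_space set"
  assumes cox: "coxeter_polytope P"

sublocale coxeter \<subseteq> full_polyhedron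
  using cox by unfold_locales (auto simp: coxeter_polytope_def)

context coxeter
begin

lemma adjacent_inner:
  assumes "f facet_of P" "g facet_of P" "f \<noteq> g" "f \<inter> g facet_of f"
  obtains m :: nat where "m \<ge> 2" "dihedral_angle P f g = pi / m" "nrm f \<bullet> nrm g = - cos (pi / m)"
proof -
  obtain m :: nat where m: "m \<ge> 2" "dihedral_angle P f g = pi / m"
    using cox assms unfolding coxeter_polytope_def by blast
  have "\<bar>nrm f \<bullet> nrm g\<bar> \<le> norm (nrm f) * norm (nrm g)" by (rule Cauchy_Schwarz_ineq2)
  then have "\<bar>nrm f \<bullet> nrm g\<bar> \<le> 1" using facet_normal(1) assms by simp
  then have "cos (dihedral_angle P f g) = - (nrm f \<bullet> nrm g)"
    unfolding dihedral_angle_def by (intro cos_arccos) auto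
  then show ?thesis using that[OF m] m(2) by simp
qed

lemma adjacent_nonpos:
  assumes "f facet_of P" "g facet_of P" "f \<noteq> g" "f \<inter> g facet_of f"
  shows "nrm f \<bullet> nrm g \<le> 0"
proof -
  obtain m :: nat where m: "m \<ge> 2" "nrm f \<bullet> nrm g = - cos (pi / m)" using adjacent_inner[OF assms] by metis
  have "pi / m \<le> pi / 2" using m(1) by (intro divide_left_mono) auto
  moreover have "pi / m \<ge> 0" by simp
  ultimately have "cos (pi / m) \<ge> 0" using pi_ge_zero by (intro cos_ge_zero) linarith+
  then show ?thesis using m(2) by simp
qed

text \<open>The facet \<open>f\<close> is cut out of its hyperplane by the facets adjacent to it, and projecting to
  the hyperplane does not leave their half-spaces because the dihedral angles are not obtuse.\<close>

lemma project_to_facet: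
  assumes f: "f facet_of P" and y: "y \<in> P"
  shows "y + (off f - nrm f \<bullet> y) *\<^sub>R nrm f \<in> f"
proof (rule ccontr)
  define t where "t = off f - nrm f \<bullet> y"
  define p where "p = y + t *\<^sub>R nrm f"
  assume "\<not> ?thesis"
  then have pf: "p \<notin> f" by (simp add: p_def t_def)
  have t: "t \<ge> 0" using facet_subset_le[OF f y] by (simp add: t_def)
  have "f face_of P" using f by (rule facet_of_imp_face_of)
  then have polyf: "polyhedron f" "convex f" using face_of_polyhedron_polyhedron[OF poly] face_of_imp_convex by blast+
  have "f \<noteq> {}" using f by (simp add: facet_of_def)
  then obtain q where q: "q \<in> rel_interior f" using polyf rel_interior_eq_empty by blast
  have "nrm f \<bullet> p = off f" using nrm_inner[OF f] by (simp add: p_def t_def inner_add_right)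
  then have "p \<in> affine hull f" using facet_normal(4)[OF f] by simp
  then obtain k s where k: "k facet_of f" "0 \<le> s" "s < 1" "(1 - s) *\<^sub>R q + s *\<^sub>R p \<in> k"
    using exit_facet[OF polyf(1) q _ pf] by metis
  obtain g where g: "g facet_of P" "g \<noteq> f" "k \<subseteq> g" "f \<inter> g facet_of f" by (rule facet_of_facet[OF f k(1)])
  have qf: "q \<in> f" "q \<in> P" using q rel_interior_subset facet_of_imp_subset[OF f] by blast+
  have "q \<notin> f \<inter> g"
    using face_of_disjoint_rel_interior[OF facet_Int_face(1,2)[OF f g(1) g(2)[symmetric]]] q by blast
  then have "nrm g \<bullet> q < off g" using facet_subset_le[OF g(1) qf(2)] facet_mem[OF g(1)] qf by force
  then have "(1 - s) * (nrm g \<bullet> q) < (1 - s) * off g" using k(3) by simp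
  moreover have "nrm g \<bullet> p \<le> off g"
  proof -
    have "t * (nrm f \<bullet> nrm g) \<le> 0"
      using adjacent_nonpos[OF f g(1) g(2)[symmetric] g(4)] t by (simp add: mult_nonneg_nonpos)
    then show ?thesis using facet_subset_le[OF g(1) y] by (simp add: p_def inner_add_right inner_commute)
  qed
  then have "s * (nrm g \<bullet> p) \<le> s * off g" using k(2) by (intro mult_left_mono)
  ultimately have "nrm g \<bullet> ((1 - s) *\<^sub>R q + s *\<^sub>R p) < off g" by (simp add: inner_add_right algebra_simps)
  then show False using k(4) g(3) facet_mem[OF g(1)] by auto
qed

text \<open>A point of \<open>g\<close> outside \<open>f\<close> moves in the direction of the
  normal of \<open>f\<close> when it is projected to \<open>f\<close>. It stays in \<open>P\<close>,
  so it does not cross the hyperplane of \<open>g\<close>.\<close>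

lemma normals_nonpos:
  assumes f: "f facet_of P" and g: "g facet_of P" and ne: "f \<noteq> g"
  shows "nrm f \<bullet> nrm g \<le> 0"
proof -
  obtain y where y: "y \<in> g" "y \<notin> f" using facet_not_subset[OF g f] ne by blast
  have yP: "y \<in> P" using y facet_of_imp_subset[OF g] by blast
  define t where "t = off f - nrm f \<bullet> y"
  have "nrm f \<bullet> y \<noteq> off f" using y(2) yP facet_mem[OF f] by blast
  then have t: "t > 0" using facet_subset_le[OF f yP] by (simp add: t_def)
  have "y + t *\<^sub>R nrm f \<in> f" unfolding t_def by (rule project_to_facet[OF f yP])
  then have "nrm g \<bullet> (y + t *\<^sub>R nrm f) \<le> off g"
    using facet_subset_le[OF g] facet_of_imp_subset[OF f] by blast
  moreover have "nrm g \<bullet> y = off g" using y facet_mem[OF g] by blast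
  ultimately have "t * (nrm f \<bullet> nrm g) \<le> 0" by (simp add: inner_add_right inner_commute)
  then show ?thesis using t by (simp add: mult_le_0_iff)
qed

text \<open>Alternately projecting to two nonparallel facets moves a point of the first one along a fixed
  direction into their intersection, which therefore has codimension 2.\<close>

lemma nonparallel_adjacent:
  assumes f: "f facet_of P" and g: "g facet_of P" and ne: "f \<noteq> g" and np: "nrm g \<noteq> - nrm f"
  shows "f \<inter> g facet_of f"
proof -
  define c where "c = nrm f \<bullet> nrm g"
  have c0: "c \<le> 0" unfolding c_def by (rule normals_nonpos[OF f g ne])
  have "(nrm f + nrm g) \<bullet> (nrm f + nrm g) = 2 + 2 * c"
    using nrm_inner[OF f] nrm_inner[OF g] by (simp add: c_def inner_add_left inner_add_right inner_commute)
  moreover have "nrm f + nrm g \<noteq> 0" using np by (metis add_eq_0_iff)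
  then have "(nrm f + nrm g) \<bullet> (nrm f + nrm g) > 0" by simp
  ultimately have c1: "c > - 1" by linarith
  have c2: "1 - c\<^sup>2 > 0" using c0 c1 by (simp add: abs_square_less_1)
  \<comment> \<open>The part of the normal of \<open>g\<close> that is tangent to \<open>f\<close>:
    projecting to \<open>g\<close> and back to \<open>f\<close> displaces a point of
    \<open>f\<close> by a multiple of \<open>v\<close>.\<close>
  define v where "v = nrm g - c *\<^sub>R nrm f"
  have gv: "nrm g \<bullet> v = 1 - c\<^sup>2"
    using nrm_inner[OF g] by (simp add: v_def inner_diff_right c_def inner_commute power2_eq_square)
  have step: "p + (off g - nrm g \<bullet> p) *\<^sub>R v \<in> f" if p: "p \<in> f" for p
  proof -
    define d where "d = off g - nrm g \<bullet> p"
    have pP: "p \<in> P" using p facet_of_imp_subset[OF f] by blast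
    have "p + d *\<^sub>R nrm g \<in> g" unfolding d_def by (rule project_to_facet[OF g pP])
    then have "p + d *\<^sub>R nrm g \<in> P" using facet_of_imp_subset[OF g] by blast
    then have "(p + d *\<^sub>R nrm g) + (off f - nrm f \<bullet> (p + d *\<^sub>R nrm g)) *\<^sub>R nrm f \<in> f"
      by (rule project_to_facet[OF f])
    moreover have "off f - nrm f \<bullet> (p + d *\<^sub>R nrm g) = - (d * c)"
      using facet_mem[OF f] p by (simp add: inner_add_right c_def)
    ultimately have "(p + d *\<^sub>R nrm g) + (- (d * c)) *\<^sub>R nrm f \<in> f" by (simp only:)
    moreover have "(p + d *\<^sub>R nrm g) + (- (d * c)) *\<^sub>R nrm f = p + d *\<^sub>R v"
      by (simp add: v_def scaleR_diff_right)
    ultimately show ?thesis by (simp only: d_def)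
  qed
  have reach: "\<exists>s. p + s *\<^sub>R v \<in> f \<inter> g" if p: "p \<in> f" for p
  proof -
    define S where "S = {s. 0 \<le> s \<and> p + s *\<^sub>R v \<in> f}"
    have "closed f" using polyhedron_imp_closed[OF face_of_polyhedron_polyhedron[OF poly facet_of_imp_face_of[OF f]]] .
    moreover have "S = {0..} \<inter> (\<lambda>s. p + s *\<^sub>R v) -` f" by (auto simp: S_def)
    ultimately have clS: "closed S"
      by (auto intro!: continuous_closed_preimage continuous_intros)
    have bd: "s \<le> (off g - nrm g \<bullet> p) / (1 - c\<^sup>2)" if "s \<in> S" for s
    proof -
      have "p + s *\<^sub>R v \<in> P" using that facet_of_imp_subset[OF f] by (auto simp: S_def)
      then have "nrm g \<bullet> p + s * (1 - c\<^sup>2) \<le> off g" using facet_subset_le[OF g] gv by (fastforce simp: inner_add_right)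
      then show ?thesis using c2 by (simp add: pos_le_divide_eq)
    qed
    then have bS: "bdd_above S" by (auto simp: bdd_above_def)
    have "0 \<in> S" using p by (simp add: S_def)
    define m where "m = Sup S"
    have mS: "m \<in> S" unfolding m_def using closed_contains_Sup[OF _ bS clS] \<open>0 \<in> S\<close> by blast
    define q where "q = p + m *\<^sub>R v"
    have q: "q \<in> f" "m \<ge> 0" using mS by (auto simp: S_def q_def)
    \<comment> \<open>From the last point \<open>q\<close> of \<open>f\<close> on the ray a further
      step leads on by \<open>d \<ge> 0\<close>; hence \<open>d = 0\<close> and \<open>q\<close>
      lies on \<open>g\<close>.\<close>
    define d where "d = off g - nrm g \<bullet> q"
    have "d \<ge> 0" using q facet_subset_le[OF g] facet_of_imp_subset[OF f] by (auto simp: d_def)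
    moreover have "q + d *\<^sub>R v \<in> f" unfolding d_def by (rule step[OF q(1)])
    then have "m + d \<in> S" using q(2) \<open>d \<ge> 0\<close> by (simp add: S_def q_def scaleR_left_distrib add.assoc)
    then have "m + d \<le> m" unfolding m_def by (intro cSup_upper bS)
    ultimately have "d = 0" by simp
    then have "q \<in> g" using q(1) facet_mem[OF g] facet_of_imp_subset[OF f] by (auto simp: d_def)
    then show ?thesis using q(1) unfolding q_def by blast
  qed
  have "f \<noteq> {}" using f by (simp add: facet_of_def)
  then obtain q0 where q0: "q0 \<in> f \<inter> g" using reach by blast
  \<comment> \<open>Every point of \<open>f\<close> reaches \<open>f \<inter> g\<close> in the
    direction \<open>v\<close>, so one additional point spans \<open>f\<close> from the
    intersection.\<close>
  have "f \<subseteq> affine hull (insert (q0 + v) (f \<inter> g))"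
  proof
    fix p assume "p \<in> f"
    then obtain s where s: "p + s *\<^sub>R v \<in> f \<inter> g" using reach by blast
    let ?H = "affine hull (insert (q0 + v) (f \<inter> g))"
    have "p + s *\<^sub>R v \<in> ?H" "q0 + v \<in> ?H" "q0 \<in> ?H" using s q0 by (auto intro: hull_inc)
    then have "(p + s *\<^sub>R v) + (- s) *\<^sub>R ((q0 + v) - q0) \<in> ?H"
      by (intro mem_affine_3_minus affine_affine_hull)
    then show "p \<in> ?H" by simp
  qed
  then have "aff_dim f \<le> aff_dim (insert (q0 + v) (f \<inter> g))"
    by (metis aff_dim_affine_hull aff_dim_subset)
  also have "\<dots> \<le> aff_dim (f \<inter> g) + 1" by (simp add: aff_dim_insert)
  finally have "aff_dim (f \<inter> g) = aff_dim f - 1" using facet_Int_face(3)[OF f g ne] by linarith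
  then show ?thesis using facet_Int_face(1)[OF f g ne] q0 by (auto simp: facet_of_def)
qed

text \<open>Parallel hyperplanes have unit normals that agree up to sign, and equal normals are
  excluded by \<open>normals_nonpos\<close>.\<close>

lemma parallel_iff:
  assumes f: "f facet_of P" and g: "g facet_of P" and ne: "f \<noteq> g"
  shows "affine_parallel (affine hull f) (affine hull g) \<longleftrightarrow> nrm g = - nrm f"
proof
  assume "affine_parallel (affine hull f) (affine hull g)"
  then obtain v where "affine hull g = (\<lambda>x. v + x) ` (affine hull f)" by (auto simp: affine_parallel_def)
  then have "{x. nrm g \<bullet> x = off g} = (\<lambda>x. v + x) ` {x. nrm f \<bullet> x = off f}"
    using facet_normal(4) f g by simp
  then have e: "nrm g = (nrm g \<bullet> nrm f) *\<^sub>R nrm f"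
    by (rule hyperplane_eq_normals(1)[OF facet_normal(1)[OF f]])
  have "norm (nrm g) = \<bar>nrm g \<bullet> nrm f\<bar> * norm (nrm f)" by (metis e norm_scaleR)
  then have "\<bar>nrm g \<bullet> nrm f\<bar> = 1" by (simp add: facet_normal(1)[OF f] facet_normal(1)[OF g])
  then have "nrm g \<bullet> nrm f = - 1" using normals_nonpos[OF g f] ne by auto
  then show "nrm g = - nrm f" using e by simp
next
  assume e: "nrm g = - nrm f"
  have ff: "nrm f \<bullet> nrm f = 1" by (rule nrm_inner[OF f])
  have "affine hull g = (\<lambda>x. (- off g - off f) *\<^sub>R nrm f + x) ` (affine hull f)"
  proof (intro equalityI subsetI)
    fix x assume "x \<in> affine hull g"
    then have "nrm f \<bullet> x = - off g" using facet_normal(4)[OF g] e by simp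
    then have "nrm f \<bullet> (x - (- off g - off f) *\<^sub>R nrm f) = off f" using ff by (simp add: inner_diff_right)
    then have "x - (- off g - off f) *\<^sub>R nrm f \<in> affine hull f" using facet_normal(4)[OF f] by simp
    then show "x \<in> (\<lambda>x. (- off g - off f) *\<^sub>R nrm f + x) ` (affine hull f)"
      by (rule rev_image_eqI) simp
  next
    fix x assume "x \<in> (\<lambda>x. (- off g - off f) *\<^sub>R nrm f + x) ` (affine hull f)"
    then show "x \<in> affine hull g" using facet_normal(4)[OF g] facet_normal(4)[OF f] e ff
      by (auto simp: inner_add_right)
  qed
  then show "affine_parallel (affine hull f) (affine hull g)" by (auto simp: affine_parallel_def)
qed

text \<open>Nonparallel facets are adjacent by \<open>nonparallel_adjacent\<close>, so the
  \<open>THE\<close> in \<open>coxeter_edge\<close> picks the actual submultiple of the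
  angle.\<close>

lemma edge_cases:
  assumes f: "f facet_of P" and g: "g facet_of P" and ne: "f \<noteq> g"
  obtains "nrm g = - nrm f" "coxeter_edge P f g = Bold"
  | m :: nat where "m \<ge> 2" "nrm f \<bullet> nrm g = - cos (pi / m)" "coxeter_edge P f g = Edge (m - 2)"
proof (cases "nrm g = - nrm f")
  case True
  then show ?thesis using that(1) parallel_iff[OF assms] by (simp add: coxeter_edge_def)
next
  case False
  have adj: "f \<inter> g facet_of f" by (rule nonparallel_adjacent[OF assms False])
  obtain m :: nat where m: "m \<ge> 2" "dihedral_angle P f g = pi / m" "nrm f \<bullet> nrm g = - cos (pi / m)"
    by (rule adjacent_inner[OF assms adj])
  have "(THE m::nat. m \<ge> 2 \<and> dihedral_angle P f g = pi / real m) = m"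
  proof (rule the_equality)
    fix n :: nat assume "n \<ge> 2 \<and> dihedral_angle P f g = pi / real n"
    then show "n = m" using m by (intro pi_div_nat_inj) auto
  qed (use m in simp)
  then have "coxeter_edge P f g = Edge (m - 2)"
    using False parallel_iff[OF assms] by (simp add: coxeter_edge_def)
  then show ?thesis using that(2) m by blast
qed

lemma edge_zero_orthogonal:
  assumes "f facet_of P" "g facet_of P" "f \<noteq> g" "coxeter_edge P f g = Edge 0"
  shows "nrm f \<bullet> nrm g = 0"
proof (rule edge_cases[OF assms(1-3)])
  fix m :: nat assume m: "m \<ge> 2" "nrm f \<bullet> nrm g = - cos (pi / m)" "coxeter_edge P f g = Edge (m - 2)"
  then have "m = 2" using assms(4) by simp
  then show ?thesis using m by simp
qed (use assms(4) in simp)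

lemma facet_reflections_eq:
  "facet_reflections P = {reflection (nrm f) (off f) | f. f facet_of P}"
proof (intro equalityI subsetI)
  fix r assume "r \<in> facet_reflections P"
  then obtain a b f where a: "r = reflection a b" "a \<noteq> 0" "f facet_of P" "affine hull f = {x. a \<bullet> x = b}"
    unfolding facet_reflections_def by blast
  have "{x. a \<bullet> x = b} = {x. nrm f \<bullet> x = off f}" using facet_normal(4)[OF a(3)] a(4) by simp
  note e = hyperplane_eq_normals'[OF facet_normal(1)[OF a(3)] this]
  define t where "t = a \<bullet> nrm f"
  have a': "a = t *\<^sub>R nrm f" "b = t * off f" using e unfolding t_def .
  then have "t \<noteq> 0" using a(2) by auto
  then have "reflection (t *\<^sub>R nrm f) (t * off f) = reflection (nrm f) (off f)"
    by (rule reflection_scale)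
  then have "reflection a b = reflection (nrm f) (off f)" by (simp only: a'[symmetric])
  then show "r \<in> {reflection (nrm f) (off f) | f. f facet_of P}" using a by blast
next
  fix r assume "r \<in> {reflection (nrm f) (off f) | f. f facet_of P}"
  then obtain f where f: "r = reflection (nrm f) (off f)" "f facet_of P" by blast
  have "nrm f \<noteq> 0" using facet_normal(1)[OF f(2)] by auto
  then show "r \<in> facet_reflections P" unfolding facet_reflections_def using f facet_normal(4)[OF f(2)] by blast
qed

text \<open>This is where finite volume enters. A direction perpendicular to all normals could be
  followed indefinitely inside \<open>P\<close>, which would then contain infinitely many disjoint
  balls of the same size.\<close>

lemma normals_span: "span (nrm ` {f. f facet_of P}) = UNIV"
proof (rule ccontr)
  let ?S = "span (nrm ` {f. f facet_of P})"
  assume "?S \<noteq> UNIV"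
  then have "dim (nrm ` {f. f facet_of P}) \<noteq> DIM('a)" by (simp add: dim_eq_full)
  then have "dim (nrm ` {f. f facet_of P}) < DIM('a)"
    using dim_subset_UNIV[of "nrm ` {f. f facet_of P}"] by linarith
  then obtain w where w: "w \<noteq> 0" "\<And>x. x \<in> ?S \<Longrightarrow> orthogonal w x"
    using orthogonal_to_subspace_exists by blast
  have w0: "nrm f \<bullet> w = 0" if "f facet_of P" for f
    using w(2)[of "nrm f"] that by (simp add: span_base orthogonal_def inner_commute)
  obtain q where "q \<in> interior P" using int by blast
  then obtain e where e: "e > 0" "ball q e \<subseteq> P" by (meson mem_interior)
  \<comment> \<open>The shift has the length of a diameter of the ball, so that different translates
    are disjoint.\<close>
  define u where "u = (2 * e / norm w) *\<^sub>R w"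
  have nu: "norm u = 2 * e" using w(1) e(1) by (simp add: u_def)
  define B where "B = (\<lambda>k::nat. ball (q + real k *\<^sub>R u) e)"
  have BP: "B k \<subseteq> P" for k
  proof
    fix x assume "x \<in> B k"
    then have "x - real k *\<^sub>R u \<in> ball q e"
      by (simp add: B_def dist_norm algebra_simps)
    then have xP: "x - real k *\<^sub>R u \<in> P" using e by blast
    show "x \<in> P"
    proof (rule mem_polyhedron)
      fix f assume f: "f facet_of P"
      have "nrm f \<bullet> x = nrm f \<bullet> (x - real k *\<^sub>R u)" using w0[OF f] by (simp add: u_def inner_diff_right)
      then show "nrm f \<bullet> x \<le> off f" using facet_subset_le[OF f xP] by simp
    qed
  qed
  have disj: "disjoint_family B"
    unfolding disjoint_family_on_def
  proof (intro ballI impI)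
    fix i j :: nat assume "i \<noteq> j"
    show "B i \<inter> B j = {}"
    proof (rule ccontr)
      assume "B i \<inter> B j \<noteq> {}"
      then obtain x where x: "dist (q + real i *\<^sub>R u) x < e" "dist (q + real j *\<^sub>R u) x < e" by (auto simp: B_def)
      have "dist (q + real i *\<^sub>R u) (q + real j *\<^sub>R u) < 2 * e"
        using dist_triangle2[of "q + real i *\<^sub>R u" "q + real j *\<^sub>R u" x] x by linarith
      moreover have "dist (q + real i *\<^sub>R u) (q + real j *\<^sub>R u) = \<bar>real i - real j\<bar> * (2 * e)"
        by (simp add: dist_norm scaleR_left_diff_distrib[symmetric] nu)
      moreover have "\<bar>real i - real j\<bar> \<ge> 1" using \<open>i \<noteq> j\<close> by linarith
      then have "\<bar>real i - real j\<bar> * (2 * e) \<ge> 1 * (2 * e)" using e(1) by (intro mult_right_mono) auto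
      ultimately show False by linarith
    qed
  qed
  obtain M where M: "emeasure lborel P = ennreal M" "M \<ge> 0"
    using cox unfolding coxeter_polytope_def by (metis ennreal_cases infinity_ennreal_def less_irrefl)
  define K where "K = unit_ball_vol (real DIM('a)) * e ^ DIM('a)"
  have K: "K > 0" using e(1) by (simp add: K_def)
  have BK: "emeasure lborel (B k) = ennreal K" for k
    unfolding B_def K_def using e(1) by (subst emeasure_ball) auto
  have "real n * K \<le> M" for n
  proof -
    have "(\<Sum>k<n. emeasure lborel (B k)) = emeasure lborel (\<Union>k<n. B k)"
      using disj by (intro sum_emeasure) (auto simp: B_def disjoint_family_on_def)
    also have "\<dots> \<le> emeasure lborel P"
      using BP polyhedron_imp_closed[OF poly] by (intro emeasure_mono) auto
    finally have "(\<Sum>k<n. ennreal K) \<le> ennreal M" unfolding M(1) BK .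
    moreover have "(\<Sum>k<n. ennreal K) = ennreal (real n * K)" using K by (simp add: ennreal_mult ennreal_of_nat_eq_real_of_nat)
    ultimately show ?thesis using M(2) by simp
  qed
  then show False using K reals_Archimedean3[of K] by (metis linorder_not_less)
qed

end

text \<open>The truncated subtraction in \<open>Edge (m - 2)\<close> loses nothing since
  \<open>m \<ge> 2\<close>, so the edge determines \<open>m\<close> and thereby the Gram entry;
  \<open>Bold\<close> stands for the entry -1.\<close>

lemma edge_determines_inner:
  assumes "coxeter_polytope P" "coxeter_polytope P'" "f facet_of P" "g facet_of P" "f \<noteq> g"
    "f' facet_of P'" "g' facet_of P'" "f' \<noteq> g'" "coxeter_edge P' f' g' = coxeter_edge P f g"
  shows "outward_normal P f \<bullet> outward_normal P g = outward_normal P' f' \<bullet> outward_normal P' g'"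
proof -
  interpret p: coxeter P using assms(1) by unfold_locales
  interpret p': coxeter P' using assms(2) by unfold_locales
  show ?thesis
  proof (rule p.edge_cases[OF assms(3-5)])
    assume 1: "outward_normal P g = - outward_normal P f" "coxeter_edge P f g = Bold"
    show ?thesis
    proof (rule p'.edge_cases[OF assms(6-8)])
      assume "outward_normal P' g' = - outward_normal P' f'"
      then show ?thesis using 1(1) p.nrm_inner[OF assms(3)] p'.nrm_inner[OF assms(6)] by simp
    next
      fix n :: nat assume 2: "coxeter_edge P' f' g' = Edge (n - 2)"
      show ?thesis using assms(9) unfolding 1(2) 2 by simp
    qed
  next
    fix m :: nat
    assume 1: "m \<ge> 2" "outward_normal P f \<bullet> outward_normal P g = - cos (pi / m)"
      "coxeter_edge P f g = Edge (m - 2)"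
    show ?thesis
    proof (rule p'.edge_cases[OF assms(6-8)])
      assume 2: "coxeter_edge P' f' g' = Bold"
      show ?thesis using assms(9) unfolding 1(3) 2 by simp
    next
      fix n :: nat
      assume 2: "n \<ge> 2" "outward_normal P' f' \<bullet> outward_normal P' g' = - cos (pi / n)"
        "coxeter_edge P' f' g' = Edge (n - 2)"
      have "n = m" using assms(9) 1(1) 2(1) unfolding 1(3) 2(3) by simp
      then show ?thesis using 1(2) 2(2) by simp
    qed
  qed
qed

section \<open>The diagram of an indecomposable simplex\<close>

text \<open>\<open>pt f\<close> is the vertex opposite to \<open>f\<close>. The third clause says
  that the differences of vertices span the space.\<close>

lemma (in full_polyhedron) simplex_facets:
  assumes S: "int DIM('a) simplex P"
  obtains pt where "\<forall>f g. f facet_of P \<longrightarrow> g facet_of P \<longrightarrow> f \<noteq> g \<longrightarrow> nrm g \<bullet> pt f = off g"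
    "\<forall>f. f facet_of P \<longrightarrow> nrm f \<bullet> pt f < off f"
    "\<forall>w. (\<forall>f g. f facet_of P \<longrightarrow> g facet_of P \<longrightarrow> w \<bullet> (pt f - pt g) = 0) \<longrightarrow> w = 0"
    "card {f. f facet_of P} = DIM('a) + 1"
proof -
  obtain C where C: "\<not> affine_dependent C" "int (card C) = int DIM('a) + 1" "P = convex hull C"
    using S unfolding simplex_def by blast
  have cC: "card C = DIM('a) + 1" using C(2) by linarith
  have c2: "2 \<le> card C" using cC DIM_positive[where 'a = 'a] by linarith
  have iff: "T facet_of P \<longleftrightarrow> (\<exists>c\<in>C. T = convex hull (C - {c}))" for T
    using facet_of_convex_hull_affine_independent_alt[OF C(1)] c2 C(3) by auto
  have notin: "c \<notin> convex hull (C - {c})" if "c \<in> C" for c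
    using C(1) that convex_hull_subset_affine_hull[of "C - {c}"] unfolding affine_dependent_def by blast
  have inj: "inj_on (\<lambda>c. convex hull (C - {c})) C"
  proof (rule inj_onI)
    fix c d assume cd: "c \<in> C" "d \<in> C" "convex hull (C - {c}) = convex hull (C - {d})"
    show "c = d"
    proof (rule ccontr)
      assume "c \<noteq> d"
      then have "c \<in> convex hull (C - {d})" using cd by (intro hull_inc) auto
      then show False using notin[OF cd(1)] cd(3) by simp
    qed
  qed
  have I: "{f. f facet_of P} = (\<lambda>c. convex hull (C - {c})) ` C" using iff by auto
  define pt where "pt = inv_into C (\<lambda>c. convex hull (C - {c}))"
  have pt: "pt f \<in> C" "f = convex hull (C - {pt f})" if "f facet_of P" for f
  proof -
    have f: "f \<in> (\<lambda>c. convex hull (C - {c})) ` C" using that I by blast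
    show "pt f \<in> C" unfolding pt_def using f by (rule inv_into_into)
    show "f = convex hull (C - {pt f})" unfolding pt_def using f_inv_into_f[OF f] by simp
  qed
  have ptc: "\<exists>f. f facet_of P \<and> pt f = c" if "c \<in> C" for c
    using that iff inv_into_f_f[OF inj that] unfolding pt_def by blast
  have ptP: "pt f \<in> P" if "f facet_of P" for f
    using pt(1)[OF that] C(3) by (simp add: hull_inc)
  show ?thesis
  proof (rule that[of pt]; (intro allI impI)?)
    fix f g assume fg: "f facet_of P" "g facet_of P" "f \<noteq> g"
    have "pt f \<noteq> pt g" using pt(2) fg by metis
    then have "pt f \<in> g" using pt(1)[OF fg(1)] pt(2)[OF fg(2)] by (metis DiffI hull_inc singletonD)
    then show "nrm g \<bullet> pt f = off g" using facet_mem[OF fg(2)] by simp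
  next
    fix f assume f: "f facet_of P"
    have "pt f \<notin> f" using notin[OF pt(1)[OF f]] pt(2)[OF f] by simp
    then show "nrm f \<bullet> pt f < off f" using facet_mem[OF f] facet_subset_le[OF f ptP[OF f]] ptP[OF f] by force
  next
    fix w assume w: "\<forall>f g. f facet_of P \<longrightarrow> g facet_of P \<longrightarrow> w \<bullet> (pt f - pt g) = 0"
    show "w = 0"
    proof (rule ccontr)
      assume "w \<noteq> 0"
      obtain c0 where c0: "c0 \<in> C" using c2 by fastforce
      have "C \<subseteq> {x. w \<bullet> x = w \<bullet> c0}"
      proof
        fix c assume "c \<in> C"
        then obtain f g where "f facet_of P" "pt f = c" "g facet_of P" "pt g = c0" using ptc c0 by metis
        then show "c \<in> {x. w \<bullet> x = w \<bullet> c0}" using w[rule_format, of f g] by (simp add: inner_diff_right)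
      qed
      then have "P \<subseteq> {x. w \<bullet> x = w \<bullet> c0}" unfolding C(3) by (intro hull_minimal convex_hyperplane)
      then have "interior P \<subseteq> interior {x. w \<bullet> x = w \<bullet> c0}" by (rule interior_mono)
      then show False using int \<open>w \<noteq> 0\<close> by (simp add: interior_hyperplane)
    qed
  next
    show "card {f. f facet_of P} = DIM('a) + 1" unfolding I using card_image[OF inj] cC by simp
  qed
qed

text \<open>Dimension 1 is excluded because the facets of an interval are parallel; from dimension 2
  on, an indecomposable simplex has no parallel facets (\<open>not_opposite\<close>).\<close>

locale coxeter_simplex = coxeter F for F :: "'a::euclidean_space set" +
  assumes simplex: "int DIM('a) simplex F" and conn: "\<not> decomposable F" and dim2: "DIM('a) \<ge> 2"
begin

abbreviation I :: "'a set set" where "I \<equiv> {f. f facet_of F}"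

lemma card_I: "card I \<ge> 3"
proof -
  have "card I = DIM('a) + 1" by (rule simplex_facets[OF simplex])
  then show ?thesis using dim2 by linarith
qed

text \<open>Let \<open>h f\<close> be the height of the vertex opposite to \<open>f\<close>.
  Evaluated at the vertices, a combination of the normals with coefficients \<open>d\<close>
  vanishes exactly if the products of \<open>d f\<close> and \<open>h f\<close> do not depend on
  \<open>f\<close>. So the kernel is spanned by the reciprocal heights.\<close>

lemma kernel:
  obtains c where "\<forall>f\<in>I. c f > 0" "(\<Sum>f\<in>I. c f *\<^sub>R nrm f) = 0"
    "\<forall>d. (\<Sum>f\<in>I. d f *\<^sub>R nrm f) = 0 \<longrightarrow> (\<exists>k. \<forall>f\<in>I. d f = k * c f)"
proof -
  obtain pt where pt: "\<forall>f g. f facet_of F \<longrightarrow> g facet_of F \<longrightarrow> f \<noteq> g \<longrightarrow> nrm g \<bullet> pt f = off g"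
    "\<forall>f. f facet_of F \<longrightarrow> nrm f \<bullet> pt f < off f"
    "\<forall>w. (\<forall>f g. f facet_of F \<longrightarrow> g facet_of F \<longrightarrow> w \<bullet> (pt f - pt g) = 0) \<longrightarrow> w = 0"
    "card I = DIM('a) + 1"
    by (rule simplex_facets[OF simplex])
  define h where "h = (\<lambda>f. off f - nrm f \<bullet> pt f)"
  have h: "h f > 0" if "f \<in> I" for f using pt(2) that by (simp add: h_def)
  \<comment> \<open>The vertex \<open>pt g\<close> lies on all facets except \<open>g\<close>, so
    only the term of \<open>g\<close> deviates from its offset, by the height.\<close>
  have ev: "(\<Sum>f\<in>I. d f *\<^sub>R nrm f) \<bullet> pt g = (\<Sum>f\<in>I. d f * off f) - d g * h g" if g: "g \<in> I" for d g
  proof -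
    have "(\<Sum>f\<in>I. d f *\<^sub>R nrm f) \<bullet> pt g = (\<Sum>f\<in>I. d f * (nrm f \<bullet> pt g))" by (simp add: inner_sum_left)
    also have "\<dots> = (\<Sum>f\<in>I. d f * off f - (if f = g then d g * h g else 0))"
      using pt(1)[rule_format, of g] g by (intro sum.cong refl) (auto simp: h_def algebra_simps)
    also have "\<dots> = (\<Sum>f\<in>I. d f * off f) - d g * h g"
      using g finite_facets by (simp add: sum_subtractf)
    finally show ?thesis .
  qed
  show ?thesis
  proof (rule that[of "\<lambda>f. 1 / h f"]; (intro ballI allI impI)?)
    fix f assume "f \<in> I"
    then show "1 / h f > 0" using h by simp
  next
    show "(\<Sum>f\<in>I. (1 / h f) *\<^sub>R nrm f) = 0"
    proof (rule pt(3)[rule_format])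
      fix f g assume "f facet_of F" "g facet_of F"
      then have fg: "f \<in> I" "g \<in> I" by auto
      then show "(\<Sum>f\<in>I. (1 / h f) *\<^sub>R nrm f) \<bullet> (pt f - pt g) = 0"
        using ev[OF fg(1), of "\<lambda>f. 1 / h f"] ev[OF fg(2), of "\<lambda>f. 1 / h f"] h[OF fg(1)] h[OF fg(2)]
        by (simp only: inner_diff_right) simp
    qed
  next
    fix d assume d: "(\<Sum>f\<in>I. d f *\<^sub>R nrm f) = 0"
    have "d f * h f = (\<Sum>f\<in>I. d f * off f)" if "f \<in> I" for f using ev[OF that, of d] d by simp
    then have "d f = (\<Sum>f\<in>I. d f * off f) * (1 / h f)" if "f \<in> I" for f
      using h[OF that] that by (simp add: eq_divide_eq)
    then show "\<exists>k. \<forall>f\<in>I. d f = k * (1 / h f)" by (intro exI[of _ "\<Sum>f\<in>I. d f * off f"]) simp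
  qed
qed

text \<open>The Gram form of the normals is positive semidefinite with a one-dimensional kernel spanned by
  a positive vector. So a nonnegative test vector on which the form is not positive must have full
  support.\<close>

lemma test_vector:
  assumes D: "D \<subseteq> I" "\<And>f. f \<in> D \<Longrightarrow> d f > 0" "D \<noteq> {}"
    and le: "(\<Sum>f\<in>D. d f *\<^sub>R nrm f) \<bullet> (\<Sum>f\<in>D. d f *\<^sub>R nrm f) \<le> 0"
  shows "D = I"
proof -
  obtain c where c: "\<forall>f\<in>I. c f > 0" "(\<Sum>f\<in>I. c f *\<^sub>R nrm f) = 0"
    "\<forall>d. (\<Sum>f\<in>I. d f *\<^sub>R nrm f) = 0 \<longrightarrow> (\<exists>k. \<forall>f\<in>I. d f = k * c f)"
    by (rule kernel)
  define e where "e = (\<lambda>f. if f \<in> D then d f else 0)"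
  have "(\<Sum>f\<in>D. d f *\<^sub>R nrm f) = 0" using le inner_ge_zero[of "\<Sum>f\<in>D. d f *\<^sub>R nrm f"] by (simp del: inner_ge_zero)
  moreover have "(\<Sum>f\<in>I. e f *\<^sub>R nrm f) = (\<Sum>f\<in>D. e f *\<^sub>R nrm f)"
    using D(1) finite_facets by (intro sum.mono_neutral_right) (auto simp: e_def)
  moreover have "(\<Sum>f\<in>D. e f *\<^sub>R nrm f) = (\<Sum>f\<in>D. d f *\<^sub>R nrm f)" by (intro sum.cong) (auto simp: e_def)
  ultimately obtain k where k: "\<forall>f\<in>I. e f = k * c f" using c(3)[rule_format, of e] by auto
  obtain g where g: "g \<in> D" using D(3) by blast
  then have "k * c g > 0" using k D(1,2) by (metis e_def subsetD)
  then have "k > 0" using c(1) g D(1) by (metis subsetD zero_less_mult_pos2)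
  then have "e f > 0" if "f \<in> I" for f using k c(1) that by simp
  then show ?thesis using D(1) unfolding e_def by (metis less_irrefl subsetI subset_antisym)
qed

section \<open>The dihedral angles of the simplex\<close>

lemma inner_nonpos: "f \<in> I \<Longrightarrow> g \<in> I \<Longrightarrow> f \<noteq> g \<Longrightarrow> nrm f \<bullet> nrm g \<le> 0"
  using normals_nonpos by simp

lemma inner_self: "f \<in> I \<Longrightarrow> nrm f \<bullet> nrm f = 1"
  using nrm_inner by simp

text \<open>Opposite normals would give a positive kernel vector supported on two facets, although
  there are at least three.\<close>

lemma not_opposite:
  assumes fg: "f \<in> I" "g \<in> I" "f \<noteq> g"
  shows "nrm g \<noteq> - nrm f"
proof
  assume "nrm g = - nrm f"
  then have "(\<Sum>h\<in>{f, g}. 1 *\<^sub>R nrm h) = 0" using fg(3) by simp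
  then have "{f, g} = I" using fg by (intro test_vector[of "{f, g}" "\<lambda>_. 1"]) auto
  then have "card I = 2" using fg(3) by (metis card_2_iff)
  then show False using card_I by simp
qed

lemma angle:
  assumes fg: "f \<in> I" "g \<in> I" "f \<noteq> g"
  obtains m :: nat where "m \<ge> 2" "nrm f \<bullet> nrm g = - cos (pi / m)" "coxeter_edge F f g = Edge (m - 2)"
proof (rule edge_cases[of f g])
  show "f facet_of F" "g facet_of F" "f \<noteq> g" using fg by auto
  assume "nrm g = - nrm f"
  then show ?thesis using not_opposite[OF fg] by blast
qed (rule that)

text \<open>Connectedness of the diagram, read off the Gram matrix: an edge that is not
  \<open>Edge 0\<close> has \<open>m \<ge> 3\<close> and therefore a negative inner product.\<close>

lemma connected_normals:
  assumes S: "S \<subseteq> I" "S \<noteq> {}" "S \<noteq> I"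
  obtains f g where "f \<in> S" "g \<in> I" "g \<notin> S" "nrm f \<bullet> nrm g < 0"
proof -
  have "\<exists>f\<in>S. \<exists>g\<in>I. g \<notin> S \<and> nrm f \<bullet> nrm g < 0"
  proof (rule ccontr)
    assume no: "\<not> ?thesis"
    obtain x y where xy: "x \<in> S" "y \<in> I" "y \<notin> S" using S by blast
    define R where "R = {(v, w). v \<in> I \<and> w \<in> I \<and> v \<noteq> w \<and> coxeter_edge F v w \<noteq> Edge 0}"
    have "(x, y) \<in> R\<^sup>*"
      using conn xy S(1) unfolding decomposable_def diagram_connected_def coxeter_diagram_def R_def by auto
    then have "y \<in> S"
    proof (induction rule: rtrancl_induct)
      case base then show ?case using xy by simp
    next
      case (step v w)
      have vw: "v \<in> I" "w \<in> I" "v \<noteq> w" "coxeter_edge F v w \<noteq> Edge 0" using step(2) by (auto simp: R_def)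
      obtain m :: nat where m: "m \<ge> 2" "nrm v \<bullet> nrm w = - cos (pi / m)" "coxeter_edge F v w = Edge (m - 2)"
        by (rule angle[OF vw(1-3)])
      have "m \<noteq> 2" using vw(4) m(3) by auto
      then have "m > 2" using m(1) by simp
      then have "pi / m < pi / 2" by (intro divide_strict_left_mono) auto
      then have "cos (pi / m) > 0" using m(1) by (intro cos_gt_zero_pi) (auto intro: less_trans[of _ 0])
      then have "nrm v \<bullet> nrm w < 0" using m(2) by simp
      then show ?case using no step(3) vw(2) by blast
    qed
    then show False using xy by simp
  qed
  then show ?thesis using that by blast
qed

text \<open>For distinct facets this is the cosine of the dihedral angle, so it is 0 exactly for
  nodes that are not joined.\<close>

definition adj :: "'a set \<Rightarrow> 'a set \<Rightarrow> real" where "adj f g = - (nrm f \<bullet> nrm g)"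

lemma adj_sym: "adj f g = adj g f"
  by (simp add: adj_def inner_commute)

lemma adj_nonneg: "f \<in> I \<Longrightarrow> g \<in> I \<Longrightarrow> f \<noteq> g \<Longrightarrow> adj f g \<ge> 0"
  using inner_nonpos by (simp add: adj_def)

text \<open>With \<open>x = pi / 5\<close> the identity \<open>cos (3 * x) = - cos (2 * x)\<close>
  is a cubic equation for \<open>cos x\<close>, and the factor \<open>cos x + 1\<close> splits
  off.\<close>

lemma cos_pi_5: "4 * (cos (pi / 5))\<^sup>2 = 2 * cos (pi / 5) + 1"
proof -
  define c where "c = cos (pi / 5)"
  have "cos (3 * (pi / 5)) = cos (pi - 2 * (pi / 5))" by (rule arg_cong[of _ _ cos]) simp
  then have "cos (3 * (pi / 5)) = - cos (2 * (pi / 5))" by (simp only: cos_pi_minus)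
  then have "4 * c ^ 3 - 3 * c = - (2 * c\<^sup>2 - 1)"
    unfolding c_def by (simp only: cos_treble_cos cos_double_cos)
  then have "(c + 1) * (4 * c\<^sup>2 - 2 * c - 1) = 0"
    by (simp add: power2_eq_square power3_eq_cube algebra_simps)
  moreover have "c > 0" unfolding c_def using pi_gt_zero by (intro cos_gt_zero_pi) linarith+
  ultimately have "4 * c\<^sup>2 - 2 * c - 1 = 0" by (metis add_pos_pos less_irrefl mult_eq_0_iff zero_less_one)
  then show ?thesis unfolding c_def by simp
qed

text \<open>Rational bounds suffice because the test vectors that follow for this angle are
  rational.\<close>

lemma cos_pi_5_bounds: "4 / 5 < cos (pi / 5)" "cos (pi / 5) < 81 / 100"
proof -
  define c where "c = cos (pi / 5)"
  have e: "4 * c\<^sup>2 = 2 * c + 1" using cos_pi_5 by (simp add: c_def)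
  have "c > 0" unfolding c_def using pi_gt_zero by (intro cos_gt_zero_pi) linarith+
  have "4 / 5 < c"
  proof (rule ccontr)
    assume "\<not> ?thesis"
    then have "c * c \<le> (4/5) * c" using \<open>c > 0\<close> by (intro mult_right_mono) auto
    then show False using e \<open>\<not> 4 / 5 < c\<close> by (simp add: power2_eq_square)
  qed
  moreover have "c < 81 / 100"
  proof (rule ccontr)
    assume "\<not> ?thesis"
    then have "(81/100) * c \<le> c * c" using \<open>c > 0\<close> by (intro mult_right_mono) auto
    moreover have "4 * (c * c) = 2 * c + 1" using e by (simp add: power2_eq_square)
    ultimately show False using \<open>\<not> c < 81 / 100\<close> by linarith
  qed
  ultimately show "4 / 5 < cos (pi / 5)" "cos (pi / 5) < 81 / 100" by (simp_all add: c_def)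
qed

lemma adj_values:
  assumes fg: "f \<in> I" "g \<in> I" "f \<noteq> g"
  shows "adj f g = 0 \<or> adj f g = 1 / 2 \<or> adj f g = sqrt 2 / 2 \<or> adj f g = cos (pi / 5) \<or> sqrt 3 / 2 \<le> adj f g"
proof -
  obtain m :: nat where m: "m \<ge> 2" "nrm f \<bullet> nrm g = - cos (pi / m)" by (rule angle[OF fg])
  have a: "adj f g = cos (pi / m)" using m(2) by (simp add: adj_def)
  consider "m = 2" | "m = 3" | "m = 4" | "m = 5" | "m \<ge> 6" using m(1) by linarith
  then show ?thesis
  proof cases
    case 5
    have "cos (pi / 6) \<le> cos (pi / m)"
      using 5 by (intro cos_monotone_0_pi_le divide_left_mono) auto
    then show ?thesis using a cos_30 by simp
  next
    case 1 then show ?thesis using a by simp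
  next
    case 2 then show ?thesis using a cos_60 by simp
  next
    case 3 then show ?thesis using a cos_45 by simp
  next
    case 4 then show ?thesis using a by simp
  qed
qed

lemma connected_vertex:
  assumes "D \<subseteq> I" "D \<noteq> {}" "D \<noteq> I"
  obtains f g where "f \<in> D" "g \<in> I" "g \<notin> D" "adj f g > 0"
  using connected_normals[OF assms] unfolding adj_def by (metis neg_0_less_iff_less)

text \<open>Positive semidefiniteness of the Gram form, ready for test vectors with up to five
  nodes. Smaller instances repeat a node with coefficient 0. A forbidden subdiagram is excluded by
  coefficients that make the right-hand side negative.\<close>

lemma gram5:
  assumes "{x, y, z, t, s} \<subseteq> I"
  shows "0 \<le> p\<^sup>2 + q\<^sup>2 + r\<^sup>2 + u\<^sup>2 + v\<^sup>2 - 2 * (p * q * adj x y + p * r * adj x z + p * u * adj x t + p * v * adj x s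
    + q * r * adj y z + q * u * adj y t + q * v * adj y s + r * u * adj z t + r * v * adj z s + u * v * adj t s)"
proof -
  let ?w = "p *\<^sub>R nrm x + q *\<^sub>R nrm y + r *\<^sub>R nrm z + u *\<^sub>R nrm t + v *\<^sub>R nrm s"
  have c: "nrm y \<bullet> nrm x = nrm x \<bullet> nrm y" "nrm z \<bullet> nrm x = nrm x \<bullet> nrm z" "nrm t \<bullet> nrm x = nrm x \<bullet> nrm t"
    "nrm s \<bullet> nrm x = nrm x \<bullet> nrm s" "nrm z \<bullet> nrm y = nrm y \<bullet> nrm z" "nrm t \<bullet> nrm y = nrm y \<bullet> nrm t"
    "nrm s \<bullet> nrm y = nrm y \<bullet> nrm s" "nrm t \<bullet> nrm z = nrm z \<bullet> nrm t" "nrm s \<bullet> nrm z = nrm z \<bullet> nrm s"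
    "nrm s \<bullet> nrm t = nrm t \<bullet> nrm s" by (rule inner_commute)+
  have s: "nrm x \<bullet> nrm x = 1" "nrm y \<bullet> nrm y = 1" "nrm z \<bullet> nrm z = 1" "nrm t \<bullet> nrm t = 1" "nrm s \<bullet> nrm s = 1"
    using assms inner_self by auto
  have "0 \<le> ?w \<bullet> ?w" by (rule inner_ge_zero)
  also have "?w \<bullet> ?w = p\<^sup>2 + q\<^sup>2 + r\<^sup>2 + u\<^sup>2 + v\<^sup>2 - 2 * (p * q * adj x y + p * r * adj x z + p * u * adj x t + p * v * adj x s
    + q * r * adj y z + q * u * adj y t + q * v * adj y s + r * u * adj z t + r * v * adj z s + u * v * adj t s)"
    unfolding adj_def inner_add_left inner_add_right inner_scaleR_left inner_scaleR_right c s
    by (simp add: power2_eq_square algebra_simps)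
  finally show ?thesis .
qed

text \<open>After \<open>1 / 2\<close> the next possible value is \<open>sqrt 2 / 2\<close>, and
  \<open>7 / 10\<close> is a rational number just below it.\<close>

lemma adj_ge:
  assumes "f \<in> I" "g \<in> I" "f \<noteq> g" "adj f g > 0"
  shows "1 / 2 \<le> adj f g" "adj f g \<noteq> 1 / 2 \<Longrightarrow> 7 / 10 \<le> adj f g"
proof -
  have s2: "7 / 5 \<le> sqrt 2" by (rule real_le_rsqrt) (simp add: power2_eq_square)
  have s3: "7 / 5 \<le> sqrt 3" by (rule real_le_rsqrt) (simp add: power2_eq_square)
  show "1 / 2 \<le> adj f g" "adj f g \<noteq> 1 / 2 \<Longrightarrow> 7 / 10 \<le> adj f g"
    using adj_values[OF assms(1-3)] assms(4) cos_pi_5_bounds s2 s3 by argo+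
qed

text \<open>The test vector with entries 2, \<open>sqrt 3\<close>, 1 is the kernel vector of the
  affine diagram of \<open>G\<^sub>2\<close>, where \<open>adj x y = sqrt 3 / 2\<close> and
  \<open>adj x z = 1 / 2\<close>. A larger value between \<open>x\<close> and \<open>y\<close> makes
  the form negative. A third node \<open>z\<close> exists by connectedness.\<close>

lemma adj_le:
  assumes xy: "x \<in> I" "y \<in> I" "x \<noteq> y"
  shows "adj x y \<le> sqrt 3 / 2"
proof (rule ccontr)
  assume "\<not> ?thesis"
  then have big: "sqrt 3 / 2 < adj x y" by simp
  have no: False if z: "z \<in> I" "z \<noteq> x" "z \<noteq> y" "adj x z > 0" and ab: "x \<in> I" "y \<in> I" "x \<noteq> y" "sqrt 3 / 2 < adj x y"
    for x y z
  proof -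
    have 1: "1/2 \<le> adj x z" using adj_ge(1)[of x z] z ab by auto
    have 2: "0 \<le> adj y z" using adj_nonneg z ab by auto
    have "0 \<le> 4 + 3 + 1 - 2 * (2 * sqrt 3 * adj x y + 2 * adj x z + sqrt 3 * adj y z)"
      using gram5[of x y z z z 2 "sqrt 3" 1 0 0] z ab by simp
    moreover have "sqrt 3 * (sqrt 3 / 2) < sqrt 3 * adj x y" using ab by (intro mult_strict_left_mono) auto
    then have "3 / 2 < sqrt 3 * adj x y" by simp
    moreover have "0 \<le> sqrt 3 * adj y z" using 2 by simp
    ultimately show False using 1 by argo
  qed
  have "{x, y} \<noteq> I"
  proof
    assume "{x, y} = I"
    then show False using card_I card_2_iff[of I] xy(3) by auto
  qed
  then obtain f g where fg: "f \<in> {x, y}" "g \<in> I" "g \<notin> {x, y}" "adj f g > 0"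
    using connected_vertex[of "{x, y}"] xy by blast
  show False
  proof (cases "f = x")
    case True then show False using no[of g x y] fg xy big by auto
  next
    case False then show False using no[of g y x] fg xy big adj_sym[of x y] by auto
  qed
qed

lemma kernel_positive:
  obtains c where "\<forall>f\<in>I. c f > 0" "\<forall>g\<in>I. c g = (\<Sum>f\<in>I - {g}. c f * adj g f)"
proof -
  obtain c where c: "\<forall>f\<in>I. c f > 0" "(\<Sum>f\<in>I. c f *\<^sub>R nrm f) = 0"
    "\<forall>d. (\<Sum>f\<in>I. d f *\<^sub>R nrm f) = 0 \<longrightarrow> (\<exists>k. \<forall>f\<in>I. d f = k * c f)"
    by (rule kernel)
  have "c g = (\<Sum>f\<in>I - {g}. c f * adj g f)" if g: "g \<in> I" for g
  proof -
    have "0 = nrm g \<bullet> (\<Sum>f\<in>I. c f *\<^sub>R nrm f)" using c(2) by simp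
    also have "\<dots> = (\<Sum>f\<in>I. c f * (nrm g \<bullet> nrm f))" by (simp add: inner_sum_right)
    also have "\<dots> = c g * (nrm g \<bullet> nrm g) + (\<Sum>f\<in>I - {g}. c f * (nrm g \<bullet> nrm f))"
      by (rule sum.remove[OF finite_facets g])
    also have "\<dots> = c g - (\<Sum>f\<in>I - {g}. c f * adj g f)"
      using inner_self[OF g] by (simp add: adj_def sum_negf)
    finally show ?thesis by simp
  qed
  then show ?thesis using that c(1) by blast
qed

text \<open>Test vectors force the diagram to continue from \<open>y\<close> and \<open>x\<close> as
  a chain with simple edges. The chains with three and four nodes, \<open>H\<^sub>3\<close> and
  \<open>H\<^sub>4\<close>, have a definite Gram form, so they violate the kernel equations; with a
  fifth node the form takes a negative value.\<close>

lemma adj_not_pi_5_leaf: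
  assumes xy: "x \<in> I" "y \<in> I" "x \<noteq> y" "adj x y = cos (pi / 5)"
    and y: "\<And>w. w \<in> I \<Longrightarrow> w \<noteq> x \<Longrightarrow> w \<noteq> y \<Longrightarrow> adj y w = 0"
  shows False
proof -
  note b = cos_pi_5_bounds[folded xy(4)]
  \<comment> \<open>The kernel equations of the chains with three and four nodes would require this
    square to be \<open>3 / 4\<close> and \<open>2 / 3\<close>; the bound \<open>81 / 100\<close> is
    just good enough to stay below the latter.\<close>
  have sq: "(adj x y)\<^sup>2 < 6561 / 10000"
    using power_strict_mono[OF b(2), of 2] b(1) by (simp add: power2_eq_square)
  obtain c where c: "\<forall>f\<in>I. c f > 0" "\<forall>g\<in>I. c g = (\<Sum>f\<in>I - {g}. c f * adj g f)" by (rule kernel_positive)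
  have "{x, y} \<noteq> I"
  proof
    assume "{x, y} = I"
    then show False using card_I card_2_iff[of I] xy(3) by auto
  qed
  then obtain f z where fz: "f \<in> {x, y}" "z \<in> I" "z \<notin> {x, y}" "adj f z > 0"
    using connected_vertex[of "{x, y}"] xy by blast
  have fx: "f = x" using fz y[of z] by auto
  have z: "z \<in> I" "z \<noteq> x" "z \<noteq> y" "adj x z > 0" using fz fx by auto
  have xz: "1/2 \<le> adj x z" "adj x z \<noteq> 1/2 \<Longrightarrow> 7/10 \<le> adj x z" using adj_ge[of x z] xy z by auto
  have x: "adj x w = 0" if w: "w \<in> I" "w \<noteq> x" "w \<noteq> y" "w \<noteq> z" for w
  proof (rule ccontr)
    assume "adj x w \<noteq> 0"
    then have "1/2 \<le> adj x w" using adj_ge[of x w] adj_nonneg[of x w] w xy by auto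
    moreover have "0 \<le> adj z w" using adj_nonneg w z by auto
    ultimately show False
      using gram5[of x y z w w 2 "8/5" 1 1 0] w xy z xz b y[of z] y[of w] by (simp add: power2_eq_square)
  qed
  have xz2: "adj x z = 1/2"
  proof (rule ccontr)
    assume "\<not> ?thesis"
    then show False
      using gram5[of x y z z z 2 "8/5" "7/5" 0 0] xy z xz b y[of z] by (simp add: power2_eq_square)
  qed
  show False
  proof (cases "I = {x, y, z}")
    case True
    have r: "I - {y} = {x, z}" "I - {x} = {y, z}" "I - {z} = {x, y}" using True xy z by auto
    have e1: "c y = c x * adj x y" using c(2)[rule_format, OF xy(2)] y[of z] xy z unfolding r by (simp add: adj_sym[of y x])
    have e2: "c x = c y * adj x y + c z / 2" using c(2)[rule_format, OF xy(1)] z xz2 unfolding r by simp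
    have e3: "c z = c x / 2" using c(2)[rule_format, OF z(1)] xy y[of z] z xz2 adj_sym[of z] unfolding r by simp
    have "c x * (3/4 - (adj x y)\<^sup>2) = c x * (3/4) - c x * adj x y * adj x y"
        by (simp only: power2_eq_square right_diff_distrib mult.assoc)
      then have "c x * (3/4 - (adj x y)\<^sup>2) = 0" using e2 unfolding e1 e3 by linarith
    moreover have "c x > 0" using c(1) xy by blast
    ultimately show False using sq by simp
  next
    case False
    then obtain f t where ft: "f \<in> {x, y, z}" "t \<in> I" "t \<notin> {x, y, z}" "adj f t > 0"
      using connected_vertex[OF _ _ False[symmetric]] xy(1,2) z(1) by blast
    have t: "t \<in> I" "t \<noteq> x" "t \<noteq> y" "t \<noteq> z" "adj z t > 0" using ft x[of t] y[of t] by auto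
    have zt: "1/2 \<le> adj z t" "adj z t \<noteq> 1/2 \<Longrightarrow> 7/10 \<le> adj z t" using adj_ge[of z t] z t by auto
    have zt2: "adj z t = 1/2"
    proof (rule ccontr)
      assume "\<not> ?thesis"
      then show False
        using gram5[of x y z t t 3 "5/2" 2 "7/5" 0] xy z t xz2 zt b y[of z] y[of t] x[of t] by (simp add: power2_eq_square)
    qed
    have zw: "adj z w = 0" if w: "w \<in> I" "w \<noteq> x" "w \<noteq> y" "w \<noteq> z" "w \<noteq> t" for w
    proof (rule ccontr)
      assume "adj z w \<noteq> 0"
      then have "1/2 \<le> adj z w" using adj_ge[of z w] adj_nonneg[of z w] w z by auto
      moreover have "0 \<le> adj t w" using adj_nonneg w t by auto
      ultimately show False
        using gram5[of x y z t w 3 "5/2" 2 1 1] w xy z t xz2 zt b y[of z] y[of w] y[of t] x[of t] x[of w]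
        by (simp add: power2_eq_square)
    qed
    show False
    proof (cases "I = {x, y, z, t}")
      case True
      have r: "I - {y} = {x, z, t}" "I - {x} = {y, z, t}" "I - {z} = {x, y, t}" "I - {t} = {x, y, z}"
        using True xy z t by auto
      have e1: "c y = c x * adj x y"
        using c(2)[rule_format, OF xy(2)] y[of z] y[of t] xy z t unfolding r by (simp add: adj_sym[of y x])
      have e2: "c x = c y * adj x y + c z / 2" using c(2)[rule_format, OF xy(1)] z t x[of t] xz2 unfolding r by simp
      have "c z = c x / 2 + c t / 2"
        using c(2)[rule_format, OF z(1)] xy y[of z] z t xz2 zt2 adj_sym[of z x] adj_sym[of z y] unfolding r by simp
      moreover have "c t = c z / 2"
        using c(2)[rule_format, OF t(1)] xy y[of t] x[of t] z t zt2 adj_sym[of t] unfolding r by simp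
      ultimately have e3: "c z = c x * (2 / 3)" by linarith
      have "c x * (2/3 - (adj x y)\<^sup>2) = c x * (2/3) - c x * adj x y * adj x y"
        by (simp only: power2_eq_square right_diff_distrib mult.assoc)
      then have "c x * (2/3 - (adj x y)\<^sup>2) = 0" using e2 unfolding e1 e3 by linarith
      moreover have "c x > 0" using c(1) xy by blast
      ultimately show False using sq by simp
    next
      case False
      then obtain f s where fs: "f \<in> {x, y, z, t}" "s \<in> I" "s \<notin> {x, y, z, t}" "adj f s > 0"
        using connected_vertex[OF _ _ False[symmetric]] xy(1,2) z(1) t(1) by blast
      have s: "s \<in> I" "s \<noteq> x" "s \<noteq> y" "s \<noteq> z" "s \<noteq> t" "adj t s > 0" using fs x[of s] y[of s] zw[of s] by auto
      then have "1/2 \<le> adj t s" using adj_ge[of t s] t by auto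
      \<comment> \<open>The coefficients were chosen to make the form slightly negative: with the
        lower bound \<open>4 / 5\<close> the sum of squares is 62.64 and the mixed terms are at
        least 62.864.\<close>
      then show False
        using gram5[of x y z t s "26/5" "21/5" "18/5" 2 1] xy z t s xz2 zt2 b y[of z] y[of s] y[of t] x[of t] x[of s] zw[of s]
        by (simp add: power2_eq_square)
    qed
  qed
qed

text \<open>If both ends of the edge had further neighbours, the form would already be negative on a
  triangle or on a chain of four nodes. So one end is a leaf.\<close>

lemma adj_not_pi_5:
  assumes xy: "x \<in> I" "y \<in> I" "x \<noteq> y"
  shows "adj x y \<noteq> cos (pi / 5)"
proof
  assume a: "adj x y = cos (pi / 5)"
  note b = cos_pi_5_bounds[folded a]
  have two: False if z: "z \<in> I" "z \<noteq> x" "z \<noteq> y" "adj x z \<noteq> 0" and t: "t \<in> I" "t \<noteq> x" "t \<noteq> y" "adj y t \<noteq> 0" for z t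
  proof -
    have p: "1/2 \<le> adj x z" "1/2 \<le> adj y t" "0 \<le> adj x t" "0 \<le> adj y z"
      using adj_ge(1)[of x z] adj_ge(1)[of y t] adj_nonneg[of x z] adj_nonneg[of y t] adj_nonneg[of x t]
        adj_nonneg[of y z] z t xy by auto
    show False
    proof (cases "z = t")
      case True
      then show False using gram5[of x y z z z 1 1 1 0 0] z xy p b by simp
    next
      case False
      then have "0 \<le> adj z t" using adj_nonneg z t by auto
      then show False using gram5[of x y z t t 2 2 1 1 0] z t xy p b by simp
    qed
  qed
  show False
  proof (cases "\<exists>t. t \<in> I \<and> t \<noteq> x \<and> t \<noteq> y \<and> adj y t \<noteq> 0")
    case False
    then show False by (intro adj_not_pi_5_leaf[OF xy a]) blast
  next
    case True
    then show False using two xy a by (intro adj_not_pi_5_leaf[of y x]) (auto simp: adj_sym[of y x])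
  qed
qed

section \<open>Squared lengths that make the normals crystallographic\<close>

lemma adj_cases:
  assumes fg: "f \<in> I" "g \<in> I" "f \<noteq> g"
  obtains k :: nat where "k \<in> {0, 1, 2, 3}" "adj f g = sqrt (real k) / 2"
proof -
  have "adj f g = 0 \<or> adj f g = 1 / 2 \<or> adj f g = sqrt 2 / 2 \<or> adj f g = sqrt 3 / 2"
    using adj_values[OF fg] adj_not_pi_5[OF fg] order_antisym[OF adj_le[OF fg]] by blast
  then show ?thesis
  proof (elim disjE)
    assume "adj f g = 0" then show ?thesis by (intro that[of 0]) auto
  next
    assume "adj f g = 1 / 2" then show ?thesis by (intro that[of 1]) auto
  next
    assume "adj f g = sqrt 2 / 2" then show ?thesis by (intro that[of 2]) auto
  next
    assume "adj f g = sqrt 3 / 2" then show ?thesis by (intro that[of 3]) auto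
  qed
qed

text \<open>Here \<open>k\<close> is four times the squared cosine. If the squared lengths have the
  ratio \<open>k\<close>, then the Cartan numbers of the two scaled normals are -1 and
  \<open>- k\<close>.\<close>

definition compatible :: "('a set \<Rightarrow> nat) \<Rightarrow> 'a set \<Rightarrow> 'a set \<Rightarrow> bool" where
  "compatible N f g \<longleftrightarrow> (\<exists>k::nat. adj f g = sqrt (real k) / 2 \<and> (N g = k * N f \<or> N f = k * N g))"

definition inner_node :: "'a set set \<Rightarrow> 'a set \<Rightarrow> bool" where
  "inner_node E f \<longleftrightarrow> (\<exists>g\<in>E. \<exists>h\<in>E. g \<noteq> h \<and> g \<noteq> f \<and> h \<noteq> f \<and> adj f g > 0 \<and> adj f h > 0)"

definition leafless :: "'a set set \<Rightarrow> bool" where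
  "leafless E \<longleftrightarrow> (\<forall>f\<in>E. inner_node E f)"

lemma compatible_sym: "compatible N f g \<Longrightarrow> compatible N g f"
  unfolding compatible_def by (subst adj_sym) blast

text \<open>Removing leaves one after the other either exhausts a set of nodes, in which case squared lengths can be
  assigned in the opposite order, or leaves a subdiagram without leaves.\<close>

lemma leaf_removal:
  assumes "D \<subseteq> I"
  shows "(\<exists>E\<subseteq>D. E \<noteq> {} \<and> leafless E) \<or>
    (\<exists>N. (\<forall>f\<in>D. N f > 0) \<and> (\<forall>f\<in>D. \<forall>g\<in>D. f \<noteq> g \<longrightarrow> adj f g > 0 \<longrightarrow> compatible N f g))"
  using finite_subset[OF assms finite_facets] assms
proof (induction D rule: finite_psubset_induct)
  case (psubset D)
  show ?case
  proof (cases "D = {} \<or> leafless D")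
    case True
    then show ?thesis
    proof
      assume "D = {}" then show ?thesis by simp
    next
      assume l: "leafless D"
      show ?thesis
      proof (cases "D = {}")
        case True then show ?thesis by simp
      next
        case False then show ?thesis using l by (intro disjI1 exI[of _ D] conjI order_refl)
      qed
    qed
  next
    case False
    then obtain f where f0: "f \<in> D" "\<not> inner_node D f" unfolding leafless_def by blast
    have f: "f \<in> D" "g = h" if "g \<in> D" "h \<in> D" "g \<noteq> f" "h \<noteq> f" "adj f g > 0" "adj f h > 0" for g h
    proof -
      show "f \<in> D" by (rule f0(1))
      show "g = h" using f0(2) that unfolding inner_node_def by blast
    qed
    have sub: "D - {f} \<subset> D" "D - {f} \<subseteq> I" using f0(1) psubset.prems by auto
    show ?thesis
    proof (cases "\<exists>E\<subseteq>D - {f}. E \<noteq> {} \<and> leafless E")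
      case True
      then obtain E where E: "E \<subseteq> D - {f}" "E \<noteq> {} \<and> leafless E" by (elim exE conjE) simp
      then have "E \<subseteq> D" by blast
      then show ?thesis using E(2) by (intro disjI1 exI[of _ E] conjI) auto
    next
      case False
      have "\<exists>N. (\<forall>f\<in>D - {f}. N f > 0) \<and> (\<forall>g\<in>D - {f}. \<forall>h\<in>D - {f}. g \<noteq> h \<longrightarrow> adj g h > 0 \<longrightarrow> compatible N g h)"
        by (rule disjE[OF psubset.IH[OF sub] notE[OF False]])
      then obtain N where N0: "\<forall>g\<in>D - {f}. N g > (0::nat)"
        "\<forall>g\<in>D - {f}. \<forall>h\<in>D - {f}. g \<noteq> h \<longrightarrow> adj g h > 0 \<longrightarrow> compatible N g h"
        by auto
      have N: "\<And>g. g \<in> D - {f} \<Longrightarrow> N g > 0"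
        "\<And>g h. g \<in> D - {f} \<Longrightarrow> h \<in> D - {f} \<Longrightarrow> g \<noteq> h \<Longrightarrow> adj g h > 0 \<Longrightarrow> compatible N g h"
        using N0 by simp_all
      obtain n where n: "n > 0" "\<And>g. g \<in> D - {f} \<Longrightarrow> adj f g > 0 \<Longrightarrow> compatible (N(f := n)) g f"
      proof (cases "\<exists>g\<in>D - {f}. adj f g > 0")
        case True
        then obtain g where g: "g \<in> D - {f}" "adj f g > 0" by blast
        obtain k :: nat where k: "k \<in> {0, 1, 2, 3}" "adj f g = sqrt (real k) / 2"
        proof (rule adj_cases[of f g])
          show "f \<in> I" "g \<in> I" "f \<noteq> g" using f0(1) g(1) psubset.prems by auto
        qed
        have k0: "k \<noteq> 0" using k(2) g(2) by (intro notI) simp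
        show ?thesis
        \<comment> \<open>The removed node has \<open>g\<close> as its only neighbour, so its length
          can be chosen freely to suit this one edge.\<close>
        proof (rule that[of "k * N g"])
          show "k * N g > 0" using k0 N(1)[OF g(1)] by simp
          fix h assume h: "h \<in> D - {f}" "adj f h > 0"
          have "h = g" using f(2)[of h g] h g by blast
          then show "compatible (N(f := k * N g)) h f" using g k(2) adj_sym[of g f] by (auto simp: compatible_def)
        qed
      next
        case False
        show ?thesis by (rule that[of 1]) (use False in auto)
      qed
      let ?N = "N(f := n)"
      have "?N g > 0" if "g \<in> D" for g using N(1)[of g] n(1) that by auto
      moreover have "compatible ?N g h" if gh: "g \<in> D" "h \<in> D" "g \<noteq> h" "adj g h > 0" for g h
      proof -
        consider "g = f" | "h = f" | "g \<noteq> f" "h \<noteq> f" by blast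
        then show ?thesis
        proof cases
          case 1 then show ?thesis using n(2)[of h] gh compatible_sym[of _ h g] by auto
        next
          case 2 then show ?thesis using n(2)[of g] gh adj_sym[of f g] by auto
        next
          case 3 then have "compatible N g h" using N(2)[of g h] gh by auto
          then show ?thesis using 3 by (simp add: compatible_def)
        qed
      qed
      ultimately have "(\<forall>g\<in>D. ?N g > 0) \<and> (\<forall>g\<in>D. \<forall>h\<in>D. g \<noteq> h \<longrightarrow> adj g h > 0 \<longrightarrow> compatible ?N g h)"
        by (intro conjI ballI impI)
      then show ?thesis by (intro disjI2 exI[of _ ?N])
    qed
  qed
qed

text \<open>Every node has two neighbours with weight at least \<open>1 / 2\<close>, so each row sum
  is at least 1 and the all-ones vector is a test vector. Equality throughout then forces all
  weights to be \<open>1 / 2\<close>: the diagram is a cycle of simple edges.\<close>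

lemma leafless_half:
  assumes E: "E \<subseteq> I" "E \<noteq> {}"
    and two: "leafless E"
  shows "E = I" "f \<in> I \<Longrightarrow> g \<in> I \<Longrightarrow> f \<noteq> g \<Longrightarrow> adj f g > 0 \<Longrightarrow> adj f g = 1 / 2"
proof -
  let ?r = "\<lambda>f. \<Sum>g\<in>E - {f}. adj f g"
  have fin: "finite E" by (rule finite_subset[OF E(1) finite_facets])
  have pair: "adj f g + adj f h \<le> ?r f" if "f \<in> E" "g \<in> E" "h \<in> E" "g \<noteq> h" "g \<noteq> f" "h \<noteq> f" for f g h
  proof -
    have "(\<Sum>g\<in>{g, h}. adj f g) \<le> ?r f"
      using that fin E(1) adj_nonneg by (intro sum_mono2) auto
    then show ?thesis using that(4) by simp
  qed
  have r1: "1 \<le> ?r f" if f: "f \<in> E" for f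
  proof -
    have "inner_node E f" using two f unfolding leafless_def by blast
    then obtain g h where gh: "g \<in> E" "h \<in> E" "g \<noteq> h" "g \<noteq> f" "h \<noteq> f" "adj f g > 0" "adj f h > 0"
      unfolding inner_node_def by blast
    have "1 / 2 \<le> adj f g" "1 / 2 \<le> adj f h" using adj_ge(1)[of f g] adj_ge(1)[of f h] gh f E(1) by auto
    then show ?thesis using pair[OF f gh(1-5)] by linarith
  qed
  let ?w = "\<Sum>f\<in>E. nrm f"
  have row: "nrm f \<bullet> ?w = 1 - ?r f" if f: "f \<in> E" for f
  proof -
    have "nrm f \<bullet> ?w = (\<Sum>g\<in>E. nrm f \<bullet> nrm g)" by (rule inner_sum_right)
    also have "\<dots> = nrm f \<bullet> nrm f + (\<Sum>g\<in>E - {f}. nrm f \<bullet> nrm g)" by (rule sum.remove[OF fin f])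
    also have "\<dots> = 1 - ?r f" using inner_self f E(1) by (auto simp: adj_def sum_negf)
    finally show ?thesis .
  qed
  have nw: "?w \<bullet> ?w = (\<Sum>f\<in>E. 1 - ?r f)"
    unfolding inner_sum_left[of nrm E ?w] by (intro sum.cong refl row)
  have "(\<Sum>f\<in>E. 1 - ?r f) \<le> 0" using r1 by (intro sum_nonpos) simp
  then have "(\<Sum>f\<in>E. 1 *\<^sub>R nrm f) \<bullet> (\<Sum>f\<in>E. 1 *\<^sub>R nrm f) \<le> 0" using nw by simp
  then show EI: "E = I" using E by (intro test_vector[where d = "\<lambda>_. 1"]) auto
  have "(\<Sum>f\<in>E. ?r f - 1) = - (\<Sum>f\<in>E. 1 - ?r f)" by (simp add: sum_subtractf)
  also have "\<dots> \<le> 0" using nw inner_ge_zero[of ?w] by linarith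
  finally have "(\<Sum>f\<in>E. ?r f - 1) = 0" using r1 by (intro order_antisym sum_nonneg) auto
  then have r: "?r f = 1" if "f \<in> E" for f
    using sum_nonneg_eq_0_iff[OF fin, of "\<lambda>f. ?r f - 1"] r1 that by simp
  assume fg: "f \<in> I" "g \<in> I" "f \<noteq> g" "adj f g > 0"
  have "inner_node E f" using two fg(1) EI unfolding leafless_def by blast
  then obtain a b where ab: "a \<in> E" "b \<in> E" "a \<noteq> b" "a \<noteq> f" "b \<noteq> f" "adj f a > 0" "adj f b > 0"
    unfolding inner_node_def by blast
  obtain h where h: "h \<in> E" "h \<noteq> f" "h \<noteq> g" "adj f h > 0"
    by (cases "a = g") (use that[of a] that[of b] ab in auto)
  have "1 / 2 \<le> adj f g" "1 / 2 \<le> adj f h" using adj_ge(1)[of f g] adj_ge(1)[of f h] h fg E(1) by auto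
  moreover have "adj f g + adj f h \<le> 1" using pair[of f g h] h fg EI r[of f] by auto
  ultimately show "adj f g = 1 / 2" by linarith
qed

text \<open>A cycle, where leaf removal gets stuck, has only simple edges, and the constant length 1
  serves.\<close>

lemma squared_lengths:
  obtains N where "\<forall>f\<in>I. N f > 0" "\<forall>f\<in>I. \<forall>g\<in>I. f \<noteq> g \<longrightarrow> adj f g > 0 \<longrightarrow> compatible N f g"
proof (cases "\<exists>E\<subseteq>I. E \<noteq> {} \<and> leafless E")
  case True
  then obtain E where E: "E \<subseteq> I" "E \<noteq> {}" "leafless E" by blast
  show ?thesis
  proof (rule that[of "\<lambda>_. 1"]; (intro ballI impI)?)
    fix f g assume "f \<in> I" "g \<in> I" "f \<noteq> g" "adj f g > 0"
    then have "adj f g = 1 / 2" using leafless_half(2)[OF E] by blast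
    then show "compatible (\<lambda>_. 1) f g" unfolding compatible_def by (intro exI[of _ 1]) simp
  qed simp
next
  case False
  have "\<exists>N. (\<forall>f\<in>I. N f > 0) \<and> (\<forall>f\<in>I. \<forall>g\<in>I. f \<noteq> g \<longrightarrow> adj f g > 0 \<longrightarrow> compatible N f g)"
    by (rule disjE[OF leaf_removal[OF order_refl] notE[OF False]])
  then show ?thesis using that by (elim exE conjE)
qed

lemma scaled_normals:
  obtains \<alpha> where "\<forall>f\<in>I. \<exists>t>0. \<alpha> f = t *\<^sub>R nrm f" "\<forall>f\<in>I. \<exists>n::nat. n > 0 \<and> \<alpha> f \<bullet> \<alpha> f = real n"
    "\<forall>f\<in>I. \<forall>g\<in>I. 2 * (\<alpha> f \<bullet> \<alpha> g) / (\<alpha> f \<bullet> \<alpha> f) \<in> \<int>"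
proof -
  obtain N where N: "\<forall>f\<in>I. N f > 0" "\<forall>f\<in>I. \<forall>g\<in>I. f \<noteq> g \<longrightarrow> adj f g > 0 \<longrightarrow> compatible N f g"
    by (rule squared_lengths)
  define \<alpha> where "\<alpha> = (\<lambda>f. sqrt (real (N f)) *\<^sub>R nrm f)"
  have s: "\<alpha> f \<bullet> \<alpha> f = real (N f)" if "f \<in> I" for f using inner_self[OF that] by (simp add: \<alpha>_def)
  show ?thesis
  proof (rule that[of \<alpha>]; (intro ballI)?)
    fix f assume f: "f \<in> I"
    then show "\<exists>t>0. \<alpha> f = t *\<^sub>R nrm f" using N(1) by (intro exI[of _ "sqrt (real (N f))"]) (simp add: \<alpha>_def)
    show "\<exists>n::nat. n > 0 \<and> \<alpha> f \<bullet> \<alpha> f = real n" using s[OF f] N(1) f by blast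
  next
    fix f g assume f: "f \<in> I" and g: "g \<in> I"
    have pos: "N f > 0" "N g > 0" using N(1) f g by auto
    show "2 * (\<alpha> f \<bullet> \<alpha> g) / (\<alpha> f \<bullet> \<alpha> f) \<in> \<int>"
    proof (cases "f = g")
      case True
      then show ?thesis using s[OF f] pos by simp
    next
      case ne: False
      have e: "2 * (\<alpha> f \<bullet> \<alpha> g) = - (2 * adj f g * (sqrt (real (N f)) * sqrt (real (N g))))"
        by (simp add: \<alpha>_def adj_def)
      show ?thesis
      proof (cases "adj f g = 0")
        case True then show ?thesis using e by simp
      next
        case False
        then have "compatible N f g" using N(2) f g ne adj_nonneg[OF f g ne] by simp
        then obtain k :: nat where k: "adj f g = sqrt (real k) / 2" "N g = k * N f \<or> N f = k * N g"
          unfolding compatible_def by blast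
        from k(2) show ?thesis
        proof
          assume 1: "N g = k * N f"
          have "2 * adj f g * (sqrt (real (N f)) * sqrt (real (N g))) = sqrt k * (sqrt (N f) * sqrt (k * N f))"
            unfolding k(1) 1 by simp
          also have "\<dots> = (sqrt k * sqrt k) * (sqrt (N f) * sqrt (N f))"
            unfolding of_nat_mult real_sqrt_mult by (simp only: ac_simps)
          also have "\<dots> = real k * real (N f)" by simp
          finally have "2 * (\<alpha> f \<bullet> \<alpha> g) / (\<alpha> f \<bullet> \<alpha> f) = - real k" using e s[OF f] pos by simp
          then show ?thesis by simp
        next
          assume 1: "N f = k * N g"
          have "2 * adj f g * (sqrt (real (N f)) * sqrt (real (N g))) = sqrt k * (sqrt (k * N g) * sqrt (N g))"
            unfolding k(1) 1 by simp
          also have "\<dots> = (sqrt k * sqrt k) * (sqrt (N g) * sqrt (N g))"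
            unfolding of_nat_mult real_sqrt_mult by (simp only: ac_simps)
          also have "\<dots> = real (N f)" using 1 by simp
          finally have "2 * (\<alpha> f \<bullet> \<alpha> g) / (\<alpha> f \<bullet> \<alpha> f) = - 1" using e s[OF f] pos by simp
          then show ?thesis by simp
        qed
      qed
    qed
  qed
qed

end

section \<open>The root system of a Euclidean reflection group\<close>

lemma reflection_eq_rf: "reflection a b x = rf a x + (2 * b / (a \<bullet> a)) *\<^sub>R a"
proof -
  have "2 * (a \<bullet> x - b) / (a \<bullet> a) = 2 * (a \<bullet> x) / (a \<bullet> a) - 2 * b / (a \<bullet> a)"
    by (simp add: diff_divide_distrib)
  then show ?thesis unfolding reflection_def by (simp add: scaleR_left_diff_distrib)
qed

lemma linear_part_reflection: "linear_part (reflection a b) = rf a"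
  by (rule ext) (simp add: linear_part_def reflection_def diff_divide_distrib scaleR_left_diff_distrib)

lemma reflection_involution: "reflection a b (reflection a b x) = x"
proof -
  have "rf a (reflection a b x) = x - (2 * b / (a \<bullet> a)) *\<^sub>R a"
    by (subst reflection_eq_rf) (simp add: rf_add rf_scale)
  then show ?thesis by (subst reflection_eq_rf) simp
qed

lemma isom_linear_part:
  assumes "f \<in> carrier isom_group"
  shows "orthogonal_transformation (linear_part f)" "f x = linear_part f x + f 0"
proof -
  have d: "dist (f x) (f y) = dist x y" for x y using assms by (simp add: isom_group_def)
  have "dist (linear_part f x) (linear_part f y) = dist x y" for x y
    using d[of x y] by (simp add: linear_part_def dist_norm)
  then show "orthogonal_transformation (linear_part f)"
    by (simp add: orthogonal_transformation_isometry linear_part_def)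
qed (simp add: linear_part_def)

lemma isom_diff: "f \<in> carrier isom_group \<Longrightarrow> f x - f y = linear_part f (x - y)"
  using linear_diff[OF orthogonal_transformation_linear[OF isom_linear_part(1)]]
  by (metis add_diff_cancel_right isom_linear_part(2))

lemma linear_part_comp:
  assumes "f \<in> carrier isom_group" "g \<in> carrier isom_group"
  shows "linear_part (f \<circ> g) = linear_part f \<circ> linear_part g"
proof
  fix x
  have "linear_part (f \<circ> g) x = f (g x) - f (g 0)" by (simp add: linear_part_def)
  also have "\<dots> = linear_part f (g x - g 0)" by (rule isom_diff[OF assms(1)])
  finally show "linear_part (f \<circ> g) x = (linear_part f \<circ> linear_part g) x" by (simp add: linear_part_def)
qed

lemma isom_reflection_conj:
  assumes "f \<in> carrier isom_group"
  shows "f (reflection a b x) = reflection (linear_part f a) (b + linear_part f a \<bullet> f 0) (f x)"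
proof -
  let ?L = "linear_part f"
  have L: "orthogonal_transformation ?L" by (rule isom_linear_part(1)[OF assms])
  then have lin: "linear ?L" and inn: "\<And>u v. ?L u \<bullet> ?L v = u \<bullet> v"
    by (auto simp: orthogonal_transformation_def)
  have "?L a \<bullet> f x - (b + ?L a \<bullet> f 0) = a \<bullet> x - b"
    using isom_linear_part(2)[OF assms, of x] inn by (simp add: inner_add_right)
  moreover have "f (reflection a b x) = f x + ?L (reflection a b x - x)"
    using isom_diff[OF assms, of "reflection a b x" x] by (simp add: algebra_simps)
  ultimately show ?thesis using lin inn by (simp add: reflection_def linear_neg linear_scale)
qed

lemma isom_group_simps [simp]:
  "f \<otimes>\<^bsub>isom_group\<^esub> g = f \<circ> g" "\<one>\<^bsub>isom_group\<^esub> = id"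
  by (simp_all add: isom_group_def)

lemma reflection_isom: "a \<noteq> 0 \<Longrightarrow> reflection a b \<in> carrier isom_group"
  using reflections_subset by (auto simp: reflections_def)

lemma inv_reflection:
  assumes "r \<in> reflections"
  shows "inv\<^bsub>isom_group\<^esub> r = r"
proof -
  obtain a b where r: "r = reflection a b" "a \<noteq> 0" using assms by (auto simp: reflections_def)
  have "r \<otimes>\<^bsub>isom_group\<^esub> r = \<one>\<^bsub>isom_group\<^esub>" unfolding r(1) by (simp add: fun_eq_iff reflection_involution)
  then show ?thesis
    using group.inv_equality[OF group_isom_group] reflections_subset assms by blast
qed

abbreviation gen_by :: "('a::euclidean_space \<Rightarrow> 'a) set \<Rightarrow> ('a \<Rightarrow> 'a) set" where
  "gen_by R \<equiv> generate isom_group R"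

lemma generate_comp:
  "f \<in> gen_by R \<Longrightarrow> g \<in> gen_by R \<Longrightarrow> f \<circ> g \<in> gen_by R"
  using generate.eng[of f isom_group R g] by simp

text \<open>Reflections are their own inverses, so elements of the group are words in the generators
  and can be built by multiplying from the left.\<close>

lemma reflection_group_induct:
  assumes g: "g \<in> gen_by R" and R: "R \<subseteq> reflections"
    and one: "P id" and step: "\<And>r g. r \<in> R \<Longrightarrow> g \<in> gen_by R \<Longrightarrow> P g \<Longrightarrow> P (r \<circ> g)"
  shows "P g"
proof -
  \<comment> \<open>The claim is strengthened to products \<open>g \<circ> h\<close>, because
    \<open>generate\<close> multiplies arbitrary elements rather than prepending generators.\<close>
  have "\<forall>h\<in>gen_by R. P h \<longrightarrow> P (g \<circ> h)"
    using g
  proof (induction rule: generate.induct)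
    case one then show ?case by simp
  next
    case (incl r) then show ?case using step by blast
  next
    case (inv r)
    then have e: "inv\<^bsub>isom_group\<^esub> r = r" using R by (intro inv_reflection) blast
    show ?case unfolding e using step inv by blast
  next
    case (eng a b)
    show ?case
    proof (intro ballI impI)
      fix h assume h: "h \<in> gen_by R" "P h"
      then have "P (b \<circ> h)" "b \<circ> h \<in> gen_by R"
        using eng generate_comp by blast+
      then have "P (a \<circ> (b \<circ> h))" using eng by blast
      then show "P (a \<otimes>\<^bsub>isom_group\<^esub> b \<circ> h)" by (simp add: comp_assoc)
    qed
  qed
  moreover have "id \<in> gen_by R" using generate.one[of isom_group R] by simp
  ultimately show ?thesis using one by fastforce
qed

section \<open>The lattice of the scaled normals\<close>

lemma span_UNIV_nonorthogonal:
  assumes "span A = UNIV" "a \<noteq> 0"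
  obtains x where "x \<in> A" "a \<bullet> x \<noteq> 0"
proof -
  have "\<not> A \<subseteq> {x. a \<bullet> x = 0}"
  proof
    assume "A \<subseteq> {x. a \<bullet> x = 0}"
    then have "span A \<subseteq> {x. a \<bullet> x = 0}" by (intro span_minimal subspace_hyperplane)
    then have "a \<in> {x. a \<bullet> x = 0}" using assms(1) by blast
    then show False using assms(2) by simp
  qed
  then show ?thesis using that by blast
qed

text \<open>Integral squared lengths together with integral Cartan numbers make all inner products
  in the lattice half-integers, which is what keeps the lattice discrete.\<close>

locale crystal =
  fixes A :: "'a::euclidean_space set"
  assumes finA: "finite A" and spanA: "span A = UNIV"
    and norms: "a \<in> A \<Longrightarrow> \<exists>n::nat. n > 0 \<and> a \<bullet> a = real n"
    and crystA: "a \<in> A \<Longrightarrow> b \<in> A \<Longrightarrow> 2 * (a \<bullet> b) / (a \<bullet> a) \<in> \<int>"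
begin

inductive_set lat :: "'a set" where
  zero: "0 \<in> lat"
| add: "x \<in> lat \<Longrightarrow> a \<in> A \<Longrightarrow> x + a \<in> lat"
| diff: "x \<in> lat \<Longrightarrow> a \<in> A \<Longrightarrow> x - a \<in> lat"

lemma nonzero: "a \<in> A \<Longrightarrow> a \<bullet> a > 0"
  using norms by fastforce

lemma A_lat: "a \<in> A \<Longrightarrow> a \<in> lat"
  using lat.add[OF lat.zero] by simp

lemma lat_plus: "y \<in> lat \<Longrightarrow> x \<in> lat \<Longrightarrow> x + y \<in> lat"
  by (induction y rule: lat.induct)
    (auto simp: add.assoc[symmetric] add_diff_eq intro: lat.intros)

lemma lat_uminus: "x \<in> lat \<Longrightarrow> - x \<in> lat"
proof (induction x rule: lat.induct)
  case zero then show ?case by (simp add: lat.zero)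
next
  case (add x a)
  then have "- x - a \<in> lat" by (intro lat.diff)
  then show ?case by simp
next
  case (diff x a)
  then have "- x + a \<in> lat" by (intro lat.add)
  then show ?case by simp
qed

lemma lat_minus: "x \<in> lat \<Longrightarrow> y \<in> lat \<Longrightarrow> x - y \<in> lat"
  using lat_plus[of "- y" x] lat_uminus by simp

lemma lat_scale:
  assumes "k \<in> \<int>" "x \<in> lat"
  shows "k *\<^sub>R x \<in> lat"
proof -
  have n: "real n *\<^sub>R x \<in> lat" for n
    by (induction n) (use assms(2) in \<open>auto simp: scaleR_left_distrib intro: lat.zero lat_plus\<close>)
  obtain i :: int where i: "k = of_int i" using assms(1) by (auto elim: Ints_cases)
  show ?thesis
  proof (cases "0 \<le> i")
    case True
    then have "k = real (nat i)" using i by simp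
    then show ?thesis using n by simp
  next
    case False
    then have "k = - real (nat (- i))" using i by simp
    then show ?thesis using lat_uminus[OF n] by simp
  qed
qed

lemma lat_cryst: "x \<in> lat \<Longrightarrow> a \<in> A \<Longrightarrow> 2 * (a \<bullet> x) / (a \<bullet> a) \<in> \<int>"
  by (induction x rule: lat.induct)
    (auto simp: inner_add_right inner_diff_right distrib_left right_diff_distrib add_divide_distrib diff_divide_distrib
      intro: crystA)

lemma lat_inner_A: "x \<in> lat \<Longrightarrow> a \<in> A \<Longrightarrow> 2 * (a \<bullet> x) \<in> \<int>"
proof -
  assume xa: "x \<in> lat" "a \<in> A"
  obtain n :: nat where n: "a \<bullet> a = real n" using norms[OF xa(2)] by blast
  have "2 * (a \<bullet> x) / (a \<bullet> a) * (a \<bullet> a) \<in> \<int>" using lat_cryst[OF xa] by (intro Ints_mult) (simp_all add: n)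
  then show ?thesis using nonzero[OF xa(2)] by simp
qed

lemma lat_inner: "y \<in> lat \<Longrightarrow> x \<in> lat \<Longrightarrow> 2 * (y \<bullet> x) \<in> \<int>"
  by (induction y rule: lat.induct)
    (auto simp: inner_add_left inner_diff_left distrib_left right_diff_distrib intro: lat_inner_A)

lemma lat_norm:
  assumes "x \<in> lat" "x \<noteq> 0"
  shows "1 / 2 \<le> x \<bullet> x"
proof -
  obtain i :: int where i: "2 * (x \<bullet> x) = of_int i" using lat_inner[OF assms(1,1)] by (auto elim: Ints_cases)
  moreover have "x \<bullet> x > 0" using assms(2) by simp
  ultimately have "i > 0" by (metis mult_pos_pos of_int_0_less_iff zero_less_numeral)
  then have "i \<ge> 1" by simp
  then have "of_int i \<ge> (1::real)" by simp
  then show ?thesis using i by linarith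
qed

text \<open>Nonzero lattice vectors have squared length at least \<open>1 / 2\<close>, so two
  lattice points at distance below \<open>1 / 2\<close> coincide and there is no limit
  point.\<close>

lemma lat_finite: "finite (cball 0 r \<inter> lat)"
proof (rule finite_not_islimpt_in_compact)
  fix z :: 'a
  show "\<not> z islimpt lat"
  proof (rule discrete_imp_not_islimpt[of "1/2"])
    fix x y assume xy: "x \<in> lat" "y \<in> lat" "dist y x < 1/2"
    show "y = x"
    proof (rule ccontr)
      assume "y \<noteq> x"
      then have "1/2 \<le> (y - x) \<bullet> (y - x)" using lat_norm[OF lat_minus[OF xy(2,1)]] by simp
      moreover have "(y - x) \<bullet> (y - x) < (1/2)\<^sup>2"
        unfolding power2_norm_eq_inner[symmetric] using xy(3) by (intro power_strict_mono) (auto simp: dist_norm)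
      ultimately show False by (simp add: power2_eq_square)
    qed
  qed simp
qed simp

lemma lat_rf:
  assumes "x \<in> lat" "a \<in> A"
  shows "rf a x \<in> lat"
  unfolding rf_eq by (intro lat_minus lat_scale lat_cryst A_lat assms)

definition primitive :: "'a \<Rightarrow> bool" where
  "primitive \<beta> \<longleftrightarrow> \<beta> \<in> lat \<and> \<beta> \<noteq> 0 \<and> (\<forall>t. t *\<^sub>R \<beta> \<in> lat \<longrightarrow> t \<in> \<int>)"

text \<open>A shortest nonzero lattice vector on the line is primitive: if a multiple by
  \<open>t\<close> lies in the lattice, so does the one by the fractional part of \<open>t\<close>,
  which is shorter and therefore 0.\<close>

lemma primitive_exists:
  assumes "a \<in> lat" "a \<noteq> 0"
  obtains t where "t \<noteq> 0" "primitive (t *\<^sub>R a)"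
proof -
  let ?S = "{x \<in> cball 0 (norm a) \<inter> lat. x \<noteq> 0 \<and> (\<exists>t. x = t *\<^sub>R a)}"
  have "finite ?S" by (rule finite_subset[OF _ lat_finite[of "norm a"]]) blast
  moreover have "a \<in> ?S" using assms by (auto intro: exI[of _ 1])
  ultimately obtain x where x: "x \<in> ?S" "\<And>y. y \<in> ?S \<Longrightarrow> norm x \<le> norm y"
    using ex_min_if_finite[of "norm ` ?S"] by (metis (no_types, lifting) arg_min_if_finite(1) arg_min_least empty_iff)
  obtain s where s: "x = s *\<^sub>R a" using x by blast
  have "t \<in> \<int>" if t: "t *\<^sub>R x \<in> lat" for t
  proof -
    define u where "u = frac t"
    have u: "0 \<le> u" "u < 1" unfolding u_def by (simp_all add: frac_lt_1)
    have "u *\<^sub>R x = t *\<^sub>R x - of_int \<lfloor>t\<rfloor> *\<^sub>R x" by (simp add: u_def frac_def scaleR_left_diff_distrib)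
    then have ul: "u *\<^sub>R x \<in> lat" using t x(1) by (auto intro!: lat_minus lat_scale)
    have "u = 0"
    proof (rule ccontr)
      assume "u \<noteq> 0"
      have nu: "norm (u *\<^sub>R x) < norm x"
        using u x(1) mult_strict_right_mono[of u 1 "norm x"] by simp
      moreover have "norm x \<le> norm a" using x(1) by simp
      ultimately have "u *\<^sub>R x \<in> cball 0 (norm a)" by simp
      moreover have "\<exists>t. u *\<^sub>R x = t *\<^sub>R a" using s by auto
      moreover have "u *\<^sub>R x \<noteq> 0" using \<open>u \<noteq> 0\<close> x(1) by simp
      ultimately have "u *\<^sub>R x \<in> ?S" using ul by blast
      then show False using x(2)[of "u *\<^sub>R x"] nu by simp
    qed
    then show ?thesis by (simp add: u_def frac_eq_0_iff)
  qed
  then have "primitive x" using x(1) by (simp add: primitive_def)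
  moreover have "s \<noteq> 0" using x(1) s by auto
  ultimately show ?thesis using that s by blast
qed

lemma primitive_image:
  assumes B: "linear B" "inj B" "B ` lat = lat" and p: "primitive \<beta>"
  shows "primitive (B \<beta>)"
proof -
  have "B \<beta> \<noteq> 0" using B(1,2) p by (metis injD linear_0 primitive_def)
  moreover have "t \<in> \<int>" if "t *\<^sub>R B \<beta> \<in> lat" for t
  proof -
    have "B (t *\<^sub>R \<beta>) \<in> B ` lat" using that B(1,3) by (simp add: linear_scale)
    then have "t *\<^sub>R \<beta> \<in> lat" using B(2) by (simp add: inj_image_mem_iff)
    then show ?thesis using p by (simp add: primitive_def)
  qed
  ultimately show ?thesis using B(3) p by (auto simp: primitive_def)
qed

text \<open>The reflection changes a lattice vector by a lattice vector, namely
  \<open>\<beta>\<close> times this Cartan number, and primitivity makes the factor an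
  integer.\<close>

lemma primitive_cryst:
  assumes p: "primitive \<beta>" and r: "rf \<beta> ` lat = lat" and x: "x \<in> lat"
  shows "2 * (\<beta> \<bullet> x) / (\<beta> \<bullet> \<beta>) \<in> \<int>"
proof -
  have "rf \<beta> x \<in> lat" using r x by blast
  then have "x - rf \<beta> x \<in> lat" using x by (intro lat_minus)
  then have "(2 * (\<beta> \<bullet> x) / (\<beta> \<bullet> \<beta>)) *\<^sub>R \<beta> \<in> lat" by (simp add: rf_eq)
  then show ?thesis using p by (simp add: primitive_def)
qed

text \<open>Some \<open>a\<close> in \<open>A\<close> is not perpendicular to
  \<open>\<beta>\<close>. A nonzero integral Cartan number has absolute value at least 1, which
  bounds the norm of \<open>\<beta>\<close> by twice that of \<open>a\<close>. The sum over
  \<open>A\<close> makes the bound uniform and hence the root system finite.\<close>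

lemma primitive_bound:
  assumes p: "primitive \<beta>" and r: "rf \<beta> ` lat = lat"
  shows "norm \<beta> \<le> 2 * (\<Sum>a\<in>A. norm a)"
proof -
  obtain a where a: "a \<in> A" "\<beta> \<bullet> a \<noteq> 0"
    using span_UNIV_nonorthogonal[OF spanA, of \<beta>] p by (auto simp: primitive_def)
  have b: "norm \<beta> > 0" "\<beta> \<bullet> \<beta> > 0" using p by (auto simp: primitive_def)
  have "2 * (\<beta> \<bullet> a) / (\<beta> \<bullet> \<beta>) \<in> \<int>" by (rule primitive_cryst[OF p r A_lat[OF a(1)]])
  then have "1 \<le> \<bar>2 * (\<beta> \<bullet> a) / (\<beta> \<bullet> \<beta>)\<bar>" using a(2) b by (intro Ints_nonzero_abs_ge1) auto
  then have "\<beta> \<bullet> \<beta> \<le> 2 * \<bar>\<beta> \<bullet> a\<bar>" using b by (simp add: divide_simps)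
  also have "\<dots> \<le> 2 * (norm \<beta> * norm a)" using Cauchy_Schwarz_ineq2[of \<beta> a] by simp
  finally have "norm \<beta> * norm \<beta> \<le> norm \<beta> * (2 * norm a)" by (simp add: power2_norm_eq_inner[symmetric] power2_eq_square)
  then have "norm \<beta> \<le> 2 * norm a" using b(1) by simp
  moreover have "norm a \<le> (\<Sum>a\<in>A. norm a)" using a(1) finA by (intro member_le_sum) auto
  ultimately show ?thesis by linarith
qed

end

text \<open>Two parallel mirrors move a point to images that differ by
  \<open>2 * (c - c') / (\<beta> \<bullet> \<beta>)\<close> times \<open>\<beta>\<close>;
  \<open>disc\<close> says that this factor is a multiple of \<open>2 * \<kappa>\<close>, with one
  \<open>\<kappa>\<close> for all roots. \<open>nofix\<close> says that no point lies on all
  mirrors.\<close>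

locale affine_refl = root_sys \<Phi> for \<Phi> :: "'a::euclidean_space set" +
  fixes G :: "('a \<Rightarrow> 'a) set"
  assumes gen: "G = gen_by (G \<inter> reflections)"
    and normal_root: "a \<noteq> 0 \<Longrightarrow> reflection a c \<in> G \<Longrightarrow> \<exists>t. t \<noteq> 0 \<and> t *\<^sub>R a \<in> \<Phi>"
    and root_refl: "\<beta> \<in> \<Phi> \<Longrightarrow> \<exists>c. reflection \<beta> c \<in> G"
    and disc: "\<exists>\<kappa>>0. \<forall>\<beta>\<in>\<Phi>. \<forall>c c'. reflection \<beta> c \<in> G \<longrightarrow> reflection \<beta> c' \<in> G \<longrightarrow> (c - c') / (\<kappa> * (\<beta> \<bullet> \<beta>)) \<in> \<int>"
    and nofix: "\<exists>\<beta>\<in>\<Phi>. \<exists>c. reflection \<beta> c \<in> G \<and> c \<noteq> \<beta> \<bullet> p"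

lemma generate_conj_reflection:
  assumes "R \<subseteq> reflections" "a \<noteq> 0" "reflection a c \<in> gen_by R" "reflection b d \<in> gen_by R"
  shows "reflection (rf a b) (d + rf a b \<bullet> reflection a c 0) \<in> gen_by R"
proof -
  have "reflection a c \<circ> (reflection b d \<circ> reflection a c) \<in> gen_by R"
    by (intro generate_comp assms)
  moreover have "(reflection a c \<circ> (reflection b d \<circ> reflection a c)) x = reflection (rf a b) (d + rf a b \<bullet> reflection a c 0) x" for x
    using isom_reflection_conj[OF reflection_isom[OF assms(2)], of c b d "reflection a c x"]
    by (simp add: reflection_involution linear_part_reflection)
  then have "reflection a c \<circ> (reflection b d \<circ> reflection a c) = reflection (rf a b) (d + rf a b \<bullet> reflection a c 0)"
    by (intro ext)
  ultimately show ?thesis by simp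
qed

section \<open>The root system of the group of the simplex\<close>

context coxeter_simplex
begin

text \<open>All linear parts preserve the lattice of the scaled normals. Taking primitive lattice
  vectors as roots gives integral Cartan numbers, finiteness and reducedness; irreducibility comes
  from the connected diagram.\<close>

lemma affine_refl_exists:
  obtains \<Phi> where "affine_refl \<Phi> (reflection_group F)"
proof -
  define G where "G = reflection_group F"
  define R where "R = {reflection (nrm f) (off f) | f. f facet_of F}"
  have G: "G = gen_by R" unfolding G_def reflection_group_def R_def facet_reflections_eq ..
  have nrm0: "nrm f \<noteq> 0" if "f \<in> I" for f using inner_self[OF that] by auto
  have R: "R \<subseteq> reflections" unfolding R_def reflections_def using nrm0 by blast
  have Gisom: "G \<subseteq> carrier isom_group"
    unfolding G using group.generate_incl[OF group_isom_group] R reflections_subset by blast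
  have RI: "r \<in> carrier isom_group" if "r \<in> R" for r using that R reflections_subset by blast
  have GI: "g \<in> carrier isom_group" if "g \<in> gen_by R" for g using that Gisom unfolding G by blast
  obtain \<alpha> where \<alpha>: "\<forall>f\<in>I. \<exists>t>0. \<alpha> f = t *\<^sub>R nrm f" "\<forall>f\<in>I. \<exists>n::nat. n > 0 \<and> \<alpha> f \<bullet> \<alpha> f = real n"
    "\<forall>f\<in>I. \<forall>g\<in>I. 2 * (\<alpha> f \<bullet> \<alpha> g) / (\<alpha> f \<bullet> \<alpha> f) \<in> \<int>" by (rule scaled_normals)
  have rfa: "rf (nrm f) = rf (\<alpha> f)" if f: "f \<in> I" for f
  proof -
    obtain t where t: "t > 0" "\<alpha> f = t *\<^sub>R nrm f" using bspec[OF \<alpha>(1) f] by blast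
    then show ?thesis using rf_scaled[of t "nrm f"] by simp
  qed
  interpret A: crystal "\<alpha> ` I"
  proof
    show "finite (\<alpha> ` I)" using finite_facets by simp
    have "nrm f \<in> span (\<alpha> ` I)" if "f \<in> I" for f
    proof -
      obtain t where t: "t > 0" "\<alpha> f = t *\<^sub>R nrm f" using bspec[OF \<alpha>(1) \<open>f \<in> I\<close>] by blast
      have "(1 / t) *\<^sub>R \<alpha> f \<in> span (\<alpha> ` I)" using that by (intro span_scale span_base) blast
      then show ?thesis using t by simp
    qed
    then have "span (nrm ` I) \<subseteq> span (\<alpha> ` I)" by (intro span_minimal subspace_span) blast
    then show "span (\<alpha> ` I) = UNIV" using normals_span by blast
    show "\<exists>n::nat. n > 0 \<and> a \<bullet> a = real n" if "a \<in> \<alpha> ` I" for a using that \<alpha>(2) by blast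
    show "2 * (a \<bullet> b) / (a \<bullet> a) \<in> \<int>" if "a \<in> \<alpha> ` I" "b \<in> \<alpha> ` I" for a b using that \<alpha>(3) by blast
  qed
  let ?L = A.lat
  have rfL: "rf (nrm f) ` ?L = ?L" if "f \<in> I" for f
  proof -
    have sub: "rf (\<alpha> f) x \<in> ?L" if "x \<in> ?L" for x using A.lat_rf[OF that, of "\<alpha> f"] \<open>f \<in> I\<close> by blast
    have "x \<in> rf (\<alpha> f) ` ?L" if "x \<in> ?L" for x using sub[OF that] by (metis image_eqI rf_rf)
    then show ?thesis unfolding rfa[OF that] using sub by blast
  qed
  have LG: "linear_part g ` ?L = ?L" if "g \<in> G" for g
    using that[unfolded G] R
  proof (rule reflection_group_induct)
    show "linear_part id ` ?L = ?L" by (simp add: linear_part_def)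
    fix r g assume r: "r \<in> R" and g: "g \<in> gen_by R" and IH: "linear_part g ` ?L = ?L"
    obtain f where f: "r = reflection (nrm f) (off f)" "f \<in> I" using r by (auto simp: R_def)
    have "linear_part (r \<circ> g) = rf (nrm f) \<circ> linear_part g"
      using linear_part_comp[OF RI[OF r] GI[OF g]] unfolding f(1) linear_part_reflection .
    then show "linear_part (r \<circ> g) ` ?L = ?L" by (simp only: image_comp[symmetric] IH rfL[OF f(2)])
  qed
  define \<Phi> where "\<Phi> = {\<beta>. A.primitive \<beta> \<and> (\<exists>c. reflection \<beta> c \<in> G)}"
  have \<Phi>L: "rf \<beta> ` ?L = ?L" if "\<beta> \<in> \<Phi>" for \<beta>
  proof -
    obtain c where "reflection \<beta> c \<in> G" using \<open>\<beta> \<in> \<Phi>\<close> by (auto simp: \<Phi>_def)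
    then show ?thesis using LG by (metis linear_part_reflection)
  qed
  have normal: "\<exists>t. t \<noteq> 0 \<and> t *\<^sub>R a \<in> \<Phi>" if a: "a \<in> ?L" "a \<noteq> 0" "reflection a c \<in> G" for a c
  proof -
    obtain t where t: "t \<noteq> 0" "A.primitive (t *\<^sub>R a)" using A.primitive_exists[OF a(1,2)] by blast
    have "reflection (t *\<^sub>R a) (t * c) \<in> G" unfolding reflection_scale[OF t(1)] by (rule a(3))
    then show ?thesis using t unfolding \<Phi>_def by blast
  qed
  have refG: "reflection (nrm f) (off f) \<in> G" if "f \<in> I" for f
    unfolding G using that by (intro generate.incl) (auto simp: R_def)
  have nroot: "\<exists>t. t \<noteq> 0 \<and> t *\<^sub>R nrm f \<in> \<Phi>" if f: "f \<in> I" for f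
  proof -
    obtain s where s: "s > 0" "\<alpha> f = s *\<^sub>R nrm f" using bspec[OF \<alpha>(1) f] by blast
    have "reflection (\<alpha> f) (s * off f) \<in> G" using reflection_scale[of s "nrm f" "off f"] s refG[OF f] by simp
    moreover have "\<alpha> f \<in> ?L" using A.A_lat[of "\<alpha> f"] f by blast
    moreover have "\<alpha> f \<noteq> 0" using s nrm0[OF f] by simp
    ultimately obtain t where "t \<noteq> 0" "t *\<^sub>R \<alpha> f \<in> \<Phi>" using normal[of "\<alpha> f"] by blast
    then show ?thesis using s by (intro exI[of _ "t * s"]) auto
  qed
  have "root_sys \<Phi>"
  proof
    show "finite \<Phi>"
    proof (rule finite_subset[OF _ A.lat_finite[of "2 * (\<Sum>a\<in>\<alpha> ` I. norm a)"]], rule subsetI)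
      fix \<beta> assume b: "\<beta> \<in> \<Phi>"
      then have "A.primitive \<beta>" by (simp add: \<Phi>_def)
      then show "\<beta> \<in> cball 0 (2 * (\<Sum>a\<in>\<alpha> ` I. norm a)) \<inter> ?L"
        using A.primitive_bound[OF _ \<Phi>L[OF b]] by (simp add: A.primitive_def)
    qed
    show "0 \<notin> \<Phi>" by (simp add: \<Phi>_def A.primitive_def)
    have "nrm f \<in> span \<Phi>" if "f \<in> I" for f
    proof -
      obtain t where t: "t \<noteq> 0" "t *\<^sub>R nrm f \<in> \<Phi>" using nroot[OF \<open>f \<in> I\<close>] by blast
      have "(1 / t) *\<^sub>R (t *\<^sub>R nrm f) \<in> span \<Phi>" using t(2) by (intro span_scale span_base)
      then show ?thesis using t(1) by simp
    qed
    then have "span (nrm ` I) \<subseteq> span \<Phi>" by (intro span_minimal subspace_span) blast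
    then show "span \<Phi> = UNIV" using normals_span by blast
  next
    fix a b assume a: "a \<in> \<Phi>" and b: "b \<in> \<Phi>"
    obtain c d where c: "reflection a c \<in> G" and d: "reflection b d \<in> G" using a b by (auto simp: \<Phi>_def)
    have a0: "a \<noteq> 0" using a by (simp add: \<Phi>_def A.primitive_def)
    have "reflection (rf a b) (d + rf a b \<bullet> reflection a c 0) \<in> G"
      using generate_conj_reflection[OF R a0] c d unfolding G by blast
    moreover have "A.primitive (rf a b)"
    proof (rule A.primitive_image[OF linear_rf _ \<Phi>L[OF a]])
      show "inj (rf a)" by (metis injI rf_rf)
      show "A.primitive b" using b by (simp add: \<Phi>_def)
    qed
    ultimately show "rf a b \<in> \<Phi>" unfolding \<Phi>_def by blast
    show "2 * (a \<bullet> b) / (a \<bullet> a) \<in> \<int>"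
      using A.primitive_cryst[of a b] \<Phi>L[OF a] a b by (simp add: \<Phi>_def A.primitive_def)
  next
    fix a :: 'a and c assume a: "a \<in> \<Phi>" "c *\<^sub>R a \<in> \<Phi>"
    have p: "A.primitive a" "A.primitive (c *\<^sub>R a)" using a by (auto simp: \<Phi>_def)
    have c: "c \<noteq> 0" "c \<in> \<int>" using p by (auto simp: A.primitive_def)
    have "(1 / c) *\<^sub>R (c *\<^sub>R a) \<in> ?L" using c(1) p(1) by (simp add: A.primitive_def)
    then have "1 / c \<in> \<int>" using p(2) by (simp only: A.primitive_def)
    then obtain i j :: int where ij: "c = of_int i" "1 / c = of_int j" using c(2) by (auto elim!: Ints_cases)
    then have "of_int (i * j) = (1::real)" using c(1) by (metis nonzero_mult_div_cancel_left of_int_mult times_divide_eq_right mult.right_neutral)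
    then have "i * j = 1" by linarith
    then have "i = 1 \<or> i = - 1" by (metis zmult_eq_1_iff)
    then show "c = 1 \<or> c = - 1" using ij(1) by auto
  next
    fix S :: "'a set" assume S: "subspace S" "\<And>a. a \<in> \<Phi> \<Longrightarrow> a \<in> S \<or> (\<forall>x\<in>S. a \<bullet> x = 0)"
    have Sn: "nrm f \<in> S \<or> (\<forall>x\<in>S. nrm f \<bullet> x = 0)" if "f \<in> I" for f
    proof -
      obtain t where t: "t \<noteq> 0" "t *\<^sub>R nrm f \<in> \<Phi>" using nroot[OF \<open>f \<in> I\<close>] by blast
      show ?thesis
      proof (cases "t *\<^sub>R nrm f \<in> S")
        case True
        then have "(1 / t) *\<^sub>R (t *\<^sub>R nrm f) \<in> S" using S(1) subspace_scale by blast
        moreover have "(1 / t) *\<^sub>R (t *\<^sub>R nrm f) = nrm f" using t(1) by simp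
        ultimately show ?thesis by metis
      next
        case False then show ?thesis using S(2)[OF t(2)] t(1) by simp
      qed
    qed
    \<comment> \<open>A subspace that contains or is perpendicular to each root sorts the facet
      normals in the same way, and connectedness allows only the two trivial sortings.\<close>
    let ?S = "{f \<in> I. nrm f \<in> S}"
    consider "?S = {}" | "?S = I" | "?S \<noteq> {}" "?S \<noteq> I" by blast
    then show "S = {0} \<or> S = UNIV"
    proof cases
      case 1
      have "x = 0" if x: "x \<in> S" for x
      proof (rule ccontr)
        assume "x \<noteq> 0"
        then obtain y where "y \<in> nrm ` I" "x \<bullet> y \<noteq> 0" by (rule span_UNIV_nonorthogonal[OF normals_span])
        then show False using 1 Sn x by (auto simp: inner_commute)
      qed
      then show ?thesis using subspace_0[OF S(1)] by auto
    next
      case 2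
      then have "span (nrm ` I) \<subseteq> S" using S(1) by (intro span_minimal) auto
      then show ?thesis using normals_span by blast
    next
      case 3
      obtain f g where fg: "f \<in> ?S" "g \<in> I" "g \<notin> ?S" "nrm f \<bullet> nrm g < 0"
        by (rule connected_normals[of ?S]) (use 3 in auto)
      then have "nrm g \<bullet> nrm f = 0" using Sn[OF fg(2)] by blast
      then show ?thesis using fg(4) by (simp add: inner_commute)
    qed
  qed
  moreover have "affine_refl_axioms \<Phi> G"
  proof
    have "R \<subseteq> G \<inter> reflections" using R G by (auto intro: generate.incl)
    then have "G \<subseteq> gen_by (G \<inter> reflections)"
      using G group.mono_generate[OF group_isom_group, of R "G \<inter> reflections"] reflections_subset by blast
    moreover have "gen_by (G \<inter> reflections) \<subseteq> G"
      by (rule group.generate_subgroup_incl[OF group_isom_group])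
        (use subgroup_reflection_group[of F] in \<open>auto simp: G_def\<close>)
    ultimately show "G = gen_by (G \<inter> reflections)" by blast
  next
    fix a :: 'a and c assume a: "a \<noteq> 0" "reflection a c \<in> G"
    \<comment> \<open>The reflection moves a lattice vector by a multiple of \<open>a\<close>, so
      the line of \<open>a\<close> meets the lattice outside 0.\<close>
    obtain x where x: "x \<in> ?L" "a \<bullet> x \<noteq> 0" using span_UNIV_nonorthogonal[OF A.spanA a(1)] A.A_lat by metis
    define s where "s = 2 * (a \<bullet> x) / (a \<bullet> a)"
    have "rf a x \<in> ?L" using LG[OF a(2)] x(1) unfolding linear_part_reflection by blast
    then have "x - rf a x \<in> ?L" using x(1) by (intro A.lat_minus)
    then have sL: "s *\<^sub>R a \<in> ?L" by (simp add: rf_eq s_def)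
    have s0: "s \<noteq> 0" using x(2) a(1) by (simp add: s_def)
    have "reflection (s *\<^sub>R a) (s * c) \<in> G" unfolding reflection_scale[OF s0] by (rule a(2))
    then obtain t where "t \<noteq> 0" "t *\<^sub>R (s *\<^sub>R a) \<in> \<Phi>" using normal[OF sL] s0 a(1) by auto
    then show "\<exists>t. t \<noteq> 0 \<and> t *\<^sub>R a \<in> \<Phi>" using s0 by (intro exI[of _ "t * s"]) auto
  next
    show "\<exists>c. reflection \<beta> c \<in> G" if "\<beta> \<in> \<Phi>" for \<beta> using that by (simp add: \<Phi>_def)
  next
    obtain pt where pt: "\<forall>f g. f facet_of F \<longrightarrow> g facet_of F \<longrightarrow> f \<noteq> g \<longrightarrow> nrm g \<bullet> pt f = off g"
      "\<forall>f. f facet_of F \<longrightarrow> nrm f \<bullet> pt f < off f"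
      "\<forall>w. (\<forall>f g. f facet_of F \<longrightarrow> g facet_of F \<longrightarrow> w \<bullet> (pt f - pt g) = 0) \<longrightarrow> w = 0"
      "card I = DIM('a) + 1" by (rule simplex_facets[OF simplex])
    have "I \<noteq> {}" using card_I by (metis card.empty not_numeral_le_zero)
    then obtain f0 where f0: "f0 \<in> I" by blast
    \<comment> \<open>The vertex opposite to \<open>f0\<close>: it lies on all other facets, so
      among the generators only the reflection in \<open>f0\<close> moves it.\<close>
    define p where "p = pt f0"
    have p: "nrm g \<bullet> p = off g" if "g \<in> I" "g \<noteq> f0" for g using pt(1) f0 that unfolding p_def by blast
    have p0: "nrm f0 \<bullet> p < off f0" using pt(2) f0 unfolding p_def by blast
    obtain t0 where t0: "t0 > 0" "\<alpha> f0 = t0 *\<^sub>R nrm f0" using bspec[OF \<alpha>(1) f0] by blast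
    define s where "s = 2 * (off f0 - nrm f0 \<bullet> p) / t0"
    have s: "s > 0" using p0 t0 by (simp add: s_def)
    have rp: "\<exists>l\<in>?L. reflection (nrm f) (off f) p = p + s *\<^sub>R l" if f: "f \<in> I" for f
    proof (cases "f = f0")
      case True
      have "reflection (nrm f) (off f) p = p + s *\<^sub>R \<alpha> f0"
        using True inner_self[OF f0] t0(1) unfolding reflection_def t0(2) s_def by (simp add: scaleR_left_diff_distrib)
      then show ?thesis using A.A_lat[of "\<alpha> f0"] f0 by blast
    next
      case False
      then show ?thesis using p[OF f] A.lat.zero by (intro bexI[of _ 0]) (auto simp: reflection_def)
    qed
    \<comment> \<open>\<open>s\<close> is the factor by which the reflection in \<open>f0\<close>
      moves \<open>p\<close> along \<open>\<alpha> f0\<close>. Therefore the orbit of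
      \<open>p\<close> stays in a translate of the lattice scaled by \<open>s\<close>, which yields
      \<open>disc\<close>.\<close>
    have orbit: "\<exists>l\<in>?L. g p = p + s *\<^sub>R l" if "g \<in> G" for g
      using that[unfolded G] R
    proof (rule reflection_group_induct)
      show "\<exists>l\<in>?L. id p = p + s *\<^sub>R l" using A.lat.zero by (intro bexI[of _ 0]) auto
      fix r g assume r: "r \<in> R" and g: "\<exists>l\<in>?L. g p = p + s *\<^sub>R l"
      obtain f where f: "r = reflection (nrm f) (off f)" "f \<in> I" using r by (auto simp: R_def)
      obtain l where l: "l \<in> ?L" "g p = p + s *\<^sub>R l" using g by blast
      obtain m where m: "m \<in> ?L" "r p = p + s *\<^sub>R m" using rp[OF f(2)] unfolding f(1) by blast
      have "r (g p) - r p = rf (nrm f) (g p - p)"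
        using isom_diff[OF RI[OF r], of "g p" p] unfolding f(1) linear_part_reflection .
      then have "r (g p) = p + s *\<^sub>R (m + rf (nrm f) l)"
        using l(2) m(2) by (simp add: rf_scale scaleR_right_distrib algebra_simps)
      moreover have "m + rf (nrm f) l \<in> ?L" using rfL[OF f(2)] l(1) m(1) by (intro A.lat_plus) auto
      ultimately show "\<exists>l\<in>?L. (r \<circ> g) p = p + s *\<^sub>R l" by auto
    qed
    show "\<exists>\<kappa>>0. \<forall>\<beta>\<in>\<Phi>. \<forall>c c'. reflection \<beta> c \<in> G \<longrightarrow> reflection \<beta> c' \<in> G \<longrightarrow> (c - c') / (\<kappa> * (\<beta> \<bullet> \<beta>)) \<in> \<int>"
    proof (intro exI[of _ "s / 2"] conjI ballI allI impI)
      show "s / 2 > 0" using s by simp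
      fix \<beta> c c' assume b: "\<beta> \<in> \<Phi>" "reflection \<beta> c \<in> G" "reflection \<beta> c' \<in> G"
      obtain l l' where l: "l \<in> ?L" "l' \<in> ?L" "reflection \<beta> c p = p + s *\<^sub>R l" "reflection \<beta> c' p = p + s *\<^sub>R l'"
        using orbit[OF b(2)] orbit[OF b(3)] by blast
      \<comment> \<open>The images of \<open>p\<close> under two parallel mirrors differ by
        \<open>d *\<^sub>R \<beta>\<close>, which lies in the scaled lattice; primitivity of
        \<open>\<beta>\<close> makes \<open>d / s\<close> an integer.\<close>
      define d where "d = 2 * (c - c') / (\<beta> \<bullet> \<beta>)"
      have "reflection \<beta> c p - reflection \<beta> c' p = d *\<^sub>R \<beta>"
        by (simp add: reflection_def d_def scaleR_left_diff_distrib[symmetric] diff_divide_distrib[symmetric])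
      then have "d *\<^sub>R \<beta> = s *\<^sub>R (l - l')" using l(3,4) by (simp add: scaleR_diff_right)
      then have "(1 / s) *\<^sub>R (d *\<^sub>R \<beta>) = (1 / s) *\<^sub>R (s *\<^sub>R (l - l'))" by (rule arg_cong)
      then have "(d / s) *\<^sub>R \<beta> = l - l'" using s by simp
      then have "(d / s) *\<^sub>R \<beta> \<in> ?L" using A.lat_minus[OF l(1,2)] by simp
      then have "d / s \<in> \<int>" using b(1) by (simp add: \<Phi>_def A.primitive_def)
      moreover have "d / s = (c - c') / (s / 2 * (\<beta> \<bullet> \<beta>))" by (simp add: d_def mult.commute)
      ultimately show "(c - c') / (s / 2 * (\<beta> \<bullet> \<beta>)) \<in> \<int>" by simp
    qed
    fix q
    show "\<exists>\<beta>\<in>\<Phi>. \<exists>c. reflection \<beta> c \<in> G \<and> c \<noteq> \<beta> \<bullet> q"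
    proof (rule ccontr)
      assume no: "\<not> ?thesis"
      have q: "nrm f \<bullet> q = off f" if f: "f \<in> I" for f
      proof -
        obtain t where t: "t \<noteq> 0" "t *\<^sub>R nrm f \<in> \<Phi>" using nroot[OF f] by blast
        have "reflection (t *\<^sub>R nrm f) (t * off f) \<in> G" unfolding reflection_scale[OF t(1)] by (rule refG[OF f])
        then have "t * off f = (t *\<^sub>R nrm f) \<bullet> q" using no t(2) by blast
        then show ?thesis using t(1) by simp
      qed
      obtain c where c: "\<forall>f\<in>I. c f > 0" "(\<Sum>f\<in>I. c f *\<^sub>R nrm f) = 0"
        "\<forall>d. (\<Sum>f\<in>I. d f *\<^sub>R nrm f) = 0 \<longrightarrow> (\<exists>k. \<forall>f\<in>I. d f = k * c f)" by (rule kernel)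
      \<comment> \<open>A common fixed point \<open>q\<close> would satisfy all facet equations.
        Paired with \<open>q - p\<close>, the positive relation between the normals keeps only the
        term of \<open>f0\<close>, which is positive.\<close>
      have "0 = (\<Sum>f\<in>I. c f *\<^sub>R nrm f) \<bullet> (q - p)" using c(2) by simp
      also have "\<dots> = (\<Sum>f\<in>I. c f * (nrm f \<bullet> (q - p)))" by (simp add: inner_sum_left)
      also have "\<dots> = (\<Sum>f\<in>I. if f = f0 then c f0 * (off f0 - nrm f0 \<bullet> p) else 0)"
        using p q by (intro sum.cong refl) (auto simp: inner_diff_right)
      also have "\<dots> = c f0 * (off f0 - nrm f0 \<bullet> p)" using f0 finite_facets by simp
      finally show False using c(1) f0 p0 by (metis diff_gt_0_iff_gt less_irrefl mult_pos_pos)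
    qed
  qed
  ultimately show ?thesis using that unfolding G_def affine_refl_def by blast
qed

end

text \<open>In a linear relation the terms with positive coefficients are brought to one side. The
  two sides are equal but have nonpositive inner product, so both vanish, and pairing with
  \<open>\<rho>\<close> shows that there are no positive coefficients. The same holds for the
  negated relation.\<close>

lemma obtuse_independent:
  fixes D :: "'a::euclidean_space set"
  assumes fin: "finite D" and pos: "\<And>x. x \<in> D \<Longrightarrow> \<rho> \<bullet> x > 0"
    and obt: "\<And>x y. x \<in> D \<Longrightarrow> y \<in> D \<Longrightarrow> x \<noteq> y \<Longrightarrow> x \<bullet> y \<le> 0"
  shows "independent D"
proof -
  have main: "u x \<le> 0" if s: "(\<Sum>v\<in>D. u v *\<^sub>R v) = 0" and x: "x \<in> D" for u x
  proof (rule ccontr)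
    assume "\<not> u x \<le> 0"
    define p q where "p = (\<lambda>v. max (u v) 0)" and "q = (\<lambda>v. max (- u v) 0)"
    have pq: "u v = p v - q v" "p v \<ge> 0" "q v \<ge> 0" "p v * q v = 0" for v by (auto simp: p_def q_def max_def)
    let ?z = "\<Sum>v\<in>D. p v *\<^sub>R v" and ?y = "\<Sum>v\<in>D. q v *\<^sub>R v"
    have "?z - ?y = (\<Sum>v\<in>D. u v *\<^sub>R v)" by (simp add: pq(1) scaleR_left_diff_distrib sum_subtractf)
    then have zy: "?z = ?y" using s by simp
    have "?z \<bullet> ?y = (\<Sum>v\<in>D. \<Sum>w\<in>D. p v * q w * (v \<bullet> w))"
      unfolding inner_sum_left by (simp add: inner_sum_right sum_distrib_left mult.assoc mult.left_commute)
    also have "\<dots> \<le> 0"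
    proof (intro sum_nonpos)
      fix v w assume "v \<in> D" "w \<in> D"
      then show "p v * q w * (v \<bullet> w) \<le> 0"
        using obt[of v w] pq(2)[of v] pq(3)[of w] pq(4)[of v]
        by (cases "v = w") (auto simp: mult_nonneg_nonpos)
    qed
    finally have "?z \<bullet> ?z \<le> 0" unfolding zy by (simp only: inner_commute)
    then have "?z \<bullet> ?z = 0" using inner_ge_zero[of ?z] by linarith
    then have "?z = 0" by (simp only: inner_eq_zero_iff)
    then have "0 = \<rho> \<bullet> ?z" by simp
    also have "\<dots> = (\<Sum>v\<in>D. p v * (\<rho> \<bullet> v))" by (simp add: inner_sum_right)
    also have "\<dots> > 0"
      by (rule sum_pos2[OF fin x]) (use \<open>\<not> u x \<le> 0\<close> pos x pq(2) in \<open>auto simp: p_def less_imp_le\<close>)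
    finally show False by simp
  qed
  show ?thesis
  proof
    assume "dependent D"
    then obtain u v where uv: "v \<in> D" "u v \<noteq> 0" "(\<Sum>v\<in>D. u v *\<^sub>R v) = 0" using dependent_finite[OF fin] by auto
    have "(\<Sum>v\<in>D. (- u v) *\<^sub>R v) = 0" using uv(3) by (simp add: sum_negf)
    then have "- u v \<le> 0" using main[of "\<lambda>v. - u v" v] uv(1) by simp
    moreover have "u v \<le> 0" by (rule main[OF uv(3,1)])
    ultimately show False using uv(2) by simp
  qed
qed

lemma independent_dual:
  fixes D :: "'a::euclidean_space set"
  assumes "independent D"
  obtains w where "\<And>x. x \<in> D \<Longrightarrow> w \<bullet> x = c x"
proof -
  obtain g where g: "linear g" "\<forall>x\<in>D. g x = c x" using linear_independent_extend[OF assms] by blast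
  have "(\<Sum>b\<in>Basis. g b *\<^sub>R b) \<bullet> x = g x" for x
  proof -
    have "g x = g (\<Sum>b\<in>Basis. (x \<bullet> b) *\<^sub>R b)" by (simp add: euclidean_representation)
    also have "\<dots> = (\<Sum>b\<in>Basis. (x \<bullet> b) * g b)" using g(1) by (simp add: linear_sum linear_scale)
    finally show ?thesis unfolding inner_sum_left by (simp add: inner_commute mult.commute)
  qed
  then show ?thesis using that g(2) by (metis (no_types, lifting))
qed

section \<open>Simple roots and special points\<close>

context root_sys
begin

text \<open>Both Cartan integers are positive with product below 4, so one of them is 1 and its
  reflection subtracts one root from the other.\<close>

lemma acute_diff_root:
  assumes "\<alpha> \<in> \<Phi>" "\<beta> \<in> \<Phi>" "\<alpha> \<noteq> \<beta>" "\<alpha> \<bullet> \<beta> > 0"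
  shows "\<alpha> - \<beta> \<in> \<Phi>"
proof -
  have ne: "\<beta> \<noteq> - \<alpha>"
  proof
    assume "\<beta> = - \<alpha>"
    then have "\<alpha> \<bullet> \<beta> = - (\<alpha> \<bullet> \<alpha>)" by simp
    then show False using assms(4) inner_ge_zero[of \<alpha>] by linarith
  qed
  obtain p q :: int where pq: "2 * (\<alpha> \<bullet> \<beta>) = p * (\<alpha> \<bullet> \<alpha>)" "2 * (\<alpha> \<bullet> \<beta>) = q * (\<beta> \<bullet> \<beta>)" "p * q < 4" "p * q \<ge> 0"
    by (rule cartan[OF assms(1,2) assms(3)[symmetric] ne])
  have "p * (\<alpha> \<bullet> \<alpha>) > 0" "q * (\<beta> \<bullet> \<beta>) > 0" using pq(1,2) assms(4) by linarith+
  then have "p > 0" "q > 0" using norm_pos[OF assms(1)] norm_pos[OF assms(2)] by (simp_all add: zero_less_mult_iff)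
  then have "p = 1 \<or> q = 1"
  proof -
    have "\<not> (p \<ge> 2 \<and> q \<ge> 2)"
    proof
      assume "p \<ge> 2 \<and> q \<ge> 2"
      then have "2 * 2 \<le> p * q" by (intro mult_mono) auto
      then show False using pq(3) by simp
    qed
    then show ?thesis using \<open>p > 0\<close> \<open>q > 0\<close> by linarith
  qed
  then show ?thesis
  proof
    assume "q = 1" then show ?thesis using diff_root[OF assms(1,2)] pq(2) by simp
  next
    assume "p = 1"
    then have "\<beta> - \<alpha> \<in> \<Phi>" using diff_root[OF assms(2,1)] pq(1) by (simp add: inner_commute)
    then show ?thesis using neg_root[of "\<beta> - \<alpha>"] by simp
  qed
qed

text \<open>\<open>\<Delta>\<close> consists of the positive roots that are not sums of two positive
  roots. The last clause replaces the statement that the simple reflections generate the Weyl group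
  and carry simple roots to all roots; \<open>special_point\<close> applies it to the roots that
  have a mirror through a given point.\<close>

lemma simple_system:
  obtains \<Delta> where "\<Delta> \<subseteq> \<Phi>" "independent \<Delta>"
    "\<forall>B. \<Delta> \<subseteq> B \<longrightarrow> (\<forall>\<delta>\<in>\<Delta>. \<forall>x\<in>B. rf \<delta> x \<in> B) \<longrightarrow> (\<forall>x\<in>B. - x \<in> B) \<longrightarrow> \<Phi> \<subseteq> B"
proof -
  obtain \<rho> where \<rho>: "\<And>x. x \<in> \<Phi> \<Longrightarrow> \<rho> \<bullet> x \<noteq> 0" using exists_regular_vector[OF fin nz] by metis
  define pos where "pos = {\<beta> \<in> \<Phi>. \<rho> \<bullet> \<beta> > 0}"
  define \<Delta> where "\<Delta> = {\<beta> \<in> pos. \<not> (\<exists>x\<in>pos. \<exists>y\<in>pos. \<beta> = x + y)}"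
  have posD: "\<beta> \<in> \<Phi>" "\<rho> \<bullet> \<beta> > 0" if "\<beta> \<in> pos" for \<beta> using that by (auto simp: pos_def)
  have pos_cases: "\<beta> \<in> pos \<or> - \<beta> \<in> pos" if "\<beta> \<in> \<Phi>" for \<beta>
    using \<rho>[OF that] that neg_root[OF that] by (auto simp: pos_def)
  have finpos: "finite pos" using fin by (simp add: pos_def)
  have \<Delta>pos: "\<delta> \<in> pos" if "\<delta> \<in> \<Delta>" for \<delta> using that by (simp add: \<Delta>_def)
  have simple: "\<delta> \<noteq> x + y" if "\<delta> \<in> \<Delta>" "x \<in> pos" "y \<in> pos" for \<delta> x y using that unfolding \<Delta>_def by blast
  \<comment> \<open>The heights \<open>\<rho> \<bullet> \<beta>\<close> are real numbers, so the
    induction runs on the number of positive roots of smaller height.\<close>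
  have ind: "P \<beta>" if b: "\<beta> \<in> pos" and base: "\<And>\<delta>. \<delta> \<in> \<Delta> \<Longrightarrow> P \<delta>" and sum: "\<And>x y. P x \<Longrightarrow> P y \<Longrightarrow> P (x + y)" for P \<beta>
    using b
  proof (induction "card {\<gamma> \<in> pos. \<rho> \<bullet> \<gamma> < \<rho> \<bullet> \<beta>}" arbitrary: \<beta> rule: less_induct)
    case less
    show ?case
    proof (cases "\<beta> \<in> \<Delta>")
      case True then show ?thesis by (rule base)
    next
      case False
      then obtain x y where xy: "x \<in> pos" "y \<in> pos" "\<beta> = x + y" using less.prems unfolding \<Delta>_def by blast
      have lt: "\<rho> \<bullet> x < \<rho> \<bullet> \<beta>" "\<rho> \<bullet> y < \<rho> \<bullet> \<beta>" using posD(2)[OF xy(1)] posD(2)[OF xy(2)] xy(3) by (simp_all add: inner_add_right)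
      have c: "card {\<gamma> \<in> pos. \<rho> \<bullet> \<gamma> < \<rho> \<bullet> z} < card {\<gamma> \<in> pos. \<rho> \<bullet> \<gamma> < \<rho> \<bullet> \<beta>}" if "z \<in> pos" "\<rho> \<bullet> z < \<rho> \<bullet> \<beta>" for z
        using that finpos by (intro psubset_card_mono) auto
      show ?thesis unfolding xy(3) by (intro sum less.hyps[of x] less.hyps[of y] c xy(1,2) lt)
    qed
  qed
  have obt: "x \<bullet> y \<le> 0" if xy: "x \<in> \<Delta>" "y \<in> \<Delta>" "x \<noteq> y" for x y
  proof (rule ccontr)
    assume "\<not> ?thesis"
    then have d: "x - y \<in> \<Phi>" using acute_diff_root[of x y] xy \<Delta>pos posD(1) by simp
    from pos_cases[OF d] show False
    proof
      assume "x - y \<in> pos"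
      from simple[OF xy(1) this \<Delta>pos[OF xy(2)]] show False by simp
    next
      assume "- (x - y) \<in> pos"
      from simple[OF xy(2) this \<Delta>pos[OF xy(1)]] show False by simp
    qed
  qed
  have indep: "independent \<Delta>"
  proof (rule obtuse_independent)
    show "finite \<Delta>" using finpos by (simp add: \<Delta>_def)
    show "\<rho> \<bullet> x > 0" if "x \<in> \<Delta>" for x by (rule posD(2)[OF \<Delta>pos[OF that]])
  qed (rule obt)
  have spanD: "\<beta> \<in> span \<Delta>" if "\<beta> \<in> pos" for \<beta> by (rule ind[OF that]) (auto intro: span_base span_add)
  have dual: "\<exists>w. \<forall>x\<in>\<Delta>. w \<bullet> x = (if x = \<delta> then 1 else 0)" for \<delta>
    using independent_dual[OF indep, of "\<lambda>x. if x = \<delta> then 1 else 0"] by metis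
  then obtain w where w: "\<And>\<delta> x. x \<in> \<Delta> \<Longrightarrow> w \<delta> \<bullet> x = (if x = \<delta> then 1 else 0)" by metis
  have wpos: "w \<delta> \<bullet> \<beta> \<ge> 0" if "\<beta> \<in> pos" for \<delta> \<beta>
    by (rule ind[OF that]) (auto simp: w inner_add_right)
  have B: "\<Phi> \<subseteq> B" if DB: "\<Delta> \<subseteq> B" and refl: "\<And>\<delta> x. \<delta> \<in> \<Delta> \<Longrightarrow> x \<in> B \<Longrightarrow> rf \<delta> x \<in> B"
    and neg: "\<And>x. x \<in> B \<Longrightarrow> - x \<in> B" for B
  proof -
    have posB: "\<beta> \<in> B" if "\<beta> \<in> pos" for \<beta>
      using that
    proof (induction "card {\<gamma> \<in> pos. \<rho> \<bullet> \<gamma> < \<rho> \<bullet> \<beta>}" arbitrary: \<beta> rule: less_induct)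
      case less
      note b = less.prems
      show ?case
      proof (cases "\<beta> \<in> \<Delta>")
        case True then show ?thesis using DB by blast
      next
        case False
        \<comment> \<open>Otherwise the product of \<open>\<beta>\<close> with every sum of simple
          roots would be nonpositive, in particular that with \<open>\<beta>\<close> itself.\<close>
        have "\<exists>\<delta>\<in>\<Delta>. \<beta> \<bullet> \<delta> > 0"
        proof (rule ccontr)
          assume "\<not> ?thesis"
          then have no: "\<beta> \<bullet> \<delta> \<le> 0" if "\<delta> \<in> \<Delta>" for \<delta> using that by force
          have "\<beta> \<bullet> \<beta> \<le> 0" by (rule ind[OF b, of "\<lambda>x. \<beta> \<bullet> x \<le> 0"]) (auto simp: no inner_add_right)
          then show False using norm_pos[OF posD(1)[OF b]] by simp
        qed
        then obtain \<delta> where \<delta>: "\<delta> \<in> \<Delta>" "\<beta> \<bullet> \<delta> > 0" by blast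
        define k where "k = 2 * (\<delta> \<bullet> \<beta>) / (\<delta> \<bullet> \<delta>)"
        have \<delta>\<Phi>: "\<delta> \<in> \<Phi>" by (rule posD(1)[OF \<Delta>pos[OF \<delta>(1)]])
        have k: "k > 0" using \<delta>(2) norm_pos[OF \<delta>\<Phi>] by (simp add: k_def inner_commute)
        have r: "rf \<delta> \<beta> = \<beta> - k *\<^sub>R \<delta>" by (simp add: rf_eq k_def)
        have rP: "rf \<delta> \<beta> \<in> \<Phi>" by (rule rf_root[OF \<delta>\<Phi> posD(1)[OF b]])
        \<comment> \<open>The reflection changes only the coordinate at \<open>\<delta>\<close>. If
          the result were negative, all other coordinates of \<open>\<beta>\<close> would vanish and
          \<open>\<beta>\<close> would be the simple root \<open>\<delta>\<close>.\<close>
        have "- rf \<delta> \<beta> \<notin> pos"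
        proof
          assume n: "- rf \<delta> \<beta> \<in> pos"
          have z: "w \<epsilon> \<bullet> \<beta> = 0" if "\<epsilon> \<noteq> \<delta>" for \<epsilon>
          proof -
            have "w \<epsilon> \<bullet> (- rf \<delta> \<beta>) = - (w \<epsilon> \<bullet> \<beta>)" using w[OF \<delta>(1), of \<epsilon>] that by (simp add: r inner_diff_right)
            then show ?thesis using wpos[OF n, of \<epsilon>] wpos[OF b, of \<epsilon>] by linarith
          qed
          let ?d = "\<beta> - (w \<delta> \<bullet> \<beta>) *\<^sub>R \<delta>"
          have d0: "w \<epsilon> \<bullet> ?d = 0" for \<epsilon>
            using z[of \<epsilon>] w[OF \<delta>(1), of \<epsilon>] by (cases "\<epsilon> = \<delta>") (auto simp: inner_diff_right)
          have finD: "finite \<Delta>" using finpos by (rule rev_finite_subset) (auto simp: \<Delta>_def)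
          have "?d \<in> span \<Delta>" by (intro span_diff span_scale spanD b span_base \<delta>(1))
          then obtain c where c: "?d = (\<Sum>v\<in>\<Delta>. c v *\<^sub>R v)" unfolding span_finite[OF finD] by blast
          have "c v = 0" if v: "v \<in> \<Delta>" for v
          proof -
            have "0 = w v \<bullet> (\<Sum>x\<in>\<Delta>. c x *\<^sub>R x)" using d0[of v] unfolding c by simp
            also have "\<dots> = (\<Sum>x\<in>\<Delta>. c x * (w v \<bullet> x))" by (simp add: inner_sum_right)
            also have "\<dots> = (\<Sum>x\<in>\<Delta>. if x = v then c v else 0)" by (intro sum.cong refl) (auto simp: w)
            also have "\<dots> = c v" using v finD by simp
            finally show ?thesis by simp
          qed
          then have "?d = 0" unfolding c by simp
          then have e: "\<beta> = (w \<delta> \<bullet> \<beta>) *\<^sub>R \<delta>" by simp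
          then have "(w \<delta> \<bullet> \<beta>) *\<^sub>R \<delta> \<in> \<Phi>" using posD(1)[OF b] by metis
          then have "w \<delta> \<bullet> \<beta> = 1 \<or> w \<delta> \<bullet> \<beta> = - 1" by (rule reduced[OF \<delta>\<Phi>])
          then have "w \<delta> \<bullet> \<beta> = 1" using wpos[OF b, of \<delta>] by linarith
          then have "\<beta> = \<delta>" using e by (metis scaleR_one)
          then show False using False \<delta>(1) by simp
        qed
        then have rpos: "rf \<delta> \<beta> \<in> pos" using pos_cases[OF rP] by blast
        have lt: "\<rho> \<bullet> rf \<delta> \<beta> < \<rho> \<bullet> \<beta>" using k posD(2)[OF \<Delta>pos[OF \<delta>(1)]] by (simp add: r inner_diff_right)
        have "card {\<gamma> \<in> pos. \<rho> \<bullet> \<gamma> < \<rho> \<bullet> rf \<delta> \<beta>} < card {\<gamma> \<in> pos. \<rho> \<bullet> \<gamma> < \<rho> \<bullet> \<beta>}"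
          using lt rpos finpos by (intro psubset_card_mono) auto
        then have "rf \<delta> \<beta> \<in> B" by (rule less.hyps[OF _ rpos])
        then have "rf \<delta> (rf \<delta> \<beta>) \<in> B" by (rule refl[OF \<delta>(1)])
        then show ?thesis by simp
      qed
    qed
    show ?thesis
    proof
      fix \<beta> assume "\<beta> \<in> \<Phi>"
      from pos_cases[OF this] show "\<beta> \<in> B"
      proof
        assume "- \<beta> \<in> pos" then have "- (- \<beta>) \<in> B" by (intro neg posB)
        then show ?thesis by simp
      qed (rule posB)
    qed
  qed
  show ?thesis
  proof (rule that[of \<Delta>])
    show "\<Delta> \<subseteq> \<Phi>" using \<Delta>pos posD(1) by blast
    show "independent \<Delta>" by (rule indep)
    show "\<forall>B. \<Delta> \<subseteq> B \<longrightarrow> (\<forall>\<delta>\<in>\<Delta>. \<forall>x\<in>B. rf \<delta> x \<in> B) \<longrightarrow> (\<forall>x\<in>B. - x \<in> B) \<longrightarrow> \<Phi> \<subseteq> B"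
    proof (intro allI impI)
      fix B assume 1: "\<Delta> \<subseteq> B" and 2: "\<forall>\<delta>\<in>\<Delta>. \<forall>x\<in>B. rf \<delta> x \<in> B" and 3: "\<forall>x\<in>B. - x \<in> B"
      show "\<Phi> \<subseteq> B" by (rule B[OF 1]) ((rule 2[rule_format] 3[rule_format]; assumption)+)
    qed
  qed
qed

end

section \<open>Reflection subgroups of an affine reflection group\<close>

lemma reflection_comp_self: "reflection a c \<circ> reflection a c = id"
  by (rule ext) (simp add: reflection_involution)

lemma reflection_offset: "reflection a (a \<bullet> z + c) x = z + rf a (x - z) + (2 * c / (a \<bullet> a)) *\<^sub>R a"
proof -
  have "2 * (a \<bullet> x - (a \<bullet> z + c)) / (a \<bullet> a) = 2 * (a \<bullet> (x - z)) / (a \<bullet> a) - 2 * c / (a \<bullet> a)"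
    by (simp add: inner_diff_right diff_divide_distrib add_divide_distrib)
  then show ?thesis unfolding reflection_def[of a "a \<bullet> z + c"] rf_eq by (simp add: scaleR_left_diff_distrib)
qed

lemma generate_isom:
  assumes "R \<subseteq> reflections" "g \<in> gen_by R"
  shows "g \<in> carrier isom_group"
  using group.generate_incl[OF group_isom_group] assms reflections_subset by blast

lemma id_generate: "id \<in> gen_by R"
  using generate.one[of isom_group R] by simp

lemma generate_linear_part:
  assumes R: "R \<subseteq> reflections" and g: "g \<in> gen_by R"
    and S: "\<And>a c x. a \<noteq> 0 \<Longrightarrow> reflection a c \<in> R \<Longrightarrow> x \<in> S \<Longrightarrow> rf a x \<in> S"
  shows "\<forall>x\<in>S. linear_part g x \<in> S"
  using g R
proof (rule reflection_group_induct)
  show "\<forall>x\<in>S. linear_part id x \<in> S" by (simp add: linear_part_def)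
  fix r g assume r: "r \<in> R" and g: "g \<in> gen_by R" and IH: "\<forall>x\<in>S. linear_part g x \<in> S"
  obtain a c where a: "r = reflection a c" "a \<noteq> 0" using r R by (auto simp: reflections_def)
  have "r \<in> carrier isom_group" using r R reflections_subset by blast
  then have "linear_part (r \<circ> g) = rf a \<circ> linear_part g"
    using linear_part_comp[OF _ generate_isom[OF R g]] a(1) by (metis linear_part_reflection)
  then show "\<forall>x\<in>S. linear_part (r \<circ> g) x \<in> S" using S[of a c] a r IH by simp
qed

context affine_refl
begin

lemma G_comp: "f \<in> G \<Longrightarrow> g \<in> G \<Longrightarrow> f \<circ> g \<in> G"
  using generate_comp[of f "G \<inter> reflections" g] gen by simp

lemma G_isom: "g \<in> G \<Longrightarrow> g \<in> carrier isom_group"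
  using generate_isom[of "G \<inter> reflections" g] gen by simp

lemma G_id: "id \<in> G"
  using id_generate[of "G \<inter> reflections"] gen by simp

lemma G_conj:
  "a \<noteq> 0 \<Longrightarrow> reflection a c \<in> G \<Longrightarrow> reflection b d \<in> G \<Longrightarrow> reflection (rf a b) (d + rf a b \<bullet> reflection a c 0) \<in> G"
  using generate_conj_reflection[of "G \<inter> reflections" a c b d] gen by simp

text \<open>Simple roots are independent, so one mirror for each of them can be chosen and these
  mirrors have a common point \<open>z\<close>. The roots with a mirror through \<open>z\<close> are
  closed under reflections in such roots, hence comprise all roots.\<close>

lemma special_point: "\<exists>z. \<forall>\<beta>\<in>\<Phi>. reflection \<beta> (\<beta> \<bullet> z) \<in> G"
proof -
  obtain \<Delta> where \<Delta>: "\<Delta> \<subseteq> \<Phi>" "independent \<Delta>"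
    "\<forall>B. \<Delta> \<subseteq> B \<longrightarrow> (\<forall>\<delta>\<in>\<Delta>. \<forall>x\<in>B. rf \<delta> x \<in> B) \<longrightarrow> (\<forall>x\<in>B. - x \<in> B) \<longrightarrow> \<Phi> \<subseteq> B"
    by (rule simple_system)
  have "\<exists>c. \<forall>\<delta>\<in>\<Delta>. reflection \<delta> (c \<delta>) \<in> G" using root_refl \<Delta>(1) by (intro bchoice) blast
  then obtain c where c: "\<And>\<delta>. \<delta> \<in> \<Delta> \<Longrightarrow> reflection \<delta> (c \<delta>) \<in> G" by blast
  obtain z where z: "\<And>\<delta>. \<delta> \<in> \<Delta> \<Longrightarrow> z \<bullet> \<delta> = c \<delta>" using independent_dual[OF \<Delta>(2), of c] by auto
  define B where "B = {\<beta>. reflection \<beta> (\<beta> \<bullet> z) \<in> G}"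
  have \<Delta>B: "\<delta> \<in> B" if "\<delta> \<in> \<Delta>" for \<delta> using c[OF that] z[OF that] by (simp add: B_def inner_commute)
  have "\<Phi> \<subseteq> B"
  proof (rule \<Delta>(3)[rule_format])
    show "\<Delta> \<subseteq> B" using \<Delta>B by blast
    fix \<delta> x assume \<delta>: "\<delta> \<in> \<Delta>" and x: "x \<in> B"
    have \<delta>0: "\<delta> \<noteq> 0" using \<delta> \<Delta>(1) nz by blast
    have 1: "reflection \<delta> (\<delta> \<bullet> z) \<in> G" using \<Delta>B[OF \<delta>] by (simp add: B_def)
    have "reflection \<delta> (\<delta> \<bullet> z) 0 = z - rf \<delta> z"
      using reflection_offset[of \<delta> z 0 0] by (simp add: rf_minus)
    then have "x \<bullet> z + rf \<delta> x \<bullet> reflection \<delta> (\<delta> \<bullet> z) 0 = rf \<delta> x \<bullet> z" by (simp add: inner_diff_right)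
    moreover have "reflection (rf \<delta> x) (x \<bullet> z + rf \<delta> x \<bullet> reflection \<delta> (\<delta> \<bullet> z) 0) \<in> G"
      using x by (intro G_conj[OF \<delta>0 1]) (simp add: B_def)
    ultimately show "rf \<delta> x \<in> B" by (simp add: B_def)
  next
    fix x assume "x \<in> B"
    then show "- x \<in> B" using reflection_scale[of "- 1" x "x \<bullet> z"] by (simp add: B_def)
  qed
  then show ?thesis unfolding B_def by blast
qed

end

section \<open>Positions of the mirrors relative to a special point\<close>

locale affine_refl_point = affine_refl \<Phi> G for \<Phi> :: "'a::euclidean_space set" and G +
  fixes z :: 'a
  assumes special: "\<beta> \<in> \<Phi> \<Longrightarrow> reflection \<beta> (\<beta> \<bullet> z) \<in> G"
begin

text \<open>Positions are measured from \<open>z\<close>, so that 0 is a position for every root and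
  reflections through \<open>z\<close> transport positions unchanged.\<close>

definition offs :: "'a \<Rightarrow> real set" where
  "offs \<beta> = {c. reflection \<beta> (\<beta> \<bullet> z + c) \<in> G}"

lemma offs_zero: "\<beta> \<in> \<Phi> \<Longrightarrow> 0 \<in> offs \<beta>"
  using special by (simp add: offs_def)

lemma offs_scale:
  assumes "t \<noteq> 0"
  shows "t * c \<in> offs (t *\<^sub>R \<beta>) \<longleftrightarrow> c \<in> offs \<beta>"
  using reflection_scale[OF assms, of \<beta> "\<beta> \<bullet> z + c"] by (simp add: offs_def distrib_left)

lemma offs_conj:
  assumes "a \<noteq> 0" "c \<in> offs a" "d \<in> offs b"
  shows "d - 2 * (a \<bullet> b) / (a \<bullet> a) * c \<in> offs (rf a b)"
proof -
  have "reflection a (a \<bullet> z + c) 0 = z - rf a z + (2 * c / (a \<bullet> a)) *\<^sub>R a"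
    using reflection_offset[of a z c 0] by (simp add: rf_minus)
  moreover have "rf a b \<bullet> a = - (a \<bullet> b)" using inner_rf_left[of a b a] by (simp add: inner_commute)
  ultimately have e: "b \<bullet> z + d + rf a b \<bullet> reflection a (a \<bullet> z + c) 0
      = rf a b \<bullet> z + (d - 2 * (a \<bullet> b) / (a \<bullet> a) * c)"
    by (simp add: inner_diff_right inner_add_right)
  have "reflection (rf a b) (b \<bullet> z + d + rf a b \<bullet> reflection a (a \<bullet> z + c) 0) \<in> G"
    using assms(2,3) by (intro G_conj[OF assms(1)]) (simp_all add: offs_def)
  then show ?thesis unfolding e offs_def by simp
qed

lemma offs_rf:
  assumes "a \<in> \<Phi>" "d \<in> offs b"
  shows "d \<in> offs (rf a b)"
proof -
  have "a \<noteq> 0" using assms(1) nz by blast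
  then show ?thesis using offs_conj[OF _ offs_zero[OF assms(1)] assms(2)] by simp
qed

lemma offs_orb: "\<gamma> \<in> orb \<Phi> \<beta> \<Longrightarrow> d \<in> offs \<beta> \<Longrightarrow> d \<in> offs \<gamma>"
  by (induction \<gamma> rule: orb.induct) (auto intro: offs_rf)

text \<open>Roots of equal length are conjugate under reflections through \<open>z\<close>, and
  these keep positions. This is the reason why a linear automorphism of the root system, applied
  around \<open>z\<close>, normalizes \<open>G\<close>.\<close>

lemma offs_norm: "\<beta> \<in> \<Phi> \<Longrightarrow> \<gamma> \<in> \<Phi> \<Longrightarrow> \<gamma> \<bullet> \<gamma> = \<beta> \<bullet> \<beta> \<Longrightarrow> d \<in> offs \<beta> \<Longrightarrow> d \<in> offs \<gamma>"
  using norm_conj[of \<beta> \<gamma>] norm_conj[of \<gamma> \<beta>] offs_orb by metis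

lemma offs_uminus: "\<beta> \<in> \<Phi> \<Longrightarrow> d \<in> offs \<beta> \<Longrightarrow> - d \<in> offs \<beta>"
  using offs_norm[of \<beta> "- \<beta>" d] neg_root[of \<beta>] offs_scale[of "- 1" "- d" \<beta>] by simp

lemma reflection_root:
  assumes "r \<in> G" "r \<in> reflections"
  obtains \<beta> c where "\<beta> \<in> \<Phi>" "c \<in> offs \<beta>" "r = reflection \<beta> (\<beta> \<bullet> z + c)"
proof -
  obtain a d where a: "r = reflection a d" "a \<noteq> 0" using assms(2) by (auto simp: reflections_def)
  obtain t where t: "t \<noteq> 0" "t *\<^sub>R a \<in> \<Phi>" using normal_root[of a d] a assms(1) by blast
  have r: "r = reflection (t *\<^sub>R a) ((t *\<^sub>R a) \<bullet> z + (t * d - (t *\<^sub>R a) \<bullet> z))"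
    unfolding add_diff_cancel_left' add_diff_eq diff_add_eq reflection_scale[OF t(1)] a(1) by simp
  then have "t * d - (t *\<^sub>R a) \<bullet> z \<in> offs (t *\<^sub>R a)" using assms(1) by (simp add: offs_def)
  then show ?thesis using that t(2) r by blast
qed

text \<open>Each generator can be replaced by the parallel reflection through \<open>z\<close>, so
  \<open>G\<close> contains its group of linear parts as a group fixing \<open>z\<close>.\<close>

lemma linear_part_at_z:
  assumes "g \<in> G"
  shows "(\<lambda>x. z + linear_part g (x - z)) \<in> G"
proof -
  have g: "g \<in> gen_by (G \<inter> reflections)" using assms gen by blast
  from g show ?thesis
  proof (rule reflection_group_induct)
    show "(\<lambda>x. z + linear_part id (x - z)) \<in> G" using G_id by (simp add: linear_part_def id_def)
    fix r g assume r: "r \<in> G \<inter> reflections" and g: "g \<in> gen_by (G \<inter> reflections)"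
      and IH: "(\<lambda>x. z + linear_part g (x - z)) \<in> G"
    obtain \<beta> c where b: "\<beta> \<in> \<Phi>" "c \<in> offs \<beta>" "r = reflection \<beta> (\<beta> \<bullet> z + c)" using reflection_root r by blast
    have "linear_part (r \<circ> g) = rf \<beta> \<circ> linear_part g"
      using linear_part_comp[of r g] G_isom r generate_isom[of "G \<inter> reflections" g] g
      unfolding b(3) linear_part_reflection by blast
    then have "(\<lambda>x. z + linear_part (r \<circ> g) (x - z)) = reflection \<beta> (\<beta> \<bullet> z) \<circ> (\<lambda>x. z + linear_part g (x - z))"
      using reflection_offset[of \<beta> z 0] by auto
    then show "(\<lambda>x. z + linear_part (r \<circ> g) (x - z)) \<in> G" using G_comp[OF special[OF b(1)] IH] by simp
  qed blast
qed

lemma linear_reflection_root: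
  assumes "g \<in> G" "linear_part g = rf a" "a \<noteq> 0"
  obtains t where "t \<noteq> 0" "t *\<^sub>R a \<in> \<Phi>"
proof -
  have "reflection a (a \<bullet> z) = (\<lambda>x. z + linear_part g (x - z))"
    using reflection_offset[of a z 0] assms(2) by auto
  then have "reflection a (a \<bullet> z) \<in> G" using linear_part_at_z[OF assms(1)] by simp
  then show ?thesis using normal_root[OF assms(3)] that by blast
qed

definition block :: "'a set \<Rightarrow> 'a set \<Rightarrow> ('a \<Rightarrow> 'a) set" where
  "block U V = {r. \<exists>\<beta>\<in>\<Phi>. (\<beta> \<in> U \<or> \<beta> \<in> V) \<and> (\<exists>c\<in>offs \<beta>. r = reflection \<beta> (\<beta> \<bullet> z + c))}"

lemma block_subset: "block U V \<subseteq> G \<inter> reflections"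
  using nz by (fastforce simp: block_def offs_def reflections_def)

lemma block_mem:
  assumes "a \<noteq> 0" "reflection a c \<in> G" "a \<in> U \<or> a \<in> V" "subspace U" "subspace V"
  shows "reflection a c \<in> block U V"
proof -
  obtain t where t: "t \<noteq> 0" "t *\<^sub>R a \<in> \<Phi>" using normal_root[OF assms(1,2)] by blast
  have r: "reflection a c = reflection (t *\<^sub>R a) ((t *\<^sub>R a) \<bullet> z + (t * c - (t *\<^sub>R a) \<bullet> z))"
    unfolding add_diff_cancel_left' add_diff_eq diff_add_eq reflection_scale[OF t(1)] by simp
  then have "t * c - (t *\<^sub>R a) \<bullet> z \<in> offs (t *\<^sub>R a)" using assms(2) by (simp add: offs_def)
  moreover have "t *\<^sub>R a \<in> U \<or> t *\<^sub>R a \<in> V" using assms(3-5) subspace_scale by blast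
  ultimately show ?thesis unfolding block_def using t(2) r by blast
qed

lemma generate_block_linear_part:
  assumes "subspace U" "subspace V" "\<And>x y. x \<in> U \<Longrightarrow> y \<in> V \<Longrightarrow> x \<bullet> y = 0" "g \<in> gen_by (block U V)"
  shows "\<forall>x\<in>U. linear_part g x \<in> U"
proof (rule generate_linear_part[OF _ assms(4)])
  show "block U V \<subseteq> reflections" using block_subset by blast
  fix a c x assume a: "a \<noteq> 0" "reflection a c \<in> block U V" and x: "x \<in> U"
  obtain \<beta> d where b: "\<beta> \<in> U \<or> \<beta> \<in> V" "reflection a c = reflection \<beta> d" using a(2) unfolding block_def by blast
  have "rf a = rf \<beta>" using b(2) by (metis linear_part_reflection)
  moreover have "rf \<beta> x \<in> U"
    using b(1) x assms(3) by (intro rf_subspace[OF assms(1)]) (auto simp: inner_commute)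
  ultimately show "rf a x \<in> U" by simp
qed

text \<open>Linear parts of the generated group preserve \<open>U\<close>. A linear reflection with
  this property has its normal in \<open>U\<close> or perpendicular to it, that is, in
  \<open>V\<close>. Block-maximality follows from this.\<close>

lemma reflection_in_block:
  assumes UV: "subspace U" "subspace V" "\<And>x y. x \<in> U \<Longrightarrow> y \<in> V \<Longrightarrow> x \<bullet> y = 0"
    "\<And>x. \<exists>u\<in>U. \<exists>v\<in>V. x = u + v"
    and g: "g \<in> gen_by (block U V)" "linear_part g = rf a" and a: "a \<noteq> 0"
  shows "a \<in> U \<or> a \<in> V"
proof -
  have inv: "rf a x \<in> U" if "x \<in> U" for x using generate_block_linear_part[OF UV(1-3) g(1)] g(2) that by metis
  have "a \<in> U \<or> (\<forall>x\<in>U. a \<bullet> x = 0)" by (rule rf_preserves_subspaceD[OF UV(1) _ a]) (rule inv)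
  then show ?thesis
  proof
    assume p: "\<forall>x\<in>U. a \<bullet> x = 0"
    obtain u v where uv: "u \<in> U" "v \<in> V" "a = u + v" using UV(4)[of a] by blast
    have "a \<bullet> u = 0" using p uv(1) by blast
    then have "u \<bullet> u = 0" using UV(3)[OF uv(1,2)] uv(3) by (simp add: inner_add_left inner_add_right inner_commute)
    then show ?thesis using uv by simp
  qed (rule disjI1)
qed

text \<open>Maximality is used twice: once to identify the group of \<open>P\<close> with the group
  of the whole block, and once to show that adding any mixed reflection generates \<open>G\<close>,
  which is the field \<open>max\<close> of \<open>split\<close>.\<close>

lemma block_split:
  fixes P :: "'a set"
  defines "I \<equiv> {f. f facet_of P}" and "u \<equiv> outward_normal P"
  assumes cox: "coxeter_polytope P" and max: "maximal_reflection_subgroup (reflection_group P) G"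
    and C: "C \<subseteq> I" "C \<noteq> {}" "C \<noteq> I" and orth: "\<And>f g. f \<in> C \<Longrightarrow> g \<in> I - C \<Longrightarrow> u f \<bullet> u g = 0"
    and U: "U = span (u ` C)" and V: "V = span (u ` (I - C))"
  shows "split \<Phi> U V" "reflection_group P = gen_by (block U V)"
proof -
  interpret p: coxeter P using cox by unfold_locales
  have u1: "u f \<bullet> u f = 1" if "f \<in> I" for f using p.nrm_inner[of f] that by (simp add: I_def u_def)
  have sU: "subspace U" and sV: "subspace V" by (simp_all add: U V)
  have perp: "x \<bullet> y = 0" if "x \<in> U" "y \<in> V" for x y
  proof -
    have "x \<bullet> u g = 0" if x: "x \<in> U" and g: "g \<in> I - C" for x g
    proof -
      have "u ` C \<subseteq> {x. u g \<bullet> x = 0}" using orth[OF _ g] by (auto simp: inner_commute)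
      then have "span (u ` C) \<subseteq> {x. u g \<bullet> x = 0}" by (intro span_minimal subspace_hyperplane)
      then show ?thesis using x by (auto simp: U inner_commute)
    qed
    then have "u ` (I - C) \<subseteq> {y. x \<bullet> y = 0}" using \<open>x \<in> U\<close> by auto
    then have "span (u ` (I - C)) \<subseteq> {y. x \<bullet> y = 0}" by (intro span_minimal subspace_hyperplane)
    then show ?thesis using \<open>y \<in> V\<close> by (auto simp: V)
  qed
  have decomp: "\<exists>a\<in>U. \<exists>b\<in>V. x = a + b" for x
  proof -
    have "u ` I = u ` C \<union> u ` (I - C)" using C(1) by blast
    then have "x \<in> span (u ` C \<union> u ` (I - C))" using p.normals_span unfolding u_def I_def by simp
    then show ?thesis unfolding span_Un U V by blast
  qed
  have U0: "U \<noteq> {0}"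
  proof -
    obtain f where f: "f \<in> C" using C(2) by blast
    then have "u f \<in> U" unfolding U by (intro span_base) blast
    then show ?thesis using u1[of f] f C(1) by fastforce
  qed
  have V0: "V \<noteq> {0}"
  proof -
    obtain f where f: "f \<in> I - C" using C(1,3) by blast
    then have "u f \<in> V" unfolding V by (intro span_base) blast
    then show ?thesis using u1[of f] f by fastforce
  qed
  define K where "K = gen_by (block U V)"
  let ?H = "reflection_group P"
  have HG: "?H \<subseteq> G" "?H \<noteq> G" using max by (auto simp: maximal_reflection_subgroup_def reflection_subgroup_def)
  have maxK: "gen_by R = G" if "R \<subseteq> G \<inter> reflections" "?H \<subset> gen_by R" for R
  proof -
    have "gen_by R \<subseteq> gen_by (G \<inter> reflections)"
      using that(1) reflections_subset by (intro group.mono_generate[OF group_isom_group]) blast+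
    then have sub: "gen_by R \<subseteq> G" using gen by simp
    then have "reflection_subgroup (gen_by R) G" using that(1) unfolding reflection_subgroup_def by blast
    then show ?thesis using max that(2) sub unfolding maximal_reflection_subgroup_def by blast
  qed
  have uG: "reflection (u f) (p.off f) \<in> ?H" if "f \<in> I" for f
    unfolding reflection_group_def p.facet_reflections_eq u_def
    by (rule generate.incl) (use that in \<open>auto simp: I_def\<close>)
  have u0: "u f \<noteq> 0" if "f \<in> I" for f using u1[OF that] by auto
  have uUV: "u f \<in> U \<or> u f \<in> V" if "f \<in> I" for f
    unfolding U V by (cases "f \<in> C") (use that in \<open>auto intro: span_base\<close>)
  have HK: "?H \<subseteq> K"
  proof -
    have "facet_reflections P \<subseteq> block U V"
    proof
      fix r assume "r \<in> facet_reflections P"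
      then obtain f where f: "r = reflection (u f) (p.off f)" "f \<in> I"
        unfolding p.facet_reflections_eq u_def I_def by blast
      show "r \<in> block U V" unfolding f(1) using HG(1) uG[OF f(2)] by (intro block_mem u0 uUV sU sV f(2)) blast
    qed
    then show ?thesis unfolding K_def reflection_group_def
      using block_subset reflections_subset by (intro group.mono_generate[OF group_isom_group]) blast+
  qed
  note inblock = reflection_in_block[OF sU sV perp decomp, folded K_def]
  \<comment> \<open>Otherwise every root would lie in \<open>U\<close> or \<open>V\<close>, against
    irreducibility.\<close>
  have "K \<noteq> G"
  proof
    assume KG: "K = G"
    have "U = {0} \<or> U = UNIV"
    proof (rule irr[OF sU])
      fix \<alpha> assume a: "\<alpha> \<in> \<Phi>"
      obtain c where c: "reflection \<alpha> c \<in> K" using root_refl[OF a] KG by blast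
      have "\<alpha> \<noteq> 0" using a nz by blast
      then have "\<alpha> \<in> U \<or> \<alpha> \<in> V" using inblock[OF _ _ c linear_part_reflection] by blast
      then show "\<alpha> \<in> U \<or> (\<forall>x\<in>U. \<alpha> \<bullet> x = 0)" using perp by (auto simp: inner_commute)
    qed
    then have UU: "U = UNIV" using U0 by blast
    have "y = 0" if "y \<in> V" for y using perp[of y y] UU that by simp
    then show False using V0 subspace_0[OF sV] by blast
  qed
  then have HeqK: "?H = K" using maxK[of "block U V"] HK block_subset unfolding K_def by blast
  then show "?H = gen_by (block U V)" by (simp add: K_def)
  have root_of: "\<exists>t. t \<noteq> 0 \<and> t *\<^sub>R u f \<in> \<Phi>" if "f \<in> I" for f
    using normal_root[OF u0[OF that]] uG[OF that] HG(1) by blast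
  have sp: "span (\<Phi> \<inter> span (u ` D)) = span (u ` D)" if "D \<subseteq> I" for D
  proof (rule antisym)
    show "span (\<Phi> \<inter> span (u ` D)) \<subseteq> span (u ` D)" by (intro span_minimal subspace_span) blast
    show "span (u ` D) \<subseteq> span (\<Phi> \<inter> span (u ` D))"
    proof (intro span_minimal subspace_span subsetI)
      fix x assume "x \<in> u ` D"
      then obtain f where f: "f \<in> D" "x = u f" by blast
      obtain t where t: "t \<noteq> 0" "t *\<^sub>R u f \<in> \<Phi>" using root_of f(1) \<open>D \<subseteq> I\<close> by blast
      have "t *\<^sub>R u f \<in> span (u ` D)" using f(1) by (intro span_scale span_base) blast
      then have "(1 / t) *\<^sub>R (t *\<^sub>R u f) \<in> span (\<Phi> \<inter> span (u ` D))" using t(2) by (intro span_scale span_base) blast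
      then show "x \<in> span (\<Phi> \<inter> span (u ` D))" using t(1) f(2) by simp
    qed
  qed
  show "split \<Phi> U V"
  proof
    show "subspace U" "subspace V" by (fact sU sV)+
    show "x \<bullet> y = 0" if "x \<in> U" "y \<in> V" for x y by (rule perp[OF that])
    show "\<exists>a\<in>U. \<exists>b\<in>V. x = a + b" for x by (rule decomp)
    show "span (\<Phi> \<inter> U) = U" "span (\<Phi> \<inter> V) = V" unfolding U V by (intro sp C(1) Diff_subset)+
    show "U \<noteq> {0}" "V \<noteq> {0}" by (fact U0 V0)+
  next
    fix \<gamma> S \<beta> x
    assume g: "\<gamma> \<in> \<Phi>" "\<gamma> \<notin> U" "\<gamma> \<notin> V"
      and S1: "\<And>\<alpha> x. \<alpha> \<in> \<Phi> \<Longrightarrow> \<alpha> \<in> U \<or> \<alpha> \<in> V \<Longrightarrow> x \<in> S \<Longrightarrow> rf \<alpha> x \<in> S"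
      and S2: "\<And>x. x \<in> S \<Longrightarrow> rf \<gamma> x \<in> S" and b: "\<beta> \<in> \<Phi>" and x: "x \<in> S"
    obtain c where c: "reflection \<gamma> c \<in> G" using root_refl[OF g(1)] by blast
    have g0: "\<gamma> \<noteq> 0" using g(1) nz by blast
    \<comment> \<open>The block with one mixed reflection generates more than the maximal subgroup,
      hence \<open>G\<close>; so a set invariant under these linear parts is invariant under
      all.\<close>
    let ?R = "insert (reflection \<gamma> c) (block U V)"
    have R: "?R \<subseteq> G \<inter> reflections" using c g0 block_subset by (auto simp: reflections_def)
    have "K \<subseteq> gen_by ?R"
      unfolding K_def using R reflections_subset by (intro group.mono_generate[OF group_isom_group]) blast+
    moreover have "reflection \<gamma> c \<notin> K"
      using inblock[OF _ _ _ linear_part_reflection g0] g(2,3) by blast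
    moreover have "reflection \<gamma> c \<in> gen_by ?R" by (rule generate.incl) simp
    ultimately have "gen_by ?R = G" by (intro maxK[OF R]) (use HeqK in blast)
    moreover obtain d where d: "reflection \<beta> d \<in> G" using root_refl[OF b] by blast
    ultimately have "\<forall>x\<in>S. linear_part (reflection \<beta> d) x \<in> S"
    proof (intro generate_linear_part[of ?R])
      show "?R \<subseteq> reflections" using R by blast
      fix a e y assume a: "a \<noteq> 0" "reflection a e \<in> ?R" and y: "y \<in> S"
      have "\<exists>\<alpha>. (\<alpha> = \<gamma> \<or> \<alpha> \<in> \<Phi> \<and> (\<alpha> \<in> U \<or> \<alpha> \<in> V)) \<and> (\<exists>d. reflection a e = reflection \<alpha> d)"
        using a(2) unfolding block_def by blast
      then obtain \<alpha> d where \<alpha>: "\<alpha> = \<gamma> \<or> \<alpha> \<in> \<Phi> \<and> (\<alpha> \<in> U \<or> \<alpha> \<in> V)" "reflection a e = reflection \<alpha> d" by blast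
      have "rf a = rf \<alpha>" using \<alpha>(2) by (metis linear_part_reflection)
      then show "rf a y \<in> S" using \<alpha>(1) S1 S2 y by auto
    qed simp
    then show "rf \<beta> x \<in> S" using x by (simp add: linear_part_reflection)
  qed
qed

end

section \<open>The indices in the exceptional case\<close>

lemma subgroup_index_eq: "subgroup_index G H = card ((\<lambda>a. (\<lambda>h. h \<circ> a) ` H) ` G)"
proof -
  have "rcosets\<^bsub>isom_group\<lparr>carrier := G\<rparr>\<^esub> H = (\<lambda>a. (\<lambda>h. h \<circ> a) ` H) ` G"
    unfolding RCOSETS_def r_coset_def by (auto simp: isom_group_def)
  then show ?thesis by (simp add: subgroup_index_def)
qed

lemma generate_left_inverse:
  assumes "R \<subseteq> reflections" "a \<in> gen_by R"
  obtains b where "b \<in> gen_by R" "b \<circ> a = id"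
proof -
  have R: "R \<subseteq> carrier isom_group" using assms(1) reflections_subset by blast
  have s: "subgroup (gen_by R) isom_group" by (rule group.generate_is_subgroup[OF group_isom_group R])
  have "inv\<^bsub>isom_group\<^esub> a \<in> gen_by R" by (rule subgroup.m_inv_closed[OF s assms(2)])
  moreover have "inv\<^bsub>isom_group\<^esub> a \<circ> a = id"
    using group.l_inv[OF group_isom_group generate_isom[OF assms]] by simp
  ultimately show ?thesis using that by blast
qed

lemma index_two:
  assumes R: "R \<subseteq> reflections" and H: "H = gen_by R" and G: "G = H \<union> (\<lambda>h. h \<circ> s) ` H" "H \<noteq> G"
  shows "subgroup_index G H = 2"
proof -
  let ?c = "\<lambda>a. (\<lambda>h. h \<circ> a) ` H"
  have id: "id \<in> H" unfolding H by (rule id_generate)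
  have comp: "f \<circ> g \<in> H" if "f \<in> H" "g \<in> H" for f g using that unfolding H by (rule generate_comp)
  have c: "?c a = H" if a: "a \<in> H" for a
  proof (rule antisym)
    show "?c a \<subseteq> H" using comp a by blast
    obtain b where b: "b \<in> H" "b \<circ> a = id" using generate_left_inverse[OF R] a unfolding H by blast
    show "H \<subseteq> ?c a"
    proof
      fix h assume "h \<in> H"
      then have "h \<circ> b \<in> H" using b(1) by (rule comp)
      moreover have "h = (h \<circ> b) \<circ> a" using b(2) by (simp add: comp_assoc)
      ultimately show "h \<in> ?c a" by (metis image_eqI)
    qed
  qed
  have cs: "?c (a \<circ> s) = ?c s" if "a \<in> H" for a
  proof -
    have "?c (a \<circ> s) = (\<lambda>h. h \<circ> s) ` ?c a" by (simp only: image_image comp_assoc)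
    then show ?thesis using c[OF that] by simp
  qed
  have img: "?c ` G = {H, ?c s}"
  proof -
    have "?c ` G = ?c ` H \<union> (\<lambda>a. ?c (a \<circ> s)) ` H" unfolding G(1) image_Un by (simp only: image_image)
    also have "?c ` H = {H}" using c id by auto
    also have "(\<lambda>a. ?c (a \<circ> s)) ` H = {?c s}" using cs id by (intro equalityI subsetI) auto
    finally show ?thesis by (simp only: insert_is_Un[of H "{?c s}"])
  qed
  have "H \<noteq> ?c s" using G by auto
  then show ?thesis unfolding subgroup_index_eq img by (intro card_2_iff[THEN iffD2] exI conjI) (rule refl)
qed

lemma three_not_two: "card S = 2 \<Longrightarrow> x \<in> S \<Longrightarrow> y \<in> S \<Longrightarrow> w \<in> S \<Longrightarrow> x \<noteq> y \<Longrightarrow> x \<noteq> w \<Longrightarrow> y \<noteq> w \<Longrightarrow> False"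
  by (auto simp: card_2_iff)

text \<open>The cosets of \<open>id\<close>, \<open>r\<close> and \<open>s\<close> are pairwise
  different; since \<open>s\<close> is an involution, \<open>r \<circ> s\<close> is the quotient
  that tells the last two apart.\<close>

lemma index_not_two:
  assumes "id \<in> G" "id \<in> H" "r \<in> G" "s \<in> G" "r \<notin> H" "s \<notin> H" "r \<circ> s \<notin> H" "s \<circ> s = id"
  shows "subgroup_index G H \<noteq> 2"
proof
  assume i: "subgroup_index G H = 2"
  let ?c = "\<lambda>a. (\<lambda>h. h \<circ> a) ` H"
  have c2: "card (?c ` G) = 2" using i by (simp add: subgroup_index_eq)
  have in_c: "a \<in> ?c a" for a by (rule image_eqI[of _ _ id]) (simp_all add: assms(2))
  have idc: "?c id = H" by simp
  have "?c r \<noteq> ?c id" using in_c[of r] assms(5) idc by metis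
  moreover have "?c s \<noteq> ?c id" using in_c[of s] assms(6) idc by metis
  moreover have "?c r \<noteq> ?c s"
  proof
    assume "?c r = ?c s"
    then obtain h where h: "h \<in> H" "r = h \<circ> s" using in_c[of r] by auto
    then have "r \<circ> s = h" using assms(8) by (simp add: comp_assoc)
    then show False using assms(7) h(1) by simp
  qed
  moreover have "?c id \<in> ?c ` G" "?c r \<in> ?c ` G" "?c s \<in> ?c ` G" using assms(1,3,4) by blast+
  ultimately show False using three_not_two[OF c2] by metis
qed

context affine_refl_point
begin

definition mirror :: "'a \<Rightarrow> real \<Rightarrow> 'a \<Rightarrow> 'a" where
  "mirror x c = reflection x (x \<bullet> z + c)"

lemma mirror_apply: "mirror x c (z + y) = z + (rf x y + (2 * c / (x \<bullet> x)) *\<^sub>R x)"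
  using reflection_offset[of x z c "z + y"] by (simp add: mirror_def add.assoc)

lemma mirror_eqI: "(\<And>y. f (z + y) = g (z + y)) \<Longrightarrow> f = g"
  by (rule ext) (metis add.commute diff_add_cancel)

text \<open>All four directions have mirrors at exactly the multiples of \<open>t\<close>. The
  diagonal mirrors generate a subgroup normalized by \<open>s\<close>, and every axis mirror lies in
  its coset of \<open>s\<close>, so the index is 2. The axis mirrors generate a subgroup without
  diagonal reflections that also misses a translation composed of two diagonal ones, so its index is
  not 2.\<close>

lemma square_index:
  assumes a0: "a \<noteq> 0" and ab: "a \<bullet> b = 0" "a \<bullet> a = b \<bullet> b" and t: "t > 0"
    and offs: "\<And>x c. x \<in> {a, b, a + b, a - b} \<Longrightarrow> c \<in> offs x \<longleftrightarrow> c / t \<in> \<int>"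
    and refls: "\<And>r. r \<in> G \<Longrightarrow> r \<in> reflections \<Longrightarrow> \<exists>x\<in>{a, b, a + b, a - b}. \<exists>c\<in>offs x. r = mirror x c"
    and H: "H = gen_by {r. \<exists>x\<in>{a, b}. \<exists>c\<in>offs x. r = mirror x c}"
    and H': "H' = gen_by {r. \<exists>x\<in>{a + b, a - b}. \<exists>c\<in>offs x. r = mirror x c}" "H' \<noteq> G"
  shows "subgroup_index G H' = 2 \<and> subgroup_index G H \<noteq> 2"
proof (intro conjI)
  let ?n = "a \<bullet> a"
  have n: "?n > 0" using a0 by simp
  have b0: "b \<noteq> 0" using n ab(2) by auto
  have pn: "(a + b) \<bullet> (a + b) = 2 * ?n" "(a - b) \<bullet> (a - b) = 2 * ?n" "(a + b) \<bullet> (a - b) = 0" "b \<bullet> a = 0"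
    using ab by (simp_all add: inner_add_left inner_add_right inner_diff_left inner_diff_right inner_commute)
  have ne: "a + b \<noteq> 0" "a - b \<noteq> 0" using pn(1,2) n by auto
  have zero: "0 \<in> offs x" if "x \<in> {a, b, a + b, a - b}" for x unfolding offs[OF that] by simp
  let ?R = "{r. \<exists>x\<in>{a, b}. \<exists>c\<in>offs x. r = mirror x c}" and ?R' = "{r. \<exists>x\<in>{a + b, a - b}. \<exists>c\<in>offs x. r = mirror x c}"
  have refl_refl: "mirror x c \<in> reflections" if "x \<noteq> 0" for x c using that by (auto simp: mirror_def reflections_def)
  have reflG: "mirror x c \<in> G" if "c \<in> offs x" for x c using that by (simp add: offs_def mirror_def)
  have R: "?R \<subseteq> reflections" "?R' \<subseteq> reflections" using refl_refl a0 b0 ne by auto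
  define s where "s = mirror a 0"
  have ss: "s \<circ> s = id" unfolding s_def mirror_def by (rule reflection_comp_self)
  have s_assoc: "s \<circ> (s \<circ> f) = f" for f using ss by (simp add: comp_assoc[symmetric])
  have p': "mirror (a + b) c \<in> H'" if "c / t \<in> \<int>" for c
    unfolding H'(1) by (rule generate.incl) (use that offs[of "a + b" c] in auto)
  have m': "mirror (a - b) c \<in> H'" if "c / t \<in> \<int>" for c
    unfolding H'(1) by (rule generate.incl) (use that offs[of "a - b" c] in auto)
  have H'comp: "f \<circ> g \<in> H'" if "f \<in> H'" "g \<in> H'" for f g using that unfolding H'(1) by (rule generate_comp)
  have conj: "s \<circ> (mirror x c \<circ> s) = mirror y (- c)" if e: "rf a x = - y" "x \<bullet> x = 2 * ?n" "y \<bullet> y = 2 * ?n" for x y c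
  proof (rule mirror_eqI)
    fix w
    have "(s \<circ> (mirror x c \<circ> s)) (z + w) = z + (rf a (rf x (rf a w)) + (2 * c / (2 * ?n)) *\<^sub>R - y)"
      by (simp add: s_def mirror_apply rf_add rf_scale e)
    also have "rf a (rf x (rf a w)) = rf y w"
      using orthogonal_transformation_rf_conj[OF orthogonal_transformation_rf[of a], of x "rf a w"] e(1)
        rf_scaled[of "- 1" y] by simp
    finally show "(s \<circ> (mirror x c \<circ> s)) (z + w) = mirror y (- c) (z + w)"
      unfolding mirror_apply e
      by (simp only: scaleR_minus_right scaleR_minus_left mult_minus_right minus_divide_left[symmetric])
  qed
  have p1: "rf a (a + b) = - (a - b)" and p2: "rf a (a - b) = - (a + b)"
    using ab n by (simp_all add: rf_eq inner_add_right inner_diff_right scaleR_2)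
  \<comment> \<open>\<open>s\<close> exchanges the two diagonal directions and negates the positions
    of the mirrors.\<close>
  have norm: "s \<circ> (h \<circ> s) \<in> H'" if "h \<in> H'" for h
    using that[unfolded H'(1)] R(2)
  proof (rule reflection_group_induct)
    show "s \<circ> (id \<circ> s) \<in> H'" using ss id_generate by (simp add: H'(1))
    fix r g assume r: "r \<in> ?R'" and IH: "s \<circ> (g \<circ> s) \<in> H'"
    have "s \<circ> (r \<circ> s) \<in> H'"
    proof -
      from r consider c where "c / t \<in> \<int>" "r = mirror (a + b) c" | c where "c / t \<in> \<int>" "r = mirror (a - b) c"
        using offs[of "a + b"] offs[of "a - b"] by blast
      then show ?thesis
      proof cases
        case (1 c)
        then show ?thesis using m'[of "- c"] conj[OF p1 pn(1,2)] by (simp add: minus_divide_left[symmetric])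
      next
        case (2 c)
        then show ?thesis using p'[of "- c"] conj[OF p2 pn(2,1)] by (simp add: minus_divide_left[symmetric])
      qed
    qed
    then have "(s \<circ> (r \<circ> s)) \<circ> (s \<circ> (g \<circ> s)) \<in> H'" using IH by (rule H'comp)
    moreover have "(s \<circ> (r \<circ> s)) \<circ> (s \<circ> (g \<circ> s)) = s \<circ> ((r \<circ> g) \<circ> s)"
      by (simp only: comp_assoc s_assoc)
    ultimately show "s \<circ> ((r \<circ> g) \<circ> s) \<in> H'" by simp
  qed
  have half: "2 * c / (2 * ?n) = c / ?n" for c by simp
  have rA: "mirror a c \<circ> s \<in> H'" if c: "c / t \<in> \<int>" for c
  proof -
    \<comment> \<open>Both sides are the translation along \<open>a\<close>; on the right it is
      composed of translations along the two diagonals, each a product of two parallel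
      mirrors.\<close>
    have "mirror a c \<circ> s = (mirror (a + b) c \<circ> mirror (a + b) 0) \<circ> (mirror (a - b) c \<circ> mirror (a - b) 0)"
    proof (rule mirror_eqI)
      fix y
      have "((mirror (a + b) c \<circ> mirror (a + b) 0) \<circ> (mirror (a - b) c \<circ> mirror (a - b) 0)) (z + y)
          = z + (y + (c / ?n) *\<^sub>R (a - b) + (c / ?n) *\<^sub>R (a + b))"
        by (simp add: mirror_apply pn)
      also have "(c / ?n) *\<^sub>R (a - b) + (c / ?n) *\<^sub>R (a + b) = (2 * c / ?n) *\<^sub>R a"
        unfolding scaleR_right_distrib[symmetric] by (simp add: scaleR_2[symmetric])
      then have "y + (c / ?n) *\<^sub>R (a - b) + (c / ?n) *\<^sub>R (a + b) = y + (2 * c / ?n) *\<^sub>R a" by (simp only: add.assoc)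
      finally show "(mirror a c \<circ> s) (z + y) = ((mirror (a + b) c \<circ> mirror (a + b) 0) \<circ> (mirror (a - b) c \<circ> mirror (a - b) 0)) (z + y)"
        by (simp add: s_def mirror_apply)
    qed
    then show ?thesis using p'[of c] p'[of 0] m'[of c] m'[of 0] c by (auto intro!: H'comp)
  qed
  have rB: "mirror b c \<circ> s \<in> H'" if c: "c / t \<in> \<int>" for c
  proof -
    \<comment> \<open>Two perpendicular mirrors compose to the same linear map for the axes as for
      the diagonals; the positions are chosen to give the same translation part.\<close>
    have "mirror b c \<circ> s = mirror (a + b) c \<circ> mirror (a - b) (- c)"
    proof (rule mirror_eqI)
      fix y
      have f: "rf (a + b) (a - b) = a - b" by (rule rf_fix[OF pn(3)])
      have l: "rf b (rf a y) = y - (2 * (a \<bullet> y) / ?n) *\<^sub>R a - (2 * (b \<bullet> y) / ?n) *\<^sub>R b"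
        using pn(4) ab by (simp add: rf_eq inner_diff_right)
      have "rf (a + b) (rf (a - b) y) = rf (a + b) y - (((a - b) \<bullet> y) / ?n) *\<^sub>R (a - b)"
        unfolding rf_eq[of "a - b"] rf_diff[of "a + b" y] rf_scale f pn half by simp
      also have "\<dots> = y - ((((a + b) \<bullet> y) / ?n) *\<^sub>R (a + b) + (((a - b) \<bullet> y) / ?n) *\<^sub>R (a - b))"
        unfolding rf_eq[of "a + b"] pn half by simp
      also have "(((a + b) \<bullet> y) / ?n) *\<^sub>R (a + b) + (((a - b) \<bullet> y) / ?n) *\<^sub>R (a - b)
          = (2 * (a \<bullet> y) / ?n) *\<^sub>R a + (2 * (b \<bullet> y) / ?n) *\<^sub>R b"
      proof -
        define p q where "p = (a \<bullet> y) / ?n" and "q = (b \<bullet> y) / ?n"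
        have f: "((a + b) \<bullet> y) / ?n = p + q" "((a - b) \<bullet> y) / ?n = p - q" "2 * (a \<bullet> y) / ?n = p + p" "2 * (b \<bullet> y) / ?n = q + q"
          by (simp_all add: p_def q_def inner_add_left inner_diff_left add_divide_distrib diff_divide_distrib)
        show ?thesis
          unfolding f scaleR_left_distrib scaleR_left_diff_distrib scaleR_add_right scaleR_diff_right by simp
      qed
      finally have k: "rf (a + b) (rf (a - b) y) = rf b (rf a y)" unfolding l by simp
      have "(mirror (a + b) c \<circ> mirror (a - b) (- c)) (z + y) = z + (rf b (rf a y) + ((- c / ?n) *\<^sub>R (a - b) + (c / ?n) *\<^sub>R (a + b)))"
        by (simp add: mirror_apply pn rf_diff[of "a + b" "rf (a - b) y"] rf_scale f k)
      also have "(- c / ?n) *\<^sub>R (a - b) + (c / ?n) *\<^sub>R (a + b) = (c / ?n) *\<^sub>R (2 *\<^sub>R b)"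
        by (simp add: scaleR_2 scaleR_add_right scaleR_diff_right)
      finally show "(mirror b c \<circ> s) (z + y) = (mirror (a + b) c \<circ> mirror (a - b) (- c)) (z + y)"
        using ab(2) by (simp add: s_def mirror_apply mult.commute)
    qed
    then show ?thesis using p'[of c] m'[of "- c"] c by (auto intro!: H'comp simp: minus_divide_left[symmetric])
  qed
  let ?M = "H' \<union> (\<lambda>h. h \<circ> s) ` H'"
  have GM: "g \<in> ?M" if "g \<in> G" for g
  proof -
    have "g \<in> gen_by (G \<inter> reflections)" using that gen by blast
    then show ?thesis
    proof (rule reflection_group_induct)
      show "id \<in> ?M" by (rule UnI1) (simp only: H'(1) id_generate)
      fix r g assume r: "r \<in> G \<inter> reflections" and g: "g \<in> ?M"
      obtain x c where xc: "x \<in> {a, b, a + b, a - b}" "c \<in> offs x" "r = mirror x c" using refls r by blast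
      have c: "c / t \<in> \<int>" using xc offs by blast
      have "r \<in> H' \<or> r \<circ> s \<in> H'" using xc(1) rA[OF c] rB[OF c] p'[OF c] m'[OF c] unfolding xc(3) by blast
      then show "r \<circ> g \<in> ?M"
      proof
        assume rH: "r \<in> H'"
        from g show ?thesis
        proof
          assume "g \<in> H'" then show ?thesis by (intro UnI1 H'comp[OF rH])
        next
          assume "g \<in> (\<lambda>h. h \<circ> s) ` H'"
          then obtain h where h: "h \<in> H'" "g = h \<circ> s" by blast
          then have "r \<circ> g = (r \<circ> h) \<circ> s" by (simp add: comp_assoc)
          then show ?thesis using imageI[OF H'comp[OF rH h(1)], of "\<lambda>h. h \<circ> s"] by (simp only: UnI2)
        qed
      next
        assume rs: "r \<circ> s \<in> H'"
        have r_eq: "r \<circ> f = (r \<circ> s) \<circ> (s \<circ> f)" for f by (simp only: comp_assoc s_assoc)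
        from g show ?thesis
        proof
          assume gH: "g \<in> H'"
          have "r \<circ> g = ((r \<circ> s) \<circ> (s \<circ> (g \<circ> s))) \<circ> s"
            unfolding r_eq[of g] by (simp only: comp_assoc ss comp_id)
          then show ?thesis using imageI[OF H'comp[OF rs norm[OF gH]], of "\<lambda>h. h \<circ> s"] by (simp only: UnI2)
        next
          assume "g \<in> (\<lambda>h. h \<circ> s) ` H'"
          then obtain h where h: "h \<in> H'" "g = h \<circ> s" by blast
          have "r \<circ> g = (r \<circ> s) \<circ> (s \<circ> (h \<circ> s))" unfolding h(2) by (rule r_eq)
          then show ?thesis using H'comp[OF rs norm[OF h(1)]] by (simp only: UnI1)
        qed
      qed
    qed blast
  qed
  have H'G: "h \<in> G" if "h \<in> H'" for h
  proof -
    have "?R' \<subseteq> G" using reflG by auto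
    then have "?R' \<subseteq> G \<inter> reflections" using R(2) by (rule Int_greatest)
    then have "H' \<subseteq> gen_by (G \<inter> reflections)"
      unfolding H'(1) using reflections_subset by (intro group.mono_generate[OF group_isom_group]) blast+
    then show ?thesis using that gen by blast
  qed
  have sG: "s \<in> G" unfolding s_def by (rule reflG) (rule zero, simp)
  have "?M \<subseteq> G"
  proof
    fix g assume "g \<in> ?M"
    then show "g \<in> G"
    proof
      assume "g \<in> (\<lambda>h. h \<circ> s) ` H'"
      then obtain h where "h \<in> H'" "g = h \<circ> s" by blast
      then show ?thesis using G_comp[OF H'G sG] by simp
    qed (rule H'G)
  qed
  then have "G = ?M" using GM by (intro equalityI subsetI) auto
  then show "subgroup_index G H' = 2" by (rule index_two[OF R(2) H'(1) _ H'(2)])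
  show "subgroup_index G H \<noteq> 2"
  proof (rule index_not_two)
    let ?r = "mirror (a + b) 0" and ?s = "mirror (a + b) t"
    show "id \<in> G" by (rule G_id)
    show "id \<in> H" unfolding H by (rule id_generate)
    show "?r \<in> G" "?s \<in> G" using offs[of "a + b"] t by (intro reflG, simp)+
    \<comment> \<open>The linear parts of \<open>H\<close> preserve the line of \<open>a\<close>,
      but a diagonal reflection sends \<open>a\<close> to \<open>- b\<close>.\<close>
    have "mirror (a + b) c \<notin> H" for c
    proof
      assume "mirror (a + b) c \<in> H"
      then have "\<forall>x\<in>span {a}. linear_part (mirror (a + b) c) x \<in> span {a}"
      proof (intro generate_linear_part[OF R(1)])
        fix x d y assume x: "reflection x d \<in> ?R" and y: "y \<in> span {a}"
        obtain w e where w: "w = a \<or> w = b" "reflection x d = mirror w e" using x by auto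
        have rx: "rf x = rf w" using w(2) unfolding mirror_def by (metis linear_part_reflection)
        have "w \<in> span {a} \<or> (\<forall>y\<in>span {a}. w \<bullet> y = 0)"
          using w(1)
        proof
          assume "w = a" then show ?thesis by (simp add: span_base)
        next
          assume "w = b" then show ?thesis by (auto simp: span_singleton pn(4))
        qed
        then show "rf x y \<in> span {a}" unfolding rx by (rule rf_subspace[OF subspace_span _ y])
      qed (simp add: H)
      then have "rf (a + b) a \<in> span {a}" by (simp add: mirror_def linear_part_reflection span_base)
      moreover have "rf (a + b) a = - b"
        unfolding rf_eq pn using n pn(4) by (simp add: inner_add_left)
      ultimately obtain k where "- b = k *\<^sub>R a" by (auto simp: span_singleton)
      then have "(- b) \<bullet> b = k * (a \<bullet> b)" by (metis inner_scaleR_left)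
      then show False using ab b0 by simp
    qed
    then show "?r \<notin> H" "?s \<notin> H" by blast+
    show "?s \<circ> ?s = id" unfolding mirror_def by (rule reflection_comp_self)
    show "?r \<circ> ?s \<notin> H"
    proof
      assume "?r \<circ> ?s \<in> H"
      \<comment> \<open>Invariant of \<open>H\<close>: its elements displace \<open>z\<close> along
        \<open>a\<close> by multiples of \<open>2 * t\<close>, whereas the product of the two
        diagonal reflections displaces it by \<open>- t\<close>.\<close>
      then have "(a \<bullet> ((?r \<circ> ?s) z - z)) / (2 * t) \<in> \<int>"
        unfolding H using R(1)
      proof (rule reflection_group_induct)
        show "(a \<bullet> (id z - z)) / (2 * t) \<in> \<int>" by simp
        fix r g assume r: "r \<in> ?R" and IH: "(a \<bullet> (g z - z)) / (2 * t) \<in> \<int>"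
        define y where "y = g z - z"
        have gz: "g z = z + y" by (simp add: y_def)
        obtain x c where xc: "x = a \<or> x = b" "c \<in> offs x" "r = mirror x c" using r by auto
        from xc(1) show "(a \<bullet> ((r \<circ> g) z - z)) / (2 * t) \<in> \<int>"
        proof
          assume x: "x = a"
          have c: "c / t \<in> \<int>" using xc(2) offs[of a c] x by simp
          have "a \<bullet> ((r \<circ> g) z - z) = a \<bullet> rf a y + 2 * c"
            unfolding comp_apply gz xc(3) x mirror_apply using n by (simp add: inner_add_right)
          also have "a \<bullet> rf a y = - (a \<bullet> y)" using inner_rf_left[of a a y] by simp
          finally have "(a \<bullet> ((r \<circ> g) z - z)) / (2 * t) = c / t - (a \<bullet> y) / (2 * t)" using t by (simp add: field_simps)
          then show ?thesis using c IH by (simp add: y_def)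
        next
          assume x: "x = b"
          have "a \<bullet> ((r \<circ> g) z - z) = a \<bullet> rf b y"
            unfolding comp_apply gz xc(3) x mirror_apply using ab(1) by (simp add: inner_add_right)
          also have "a \<bullet> rf b y = a \<bullet> y" using inner_rf_left[of b a y] unfolding rf_fix[OF pn(4)] by simp
          finally show ?thesis using IH by (simp only: y_def)
        qed
      qed
      moreover have "a \<bullet> ((?r \<circ> ?s) z - z) = - t"
      proof -
        have "?s (z + 0) = z + (rf (a + b) 0 + (2 * t / (2 * ?n)) *\<^sub>R (a + b))" unfolding mirror_apply pn by (rule refl)
        then have 1: "?s z = z + (t / ?n) *\<^sub>R (a + b)" by simp
        have "(?r \<circ> ?s) z = z + (rf (a + b) ((t / ?n) *\<^sub>R (a + b)) + (2 * 0 / (2 * ?n)) *\<^sub>R (a + b))"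
          unfolding comp_apply 1 mirror_apply pn by (rule refl)
        then have "(?r \<circ> ?s) z - z = - ((t / ?n) *\<^sub>R (a + b))" by (simp add: rf_scale del: minus_add_distrib)
        then have "a \<bullet> ((?r \<circ> ?s) z - z) = - (t / ?n * (?n + a \<bullet> b))" by (simp only: inner_minus_right inner_scaleR_right inner_add_right)
        then show ?thesis using n ab(1) by simp
      qed
      ultimately have "- (1 / 2) \<in> (\<int> :: real set)" using t by simp
      then obtain i :: int where "- (1 / 2) = (of_int i :: real)" by (auto elim!: Ints_cases)
      then have "(of_int (2 * i) :: real) = of_int (- 1)" by simp
      then have "2 * i = - 1" by (simp only: of_int_eq_iff)
      then show False by presburger
    qed
  qed
qed

end

text \<open>Models the positions of parallel mirrors, which are closed under reflecting one position
  in another but not evidently under addition. With the least positive member \<open>n\<close> the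
  set is invariant under shifts by \<open>2 * n\<close>, and the residues that occur are 0 and
  \<open>n\<close>.\<close>

lemma doubling_closed_int:
  fixes K :: "int set"
  assumes zero: "0 \<in> K" and refl: "\<And>x y. x \<in> K \<Longrightarrow> y \<in> K \<Longrightarrow> x - 2 * y \<in> K" and neg: "\<And>x. x \<in> K \<Longrightarrow> - x \<in> K"
    and ne: "\<exists>x\<in>K. x \<noteq> 0"
  obtains n where "n > 0" "\<And>k. k \<in> K \<longleftrightarrow> n dvd k"
proof -
  obtain x where x: "x \<in> K" "x \<noteq> 0" using ne by blast
  have "\<exists>j::nat. j > 0 \<and> int j \<in> K"
    using x neg[OF x(1)] by (intro exI[of _ "nat \<bar>x\<bar>"]) (auto simp: abs_if)
  define m where "m = (LEAST j::nat. j > 0 \<and> int j \<in> K)"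
  have m: "m > 0" "int m \<in> K"
    using LeastI_ex[OF \<open>\<exists>j::nat. j > 0 \<and> int j \<in> K\<close>] unfolding m_def by auto
  have least: "int m \<le> k" if "k \<in> K" "k > 0" for k
  proof -
    have "m \<le> nat k" unfolding m_def using that by (intro Least_le) auto
    then show ?thesis using that(2) by linarith
  qed
  define n where "n = int m"
  have n: "n > 0" "n \<in> K" using m by (simp_all add: n_def)
  have up: "x + 2 * n * int j \<in> K" if "x \<in> K" for x j
  proof (induction j)
    case (Suc j)
    have "(x + 2 * n * int j) - 2 * (- n) \<in> K" by (rule refl[OF Suc neg[OF n(2)]])
    then show ?case by (simp add: algebra_simps)
  qed (simp add: that)
  have shift: "x + 2 * n * i \<in> K" if x: "x \<in> K" for x i
  proof (cases "i \<ge> 0")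
    case True then show ?thesis using up[OF x, of "nat i"] by simp
  next
    case False
    then have "- (- x + 2 * n * int (nat (- i))) \<in> K" by (intro neg up x)
    then show ?thesis using False by (simp add: add.commute)
  qed
  have "n dvd k" if k: "k \<in> K" for k
  proof -
    define r where "r = k mod (2 * n)"
    have r0: "0 \<le> r" "r < 2 * n" using n(1) by (simp_all add: r_def)
    have kr: "k = r + 2 * n * (k div (2 * n))" unfolding r_def by simp
    have rK: "r \<in> K" using shift[OF k, of "- (k div (2 * n))"] by (simp add: r_def minus_mult_div_eq_mod)
    \<comment> \<open>A residue strictly between 0 and \<open>n\<close> contradicts minimality; one
      strictly between \<open>n\<close> and \<open>2 * n\<close> does so after reflecting it to
      \<open>2 * n - r\<close>.\<close>
    have "r = 0 \<or> r = n"
    proof (rule ccontr)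
      assume no: "\<not> ?thesis"
      then have "r \<ge> n" using least[OF rK] r0 by (simp add: n_def)
      then have "n < r" using no by simp
      moreover have "- (r + 2 * n * (- 1)) \<in> K" by (rule neg[OF shift[OF rK]])
      ultimately show False using least[of "- (r + 2 * n * (- 1))"] r0 by (simp add: n_def)
    qed
    then show ?thesis by (subst kr) auto
  qed
  moreover have "k \<in> K" if k: "n dvd k" for k
  proof -
    obtain j where j: "k = n * j" using k by blast
    show ?thesis
    proof (cases "even j")
      case True
      then obtain i where "j = 2 * i" by blast
      then show ?thesis using shift[OF zero, of i] j by (simp add: algebra_simps)
    next
      case False
      then obtain i where "j = 2 * i + 1" by (rule oddE)
      then show ?thesis using shift[OF n(2), of i] j by (simp add: algebra_simps)
    qed
  qed
  ultimately show ?thesis using that n(1) by blast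
qed

lemma divide_Ints_iff: "t \<noteq> 0 \<Longrightarrow> c / t \<in> \<int> \<longleftrightarrow> (\<exists>j::int. c = t * of_int j)" for c t :: real
  by (auto simp: divide_eq_eq mult.commute elim!: Ints_cases)

context affine_refl_point
begin

lemma offs_discrete:
  obtains \<kappa> where "\<kappa> > 0" "\<And>\<beta> c. \<beta> \<in> \<Phi> \<Longrightarrow> c \<in> offs \<beta> \<Longrightarrow> c / (\<kappa> * (\<beta> \<bullet> \<beta>)) \<in> \<int>"
proof -
  obtain \<kappa> where k: "\<kappa> > 0" "\<forall>\<beta>\<in>\<Phi>. \<forall>c c'. reflection \<beta> c \<in> G \<longrightarrow> reflection \<beta> c' \<in> G \<longrightarrow> (c - c') / (\<kappa> * (\<beta> \<bullet> \<beta>)) \<in> \<int>"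
    using disc by (elim exE conjE)
  have "c / (\<kappa> * (\<beta> \<bullet> \<beta>)) \<in> \<int>" if "\<beta> \<in> \<Phi>" "c \<in> offs \<beta>" for \<beta> c
    using k(2)[rule_format, of \<beta> "\<beta> \<bullet> z + c" "\<beta> \<bullet> z"] that special by (simp add: offs_def)
  then show ?thesis using that k(1) by blast
qed

lemma mirror_scale: "k \<noteq> 0 \<Longrightarrow> mirror (k *\<^sub>R x) (k * c) = mirror x c"
  using reflection_scale[of k x "x \<bullet> z + c"] by (simp add: mirror_def distrib_left)

text \<open>Rescaling normals does not change reflections, so the block can be described with the
  vectors that \<open>square_index\<close> expects.\<close>

lemma block_eq:
  assumes k: "k \<noteq> 0" and X: "\<Phi> \<inter> (U \<union> V) = {k *\<^sub>R x, - (k *\<^sub>R x), k *\<^sub>R y, - (k *\<^sub>R y)}"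
  shows "block U V = {r. \<exists>w\<in>{x, y}. \<exists>c\<in>offs w. r = mirror w c}"
proof (intro equalityI subsetI)
  fix r assume "r \<in> block U V"
  then obtain \<beta> c where b: "\<beta> \<in> \<Phi> \<inter> (U \<union> V)" "c \<in> offs \<beta>" "r = mirror \<beta> c"
    unfolding block_def mirror_def by blast
  then obtain w where w: "w \<in> {x, y}" "\<beta> = k *\<^sub>R w \<or> \<beta> = (- k) *\<^sub>R w" unfolding X by auto
  have "\<exists>l. l \<noteq> 0 \<and> \<beta> = l *\<^sub>R w" using w(2) k by (metis neg_equal_0_iff_equal)
  then obtain l where l: "l \<noteq> 0" "\<beta> = l *\<^sub>R w" by blast
  have c: "c = l * (c / l)" using l(1) by simp
  have "c / l \<in> offs w" using offs_scale[OF l(1), of "c / l" w] b(2) c l(2) by simp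
  moreover have "r = mirror w (c / l)" using mirror_scale[OF l(1), of w "c / l"] b(3) c l(2) by simp
  ultimately show "r \<in> {r. \<exists>w\<in>{x, y}. \<exists>c\<in>offs w. r = mirror w c}" using w(1) by blast
next
  fix r assume "r \<in> {r. \<exists>w\<in>{x, y}. \<exists>c\<in>offs w. r = mirror w c}"
  then obtain w c where w: "w \<in> {x, y}" "c \<in> offs w" "r = mirror w c" by blast
  have "k *\<^sub>R w \<in> \<Phi> \<inter> (U \<union> V)" unfolding X using w(1) by blast
  moreover have "k * c \<in> offs (k *\<^sub>R w)" using offs_scale[OF k] w(2) by simp
  moreover have "r = mirror (k *\<^sub>R w) (k * c)" using mirror_scale[OF k] w(3) by simp
  ultimately show "r \<in> block U V" unfolding block_def mirror_def by blast
qed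

text \<open>The positions for \<open>a\<close> are the multiples of some \<open>t\<close>. Those for
  \<open>a + b\<close> are among them and stable under adding twice such a multiple, so they are the
  multiples of \<open>t\<close> or of \<open>2 * t\<close>. In either case
  \<open>square_index\<close> applies, in the second one with the diagonals in the role of the axes,
  and exactly one of the two subgroups has index 2.\<close>

lemma exceptional_absurd:
  assumes ex: "exceptional \<Phi> U V U' V'"
    and H: "H = gen_by (block U V)" "H \<noteq> G" and H': "H' = gen_by (block U' V')" "H' \<noteq> G"
    and index: "subgroup_index G H = subgroup_index G H'"
  shows False
proof -
  obtain a b k where ex: "a \<noteq> 0" "a \<bullet> b = 0" "a \<bullet> a = b \<bullet> b" "k \<noteq> 0"
    "\<Phi> = {a, - a, b, - b, k *\<^sub>R (a + b), - (k *\<^sub>R (a + b)), k *\<^sub>R (a - b), - (k *\<^sub>R (a - b))}"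
    "\<Phi> \<inter> (U \<union> V) = {a, - a, b, - b}"
    "\<Phi> \<inter> (U' \<union> V') = {k *\<^sub>R (a + b), - (k *\<^sub>R (a + b)), k *\<^sub>R (a - b), - (k *\<^sub>R (a - b))}"
    using ex unfolding exceptional_def by (elim exE conjE)
  have n: "a \<bullet> a > 0" using ex(1) by simp
  have pn: "(a + b) \<bullet> (a + b) = 2 * (a \<bullet> a)" "(a - b) \<bullet> (a - b) = 2 * (a \<bullet> a)" "(a + b) \<bullet> (a - b) = 0" "b \<bullet> a = 0"
    "a \<bullet> (a + b) = a \<bullet> a" "(a + b) \<bullet> b = a \<bullet> a"
    using ex(2,3) by (simp_all add: inner_add_left inner_add_right inner_diff_left inner_diff_right inner_commute)
  have roots: "a \<in> \<Phi>" "b \<in> \<Phi>" "k *\<^sub>R (a + b) \<in> \<Phi>" "k *\<^sub>R (a - b) \<in> \<Phi>" by (simp_all add: ex(5))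
  have eq: "c \<in> offs \<beta> \<longleftrightarrow> c \<in> offs \<gamma>" if "\<beta> \<in> \<Phi>" "\<gamma> \<in> \<Phi>" "\<beta> \<bullet> \<beta> = \<gamma> \<bullet> \<gamma>" for \<beta> \<gamma> c
    using offs_norm[OF that(1,2)] offs_norm[OF that(2,1)] that(3) by auto
  have ab: "c \<in> offs b \<longleftrightarrow> c \<in> offs a" for c by (rule eq[OF roots(2,1)]) (simp add: ex(3))
  have pm: "c \<in> offs (a - b) \<longleftrightarrow> c \<in> offs (a + b)" for c
    using eq[OF roots(4,3), of "k * c"] offs_scale[OF ex(4)] pn(1,2) by simp
  have neg: "c \<in> offs (- x) \<longleftrightarrow> - c \<in> offs x" for c x using offs_scale[of "- 1" "- c" x] by simp
  have um: "- c \<in> offs (a + b)" if "c \<in> offs (a + b)" for c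
    using offs_uminus[OF roots(3), of "k * c"] offs_scale[OF ex(4), of c "a + b"] offs_scale[OF ex(4), of "- c" "a + b"] that by simp
  have nz': "a + b \<noteq> 0" using pn(1) n by auto
  \<comment> \<open>Conjugating the mirror of \<open>b\<close> through \<open>z\<close> by a
    diagonal mirror turns a diagonal position into a position for \<open>a\<close>.\<close>
  have ED: "c \<in> offs a" if "c \<in> offs (a + b)" for c
  proof -
    have "0 - 2 * ((a + b) \<bullet> b) / ((a + b) \<bullet> (a + b)) * c \<in> offs (rf (a + b) b)"
      by (rule offs_conj[OF nz' that offs_zero[OF roots(2)]])
    moreover have "rf (a + b) b = - a" unfolding rf_eq pn using n by simp
    ultimately have "- c \<in> offs (- a)" unfolding pn using n by simp
    then show ?thesis by (simp add: neg)
  qed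
  \<comment> \<open>Conjugating a diagonal mirror by a mirror of \<open>a\<close> shifts its
    position by twice that of the latter.\<close>
  have E2: "e - 2 * d \<in> offs (a + b)" if "e \<in> offs (a + b)" "d \<in> offs a" for d e
  proof -
    have "e - 2 * (a \<bullet> (a + b)) / (a \<bullet> a) * d \<in> offs (rf a (a + b))" by (rule offs_conj[OF ex(1) that(2,1)])
    moreover have "rf a (a + b) = - (a - b)" unfolding rf_eq pn using n by (simp add: scaleR_2)
    ultimately have "- (e - 2 * d) \<in> offs (a - b)" unfolding pn using n by (simp add: neg del: minus_diff_eq)
    then show ?thesis using um[of "- (e - 2 * d)"] by (simp add: pm del: minus_diff_eq)
  qed
  have E0: "0 \<in> offs (a + b)" using offs_zero[OF roots(3)] offs_scale[OF ex(4), of 0 "a + b"] by simp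
  obtain t where t: "t > 0" "\<And>c. c \<in> offs a \<longleftrightarrow> c / t \<in> \<int>"
  proof -
    obtain \<kappa> where \<kappa>: "\<kappa> > 0" "\<And>\<beta> c. \<beta> \<in> \<Phi> \<Longrightarrow> c \<in> offs \<beta> \<Longrightarrow> c / (\<kappa> * (\<beta> \<bullet> \<beta>)) \<in> \<int>"
      using offs_discrete by metis
    define m where "m = \<kappa> * (a \<bullet> a)"
    have m: "m > 0" using \<kappa>(1) n by (simp add: m_def)
    have Dm: "c / m \<in> \<int>" if "c \<in> offs a" for c using \<kappa>(2)[OF roots(1) that] by (simp add: m_def)
    \<comment> \<open>Discreteness turns the positions for \<open>a\<close> into a set of integers;
      \<open>nofix\<close> ensures that it is not just 0, where a position found for a diagonal is
      carried over by \<open>ED\<close>.\<close>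
    define K where "K = {j::int. m * of_int j \<in> offs a}"
    have "\<exists>c\<in>offs a. c \<noteq> 0"
    proof -
      obtain \<beta> c where b: "\<beta> \<in> \<Phi>" "reflection \<beta> c \<in> G" "c \<noteq> \<beta> \<bullet> z" using nofix[of z] by blast
      define d where "d = c - \<beta> \<bullet> z"
      have d: "d \<in> offs \<beta>" "d \<noteq> 0" using b by (simp_all add: d_def offs_def)
      have "\<beta> \<bullet> \<beta> = a \<bullet> a \<or> \<beta> \<bullet> \<beta> = (k *\<^sub>R (a + b)) \<bullet> (k *\<^sub>R (a + b))"
        using b(1) ex(3) pn(1,2) unfolding ex(5) by (auto simp del: inner_add_left inner_add_right)
      then show ?thesis
      proof
        assume "\<beta> \<bullet> \<beta> = a \<bullet> a"
        then show ?thesis using eq[OF b(1) roots(1)] d by auto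
      next
        assume "\<beta> \<bullet> \<beta> = (k *\<^sub>R (a + b)) \<bullet> (k *\<^sub>R (a + b))"
        then have "k * (d / k) \<in> offs (k *\<^sub>R (a + b))" using eq[OF b(1) roots(3), of d] d(1) ex(4) by simp
        then have "d / k \<in> offs a" using offs_scale[OF ex(4)] ED by blast
        then show ?thesis using d(2) ex(4) by (intro bexI[of _ "d / k"]) auto
      qed
    qed
    then obtain c where c: "c \<in> offs a" "c \<noteq> 0" by blast
    obtain i :: int where ci: "c = m * of_int i" using Dm[OF c(1)] m divide_Ints_iff[of m c] by auto
    obtain p where p: "p > 0" "\<And>j. j \<in> K \<longleftrightarrow> p dvd j"
    proof (rule doubling_closed_int[of K])
      show "0 \<in> K" using offs_zero[OF roots(1)] by (simp add: K_def)
      show "- x \<in> K" if "x \<in> K" for x using offs_uminus[OF roots(1), of "m * of_int x"] that by (simp add: K_def)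
      show "\<exists>x\<in>K. x \<noteq> 0" using c ci by (intro bexI[of _ i]) (auto simp: K_def)
      fix x y assume xy: "x \<in> K" "y \<in> K"
      have "m * of_int x - 2 * (a \<bullet> a) / (a \<bullet> a) * (m * of_int y) \<in> offs (rf a a)"
        using xy by (intro offs_conj[OF ex(1)]) (simp_all add: K_def)
      then have "- (m * of_int x - 2 * (m * of_int y)) \<in> offs a" using n by (simp add: neg del: minus_diff_eq)
      then have "- (- (m * of_int x - 2 * (m * of_int y))) \<in> offs a" by (rule offs_uminus[OF roots(1)])
      then show "x - 2 * y \<in> K" by (simp add: K_def algebra_simps)
    qed (rule that)
    show ?thesis
    proof (rule that[of "m * of_int p"])
      show "m * of_int p > 0" using m p(1) by simp
      fix c
      show "c \<in> offs a \<longleftrightarrow> c / (m * of_int p) \<in> \<int>"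
      proof
        assume c: "c \<in> offs a"
        obtain i :: int where ci: "c = m * of_int i" using Dm[OF c] m divide_Ints_iff[of m c] by auto
        then have "p dvd i" using c p(2)[of i] by (simp add: K_def)
        then obtain j where "i = p * j" by blast
        then have "c / (m * of_int p) = of_int j" using ci m p(1) by simp
        then show "c / (m * of_int p) \<in> \<int>" by simp
      next
        assume "c / (m * of_int p) \<in> \<int>"
        then obtain j :: int where "c = m * of_int (p * j)"
          using m p(1) divide_Ints_iff[of "m * of_int p" c] by auto
        then show "c \<in> offs a" using p(2)[of "p * j"] by (simp add: K_def)
      qed
    qed
  qed
  have Hm: "block U V = {r. \<exists>w\<in>{a, b}. \<exists>c\<in>offs w. r = mirror w c}"
    using ex(6) by (intro block_eq[of 1]) simp_all
  have Hm2: "block U V = {r. \<exists>w\<in>{2 *\<^sub>R a, 2 *\<^sub>R b}. \<exists>c\<in>offs w. r = mirror w c}"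
    using ex(6) by (intro block_eq[of "1 / 2"]) simp_all
  have H'm: "block U' V' = {r. \<exists>w\<in>{a + b, a - b}. \<exists>c\<in>offs w. r = mirror w c}"
    by (rule block_eq[OF ex(4) ex(7)])
  have all: "r \<in> block U V \<union> block U' V'" if r: "r \<in> G" "r \<in> reflections" for r
  proof -
    obtain \<beta> c where b: "\<beta> \<in> \<Phi>" "c \<in> offs \<beta>" "r = reflection \<beta> (\<beta> \<bullet> z + c)" using reflection_root[OF r] by blast
    have "\<beta> \<in> \<Phi> \<inter> (U \<union> V) \<or> \<beta> \<in> \<Phi> \<inter> (U' \<union> V')" using b(1) unfolding ex(6,7) unfolding ex(5) by blast
    then show ?thesis using b unfolding block_def by blast
  qed
  show False
  proof (cases "t \<in> offs (a + b)")
    case True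
    have E: "c \<in> offs (a + b) \<longleftrightarrow> c / t \<in> \<int>" for c
    proof
      assume "c \<in> offs (a + b)" then show "c / t \<in> \<int>" using ED t(2) by blast
    next
      assume "c / t \<in> \<int>"
      then obtain j :: int where c: "c = t * of_int j" using t(1) divide_Ints_iff[of t c] by auto
      have mult: "of_int i * t \<in> offs a" for i :: int using t by simp
      show "c \<in> offs (a + b)"
      proof (cases "even j")
        case True
        then obtain i where "j = 2 * i" by blast
        then show ?thesis using E2[OF E0 mult[of "- i"]] c by (simp add: algebra_simps)
      next
        case False
        then obtain i where "j = 2 * i + 1" by (rule oddE)
        then show ?thesis using E2[OF \<open>t \<in> offs (a + b)\<close> mult[of "- i"]] c by (simp add: algebra_simps)
      qed
    qed
    have "subgroup_index G H' = 2 \<and> subgroup_index G H \<noteq> 2"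
    proof (rule square_index[OF ex(1-3) t(1)])
      show "H = gen_by {r. \<exists>x\<in>{a, b}. \<exists>c\<in>offs x. r = mirror x c}" unfolding H(1) Hm ..
      show "H' = gen_by {r. \<exists>x\<in>{a + b, a - b}. \<exists>c\<in>offs x. r = mirror x c}" unfolding H'(1) H'm ..
      show "H' \<noteq> G" by (rule H'(2))
      show "c \<in> offs x \<longleftrightarrow> c / t \<in> \<int>" if "x \<in> {a, b, a + b, a - b}" for x c using that t(2) ab pm E by auto
      show "\<exists>x\<in>{a, b, a + b, a - b}. \<exists>c\<in>offs x. r = mirror x c" if "r \<in> G" "r \<in> reflections" for r
        using all[OF that] unfolding Hm H'm by blast
    qed
    then show False using index by simp
  next
    case False
    have E: "c \<in> offs (a + b) \<longleftrightarrow> c / (2 * t) \<in> \<int>" for c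
    proof
      assume c: "c \<in> offs (a + b)"
      then have "c / t \<in> \<int>" using ED t(2) by blast
      then obtain j :: int where cj: "c = t * of_int j" using t(1) divide_Ints_iff[of t c] by auto
      have mult: "of_int i * t \<in> offs a" for i :: int using t by simp
      show "c / (2 * t) \<in> \<int>"
      proof (cases "even j")
        case True
        then obtain i where "j = 2 * i" by blast
        then show ?thesis using cj t(1) by simp
      next
        case odd: False
        then obtain i where "j = 2 * i + 1" by (rule oddE)
        then have "t \<in> offs (a + b)" using E2[OF c mult[of i]] cj by (simp add: algebra_simps)
        then show ?thesis using False by simp
      qed
    next
      assume "c / (2 * t) \<in> \<int>"
      then obtain j :: int where c: "c = 2 * t * of_int j" using t(1) divide_Ints_iff[of "2 * t" c] by auto
      have "- of_int j * t \<in> offs a" using t by simp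
      then show "c \<in> offs (a + b)" using E2[OF E0, of "- of_int j * t"] c by (simp add: ac_simps)
    qed
    \<comment> \<open>With \<open>a + b\<close> and \<open>a - b\<close> as axes the diagonals
      become twice \<open>a\<close> and twice \<open>b\<close>, whose positions are the multiples of
      \<open>2 * t\<close>: all four directions have the same spacing again.\<close>
    have s: "(a + b) + (a - b) = 2 *\<^sub>R a" "(a + b) - (a - b) = 2 *\<^sub>R b" by (simp_all add: scaleR_2)
    have two: "c \<in> offs (2 *\<^sub>R x) \<longleftrightarrow> c / 2 \<in> offs x" for c x using offs_scale[of 2 "c / 2" x] by simp
    have "subgroup_index G H = 2 \<and> subgroup_index G H' \<noteq> 2"
    proof (rule square_index[OF nz' pn(3), of "2 * t", unfolded s])
      show "(a + b) \<bullet> (a + b) = (a - b) \<bullet> (a - b)" unfolding pn ..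
      show "2 * t > 0" using t(1) by simp
      show "H' = gen_by {r. \<exists>x\<in>{a + b, a - b}. \<exists>c\<in>offs x. r = mirror x c}" unfolding H'(1) H'm ..
      show "H = gen_by {r. \<exists>x\<in>{2 *\<^sub>R a, 2 *\<^sub>R b}. \<exists>c\<in>offs x. r = mirror x c}" unfolding H(1) Hm2 ..
      show "H \<noteq> G" by (rule H(2))
      show "c \<in> offs x \<longleftrightarrow> c / (2 * t) \<in> \<int>" if "x \<in> {a + b, a - b, 2 *\<^sub>R a, 2 *\<^sub>R b}" for x c
        using that t(2) ab pm E two by auto
      show "\<exists>x\<in>{a + b, a - b, 2 *\<^sub>R a, 2 *\<^sub>R b}. \<exists>c\<in>offs x. r = mirror x c" if "r \<in> G" "r \<in> reflections" for r
        using all[OF that] unfolding Hm2 H'm by blast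
    qed
    then show False using index by simp
  qed
qed

text \<open>\<open>C\<close> stands for the inverse of \<open>B\<close>, so this is conjugation by
  the isometry that fixes \<open>z\<close> and has linear part \<open>B\<close>.\<close>

definition conj_at :: "('a \<Rightarrow> 'a) \<Rightarrow> ('a \<Rightarrow> 'a) \<Rightarrow> ('a \<Rightarrow> 'a) \<Rightarrow> 'a \<Rightarrow> 'a" where
  "conj_at B C g = (\<lambda>x. z + B (g (z + C (x - z)) - z))"

lemma conj_at_comp: "(\<And>x. C (B x) = x) \<Longrightarrow> conj_at B C (f \<circ> g) = conj_at B C f \<circ> conj_at B C g"
  by (simp add: conj_at_def fun_eq_iff)

lemma conj_at_id: "(\<And>x. B (C x) = x) \<Longrightarrow> conj_at B C id = id"
  by (simp add: conj_at_def fun_eq_iff)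

lemma conj_at_mirror:
  assumes B: "orthogonal_transformation B" and BC: "\<And>x. B (C x) = x"
  shows "conj_at B C (mirror \<beta> c) = mirror (B \<beta>) c"
proof (rule mirror_eqI)
  fix y
  have l: "linear B" and i: "B \<beta> \<bullet> B \<beta> = \<beta> \<bullet> \<beta>" using B by (auto simp: orthogonal_transformation_def)
  have "conj_at B C (mirror \<beta> c) (z + y) = z + B (rf \<beta> (C y) + (2 * c / (\<beta> \<bullet> \<beta>)) *\<^sub>R \<beta>)"
    by (simp add: conj_at_def mirror_apply)
  also have "\<dots> = z + (rf (B \<beta>) y + (2 * c / (B \<beta> \<bullet> B \<beta>)) *\<^sub>R B \<beta>)"
    using orthogonal_transformation_rf_conj[OF B, of \<beta> "C y"] BC l i by (simp add: linear_add linear_scale)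
  finally show "conj_at B C (mirror \<beta> c) (z + y) = mirror (B \<beta>) c (z + y)" by (simp only: mirror_apply)
qed

lemma conj_at_generate:
  assumes R: "R \<subseteq> reflections" and BC: "\<And>x. B (C x) = x" "\<And>x. C (B x) = x"
    and r: "\<And>r. r \<in> R \<Longrightarrow> conj_at B C r \<in> gen_by R'" and g: "g \<in> gen_by R"
  shows "conj_at B C g \<in> gen_by R'"
  using g R
proof (rule reflection_group_induct)
  show "conj_at B C id \<in> gen_by R'" unfolding conj_at_id[of B C, OF BC(1)] by (rule id_generate)
  fix s h assume "s \<in> R" "conj_at B C h \<in> gen_by R'"
  then show "conj_at B C (s \<circ> h) \<in> gen_by R'"
    unfolding conj_at_comp[of C B, OF BC(2)] using r by (intro generate_comp)
qed

text \<open>\<open>B\<close> maps roots to roots of the same length, so by \<open>offs_norm\<close>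
  the conjugated mirror belongs to \<open>G\<close> again.\<close>

lemma conj_at_block:
  assumes B: "matches \<Phi> U V U' V' B" and BC: "\<And>x. B (C x) = x" "\<And>x. C (B x) = x"
    and g: "g \<in> gen_by (block U V)"
  shows "conj_at B C g \<in> gen_by (block U' V')"
proof (rule conj_at_generate[OF _ _ _ _ g])
  have o: "orthogonal_transformation B" using B by (simp add: matches_def)
  show "block U V \<subseteq> reflections" using block_subset by blast
  fix r assume "r \<in> block U V"
  then obtain \<beta> c where b: "\<beta> \<in> \<Phi>" "\<beta> \<in> U \<or> \<beta> \<in> V" "c \<in> offs \<beta>" "r = mirror \<beta> c"
    unfolding block_def mirror_def by blast
  have B\<beta>: "B \<beta> \<in> \<Phi>" "B \<beta> \<in> U' \<or> B \<beta> \<in> V'" using B b(1,2) unfolding matches_def by blast+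
  have "B \<beta> \<bullet> B \<beta> = \<beta> \<bullet> \<beta>" using o by (simp add: orthogonal_transformation_def)
  then have "c \<in> offs (B \<beta>)" by (rule offs_norm[OF b(1) B\<beta>(1) _ b(3)])
  then have "mirror (B \<beta>) c \<in> block U' V'" unfolding block_def mirror_def using B\<beta> by blast
  then show "conj_at B C r \<in> gen_by (block U' V')"
    unfolding b(4) conj_at_mirror[of B C, OF o BC(1)] by (rule generate.incl)
qed (fact BC)+

text \<open>Lets \<open>conj_at_block\<close> serve for \<open>G\<close> itself, so that conjugation
  is seen to map \<open>G\<close> into \<open>G\<close>.\<close>

lemma block_all: "gen_by (block UNIV UNIV) = G"
proof -
  have "block UNIV UNIV = G \<inter> reflections"
  proof (rule antisym[OF block_subset], rule subsetI)
    fix r assume "r \<in> G \<inter> reflections"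
    then obtain \<beta> c where "\<beta> \<in> \<Phi>" "c \<in> offs \<beta>" "r = reflection \<beta> (\<beta> \<bullet> z + c)" using reflection_root[of r] by blast
    then show "r \<in> block UNIV UNIV" unfolding block_def by blast
  qed
  then show ?thesis using gen by simp
qed

lemma match_automorphism:
  assumes B: "matches \<Phi> U V U' V' B"
  shows "\<exists>\<phi>\<in>automorphisms G. \<phi> ` gen_by (block U V) = gen_by (block U' V')"
proof
  define C where "C = inv_into UNIV B"
  have o: "orthogonal_transformation B" using B by (simp add: matches_def)
  have bij: "bij B" by (rule orthogonal_transformation_bij[OF o])
  have BC: "\<And>x. B (C x) = x" "\<And>x. C (B x) = x"
    unfolding C_def using bij by (simp_all add: bij_is_surj surj_f_inv_f bij_is_inj)
  have C: "matches \<Phi> U' V' U V C" unfolding C_def by (rule matches_inv[OF B])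
  have BU: "matches \<Phi> UNIV UNIV UNIV UNIV B" "matches \<Phi> UNIV UNIV UNIV UNIV C"
    using B C by (simp_all add: matches_def)
  have inv: "conj_at B C (conj_at C B g) = g" "conj_at C B (conj_at B C g) = g" for g
    by (simp_all add: conj_at_def BC)
  let ?\<phi> = "conj_at B C"
  have G: "?\<phi> g \<in> G" "conj_at C B g \<in> G" if "g \<in> G" for g
    using conj_at_block[OF BU(1) BC] conj_at_block[OF BU(2) BC(2,1)] that unfolding block_all by blast+
  have "?\<phi> \<in> hom (isom_group\<lparr>carrier := G\<rparr>) (isom_group\<lparr>carrier := G\<rparr>)"
    using G(1) conj_at_comp[of C B, OF BC(2)] by (intro homI) simp_all
  moreover have "bij_betw ?\<phi> G G"
    by (rule bij_betw_byWitness[of _ "conj_at C B"]) (use G inv in auto)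
  ultimately show "?\<phi> \<in> automorphisms G" by (simp add: automorphisms_def iso_def)
  show "?\<phi> ` gen_by (block U V) = gen_by (block U' V')"
  proof (intro equalityI subsetI)
    fix g assume "g \<in> ?\<phi> ` gen_by (block U V)"
    then show "g \<in> gen_by (block U' V')" using conj_at_block[OF B BC] by blast
  next
    fix g assume g: "g \<in> gen_by (block U' V')"
    have "conj_at C B g \<in> gen_by (block U V)" by (rule conj_at_block[OF C BC(2,1) g])
    then show "g \<in> ?\<phi> ` gen_by (block U V)" by (rule rev_image_eqI) (simp only: inv)
  qed
qed

end

section \<open>From the diagram of the polytope to the automorphism\<close>

lemma orthogonal_facet_partition:
  assumes cox: "coxeter_polytope P" and dec: "decomposable P"
  obtains C where "C \<subseteq> {f. f facet_of P}" "C \<noteq> {}" "C \<noteq> {f. f facet_of P}"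
    "\<forall>f\<in>C. \<forall>g\<in>{f. f facet_of P} - C. outward_normal P f \<bullet> outward_normal P g = 0"
proof -
  interpret coxeter P using cox by unfold_locales
  let ?I = "{f. f facet_of P}"
  let ?R = "{(v, w). v \<in> ?I \<and> w \<in> ?I \<and> v \<noteq> w \<and> coxeter_edge P v w \<noteq> Edge 0}"
  obtain x y where xy: "x \<in> ?I" "y \<in> ?I" "(x, y) \<notin> ?R\<^sup>*"
    using dec unfolding decomposable_def diagram_connected_def coxeter_diagram_def by auto
  define C where "C = {f \<in> ?I. (x, f) \<in> ?R\<^sup>*}"
  show ?thesis
  proof (rule that[of C]; (intro ballI)?)
    show "C \<subseteq> ?I" by (auto simp: C_def)
    show "C \<noteq> {}" using xy(1) by (auto simp: C_def)
    show "C \<noteq> ?I" using xy(2,3) by (auto simp: C_def)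
    fix f g assume f: "f \<in> C" and g: "g \<in> ?I - C"
    have "(f, g) \<notin> ?R"
    proof
      assume "(f, g) \<in> ?R"
      then have "(x, g) \<in> ?R\<^sup>*" using f unfolding C_def by (auto intro: rtrancl_into_rtrancl)
      then show False using g by (simp add: C_def)
    qed
    then show "nrm f \<bullet> nrm g = 0"
      using f g by (intro edge_zero_orthogonal) (auto simp: C_def)
  qed
qed

text \<open>Normals from different parts of the diagram are perpendicular unit vectors; this
  supplies the dimension bound of \<open>coxeter_simplex\<close>.\<close>

lemma decomposable_dim:
  fixes P :: "'a::euclidean_space set"
  assumes cox: "coxeter_polytope P" and dec: "decomposable P"
  shows "DIM('a) \<ge> 2"
proof -
  interpret coxeter P using cox by unfold_locales
  obtain C where C: "C \<subseteq> {f. f facet_of P}" "C \<noteq> {}" "C \<noteq> {f. f facet_of P}"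
    "\<forall>f\<in>C. \<forall>g\<in>{f. f facet_of P} - C. nrm f \<bullet> nrm g = 0"
    by (rule orthogonal_facet_partition[OF assms])
  obtain f g where fg: "f \<in> C" "g \<in> {f. f facet_of P} - C" using C(1-3) by blast
  then have n: "nrm f \<bullet> nrm f = 1" "nrm g \<bullet> nrm g = 1" "nrm f \<bullet> nrm g = 0"
    using C(1,4) nrm_inner by auto
  have ne: "nrm f \<noteq> nrm g" using n by auto
  have "independent {nrm f, nrm g}"
    using n by (intro pairwise_orthogonal_independent) (auto simp: pairwise_def orthogonal_def inner_commute)
  then have "card {nrm f, nrm g} \<le> DIM('a)" using independent_bound by blast
  then show ?thesis using ne by simp
qed

text \<open>\<open>A\<close> matches the normals of the facets but not their offsets, so the
  correspondence of the two groups is established for linear parts only, by induction over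
  words.\<close>

lemma facet_reflections_linear_part:
  assumes cox: "coxeter_polytope P" "coxeter_polytope P'" and A: "orthogonal_transformation A"
    and h: "\<And>f. f facet_of P \<Longrightarrow> h f facet_of P' \<and> A (outward_normal P f) = outward_normal P' (h f)"
    and g: "g \<in> reflection_group P"
  shows "\<exists>g'\<in>reflection_group P'. \<forall>x. linear_part g' (A x) = A (linear_part g x)"
proof -
  interpret p: coxeter P using cox by unfold_locales
  interpret p': coxeter P' using cox by unfold_locales
  have n0: "outward_normal P f \<noteq> 0" if "f facet_of P" for f using p.facet_normal(1)[OF that] by auto
  have n0': "outward_normal P' f \<noteq> 0" if "f facet_of P'" for f using p'.facet_normal(1)[OF that] by auto
  have R: "facet_reflections P \<subseteq> reflections" unfolding p.facet_reflections_eq reflections_def using n0 by blast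
  have R': "facet_reflections P' \<subseteq> reflections" unfolding p'.facet_reflections_eq reflections_def using n0' by blast
  show ?thesis
    using g[unfolded reflection_group_def] R
  proof (rule reflection_group_induct)
    show "\<exists>g'\<in>reflection_group P'. \<forall>x. linear_part g' (A x) = A (linear_part id x)"
      unfolding reflection_group_def
      by (rule bexI[of _ id]) (simp_all add: linear_part_def id_generate)
    fix r g
    assume r: "r \<in> facet_reflections P" and g: "g \<in> gen_by (facet_reflections P)"
      and IH: "\<exists>g'\<in>reflection_group P'. \<forall>x. linear_part g' (A x) = A (linear_part g x)"
    obtain g' where g': "g' \<in> reflection_group P'" "\<And>x. linear_part g' (A x) = A (linear_part g x)" using IH by blast
    obtain f where f: "r = reflection (outward_normal P f) (p.off f)" "f facet_of P"
      using r unfolding p.facet_reflections_eq by blast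
    define r' where "r' = reflection (outward_normal P' (h f)) (p'.off (h f))"
    have r': "r' \<in> facet_reflections P'" unfolding p'.facet_reflections_eq r'_def using h[OF f(2)] by blast
    have 1: "linear_part (r \<circ> g) = rf (outward_normal P f) \<circ> linear_part g"
      using linear_part_comp[OF _ generate_isom[OF R g], of r] reflection_isom[OF n0[OF f(2)]]
      unfolding f(1) linear_part_reflection by blast
    have g'G: "g' \<in> gen_by (facet_reflections P')" using g'(1) by (simp add: reflection_group_def)
    have 2: "linear_part (r' \<circ> g') = rf (outward_normal P' (h f)) \<circ> linear_part g'"
      using linear_part_comp[OF _ generate_isom[OF R' g'G], of r'] reflection_isom[OF n0'] h[OF f(2)]
      unfolding r'_def linear_part_reflection by blast
    have "linear_part (r' \<circ> g') (A x) = A (linear_part (r \<circ> g) x)" for x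
      unfolding 1 2 using h[OF f(2)] g'(2)[of x] orthogonal_transformation_rf_conj[OF A] by simp
    moreover have "r' \<circ> g' \<in> reflection_group P'"
      unfolding reflection_group_def by (rule generate_comp[OF generate.incl[OF r'] g'G])
    ultimately show "\<exists>g'\<in>reflection_group P'. \<forall>x. linear_part g' (A x) = A (linear_part (r \<circ> g) x)" by blast
  qed
qed

text \<open>The reflection in \<open>A \<alpha>\<close> is the linear part of an element of
  \<open>G\<close>, so \<open>G\<close> has a mirror with this normal through \<open>z\<close>. The
  scalar remains open because \<open>A\<close> may change a short root direction into a long
  one.\<close>

lemma (in affine_refl_point) transported_root:
  assumes \<alpha>: "\<alpha> \<in> \<Phi>" and A: "orthogonal_transformation A" and B: "\<And>x. A (B x) = x"
    and g: "g \<in> G" "\<forall>x. linear_part g (A x) = A (linear_part (reflection \<alpha> c) x)"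
  shows "\<exists>t. t \<noteq> 0 \<and> t *\<^sub>R A \<alpha> \<in> \<Phi>"
proof -
  have "linear_part g = rf (A \<alpha>)"
  proof
    fix y
    have "linear_part g (A (B y)) = rf (A \<alpha>) (A (B y))"
      using g(2) orthogonal_transformation_rf_conj[OF A, of \<alpha> "B y"] by (simp add: linear_part_reflection)
    then show "linear_part g y = rf (A \<alpha>) y" by (simp only: B)
  qed
  moreover have "A \<alpha> \<bullet> A \<alpha> = \<alpha> \<bullet> \<alpha>" using A by (simp add: orthogonal_transformation_def)
  then have "A \<alpha> \<noteq> 0" using norm_pos[OF \<alpha>] by auto
  ultimately show ?thesis using linear_reflection_root[OF g(1)] by blast
qed

lemma span_image_orthogonal:
  assumes "linear A" "\<And>f. f \<in> C \<Longrightarrow> A (u f) = u' (h f)"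
  shows "A ` span (u ` C) = span (u' ` h ` C)"
proof -
  have "A ` u ` C = u' ` h ` C" using assms(2) by (force simp: image_iff)
  then show ?thesis using linear_span_image[OF assms(1), of "u ` C"] by simp
qed

theorem corollary3:
  fixes F P :: "'a::euclidean_space set"
  assumes "coxeter_polytope F"
    and "int DIM('a) simplex F"
    and "\<not> decomposable F"
    and "coxeter_polytope P"
    and "decomposable P"
    and "maximal_reflection_subgroup (reflection_group P) (reflection_group F)"
  shows "block_maximal (reflection_group P) (reflection_group F)
    \<and> (\<forall>P' :: 'a set.
          coxeter_polytope P' \<and> decomposable P'
          \<and> maximal_reflection_subgroup (reflection_group P') (reflection_group F)
          \<and> diagram_iso (coxeter_diagram P) (coxeter_diagram P')
          \<and> subgroup_index (reflection_group F) (reflection_group P)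
              = subgroup_index (reflection_group F) (reflection_group P')
        \<longrightarrow> (\<exists>\<phi> \<in> automorphisms (reflection_group F).
               \<phi> ` reflection_group P = reflection_group P'))"
proof -
  define G where "G = reflection_group F"
  let ?H = "reflection_group P"
  let ?I = "{f. f facet_of P}" and ?u = "outward_normal P"
  have maxP: "maximal_reflection_subgroup ?H G" using assms(6) by (simp add: G_def)
  interpret F: coxeter_simplex F
    using assms(1-3) decomposable_dim[OF assms(4,5)] by unfold_locales
  interpret p: coxeter P using assms(4) by unfold_locales
  obtain \<Phi> where aff: "affine_refl \<Phi> G" using F.affine_refl_exists unfolding G_def .
  interpret affine_refl \<Phi> G by (rule aff)
  obtain z where z: "\<And>\<beta>. \<beta> \<in> \<Phi> \<Longrightarrow> reflection \<beta> (\<beta> \<bullet> z) \<in> G" using special_point by blast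
  interpret affine_refl_point \<Phi> G z by unfold_locales (rule z)
  obtain C where C: "C \<subseteq> ?I" "C \<noteq> {}" "C \<noteq> ?I" "\<forall>f\<in>C. \<forall>g\<in>?I - C. ?u f \<bullet> ?u g = 0"
    by (rule orthogonal_facet_partition[OF assms(4,5)])
  define U V where "U = span (?u ` C)" and "V = span (?u ` (?I - C))"
  have sp: "split \<Phi> U V" and H: "?H = gen_by (block U V)"
    using block_split[OF assms(4) maxP C(1-3) _ U_def V_def] C(4) by blast+
  interpret s: split \<Phi> U V by (rule sp)
  have "block_maximal ?H G"
    unfolding block_maximal_def
  proof (intro conjI ballI impI)
    show "?H \<subseteq> G" using maxP by (simp add: maximal_reflection_subgroup_def reflection_subgroup_def)
    fix r assume r: "r \<in> G \<inter> reflections" and lp: "linear_part r \<in> linear_part ` ?H"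
    obtain g where g: "g \<in> ?H" "linear_part g = linear_part r" using lp by (metis imageE)
    obtain a c where a: "r = reflection a c" "a \<noteq> 0" using r by (auto simp: reflections_def)
    \<comment> \<open>The linear part of \<open>r\<close> is a reflection and occurs in the block
      group, so its normal lies in one of the two summands and \<open>r\<close> itself is a
      generator.\<close>
    have "a \<in> U \<or> a \<in> V"
      using reflection_in_block[OF s.subU s.subV s.perp s.decomp, of g a] g a H
      by (simp add: linear_part_reflection)
    then have "r \<in> block U V" unfolding a(1) using a r by (intro block_mem s.subU s.subV) auto
    then show "r \<in> ?H" unfolding H by (rule generate.incl)
  qed
  moreover have "\<exists>\<phi>\<in>automorphisms G. \<phi> ` ?H = reflection_group P'"
    if P': "coxeter_polytope P'" "maximal_reflection_subgroup (reflection_group P') G"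
      "diagram_iso (coxeter_diagram P) (coxeter_diagram P')"
      "subgroup_index G ?H = subgroup_index G (reflection_group P')" for P'
  proof -
    let ?H' = "reflection_group P'" and ?I' = "{f. f facet_of P'}" and ?v = "outward_normal P'"
    interpret p': coxeter P' using P'(1) by unfold_locales
    obtain h where h: "bij_betw h ?I ?I'" "\<And>f g. f \<in> ?I \<Longrightarrow> g \<in> ?I \<Longrightarrow> f \<noteq> g \<Longrightarrow> coxeter_edge P' (h f) (h g) = coxeter_edge P f g"
      using P'(3) unfolding diagram_iso_def coxeter_diagram_def by auto
    have hI: "h f \<in> ?I'" if "f \<in> ?I" for f using bij_betwE[OF h(1)] that by blast
    have hinj: "inj_on h ?I" and himg: "h ` ?I = ?I'" using h(1) by (auto simp: bij_betw_def)
    have gram: "?u f \<bullet> ?u g = ?v (h f) \<bullet> ?v (h g)" if fg: "f \<in> ?I" "g \<in> ?I" for f g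
    proof (cases "f = g")
      case True
      then show ?thesis using p.nrm_inner[of g] p'.nrm_inner[of "h g"] fg hI[OF fg(2)] by simp
    next
      case False
      then have "h f \<noteq> h g" using hinj fg by (simp add: inj_on_eq_iff)
      then show ?thesis
        using fg hI[OF fg(1)] hI[OF fg(2)] False h(2)[OF fg False]
        by (intro edge_determines_inner[OF assms(4) P'(1)]) simp_all
    qed
    \<comment> \<open>The diagram fixes the Gram matrix of the normals, and finite volume makes the
      normals span, so an isometry carries one set of normals to the other.\<close>
    obtain A where A: "orthogonal_transformation A" "\<And>f. f \<in> ?I \<Longrightarrow> A (?u f) = ?v (h f)"
    proof (rule gram_isometry[of ?I ?u "\<lambda>f. ?v (h f)"])
      show "?u f \<bullet> ?u g = ?v (h f) \<bullet> ?v (h g)" if "f \<in> ?I" "g \<in> ?I" for f g by (rule gram[OF that])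
      show "span (?u ` ?I) = UNIV" by (rule p.normals_span)
    qed (rule that)
    have linA: "linear A" using A(1) by (simp add: orthogonal_transformation_def)
    have bijA: "bij A" by (rule orthogonal_transformation_bij[OF A(1)])
    let ?C' = "h ` C"
    define U' V' where "U' = span (?v ` ?C')" and "V' = span (?v ` (?I' - ?C'))"
    have hC: "?I' - ?C' = h ` (?I - C)" using hinj C(1) himg by (simp add: inj_on_image_set_diff)
    have AU: "A ` U = U'"
      unfolding U_def U'_def using C(1) A(2) by (intro span_image_orthogonal linA) blast
    have AV: "A ` V = V'"
      unfolding V_def V'_def hC using A(2) by (intro span_image_orthogonal linA) blast
    have C': "?C' \<subseteq> ?I'" "?C' \<noteq> {}" "?C' \<noteq> ?I'"
    proof -
      show "?C' \<subseteq> ?I'" using C(1) himg by blast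
      show "?C' \<noteq> {}" using C(2) by blast
      show "?C' \<noteq> ?I'" using hC C(1,3) by blast
    qed
    have orth': "?v f \<bullet> ?v g = 0" if f: "f \<in> ?C'" and g: "g \<in> ?I' - ?C'" for f g
    proof -
      obtain f0 where f0: "f0 \<in> C" "f = h f0" using f by blast
      obtain g0 where g0: "g0 \<in> ?I - C" "g = h g0" using g unfolding hC by blast
      have "?u f0 \<bullet> ?u g0 = 0" using C(4) f0(1) g0(1) by blast
      moreover have "?u f0 \<bullet> ?u g0 = ?v f \<bullet> ?v g" unfolding f0(2) g0(2) using f0(1) g0(1) C(1) by (intro gram) auto
      ultimately show ?thesis by simp
    qed
    have sp': "split \<Phi> U' V'" and H': "?H' = gen_by (block U' V')"
      by (rule block_split[OF P'(1,2) C' orth' U'_def V'_def]; assumption)+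
    have HG: "?H \<subseteq> G" "?H' \<subseteq> G" "?H \<noteq> G" "?H' \<noteq> G"
      using maxP P'(2) by (auto simp: maximal_reflection_subgroup_def reflection_subgroup_def)
    have lin: "\<exists>g'\<in>?H'. \<forall>x. linear_part g' (A x) = A (linear_part g x)" if "g \<in> ?H" for g
      using A(2) hI by (intro facet_reflections_linear_part[OF assms(4) P'(1) A(1) _ that]) blast
    define B where "B = inv_into UNIV A"
    have B: "orthogonal_transformation B" "\<And>x. A (B x) = x" "\<And>x. B (A x) = x"
      unfolding B_def using orthogonal_transformation_inv[OF A(1)] bijA
      by (simp_all add: bij_is_surj surj_f_inv_f bij_is_inj)
    have lin': "\<exists>g'\<in>?H. \<forall>x. linear_part g' (B x) = B (linear_part g x)" if "g \<in> ?H'" for g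
    proof (rule facet_reflections_linear_part[OF P'(1) assms(4) B(1) _ that, of "inv_into ?I h"])
      fix f assume "f facet_of P'"
      then have f: "f \<in> h ` ?I" using himg by simp
      have k: "inv_into ?I h f \<in> ?I" "h (inv_into ?I h f) = f" using inv_into_into[OF f] f_inv_into_f[OF f] .
      then have "B (?v f) = ?u (inv_into ?I h f)" using A(2)[OF k(1)] B(3) by metis
      then show "inv_into ?I h f facet_of P \<and> B (?v f) = ?u (inv_into ?I h f)" using k(1) by simp
    qed
    \<comment> \<open>The subgroups provide what \<open>linear_match\<close> asks of
      \<open>A\<close>: reflections in roots of the block have linear parts that are transported by
      \<open>A\<close> and, in the other direction, by its inverse.\<close>
    have "(\<exists>B. matches \<Phi> U V U' V' B) \<or> exceptional \<Phi> U V U' V'"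
    proof (rule linear_match[OF sp sp' A(1) _ _ AU AV])
      fix \<alpha> assume a: "\<alpha> \<in> \<Phi>" "\<alpha> \<in> U \<or> \<alpha> \<in> V"
      have "reflection \<alpha> (\<alpha> \<bullet> z) \<in> ?H"
        unfolding H using z[OF a(1)] a nz by (intro generate.incl block_mem s.subU s.subV) auto
      from lin[OF this] obtain g where "g \<in> ?H'" "\<forall>x. linear_part g (A x) = A (linear_part (reflection \<alpha> (\<alpha> \<bullet> z)) x)" by blast
      with transported_root[OF a(1) A(1) B(2)] HG(2) show "\<exists>c. c *\<^sub>R A \<alpha> \<in> \<Phi>" by blast
    next
      fix \<alpha> assume a: "\<alpha> \<in> \<Phi>" "\<alpha> \<in> U' \<or> \<alpha> \<in> V'"
      interpret s': split \<Phi> U' V' by (rule sp')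
      have "reflection \<alpha> (\<alpha> \<bullet> z) \<in> ?H'"
        unfolding H' using z[OF a(1)] a nz by (intro generate.incl block_mem s'.subU s'.subV) auto
      from lin'[OF this] obtain g where "g \<in> ?H" "\<forall>x. linear_part g (B x) = B (linear_part (reflection \<alpha> (\<alpha> \<bullet> z)) x)" by blast
      with transported_root[OF a(1) B(1) B(3)] HG(1)
      obtain t where t: "t \<noteq> 0" "t *\<^sub>R B \<alpha> \<in> \<Phi>" by blast
      have BUV: "B \<alpha> \<in> U \<or> B \<alpha> \<in> V" using a(2) B(3) unfolding AU[symmetric] AV[symmetric] by auto
      have "t *\<^sub>R B \<alpha> \<in> U \<or> t *\<^sub>R B \<alpha> \<in> V" using BUV s.subU s.subV subspace_scale by blast
      moreover have "\<alpha> = (1 / t) *\<^sub>R A (t *\<^sub>R B \<alpha>)" using t(1) B(2) by (simp add: linear_scale[OF linA])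
      ultimately show "\<exists>\<beta>\<in>\<Phi>. (\<beta> \<in> U \<or> \<beta> \<in> V) \<and> (\<exists>c. \<alpha> = c *\<^sub>R A \<beta>)" using t(2) by blast
    qed
    then show ?thesis
    proof
      assume "\<exists>B. matches \<Phi> U V U' V' B"
      then show ?thesis unfolding H H' using match_automorphism by blast
    next
      assume "exceptional \<Phi> U V U' V'"
      then show ?thesis using exceptional_absurd[OF _ H HG(3) H' HG(4) P'(4)] by blast
    qed
  qed
  ultimately show ?thesis unfolding G_def by blast
qed

end
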